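(* Let $K:\mathbb{R}^d\to\mathbb{R}^d$ satisfy, for some $\alpha<d-1$ and some $C>0$, $$\operatorname{div}K=0,\qquad |K(x)|+|x||\nabla K(x)|\le\frac{C}{|x|^\alpha}\quad\text{for all }x\in\mathbb{R}^d\setminus\{0\}.$$ Let $(\varphi_N)_{N\in\mathbb{N}}$ be a sequence of divergence-free vector fields uniformly bounded in $L^\infty((0,\infty);W^{1,\infty}(\mathbb{R}^d))$. Let $\tau_0^N\in L^\infty(\mathbb{R}^d)\cap\mathcal{P}(\mathbb{R}^d)$ be uniformly bounded and let $\tau_N$ be the solutions to $$\partial_t\tau_N+(K\ast\tau_N+\varphi_N)\cdot\nabla\tau_N=0,\qquad \tau_N(0)=\tau_0^N .$$ Let $X_i^0\in\mathbb{R}^d$, $1\le i\le N$, and consider $$\dot X_i(t)=\varphi_N(t,X_i(t))+\frac1N\sum_{j\ne i}K(X_i(t)-X_j(t))+E_i(t),\qquad X_i(0)=X_i^0 .$$ Let $\sigma_N(t):=\frac1N\sum_i\delta_{X_i(t)}$, $\eta(t):=\mathcal{W}_\infty(\sigma_N(t),\tau_N(t))$ and $d_{\min}(t):=\min_{i\ne j}|X_i(t)-X_j(t)|$. Assume there exists a sequence of non-decreasing functions $e_N$ such that for all $t\ge0$ both of the following hold: (a) $$\lim_{N\to\infty}\frac{(\eta(0)+e_N(t))^{d-(1+\alpha)}}{d_{\min}(0)^{1+\alpha}N^{(1+\alpha)/d}}=0,\qquad d_{\min}(0)N^{1/d}\lesssim1;$$ (b) for every $\lambda>0$ there exists $N_0>0$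 such that for all $N>N_0$ $$\frac{\eta(t)}{\eta(0)+e_N(t)}+\frac{d_{\min}(0)}{d_{\min}(t)}\le\lambda\ \Longrightarrow\ \sup_i|E_i(t)|\le e_N(t)\ \text{ and }\ \sup_{i\ne j}\frac{|E_i(t)-E_j(t)|}{|X_i(t)-X_j(t)|}\le C_1,$$ where $C_1$ depends only on $\sup_N\|\tau_0^N\|_{L^\infty}$, $K$, and $\sup_N\|\varphi_N\|_{L^\infty(W^{1,\infty})}$. Then, for all $T>0$ and all $N$ sufficiently large (depending on $T$), it holds for all $t\in[0,T]$ $$\eta(t)\le e^{C_2t}\big(\eta(0)+e_N(t)\big),\qquad d_{\min}(t)\ge d_{\min}(0)e^{-C_2t},$$ where $C_2$ depends only on $C_1$, $\sup_N\|\tau_0^N\|_{L^\infty}$, $K$, and $\sup_N\|\varphi_N\|_{L^\infty(W^{1,\infty})}$. Moreover, $$|(K\ast(\tau_N-\sigma_N))(x)|\le\frac{C_2}{N|\operatorname{dist}(x,\{X_i\}_i)|^\alpha}+C_2e^{C_2t}\big(\eta(0)+e_N(t)\big),$$ where $\tau_N,\sigma_N,X_i$ are evaluated at time $t$.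
   Context: $\mathcal{P}(\mathbb{R}^d)$ denotes the space of probability densities. $\mathcal{W}_\infty(\mu,\nu)=\inf_{\gamma\in\Gamma(\mu,\nu)}\gamma\text{-}\operatorname{ess\,sup}|x-y|$ is the infinite Wasserstein distance, where $\Gamma(\mu,\nu)$ is the set of couplings of $\mu$ and $\nu$. The quantities $X_i^0$, $X_i$, $E_i$, $\eta$, $d_{\min}$ all depend on $N$; the $E_i(t)\in\mathbb{R}^d$ are error terms. $\|\cdot\|_{L^\infty(W^{1,\infty})}$ is the norm of $L^\infty((0,\infty);W^{1,\infty}(\mathbb{R}^d))$. $A\lesssim B$ means $A\le CB$ with a constant $C$ independent of $N$.
   Formalization: The exponent is restricted to −1 ≤ α < d−1 (for α < −1 the claim fails, e.g. K(x)=(x₂²,0) in d=2), and in (b) the threshold N₀ may depend on λ and T but is uniform in t∈[0,T] (with N₀ depending on t the claim fails). *)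

theory Defs
  imports "HOL-Analysis.Analysis" "HOL-Probability.Essential_Supremum"
begin

text \<open>Coinductively: all iterated directional derivatives exist (and are differentiable, hence
  continuous), i.e. the function is of class C-infinity.\<close>

coinductive C_infinity :: "('a::euclidean_space \<Rightarrow> real) \<Rightarrow> bool" where
  "\<lbrakk>\<And>x. f differentiable (at x);
    \<And>v. C_infinity (\<lambda>x. frechet_derivative f (at x) v)\<rbrakk> \<Longrightarrow> C_infinity f"

definition test_function :: "('a::euclidean_space \<Rightarrow> real) \<Rightarrow> bool" where
  "test_function \<psi> \<longleftrightarrow> C_infinity \<psi> \<and> compact (closure {x. \<psi> x \<noteq> 0})"

definition Linf_norm :: "('a::euclidean_space \<Rightarrow> 'b::euclidean_space) \<Rightarrow> ennreal" where
  "Linf_norm f = esssup lborel (\<lambda>x. ennreal (norm (f x)))"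

text \<open>\<open>G x v\<close> is the weak derivative of \<open>u\<close> at \<open>x\<close> in direction \<open>v\<close>.\<close>

definition has_weak_derivative ::
  "('a::euclidean_space \<Rightarrow> 'b::euclidean_space) \<Rightarrow> ('a \<Rightarrow> 'a \<Rightarrow> 'b) \<Rightarrow> bool" where
  "has_weak_derivative u G \<longleftrightarrow>
     (\<forall>S. compact S \<longrightarrow> set_integrable lborel S u) \<and>
     (\<forall>v S. compact S \<longrightarrow> set_integrable lborel S (\<lambda>x. G x v)) \<and>
     (\<forall>x. linear (G x)) \<and>
     (\<forall>\<psi> v. test_function \<psi> \<longrightarrow>
        (LINT x|lborel. frechet_derivative \<psi> (at x) v *\<^sub>R u x) = - (LINT x|lborel. \<psi> x *\<^sub>R G x v))"

text \<open>The weak derivative is unique up to null sets, so the infimum only serves to select it; it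
  equals \<open>\<infinity>\<close> if there is no weak derivative.\<close>

definition W1inf_norm :: "('a::euclidean_space \<Rightarrow> 'b::euclidean_space) \<Rightarrow> ennreal" where
  "W1inf_norm u = (INF G\<in>{G. has_weak_derivative u G}.
     max (Linf_norm u) (esssup lborel (\<lambda>x. ennreal (onorm (G x)))))"

definition Linf_W1inf_norm :: "(real \<Rightarrow> 'a::euclidean_space \<Rightarrow> 'b::euclidean_space) \<Rightarrow> ennreal" where
  "Linf_W1inf_norm \<phi> = esssup (restrict_space lborel {0<..}) (\<lambda>t. W1inf_norm (\<phi> t))"

definition weakly_divergence_free :: "('a::euclidean_space \<Rightarrow> 'a) \<Rightarrow> bool" where
  "weakly_divergence_free u \<longleftrightarrow>
     (\<forall>\<psi>. test_function \<psi> \<longrightarrow> (LINT x|lborel. frechet_derivative \<psi> (at x) (u x)) = 0)"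

text \<open>Fields that are evaluated along trajectories: for almost every time, the continuous
  representative in space is taken.\<close>

definition divergence_free_field :: "(real \<Rightarrow> 'a::euclidean_space \<Rightarrow> 'a) \<Rightarrow> bool" where
  "divergence_free_field \<phi> \<longleftrightarrow>
     (\<lambda>(t, x). indicat_real {0<..} t *\<^sub>R \<phi> t x) \<in> borel_measurable borel \<and>
     (AE t in lborel. 0 < t \<longrightarrow> continuous_on UNIV (\<phi> t) \<and> weakly_divergence_free (\<phi> t))"

definition divergence_at :: "('a::euclidean_space \<Rightarrow> 'a) \<Rightarrow> 'a \<Rightarrow> real" where
  "divergence_at K x = (\<Sum>b\<in>Basis. frechet_derivative K (at x) b \<bullet> b)"

definition interaction_kernel :: "('a::euclidean_space \<Rightarrow> 'a) \<Rightarrow> real \<Rightarrow> real \<Rightarrow> bool" where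
  "interaction_kernel K \<alpha> C \<longleftrightarrow>
     (\<forall>x. x \<noteq> 0 \<longrightarrow> K differentiable (at x) \<and> divergence_at K x = 0 \<and>
        norm (K x) + norm x * onorm (frechet_derivative K (at x)) \<le> C / norm x powr \<alpha>)"

definition prob_density :: "('a::euclidean_space \<Rightarrow> real) \<Rightarrow> bool" where
  "prob_density f \<longleftrightarrow> f \<in> borel_measurable borel \<and> (AE x in lborel. 0 \<le> f x) \<and>
     (\<integral>\<^sup>+x. ennreal (f x) \<partial>lborel) = 1"

definition density_measure :: "('a::euclidean_space \<Rightarrow> real) \<Rightarrow> 'a measure" where
  "density_measure f = density lborel (\<lambda>x. ennreal (f x))"

definition empirical_measure :: "nat \<Rightarrow> (nat \<Rightarrow> 'a::euclidean_space) \<Rightarrow> 'a measure" where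
  "empirical_measure N X = distr (uniform_count_measure {..<N}) borel X"

definition kernel_conv :: "('a::euclidean_space \<Rightarrow> 'a) \<Rightarrow> 'a measure \<Rightarrow> 'a \<Rightarrow> 'a" where
  "kernel_conv K \<mu> x = (LINT y|\<mu>. K (x - y))"

definition couplings ::
  "'a::euclidean_space measure \<Rightarrow> 'a measure \<Rightarrow> ('a \<times> 'a) measure set" where
  "couplings \<mu> \<nu> = {\<gamma>. sets \<gamma> = sets (borel \<Otimes>\<^sub>M borel) \<and>
     distr \<gamma> borel fst = \<mu> \<and> distr \<gamma> borel snd = \<nu>}"

definition W_inf :: "'a::euclidean_space measure \<Rightarrow> 'a measure \<Rightarrow> ennreal" where
  "W_inf \<mu> \<nu> = (INF \<gamma>\<in>couplings \<mu> \<nu>. esssup \<gamma> (\<lambda>(x, y). ennreal (dist x y)))"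

text \<open>Distributional solutions, bounded locally uniformly in time and with values in the
  probability densities, of
  \<open>\<partial>\<^sub>t \<tau> + (K * \<tau> + \<phi>) \<bullet> \<nabla>\<tau> = 0\<close>, \<open>\<tau>(0) = \<tau>\<^sub>0\<close>. As the velocity is divergence free, the
  transport term is the divergence of \<open>\<tau> (K * \<tau> + \<phi>)\<close>. The equation is integrated in time, which
  selects the weakly continuous representative, so that \<open>\<tau> t\<close> is meaningful for every \<open>t \<ge> 0\<close>.
  The integrability of the kernel and of the flux (automatic for kernels that are bounded away
  from the origin) expresses that the velocity and the equation are well defined.\<close>

definition transport_solution ::
  "('a::euclidean_space \<Rightarrow> 'a) \<Rightarrow> (real \<Rightarrow> 'a \<Rightarrow> 'a) \<Rightarrow> ('a \<Rightarrow> real) \<Rightarrow> (real \<Rightarrow> 'a \<Rightarrow> real) \<Rightarrow> bool" where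
  "transport_solution K \<phi> \<tau>0 \<tau> \<longleftrightarrow>
     (let u = (\<lambda>t x. kernel_conv K (density_measure (\<tau> t)) x + \<phi> t x) in
     (\<lambda>(t, x). indicat_real {0..} t * \<tau> t x) \<in> borel_measurable borel \<and>
     (\<forall>t\<ge>0. prob_density (\<tau> t)) \<and>
     (\<forall>T. \<exists>M. \<forall>t\<in>{0..T}. Linf_norm (\<tau> t) \<le> ennreal M) \<and>
     (\<forall>t\<ge>0. \<forall>x. integrable (density_measure (\<tau> t)) (\<lambda>y. K (x - y))) \<and>
     (\<forall>\<psi>. test_function \<psi> \<longrightarrow> (\<forall>t\<ge>0.
        integrable (lborel \<Otimes>\<^sub>M lborel)
          (\<lambda>(s, x). indicat_real {0..t} s * (\<tau> s x * frechet_derivative \<psi> (at x) (u s x))) \<and>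
        (LINT x|lborel. \<psi> x * \<tau> t x) = (LINT x|lborel. \<psi> x * \<tau>0 x) +
          (LINT s:{0..t}|lborel. (LINT x|lborel. \<tau> s x * frechet_derivative \<psi> (at x) (u s x))))))"

text \<open>Absolutely continuous (Caratheodory) solutions, as \<open>\<phi>\<close> is only measurable in time. The
  particles are indexed by \<open>{..<N}\<close>.\<close>

definition particle_velocity ::
  "('a::euclidean_space \<Rightarrow> 'a) \<Rightarrow> nat \<Rightarrow> (real \<Rightarrow> 'a \<Rightarrow> 'a) \<Rightarrow> (nat \<Rightarrow> real \<Rightarrow> 'a) \<Rightarrow>
    (nat \<Rightarrow> real \<Rightarrow> 'a) \<Rightarrow> nat \<Rightarrow> real \<Rightarrow> 'a" where
  "particle_velocity K N \<phi> E X i t =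
     \<phi> t (X i t) + (1 / real N) *\<^sub>R (\<Sum>j\<in>{..<N} - {i}. K (X i t - X j t)) + E i t"

definition particle_solution ::
  "('a::euclidean_space \<Rightarrow> 'a) \<Rightarrow> nat \<Rightarrow> (real \<Rightarrow> 'a \<Rightarrow> 'a) \<Rightarrow> (nat \<Rightarrow> real \<Rightarrow> 'a) \<Rightarrow>
    (nat \<Rightarrow> 'a) \<Rightarrow> (nat \<Rightarrow> real \<Rightarrow> 'a) \<Rightarrow> bool" where
  "particle_solution K N \<phi> E X0 X \<longleftrightarrow>
     (\<forall>i<N. \<forall>t\<ge>0. set_integrable lborel {0..t} (particle_velocity K N \<phi> E X i) \<and>
        X i t = X0 i + (LINT s:{0..t}|lborel. particle_velocity K N \<phi> E X i s))"

text \<open>Only meaningful for \<open>N \<ge> 2\<close>, as there are no pairs otherwise.\<close>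

definition d_min :: "nat \<Rightarrow> (nat \<Rightarrow> 'a::euclidean_space) \<Rightarrow> real" where
  "d_min N X = Min {dist (X i) (X j) | i j. i < N \<and> j < N \<and> i \<noteq> j}"

text \<open>Power with a positive exponent.\<close>

definition ennreal_powr :: "ennreal \<Rightarrow> real \<Rightarrow> ennreal" where
  "ennreal_powr x p = (if x = top then top else ennreal (enn2real x powr p))"

end

theory Submission
  imports Defs "HOL-Probability.Probability_Measure"
begin

text \<open>
  The infinite Wasserstein distance is controlled without characteristics. By Hall's theorem,
  \<open>W_inf (empirical_measure N X) (density_measure f) \<le> r\<close> as soon as the union of the balls of radius \<open>r\<close>
  around any set \<open>I\<close> of particles has \<open>f\<close>-mass at least \<open>card I / N\<close>. Smoothed indicator functions of
  unions of balls whose centers move with the particles and whose radii grow like \<open>exp (\<Lambda> t)\<close> are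
  supersolutions of the transport equation, provided that the velocity field and the particle
  velocities differ by a small multiple of the radius. Hence mass inside such a union never decreases,
  and the condition propagates in time.

  The velocity error of a particle is bounded by Hauray's estimate, which needs the lower bound of the
  minimal distance and the smallness of \<open>(\<eta> + e)\<close> relative to \<open>d_min\<close>; conversely the minimal distance
  shrinks at most exponentially as long as this estimate holds. Both bounds are strict improvements of
  the bounds (with a factor 2) under which they are derived, so that a continuity argument gives them
  on \<open>{0..T}\<close>.
\<close>

text \<open>The constant \<open>C\<^sub>2\<close> may see the densities only through the supremum of
  the initial data, while a solution is a priori bounded, locally in time, by an unspecified
  constant. Hence a maximum principle precedes the particle estimates. It uses the same balls: run
  backwards they compare the final mass with the initial data; run forwards with the constant
  density 1 they bring the volume back to the original balls, up to a fixed enlargement of the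
  radii.

  As the kernel may grow at infinity when \<alpha> < 0, the velocity at the origin has only an
  integrable majorant in time. Increments are measured by its primitive, and terms quadratic in them
  vanish under refinement of the time partition.

  In the continuity argument neither \<open>W_inf\<close> along the solution nor \<open>e\<close> is
  known to be continuous. The bound is carried past a time t by letting the centers move for a short
  while with the velocity field evaluated at the particle positions of time t. Monotonicity of
  \<open>e\<close> enters because one radius, fixed for the final time, has to dominate all earlier
  errors.\<close>

abbreviation grad :: "('a::real_normed_vector \<Rightarrow> 'b::real_normed_vector) \<Rightarrow> 'a \<Rightarrow> 'a \<Rightarrow> 'b" where
 "grad f x \<equiv> frechet_derivative f (at x)"

section \<open>Test functions\<close>

text \<open>Finite approximations of the coinductive \<open>C_infinity\<close>. Closure under
  products and compositions becomes an ordinary induction on the order, where coinduction would need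
  a relation closed under sums of products of derivatives.\<close>

primrec times_differentiable :: "nat \<Rightarrow> ('a::euclidean_space \<Rightarrow> real) \<Rightarrow> bool" where
 "times_differentiable 0 f \<longleftrightarrow> True"
| "times_differentiable (Suc n) f \<longleftrightarrow> (\<forall>x. f differentiable (at x)) \<and>
  (\<forall>v. times_differentiable n (\<lambda>x. grad f x v))"

lemma C_infinity_iff_times_differentiable:
 "C_infinity f \<longleftrightarrow> (\<forall>n. times_differentiable n f)"
proof
 have "C_infinity f \<Longrightarrow> times_differentiable n f" for n
 proof (induction n arbitrary: f)
  case (Suc n)
  from Suc.prems show ?case
   by (cases rule: C_infinity.cases) (auto intro: Suc.IH)
 qed simp
 then show "C_infinity f \<Longrightarrow> \<forall>n. times_differentiable n f" by blast
next
 show "\<forall>n. times_differentiable n f \<Longrightarrow> C_infinity f"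
 proof (coinduction arbitrary: f rule: C_infinity.coinduct)
  case C_infinity
  have "f differentiable (at x)" for x using C_infinity[rule_format, of "Suc 0"] by simp
  moreover have "times_differentiable n (\<lambda>x. grad f x v)" for n v
   using C_infinity[rule_format, of "Suc n"] by simp
  ultimately show ?case by blast
 qed
qed

lemma times_differentiable_SucI:
 assumes "\<And>x. (f has_derivative f' x) (at x)" "\<And>v. times_differentiable n (\<lambda>x. f' x v)"
 shows "times_differentiable (Suc n) f"
proof -
 have "grad f x = f' x" for x
  using frechet_derivative_at[OF assms(1)] by simp
 then show ?thesis using assms by (auto simp: differentiable_def)
qed

lemma has_derivative_frechet:
 "times_differentiable (Suc n) f \<Longrightarrow> (f has_derivative grad f x) (at x)"
 by (simp add: frechet_derivative_works)

lemma times_differentiable_SucD: "times_differentiable (Suc n) f \<Longrightarrow> times_differentiable n f"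
 by (induction n arbitrary: f) (simp_all add: all_conj_distrib)

lemma times_differentiable_const: "times_differentiable n (\<lambda>x. c)"
proof (induction n arbitrary: c)
 case (Suc n)
 show ?case by (rule times_differentiable_SucI[where f' = "\<lambda>x v. 0"]) (auto intro: Suc)
qed simp

lemma times_differentiable_linear: "bounded_linear f \<Longrightarrow> times_differentiable n f"
 by (cases n) (auto simp del: times_differentiable.simps(2) intro!: times_differentiable_SucI[where f' = "\<lambda>x. f"]
  bounded_linear_imp_has_derivative times_differentiable_const)

lemma times_differentiable_add:
 "times_differentiable n f \<Longrightarrow> times_differentiable n g \<Longrightarrow> times_differentiable n (\<lambda>x. f x + g x)"
proof (induction n arbitrary: f g)
 case (Suc n)
 show ?case
  by (rule times_differentiable_SucI[OF has_derivative_add[OF has_derivative_frechet[OF Suc.prems(1)]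
    has_derivative_frechet[OF Suc.prems(2)]]]) (use Suc in simp)
qed simp

lemma times_differentiable_mult:
 "times_differentiable n f \<Longrightarrow> times_differentiable n g \<Longrightarrow> times_differentiable n (\<lambda>x. f x * g x)"
proof (induction n arbitrary: f g)
 case (Suc n)
 show ?case
  by (rule times_differentiable_SucI[OF has_derivative_mult[OF has_derivative_frechet[OF Suc.prems(1)]
    has_derivative_frechet[OF Suc.prems(2)]]])
   (use Suc.prems[THEN times_differentiable_SucD] Suc.prems in \<open>auto intro!: times_differentiable_add Suc.IH\<close>)
qed simp

lemma times_differentiable_sum:
 "(\<And>i. i \<in> I \<Longrightarrow> times_differentiable n (f i)) \<Longrightarrow> times_differentiable n (\<lambda>x. \<Sum>i\<in>I. f i x)"
 by (induction I rule: infinite_finite_induct)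
  (auto intro: times_differentiable_const times_differentiable_add)

text \<open>\<open>H\<close> is generalized because the induction continues with its derivative;
  linearity on the real line turns that derivative into a scalar factor, so the product rule
  applies.\<close>

lemma times_differentiable_compose:
 fixes H :: "real \<Rightarrow> real"
 shows "times_differentiable n H \<Longrightarrow> times_differentiable n f \<Longrightarrow> times_differentiable n (\<lambda>x. H (f x))"
proof (induction n arbitrary: f H)
 case (Suc n)
 have *: "grad H y w = grad H y 1 * w" for y w
  using linear_scale[OF linear_frechet_derivative, of H "at y" w 1] Suc.prems(1) by simp
 have "((\<lambda>x. H (f x)) has_derivative
   (\<lambda>v. grad H (f x) 1 * grad f x v)) (at x)" for x
  using has_derivative_compose[OF has_derivative_frechet[OF Suc.prems(2)] has_derivative_frechet[OF Suc.prems(1)]]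
  by (subst (asm) *)
 moreover have "times_differentiable n (\<lambda>x. grad H (f x) 1)"
  by (rule Suc.IH[where H = "\<lambda>y. grad H y 1"])
   (use Suc.prems(1) times_differentiable_SucD[OF Suc.prems(2)] in auto)
 then have "times_differentiable n (\<lambda>x. grad H (f x) 1 * grad f x v)" for v
  by (rule times_differentiable_mult) (use Suc.prems(2) in auto)
 ultimately show ?case
  by (rule times_differentiable_SucI)
qed simp

lemma times_differentiable_affine:
 "times_differentiable n f \<Longrightarrow> times_differentiable n (\<lambda>x. f (c *\<^sub>R x + a))"
proof (induction n arbitrary: f)
 case (Suc n)
 have "((\<lambda>x. f (c *\<^sub>R x + a)) has_derivative (\<lambda>v. grad f (c *\<^sub>R x + a) (c *\<^sub>R v))) (at x)" for x
  by (rule has_derivative_compose[where f = "\<lambda>x. c *\<^sub>R x + a"])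
   (auto intro!: derivative_eq_intros has_derivative_frechet[OF Suc.prems])
 then show ?case
  by (rule times_differentiable_SucI) (use Suc in auto)
qed simp

lemma times_differentiable_inverse:
 assumes "\<And>x. f x \<noteq> 0"
 shows "times_differentiable n f \<Longrightarrow> times_differentiable n (\<lambda>x. inverse (f x))"
proof (induction n)
 case (Suc n)
 have "((\<lambda>x. inverse (f x)) has_derivative
   (\<lambda>v. - (inverse (f x) * grad f x v * inverse (f x)))) (at x)" for x
  by (rule Deriv.has_derivative_inverse[OF assms has_derivative_frechet[OF Suc.prems]])
 then have "((\<lambda>x. inverse (f x)) has_derivative
   (\<lambda>v. (-1) * (inverse (f x) * (grad f x v * inverse (f x))))) (at x)" for x
  by (simp add: mult.assoc)
 then show ?case
  by (rule times_differentiable_SucI)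
   (intro times_differentiable_mult times_differentiable_const Suc.IH times_differentiable_SucD[OF Suc.prems];
   use Suc.prems in simp)
qed simp

text \<open>The case \<open>k = 0\<close> is the classical flat function. The negative powers close
  the family under differentiation up to linear combinations, so that smoothness is one induction
  for all \<open>k\<close> at once.\<close>

definition exp_flat :: "nat \<Rightarrow> real \<Rightarrow> real" where
 "exp_flat k x = (if x > 0 then exp (- 1 / x) / x ^ k else 0)"

lemma exp_flat_lim: "((\<lambda>x. exp_flat k x) \<longlongrightarrow> 0) (at 0)"
proof -
 have "((\<lambda>x. exp_flat k x) \<longlongrightarrow> 0) (at_right 0)"
 proof (rule Lim_transform_eventually)
  show "((\<lambda>x. (inverse x) ^ k / exp (inverse x)) \<longlongrightarrow> 0) (at_right (0::real))"
   by (rule filterlim_compose[OF tendsto_power_div_exp_0 filterlim_inverse_at_top_right])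
  show "\<forall>\<^sub>F x in at_right (0::real). (inverse x) ^ k / exp (inverse x) = exp_flat k x"
   using eventually_at_right_less[of "0::real"]
   by eventually_elim (simp add: exp_flat_def exp_minus field_simps)
 qed
 moreover have "((\<lambda>x. exp_flat k x) \<longlongrightarrow> 0) (at_left 0)"
  by (rule Lim_transform_eventually[OF tendsto_const])
   (auto simp: exp_flat_def eventually_at_filter)
 ultimately show ?thesis by (simp add: filterlim_at_split)
qed

lemma exp_flat_deriv:
 "(exp_flat k has_real_derivative exp_flat (k + 2) x - real k * exp_flat (k + 1) x) (at x)"
proof (cases "x = 0")
 case True
 \<comment> \<open>The difference quotient of \<open>exp_flat k\<close> at 0 is
   \<open>exp_flat (k + 1)\<close>.\<close>
 have "((\<lambda>h. exp_flat k (0 + h) - exp_flat k 0) has_real_derivative 0) (at 0)"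
  unfolding DERIV_def
  by (rule Lim_transform_eventually[OF exp_flat_lim[of "k + 1"]])
   (auto simp: exp_flat_def eventually_at_filter)
 then show ?thesis using True unfolding DERIV_def by (simp add: exp_flat_def)
next
 case False
 show ?thesis
 proof (cases "x > 0")
  case True
  have "x ^ k = x * x ^ (k - 1)" if "k \<noteq> 0" using that by (cases k) auto
  then have "((\<lambda>x. exp (- 1 / x) / x ^ k) has_real_derivative exp_flat (k + 2) x - real k * exp_flat (k + 1) x) (at x)"
   using True
   by (cases "k = 0") (auto intro!: derivative_eq_intros simp: exp_flat_def field_simps power2_eq_square)
  then show ?thesis
   by (rule has_field_derivative_transform_within_open[of _ _ _ "{0<..}"])
    (use True in \<open>auto simp: exp_flat_def\<close>)
 next
  case neg: False
  have "((\<lambda>x. 0) has_real_derivative exp_flat (k + 2) x - real k * exp_flat (k + 1) x) (at x)"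
   using neg by (simp add: exp_flat_def)
  then show ?thesis
   by (rule has_field_derivative_transform_within_open[of _ _ _ "{..<0}"])
    (use neg False in \<open>auto simp: exp_flat_def\<close>)
 qed
qed

lemma times_differentiable_exp_flat: "times_differentiable n (exp_flat k)"
proof (induction n arbitrary: k)
 case (Suc n)
 have *: "(exp_flat k has_derivative (\<lambda>v. (exp_flat (k + 2) x + (- real k) * exp_flat (k + 1) x) * v)) (at x)" for x
  using exp_flat_deriv[of k x] by (simp add: has_field_derivative_def)
 show ?case
  by (rule times_differentiable_SucI[OF *])
   (intro times_differentiable_mult times_differentiable_add times_differentiable_const Suc)
qed simp

definition smooth_step :: "real \<Rightarrow> real" where
 "smooth_step x = exp_flat 0 x / (exp_flat 0 x + exp_flat 0 (1 - x))"

definition smooth_step' :: "real \<Rightarrow> real" where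
 "smooth_step' x = deriv smooth_step x"

lemma exp_flat_nonneg: "0 \<le> exp_flat k x"
 by (simp add: exp_flat_def)

lemma smooth_step_denom: "0 < exp_flat 0 x + exp_flat 0 (1 - x)"
proof (cases "x > 0")
 case True then show ?thesis using exp_flat_nonneg[of 0 "1-x"] 
  by (auto simp: exp_flat_def intro!: add_pos_pos)
next
 case False then show ?thesis using exp_flat_nonneg[of 0 "x"] by (simp add: exp_flat_def)
qed

lemma times_differentiable_smooth_step: "times_differentiable n smooth_step"
proof -
 have eq: "smooth_step = (\<lambda>x. exp_flat 0 x * inverse (exp_flat 0 x + exp_flat 0 ((-1) *\<^sub>R x + 1)))"
  by (auto simp: smooth_step_def divide_inverse)
 show ?thesis unfolding eq using smooth_step_denom
  by (intro times_differentiable_mult times_differentiable_inverse times_differentiable_add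
   times_differentiable_affine times_differentiable_exp_flat) (simp add: order_less_le)
qed

lemma smooth_step_deriv: "(smooth_step has_real_derivative smooth_step' x) (at x)"
proof -
 have "smooth_step differentiable (at x)"
  using times_differentiable_smooth_step[of 1] by simp
 then show ?thesis unfolding smooth_step'_def
  using DERIV_deriv_iff_real_differentiable by blast
qed

lemma times_differentiable_smooth_step': "times_differentiable n smooth_step'"
proof -
 have "grad smooth_step x 1 = smooth_step' x" for x
  using frechet_derivative_at[OF smooth_step_deriv[unfolded has_field_derivative_def], symmetric]
  by simp
 then have "smooth_step' = (\<lambda>x. grad smooth_step x 1)" by auto
 moreover have "times_differentiable n (\<lambda>x. grad smooth_step x 1)"
  using times_differentiable_smooth_step[of "Suc n"] by simp
 ultimately show ?thesis by simp
qed

lemma smooth_step_0: "x \<le> 0 \<Longrightarrow> smooth_step x = 0"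
 and smooth_step_1: "x \<ge> 1 \<Longrightarrow> smooth_step x = 1"
 by (auto simp: smooth_step_def exp_flat_def)

lemma smooth_step_bounds: "0 \<le> smooth_step x" "smooth_step x \<le> 1"
 using exp_flat_nonneg[of 0 x] exp_flat_nonneg[of 0 "1 - x"] smooth_step_denom[of x]
 by (auto simp: smooth_step_def divide_le_eq)

lemma exp_flat_0_mono: "x \<le> y \<Longrightarrow> exp_flat 0 x \<le> exp_flat 0 y"
 by (auto simp: exp_flat_def field_simps)

lemma smooth_step_mono: "x \<le> y \<Longrightarrow> smooth_step x \<le> smooth_step y"
proof -
 assume "x \<le> y"
 have 1: "exp_flat 0 x \<le> exp_flat 0 y" and 2: "exp_flat 0 (1 - y) \<le> exp_flat 0 (1 - x)"
  using \<open>x \<le> y\<close> by (auto intro: exp_flat_0_mono)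
 have "exp_flat 0 x * exp_flat 0 (1 - y) \<le> exp_flat 0 y * exp_flat 0 (1 - x)"
  by (intro mult_mono 1 2 exp_flat_nonneg)
 then have "exp_flat 0 x * (exp_flat 0 y + exp_flat 0 (1 - y)) - exp_flat 0 y * (exp_flat 0 x + exp_flat 0 (1 - x)) \<le> 0"
  by (simp add: distrib_left)
 then show ?thesis
  unfolding smooth_step_def using smooth_step_denom[of x] smooth_step_denom[of y]
  by (subst frac_le_eq) (auto intro!: divide_nonpos_pos mult_pos_pos)
qed

lemma smooth_step'_nonneg: "0 \<le> smooth_step' x"
proof (rule ccontr)
 assume "\<not> 0 \<le> smooth_step' x"
 then obtain d where "d > 0" and d: "\<And>h. 0 < h \<Longrightarrow> h < d \<Longrightarrow> smooth_step x > smooth_step (x + h)"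
  using DERIV_neg_dec_right[OF smooth_step_deriv] by (metis not_le)
 have "smooth_step x > smooth_step (x + d / 2)" using \<open>d > 0\<close> d by simp
 moreover have "smooth_step x \<le> smooth_step (x + d / 2)" using \<open>d > 0\<close> by (intro smooth_step_mono) simp
 ultimately show False by simp
qed

text \<open>The step attains its minimum on the left half line and its maximum from 1 on, so the
  derivative vanishes there, end points included.\<close>

lemma smooth_step'_0: "x \<le> 0 \<Longrightarrow> smooth_step' x = 0"
 and smooth_step'_1: "x \<ge> 1 \<Longrightarrow> smooth_step' x = 0"
proof -
 assume "x \<le> 0"
 show "smooth_step' x = 0"
  by (rule DERIV_local_min[OF smooth_step_deriv, of 1])
   (use \<open>x \<le> 0\<close> in \<open>auto simp: smooth_step_0 smooth_step_bounds\<close>)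
next
 assume "x \<ge> 1"
 show "smooth_step' x = 0"
  by (rule DERIV_local_max[OF smooth_step_deriv, of 1])
   (use \<open>x \<ge> 1\<close> in \<open>auto simp: smooth_step_1 smooth_step_bounds\<close>)
qed


section \<open>Supports, bounds and Taylor remainders of test functions\<close>

lemma test_functionI:
 assumes "\<And>n. times_differentiable n f" "\<And>x. R < norm x \<Longrightarrow> f x = 0"
 shows "test_function f"
proof -
 have "{x. f x \<noteq> 0} \<subseteq> cball 0 R" using assms(2) by (force simp: not_le[symmetric])
 then have "compact (closure {x. f x \<noteq> 0})"
  by (meson bounded_cball bounded_subset compact_closure)
 then show ?thesis
  using assms(1) by (auto simp: test_function_def C_infinity_iff_times_differentiable)
qed

lemma test_function_times_differentiable: "test_function f \<Longrightarrow> times_differentiable n f"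
 by (simp add: test_function_def C_infinity_iff_times_differentiable)

lemma test_function_has_derivative:
 "test_function f \<Longrightarrow> (f has_derivative grad f x) (at x)"
 using has_derivative_frechet test_function_times_differentiable by blast

lemma test_function_support:
 assumes "test_function f"
 obtains R where "R > 0" "\<And>x. R < norm x \<Longrightarrow> f x = 0"
proof -
 have "bounded (closure {x. f x \<noteq> 0})"
  using assms by (auto simp: test_function_def compact_imp_bounded)
 then obtain R where "R > 0" "\<forall>x\<in>closure {x. f x \<noteq> 0}. norm x \<le> R"
  using bounded_pos by blast
 then have "R < norm x \<Longrightarrow> f x = 0" for x
  using closure_subset[of "{x. f x \<noteq> 0}"] by force
 with \<open>R > 0\<close> show ?thesis by (rule that)
qed

lemma frechet_derivative_outside:
 fixes f :: "'a::euclidean_space \<Rightarrow> real"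
 assumes "\<And>x. R < norm x \<Longrightarrow> f x = 0" "R < norm x"
 shows "grad f x = (\<lambda>_. 0)"
proof (rule frechet_derivative_at[symmetric], rule has_derivative_transform_within_open)
 show "((\<lambda>_. 0) has_derivative (\<lambda>_. 0)) (at x)" by simp
 show "open {x::'a. R < norm x}" by (intro open_Collect_less continuous_intros)
qed (use assms in auto)

lemma test_function_derivative:
 assumes "test_function f"
 shows "test_function (\<lambda>x. grad f x v)"
proof -
 obtain R where R: "R > 0" "\<And>x. R < norm x \<Longrightarrow> f x = 0"
  using test_function_support[OF assms] by blast
 show ?thesis
 proof (rule test_functionI[of _ R])
  show "times_differentiable n (\<lambda>x. grad f x v)" for n
   using test_function_times_differentiable[OF assms, of "Suc n"] by simp
  show "R < norm x \<Longrightarrow> grad f x v = 0" for x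
   using frechet_derivative_outside[of R f, OF R(2)] by metis
 qed
qed

lemma test_function_continuous: "test_function f \<Longrightarrow> continuous_on UNIV f"
 by (rule has_derivative_continuous_on) (auto intro: test_function_has_derivative)

lemma test_function_measurable: "test_function f \<Longrightarrow> f \<in> borel_measurable borel"
 by (simp add: test_function_continuous borel_measurable_continuous_onI)

lemma test_function_bounded:
 assumes "test_function f"
 obtains G where "G > 0" "\<And>x. \<bar>f x\<bar> \<le> G"
proof -
 obtain R where R: "R > 0" "\<And>x. R < norm x \<Longrightarrow> f x = 0"
  using test_function_support[OF assms] by blast
 have "compact (f ` cball 0 R)"
  by (intro compact_continuous_image continuous_on_subset[OF test_function_continuous[OF assms]]) auto
 then obtain G where G: "G > 0" "\<forall>y\<in>f ` cball 0 R. norm y \<le> G"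
  using bounded_pos compact_imp_bounded by blast
 then have "\<bar>f x\<bar> \<le> G" for x
  using R(2)[of x] by (cases "norm x \<le> R") auto
 with \<open>G > 0\<close> show ?thesis by (rule that)
qed

lemma frechet_derivative_basis:
 assumes "f differentiable (at x)"
 shows "grad f x v = (\<Sum>b\<in>Basis. (v \<bullet> b) *\<^sub>R grad f x b)"
proof -
 interpret linear "grad f x"
  using linear_frechet_derivative assms by blast
 have "grad f x (\<Sum>b\<in>Basis. (v \<bullet> b) *\<^sub>R b) = (\<Sum>b\<in>Basis. (v \<bullet> b) *\<^sub>R grad f x b)"
  by (simp add: sum scaleR)
 then show ?thesis by (simp add: euclidean_representation)
qed

lemma test_function_frechet_basis:
 "test_function f \<Longrightarrow> grad f x v = (\<Sum>b\<in>Basis. (v \<bullet> b) * grad f x b)"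
 using frechet_derivative_basis[of f x v] test_function_has_derivative[of f x]
 by (auto simp: differentiable_def)

lemma test_function_frechet_measurable [measurable]:
 assumes "test_function f" "g \<in> borel_measurable M" "h \<in> borel_measurable M"
 shows "(\<lambda>x. grad f (g x) (h x)) \<in> borel_measurable M"
proof -
 have "(\<lambda>x. grad f (g x) b) \<in> borel_measurable M" for b
  using measurable_compose[OF assms(2) test_function_measurable[OF test_function_derivative[OF assms(1)]]] .
 note [measurable] = this assms(2,3)
 show ?thesis by (subst test_function_frechet_basis[OF assms(1)]) measurable
qed

lemma test_function_gradient_bounded:
 assumes "test_function f"
 obtains G where "G > 0" "\<And>x v. \<bar>grad f x v\<bar> \<le> G * norm v"
proof -
 have "\<exists>G>0. \<forall>x. \<bar>grad f x b\<bar> \<le> G" for b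
  using test_function_bounded[OF test_function_derivative[OF assms]] by metis
 then obtain G where G: "\<And>b. G b > 0" "\<And>b x. \<bar>grad f x b\<bar> \<le> G b" by metis
 show ?thesis
 proof
  show "(\<Sum>b\<in>Basis. G b) > 0" using G by (intro sum_pos) auto
  show "\<bar>grad f x v\<bar> \<le> (\<Sum>b\<in>Basis. G b) * norm v" for x v
  proof -
   have "\<bar>grad f x v\<bar> \<le> (\<Sum>b\<in>Basis. \<bar>(v \<bullet> b) * grad f x b\<bar>)"
    by (subst test_function_frechet_basis[OF assms]) (rule sum_abs)
   also have "\<dots> \<le> (\<Sum>b\<in>Basis. norm v * G b)"
    using G by (intro sum_mono) (auto simp: abs_mult Basis_le_norm intro!: mult_mono)
   finally show ?thesis by (simp add: sum_distrib_left mult.commute)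
  qed
 qed
qed

lemma test_function_lipschitz:
 assumes "test_function f"
 obtains G where "G > 0" "\<And>x y. \<bar>f x - f y\<bar> \<le> G * dist x y" 
  "\<And>x. \<bar>f x\<bar> \<le> G" "\<And>x v. \<bar>grad f x v\<bar> \<le> G * norm v"
proof -
 obtain G where G: "G > 0" "\<And>x v. \<bar>grad f x v\<bar> \<le> G * norm v"
  using test_function_gradient_bounded[OF assms] by blast
 obtain G' where G': "G' > 0" "\<And>x. \<bar>f x\<bar> \<le> G'"
  using test_function_bounded[OF assms] by blast
 have *: "\<bar>f x - f y\<bar> \<le> G * dist x y" for x y
  using differentiable_bound[of UNIV f "\<lambda>x. grad f x" G x y]
   test_function_has_derivative[OF assms] onorm_le[of "grad f _" G] G
  by (simp add: dist_norm)
 show ?thesis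
 proof (rule that[of "G + G'"])
  show "\<bar>f x - f y\<bar> \<le> (G + G') * dist x y" for x y
   using *[of x y] \<open>G' > 0\<close> by (simp add: distrib_right add_increasing2)
  show "\<bar>f x\<bar> \<le> G + G'" for x using G'(2)[of x] G(1) by simp
  show "\<bar>grad f x v\<bar> \<le> (G + G') * norm v" for x v
   using G(2)[of x v] \<open>G' > 0\<close> by (simp add: distrib_right add_increasing2)
 qed (use G G' in auto)
qed

lemma test_function_derivative_lipschitz:
 assumes "test_function f"
 obtains G where "G > 0" "\<And>x y v. \<bar>grad f x v - grad f y v\<bar> \<le> G * dist x y * norm v"
proof -
 have "\<exists>G>0. \<forall>x y. \<bar>grad f x b - grad f y b\<bar> \<le> G * dist x y" for b
  using test_function_lipschitz[OF test_function_derivative[OF assms]] by metis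
 then obtain G where G: "\<And>b. G b > 0"
  "\<And>b x y. \<bar>grad f x b - grad f y b\<bar> \<le> G b * dist x y" by metis
 show ?thesis
 proof
  show "(\<Sum>b\<in>Basis. G b) > 0" using G by (intro sum_pos) auto
  show "\<bar>grad f x v - grad f y v\<bar> \<le> (\<Sum>b\<in>Basis. G b) * dist x y * norm v" for x y v
  proof -
   have "\<bar>grad f x v - grad f y v\<bar> \<le>
     (\<Sum>b\<in>Basis. \<bar>(v \<bullet> b) * (grad f x b - grad f y b)\<bar>)"
    by (subst (1 2) test_function_frechet_basis[OF assms])
     (simp add: sum_subtractf[symmetric] right_diff_distrib[symmetric] sum_abs)
   also have "\<dots> \<le> (\<Sum>b\<in>Basis. norm v * (G b * dist x y))"
    using G by (intro sum_mono) (auto simp: abs_mult Basis_le_norm intro!: mult_mono)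
   finally show ?thesis by (simp add: sum_distrib_left sum_distrib_right mult_ac)
  qed
 qed
qed

text \<open>Mean value inequality for \<open>f\<close> minus its linearization at \<open>x\<close>,
  whose derivative on the segment is at most \<open>G * dist x y\<close>. No compact support is
  required because it also serves \<open>smooth_step\<close>.\<close>

lemma taylor_lipschitz_derivative:
 fixes f :: "'a::euclidean_space \<Rightarrow> real"
 assumes "\<And>x. (f has_derivative f' x) (at x)" "G \<ge> 0"
  and "\<And>x y v. \<bar>f' x v - f' y v\<bar> \<le> G * dist x y * norm v"
 shows "\<bar>f y - f x - f' x (y - x)\<bar> \<le> G * (dist x y)\<^sup>2"
proof -
 have lin: "bounded_linear (f' x)" by (rule has_derivative_bounded_linear[OF assms(1)])
 have "norm ((f y - f' x y) - (f x - f' x x)) \<le> (G * dist x y) * norm (y - x)"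
 proof (rule differentiable_bound[of "closed_segment x y" "\<lambda>z. f z - f' x z" "\<lambda>z v. f' z v - f' x v"])
  fix z assume z: "z \<in> closed_segment x y"
  show "((\<lambda>z. f z - f' x z) has_derivative (\<lambda>v. f' z v - f' x v)) (at z within closed_segment x y)"
   by (rule has_derivative_at_withinI, rule has_derivative_diff[OF assms(1) bounded_linear_imp_has_derivative[OF lin]])
  have "dist z x \<le> dist x y"
   using segment_bound(1)[OF z] by (simp add: dist_norm norm_minus_commute)
  then have "G * dist z x * norm v \<le> G * dist x y * norm v" for v :: 'a
   using \<open>G \<ge> 0\<close> by (intro mult_right_mono mult_left_mono) auto
  then have "\<bar>f' z v - f' x v\<bar> \<le> G * dist x y * norm v" for v
   by (rule order.trans[OF assms(3)])
  then show "onorm (\<lambda>v. f' z v - f' x v) \<le> G * dist x y"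
   by (intro onorm_le) simp
 qed auto
 also have "(f y - f' x y) - (f x - f' x x) = f y - f x - f' x (y - x)"
  by (simp add: linear_diff[OF bounded_linear.linear[OF lin]])
 finally show ?thesis
  by (simp add: dist_norm power2_eq_square norm_minus_commute mult.assoc)
qed

lemma test_function_taylor:
 assumes "test_function f"
 obtains G where "G > 0" "\<And>x y. \<bar>f y - f x - grad f x (y - x)\<bar> \<le> G * (dist x y)\<^sup>2"
proof -
 obtain G where G: "G > 0" "\<And>x y v. \<bar>grad f x v - grad f y v\<bar> \<le> G * dist x y * norm v"
  using test_function_derivative_lipschitz[OF assms] by blast
 show ?thesis
  by (rule that[OF G(1)], rule taylor_lipschitz_derivative[OF test_function_has_derivative[OF assms] _ G(2)])
   (use G(1) in simp)
qed

lemma test_function_affine: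
 assumes "test_function f" "c \<noteq> 0"
 shows "test_function (\<lambda>x. f (c *\<^sub>R x + a))"
proof -
 obtain R where R: "R > 0" "\<And>x. R < norm x \<Longrightarrow> f x = 0"
  using test_function_support[OF assms(1)] by blast
 show ?thesis
 proof (rule test_functionI[where R = "(R + norm a) / \<bar>c\<bar>"])
  show "times_differentiable n (\<lambda>x. f (c *\<^sub>R x + a))" for n
   by (intro times_differentiable_affine test_function_times_differentiable assms)
  fix x :: 'a assume "(R + norm a) / \<bar>c\<bar> < norm x"
  then have "R + norm a < norm (c *\<^sub>R x)" using \<open>c \<noteq> 0\<close> by (simp add: field_simps)
  then have "R < norm (c *\<^sub>R x + a)" using norm_triangle_ineq4[of "c *\<^sub>R x + a" a] by simp
  then show "f (c *\<^sub>R x + a) = 0" by (rule R)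
 qed
qed

lemma test_function_mult:
 assumes "test_function f" "\<And>n. times_differentiable n g"
 shows "test_function (\<lambda>x. f x * g x)"
proof -
 obtain R where R: "R > 0" "\<And>x. R < norm x \<Longrightarrow> f x = 0"
  using test_function_support[OF assms(1)] by blast
 show ?thesis
  by (rule test_functionI[where R = R]) 
   (use R in \<open>simp_all add: times_differentiable_mult test_function_times_differentiable assms\<close>)
qed

text \<open>A function of \<open>y \<bullet> y\<close>, hence smooth at the origin. It is 1 on the
  closed unit ball and 0 from radius \<kappa> on; \<kappa> close to 1 makes the transition layer as
  thin as desired.\<close>

definition bump :: "real \<Rightarrow> 'a::euclidean_space \<Rightarrow> real" where
 "bump \<kappa> y = smooth_step ((\<kappa>\<^sup>2 - y \<bullet> y) / (\<kappa>\<^sup>2 - 1))"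

text \<open>The gradient of \<open>bump \<kappa>\<close> at \<open>y\<close> is
  \<open>- bump' \<kappa> y\<close> times \<open>y\<close>. Isolating this nonnegative radial factor
  reduces later sign questions to inner products.\<close>

definition bump' :: "real \<Rightarrow> 'a::euclidean_space \<Rightarrow> real" where
 "bump' \<kappa> y = 2 / (\<kappa>\<^sup>2 - 1) * smooth_step' ((\<kappa>\<^sup>2 - y \<bullet> y) / (\<kappa>\<^sup>2 - 1))"

lemma bump_derivative:
 assumes "\<kappa> > 1"
 shows "(bump \<kappa> has_derivative (\<lambda>w. - bump' \<kappa> y * (y \<bullet> w))) (at y)"
proof -
 have "\<kappa>\<^sup>2 > 1" using assms by (simp add: power_strict_mono one_less_power)
 have 1: "((\<lambda>y. (\<kappa>\<^sup>2 - y \<bullet> y) / (\<kappa>\<^sup>2 - 1)) has_derivative (\<lambda>w. - 2 * (y \<bullet> w) / (\<kappa>\<^sup>2 - 1))) (at y)"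
  unfolding divide_inverse
  by (rule has_derivative_eq_rhs[OF has_derivative_mult_left[where g' = "\<lambda>w. - 2 * (y \<bullet> w)"]])
   (auto intro!: derivative_eq_intros simp: inner_commute)
 show ?thesis unfolding bump_def
  by (rule has_derivative_eq_rhs[OF has_derivative_compose[OF 1 smooth_step_deriv[unfolded has_field_derivative_def]]])
   (auto simp: bump'_def)
qed

lemma times_differentiable_inner_self: "times_differentiable n (\<lambda>y::'a::euclidean_space. y \<bullet> y)"
proof (cases n)
 case (Suc m)
 have "((\<lambda>y::'a. y \<bullet> y) has_derivative (\<lambda>w. (2 *\<^sub>R w) \<bullet> y)) (at y)" for y
  by (auto intro!: derivative_eq_intros simp: inner_commute)
 then show ?thesis unfolding Suc
  by (rule times_differentiable_SucI) (intro times_differentiable_linear bounded_linear_intros)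
qed simp

lemma times_differentiable_bump_arg:
 "times_differentiable n (\<lambda>y::'a::euclidean_space. (\<kappa>\<^sup>2 - y \<bullet> y) / (\<kappa>\<^sup>2 - 1))"
proof -
 have "(\<lambda>y::'a. (\<kappa>\<^sup>2 - y \<bullet> y) / (\<kappa>\<^sup>2 - 1)) = (\<lambda>y. \<kappa>\<^sup>2 / (\<kappa>\<^sup>2 - 1) + (- 1 / (\<kappa>\<^sup>2 - 1)) * (y \<bullet> y))"
  by (auto simp: diff_divide_distrib)
 then show ?thesis
  by (simp only:) (intro times_differentiable_add times_differentiable_mult times_differentiable_const
   times_differentiable_inner_self)
qed

lemma bump_arg_nonpos: "\<kappa> > 1 \<Longrightarrow> \<kappa> \<le> norm y \<Longrightarrow> (\<kappa>\<^sup>2 - y \<bullet> y) / (\<kappa>\<^sup>2 - 1) \<le> 0"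
 using power_mono[of \<kappa> "norm y" 2] one_less_power[of \<kappa> 2]
 by (auto simp: dot_square_norm intro!: divide_nonpos_pos)

lemma bump_arg_ge_1: "\<kappa> > 1 \<Longrightarrow> norm y \<le> 1 \<Longrightarrow> 1 \<le> (\<kappa>\<^sup>2 - y \<bullet> y) / (\<kappa>\<^sup>2 - 1)"
 using power_mono[of "norm y" 1 2] one_less_power[of \<kappa> 2]
 by (auto simp: dot_square_norm)

lemma test_function_bump: "\<kappa> > 1 \<Longrightarrow> test_function (bump \<kappa>)"
 unfolding bump_def
 by (rule test_functionI[where R = \<kappa>])
  (auto intro!: times_differentiable_compose[OF times_differentiable_smooth_step] times_differentiable_bump_arg
   smooth_step_0 bump_arg_nonpos)

lemma test_function_bump': "\<kappa> > 1 \<Longrightarrow> test_function (bump' \<kappa>)"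
 unfolding bump'_def
 by (rule test_functionI[where R = \<kappa>])
  (intro times_differentiable_mult times_differentiable_const times_differentiable_bump_arg
   times_differentiable_compose[OF times_differentiable_smooth_step'],
  auto intro!: smooth_step'_0 bump_arg_nonpos)

lemma bump_eq_1: "\<kappa> > 1 \<Longrightarrow> norm y \<le> 1 \<Longrightarrow> bump \<kappa> y = 1"
 unfolding bump_def by (intro smooth_step_1 bump_arg_ge_1)

lemma bump_eq_0: "\<kappa> > 1 \<Longrightarrow> \<kappa> \<le> norm y \<Longrightarrow> bump \<kappa> y = 0"
 by (simp add: bump_def smooth_step_0 bump_arg_nonpos)

lemma bump_bounds: "0 \<le> bump \<kappa> y" "bump \<kappa> y \<le> 1"
 by (simp_all add: bump_def smooth_step_bounds)

lemma bump'_nonneg: "\<kappa> > 1 \<Longrightarrow> 0 \<le> bump' \<kappa> y"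
 using one_less_power[of \<kappa> 2] by (simp add: bump'_def smooth_step'_nonneg)

lemma bump'_eq_0: "\<kappa> > 1 \<Longrightarrow> norm y \<le> 1 \<Longrightarrow> bump' \<kappa> y = 0"
 unfolding bump'_def using smooth_step'_1[OF bump_arg_ge_1, of \<kappa> y] by simp

lemma bump'_eq_0': "\<kappa> > 1 \<Longrightarrow> \<kappa> \<le> norm y \<Longrightarrow> bump' \<kappa> y = 0"
 by (simp add: bump'_def smooth_step'_0 bump_arg_nonpos)

lemma test_function_smooth_step': "test_function smooth_step'"
 by (rule test_functionI[where R = 1])
  (simp_all add: times_differentiable_smooth_step' abs_if smooth_step'_0 smooth_step'_1 split: if_splits)

section \<open>Singular kernels and bounded densities\<close>

text \<open>A geometric series over dyadic balls: the power is taken at half of each radius, which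
  gives the factor \<open>2 powr \<beta>\<close>, and the ratio is
  \<open>2 powr (\<beta> - d)\<close>.\<close>

definition singular_const :: "real \<Rightarrow> real \<Rightarrow> real" where
 "singular_const d \<beta> = unit_ball_vol d * 2 powr \<beta> / (1 - 2 powr (\<beta> - d))"

lemma singular_const_pos: "\<beta> < d \<Longrightarrow> 0 \<le> d \<Longrightarrow> 0 < singular_const d \<beta>"
 by (auto simp: singular_const_def powr_less_one intro!: divide_pos_pos mult_pos_pos)

lemma dyadic_shell:
 fixes r R :: real
 assumes "0 < r" "r < R"
 obtains k :: nat where "R / 2 ^ Suc k \<le> r" "r < R / 2 ^ k"
proof -
 obtain n where n: "R / r < 2 ^ n" using real_arch_pow[of 2 "R / r"] by auto
 define m where "m = (LEAST n. R / r < 2 ^ n)"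
 have m: "R / r < 2 ^ m" unfolding m_def by (rule LeastI[where P = "\<lambda>n. R / r < 2 ^ n", OF n])
 have "m \<noteq> 0" using m assms by (intro notI) simp
 then obtain k where k: "m = Suc k" by (cases m) auto
 have *: "\<not> R / r < 2 ^ k" using not_less_Least[of k "\<lambda>n. R / r < 2 ^ n"] k by (simp add: m_def)
 \<comment> \<open>Minimality puts the equality at the outer end of the shell; a radius lying
   exactly there is moved to the next larger shell.\<close>
 obtain k' where k': "R / 2 ^ Suc k' < r" "r \<le> R / 2 ^ k'"
  using m * k assms by (intro that[of k]) (auto simp: field_simps)
 show ?thesis
 proof (cases "r = R / 2 ^ k'")
  case False then show ?thesis using k' by (intro that[of k']) auto
 next
  case True
  then have "k' \<noteq> 0" using assms by (intro notI) simp
  then obtain l where "k' = Suc l" by (cases k') auto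
  then show ?thesis using True assms by (intro that[of l]) (auto simp: field_simps)
 qed
qed

text \<open>Every point of the ball except \<open>x\<close> lies in a dyadic shell, where the power
  is at most its value on the inner sphere. Replacing shells by full balls still leaves a convergent
  geometric series, as \<beta> is below the dimension.\<close>

lemma nn_integral_singular:
 fixes x :: "'a::euclidean_space"
 assumes "0 \<le> \<beta>" "\<beta> < real DIM('a)" "0 < R"
 shows "(\<integral>\<^sup>+y. ennreal (norm (x - y) powr - \<beta>) * indicator (ball x R) y \<partial>lborel)
  \<le> ennreal (singular_const (real DIM('a)) \<beta> * R powr (real DIM('a) - \<beta>))"
proof -
 let ?d = "real DIM('a)" and ?q = "2 powr (\<beta> - real DIM('a)) :: real"
 define a where "a k = (R / 2 ^ Suc k) powr - \<beta>" for k
 have a0: "a k \<ge> 0" for k by (simp add: a_def)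
 have q: "0 < ?q" "?q < 1" using assms by (auto simp: powr_less_one)
 have "(\<integral>\<^sup>+y. ennreal (norm (x - y) powr - \<beta>) * indicator (ball x R) y \<partial>lborel)
   \<le> (\<integral>\<^sup>+y. (\<Sum>k. ennreal (a k) * indicator (ball x (R / 2 ^ k)) y) \<partial>lborel)"
 proof (rule nn_integral_mono)
  fix y
  show "ennreal (norm (x - y) powr - \<beta>) * indicator (ball x R) y
    \<le> (\<Sum>k. ennreal (a k) * indicator (ball x (R / 2 ^ k)) y)"
  proof (cases "y \<in> ball x R \<and> y \<noteq> x")
   case True
   then obtain k where k: "R / 2 ^ Suc k \<le> norm (x - y)" "norm (x - y) < R / 2 ^ k"
    using dyadic_shell[of "norm (x - y)" R] by (auto simp: dist_norm)
   have "norm (x - y) powr - \<beta> \<le> a k"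
    unfolding a_def using k assms by (intro powr_mono2') auto
   then have "ennreal (norm (x - y) powr - \<beta>) * indicator (ball x R) y \<le>
     ennreal (a k) * indicator (ball x (R / 2 ^ k)) y"
    using True k by (auto simp: dist_norm intro!: ennreal_leI)
   also have "\<dots> \<le> (\<Sum>k. ennreal (a k) * indicator (ball x (R / 2 ^ k)) y)"
    using sum_le_suminf[of g "{k}" for g :: "nat \<Rightarrow> ennreal", simplified] .
   finally show ?thesis .
  qed (auto simp: indicator_def)
 qed
 also have "\<dots> = (\<Sum>k. ennreal (a k) * emeasure lborel (ball x (R / 2 ^ k)))"
 proof -
  have "(\<lambda>y. ennreal (a k) * indicator (ball x (R / 2 ^ k)) y) \<in> borel_measurable lborel" for k
   by (intro borel_measurable_times_ennreal borel_measurable_indicator) auto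
  then show ?thesis by (simp add: nn_integral_suminf nn_integral_cmult_indicator)
 qed
 also have "\<dots> = (\<Sum>k. ennreal (unit_ball_vol ?d * 2 powr \<beta> * R powr (?d - \<beta>) * ?q ^ k))"
 proof (intro suminf_cong)
  fix k
  have "a k * (R / 2 ^ k) ^ DIM('a) = 2 powr \<beta> * R powr (?d - \<beta>) * ?q ^ k"
   using \<open>0 < R\<close>
   by (simp add: a_def powr_divide powr_diff powr_minus powr_mult power_divide powr_realpow[symmetric]
    powr_powr powr_add[symmetric] powr_power field_simps)
  then show "ennreal (a k) * emeasure lborel (ball x (R / 2 ^ k)) =
    ennreal (unit_ball_vol ?d * 2 powr \<beta> * R powr (?d - \<beta>) * ?q ^ k)"
   using a0[of k] \<open>0 < R\<close> by (simp add: emeasure_ball ennreal_mult[symmetric] mult_ac)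
 qed
 also have "\<dots> = ennreal (unit_ball_vol ?d * 2 powr \<beta> * R powr (?d - \<beta>) * (1 / (1 - ?q)))"
  using q by (intro suminf_ennreal_eq sums_mult geometric_sums) auto
 also have "\<dots> = ennreal (singular_const ?d \<beta> * R powr (?d - \<beta>))"
  by (simp add: singular_const_def mult_ac)
 finally show ?thesis .
qed

section \<open>Probability densities bounded by a constant\<close>

locale bounded_density =
 fixes f :: "'a::euclidean_space \<Rightarrow> real" and M :: real
 assumes density: "prob_density f" and density_le: "AE x in lborel. f x \<le> M" and M_nonneg: "0 \<le> M"
begin

lemma f_measurable [measurable]: "f \<in> borel_measurable borel"
 using density by (simp add: prob_density_def)

lemma f_nonneg: "AE x in lborel. 0 \<le> f x"
 using density by (simp add: prob_density_def)

lemma sets_density [measurable_cong]: "sets (density_measure f) = sets borel"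
 by (simp add: density_measure_def)

lemma space_density [simp]: "space (density_measure f) = UNIV"
 by (simp add: density_measure_def)

lemma prob_space_density: "prob_space (density_measure f)"
 using density by (intro prob_spaceI) (simp add: density_measure_def emeasure_density prob_density_def)

lemma nn_integral_density:
 "g \<in> borel_measurable borel \<Longrightarrow> (\<integral>\<^sup>+y. g y \<partial>density_measure f) = (\<integral>\<^sup>+y. ennreal (f y) * g y \<partial>lborel)"
 unfolding density_measure_def by (subst nn_integral_density) auto

lemma AE_density: "AE x in lborel. P x \<Longrightarrow> AE x in density_measure f. P x"
 unfolding density_measure_def by (subst AE_density) auto

lemma AE_density_neq: "AE y in density_measure f. y \<noteq> x"
 by (intro AE_density AE_lborel_singleton)

lemma emeasure_density_le:
 assumes [measurable]: "A \<in> sets borel"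
 shows "emeasure (density_measure f) A \<le> ennreal M * emeasure lborel A"
proof -
 have "emeasure (density_measure f) A = (\<integral>\<^sup>+y. ennreal (f y) * indicator A y \<partial>lborel)"
  by (simp add: density_measure_def emeasure_density)
 also have "\<dots> \<le> (\<integral>\<^sup>+y. ennreal M * indicator A y \<partial>lborel)"
  using density_le by (intro nn_integral_mono_AE) (auto intro!: mult_right_mono ennreal_leI)
 finally show ?thesis by (simp add: nn_integral_cmult)
qed

lemma measure_ball_le:
 assumes "0 \<le> r"
 shows "measure (density_measure f) (ball x r) \<le> M * unit_ball_vol (real DIM('a)) * r ^ DIM('a)"
  and "measure (density_measure f) (cball x r) \<le> M * unit_ball_vol (real DIM('a)) * r ^ DIM('a)"
proof -
 interpret prob_space "density_measure f" by (rule prob_space_density)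
 have "ennreal (measure (density_measure f) (ball x r)) \<le> ennreal (M * unit_ball_vol (real DIM('a)) * r ^ DIM('a))"
  using emeasure_density_le[of "ball x r"] assms M_nonneg
  by (simp add: emeasure_ball emeasure_eq_measure ennreal_mult[symmetric] mult.assoc)
 then show "measure (density_measure f) (ball x r) \<le> M * unit_ball_vol (real DIM('a)) * r ^ DIM('a)"
  using assms M_nonneg by (subst (asm) ennreal_le_iff) auto
 have "ennreal (measure (density_measure f) (cball x r)) \<le> ennreal (M * unit_ball_vol (real DIM('a)) * r ^ DIM('a))"
  using emeasure_density_le[of "cball x r"] assms M_nonneg
  by (simp add: emeasure_cball emeasure_eq_measure ennreal_mult[symmetric] mult.assoc)
 then show "measure (density_measure f) (cball x r) \<le> M * unit_ball_vol (real DIM('a)) * r ^ DIM('a)"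
  using assms M_nonneg by (subst (asm) ennreal_le_iff) auto
qed

text \<open>Inside the unit ball around \<open>x\<close> the density is at most \<open>M\<close>;
  outside it the power is at most 1 and the total mass is 1, which is the summand 1.\<close>

lemma nn_integral_singular_density:
 assumes "0 \<le> \<beta>" "\<beta> < real DIM('a)"
 shows "(\<integral>\<^sup>+y. ennreal (norm (x - y) powr - \<beta>) \<partial>density_measure f)
  \<le> ennreal (singular_const (real DIM('a)) \<beta> * M + 1)"
proof -
 have "(\<integral>\<^sup>+y. ennreal (norm (x - y) powr - \<beta>) \<partial>density_measure f) =
   (\<integral>\<^sup>+y. ennreal (f y) * ennreal (norm (x - y) powr - \<beta>) \<partial>lborel)"
  by (rule nn_integral_density) measurable
 also have "\<dots> \<le> (\<integral>\<^sup>+y. ennreal M * (ennreal (norm (x - y) powr - \<beta>) * indicator (ball x 1) y) + ennreal (f y) \<partial>lborel)"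
 proof (rule nn_integral_mono_AE)
  show "AE y in lborel. ennreal (f y) * ennreal (norm (x - y) powr - \<beta>) \<le>
   ennreal M * (ennreal (norm (x - y) powr - \<beta>) * indicator (ball x 1) y) + ennreal (f y)"
   using density_le
  proof eventually_elim
   case (elim y)
   show ?case
   proof (cases "y \<in> ball x 1")
    case True
    then have "ennreal (f y) * ennreal (norm (x - y) powr - \<beta>) \<le> ennreal M * ennreal (norm (x - y) powr - \<beta>)"
     using elim by (intro mult_right_mono ennreal_leI) auto
    then show ?thesis using True by (simp add: add_increasing2)
   next
    case False
    then have "norm (x - y) powr - \<beta> \<le> 1"
     using powr_mono2'[of "-\<beta>" 1 "norm (x - y)"] assms by (simp add: dist_norm)
    then have "ennreal (f y) * ennreal (norm (x - y) powr - \<beta>) \<le> ennreal (f y) * 1"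
     by (intro mult_left_mono) (auto simp: ennreal_le_1)
    then show ?thesis using False by simp
   qed
  qed
 qed
 also have "\<dots> = ennreal M * (\<integral>\<^sup>+y. ennreal (norm (x - y) powr - \<beta>) * indicator (ball x 1) y \<partial>lborel) + 1"
 proof -
  have [measurable]: "(\<lambda>y. ennreal (norm (x - y) powr - \<beta>) * indicator (ball x 1) y) \<in> borel_measurable borel"
   by (intro borel_measurable_times_ennreal borel_measurable_indicator) auto
  show ?thesis using density by (simp add: nn_integral_add nn_integral_cmult prob_density_def)
 qed
 also have "\<dots> \<le> ennreal M * ennreal (singular_const (real DIM('a)) \<beta> * 1 powr (real DIM('a) - \<beta>)) + 1"
  using assms by (intro add_mono mult_left_mono nn_integral_singular) auto
 also have "\<dots> = ennreal (singular_const (real DIM('a)) \<beta> * M + 1)"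
  using M_nonneg singular_const_pos[of \<beta> "real DIM('a)"] assms
  by (simp add: ennreal_mult[symmetric] mult.commute flip: ennreal_1 ennreal_plus del: ennreal_1)
 finally show ?thesis .
qed

lemma singular_integrable:
 assumes "0 \<le> \<beta>" "\<beta> < real DIM('a)"
 shows "integrable (density_measure f) (\<lambda>y. norm (x - y) powr - \<beta>)"
 using nn_integral_singular_density[OF assms, of x]
 by (intro integrableI_nonneg) (auto simp: le_less_trans)

lemma singular_integral_le:
 assumes "0 \<le> \<beta>" "\<beta> < real DIM('a)"
 shows "(LINT y|density_measure f. norm (x - y) powr - \<beta>) \<le> singular_const (real DIM('a)) \<beta> * M + 1"
proof -
 have "0 \<le> singular_const (real DIM('a)) \<beta> * M + 1"
  using M_nonneg singular_const_pos[of \<beta> "real DIM('a)"] assms by simp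
 moreover have "ennreal (LINT y|density_measure f. norm (x - y) powr - \<beta>) \<le> ennreal (singular_const (real DIM('a)) \<beta> * M + 1)"
  using nn_integral_singular_density[OF assms, of x]
  by (subst nn_integral_eq_integral[OF singular_integrable[OF assms], symmetric]) auto
 ultimately show ?thesis by simp
qed

end

section \<open>Pointwise estimates for the kernel\<close>

locale singular_kernel =
 fixes K :: "'a::euclidean_space \<Rightarrow> 'a" and \<alpha> C :: real
 assumes alpha_ge: "-1 \<le> \<alpha>" and alpha_less: "\<alpha> < real DIM('a) - 1" and C_pos: "0 < C"
  and kernel: "interaction_kernel K \<alpha> C"
begin

text \<open>The order of the singularity of the derivative of \<open>K\<close>; the hypothesis on
  \<alpha> says that this singularity is locally integrable.\<close>

definition \<beta> :: real where "\<beta> = 1 + \<alpha>"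

lemma beta: "0 \<le> \<beta>" "\<beta> < real DIM('a)"
 using alpha_ge alpha_less by (auto simp: \<beta>_def)

lemma K_derivative: "x \<noteq> 0 \<Longrightarrow> (K has_derivative grad K x) (at x)"
 using kernel by (simp add: interaction_kernel_def frechet_derivative_works)

text \<open>As \<alpha> may be negative, the left side need not decrease in the norm. On the right
  side the only power has the exponent \<open>- \<beta>\<close>, for which monotonicity is
  available.\<close>

lemma powr_alpha: "norm x powr - \<alpha> = norm x * norm (x::'a) powr - \<beta>"
 using powr_add[of "norm x" 1 "-\<beta>"] by (cases "x = 0") (auto simp: \<beta>_def)

lemma K_onorm_nonneg: "x \<noteq> 0 \<Longrightarrow> 0 \<le> onorm (grad K x)"
 using K_derivative has_derivative_bounded_linear onorm_pos_le by blast

lemma K_norm_powr_alpha: "x \<noteq> 0 \<Longrightarrow> norm (K x) \<le> C * norm x powr - \<alpha>"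
proof -
 assume x: "x \<noteq> 0"
 have "norm (K x) + norm x * onorm (grad K x) \<le> C / norm x powr \<alpha>"
  using kernel x by (simp add: interaction_kernel_def)
 moreover have "0 \<le> norm x * onorm (grad K x)" using K_onorm_nonneg[OF x] by simp
 ultimately show ?thesis by (simp add: powr_minus divide_inverse)
qed

lemma K_norm: "x \<noteq> 0 \<Longrightarrow> norm (K x) \<le> C * norm x * norm x powr - \<beta>"
 using K_norm_powr_alpha[of x] by (simp add: powr_alpha)

lemma K_onorm: "x \<noteq> 0 \<Longrightarrow> onorm (grad K x) \<le> C * norm x powr - \<beta>"
proof -
 assume x: "x \<noteq> 0"
 have "norm (K x) + norm x * onorm (grad K x) \<le> C * norm x powr - \<alpha>"
  using kernel x by (simp add: interaction_kernel_def powr_minus divide_inverse)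
 then have "norm x * onorm (grad K x) \<le> C * (norm x * norm x powr - \<beta>)"
  unfolding powr_alpha using norm_ge_zero[of "K x"] by linarith
 then show ?thesis using x by (simp add: mult.left_commute)
qed

text \<open>\<open>2 powr \<beta>\<close> comes from halving the distance to the origin in the near
  case of \<open>K_diff\<close>, 3 from the comparison with \<open>norm (a - b)\<close> in the far
  case.\<close>

definition C' :: real where "C' = C * (2 powr \<beta> + 3)"

lemma C'_pos: "C' > 0"
 using C_pos by (simp add: C'_def add_pos_pos)

lemma C_le_C': "3 * C \<le> C'"
 using C_pos by (simp add: C'_def distrib_left)

text \<open>If \<open>a\<close> and \<open>b\<close> are close relative to \<open>norm a\<close>,
  the segment between them stays at distance \<open>norm a / 2\<close> from the origin and the mean
  value inequality applies. Otherwise both norms are at most \<open>3 * norm (a - b)\<close>, and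
  the size of \<open>K\<close> suffices without any cancellation.\<close>

lemma K_diff:
 assumes "a \<noteq> 0" "b \<noteq> 0"
 shows "norm (K a - K b) \<le> C' * norm (a - b) * (norm a powr - \<beta> + norm b powr - \<beta>)"
proof (cases "norm (a - b) \<le> norm a / 2")
 case True
 have seg: "norm a / 2 \<le> norm z" if "z \<in> closed_segment a b" for z
 proof -
  have "norm (z - a) \<le> norm (a - b)"
   using segment_bound(1)[OF that] by (simp add: norm_minus_commute)
  then show ?thesis using True norm_triangle_ineq2[of a "a - z"] by (simp add: norm_minus_commute)
 qed
 have "norm (K a - K b) \<le> (C * (norm a / 2) powr - \<beta>) * norm (a - b)"
 proof (rule differentiable_bound[of "closed_segment a b" K "\<lambda>z. grad K z"])
  fix z assume z: "z \<in> closed_segment a b"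
  then have "z \<noteq> 0" using seg[OF z] \<open>a \<noteq> 0\<close> by auto
  then show "(K has_derivative grad K z) (at z within closed_segment a b)"
   by (rule has_derivative_at_withinI[OF K_derivative])
  have "norm z powr - \<beta> \<le> (norm a / 2) powr - \<beta>"
   using seg[OF z] \<open>a \<noteq> 0\<close> beta by (intro powr_mono2') auto
  then show "onorm (grad K z) \<le> C * (norm a / 2) powr - \<beta>"
   using K_onorm[OF \<open>z \<noteq> 0\<close>] C_pos by (meson mult_left_mono order_trans less_imp_le)
 qed auto
 also have "(C * (norm a / 2) powr - \<beta>) * norm (a - b) = (C * 2 powr \<beta>) * norm (a - b) * norm a powr - \<beta>"
  by (simp add: powr_divide powr_minus field_simps)
 also have "\<dots> \<le> C' * norm (a - b) * (norm a powr - \<beta> + norm b powr - \<beta>)"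
  using C_pos by (intro mult_mono) (auto simp: C'_def)
 finally show ?thesis .
next
 case False
 then have a: "norm a \<le> 2 * norm (a - b)" by simp
 then have b: "norm b \<le> 3 * norm (a - b)" using norm_triangle_ineq3[of a b] by linarith
 have a: "norm a \<le> 3 * norm (a - b)" using a norm_ge_zero[of "a - b"] by linarith
 have "norm (K a) \<le> C * norm a * norm a powr - \<beta>" "norm (K b) \<le> C * norm b * norm b powr - \<beta>"
  using K_norm assms by auto
 moreover have "C * norm a * norm a powr - \<beta> \<le> (C * (3 * norm (a - b))) * norm a powr - \<beta>"
  using a C_pos by (intro mult_right_mono mult_left_mono) auto
 moreover have "C * norm b * norm b powr - \<beta> \<le> (C * (3 * norm (a - b))) * norm b powr - \<beta>"
  using b C_pos by (intro mult_right_mono mult_left_mono) auto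
 ultimately have "norm (K a - K b) \<le> (3 * C) * norm (a - b) * (norm a powr - \<beta> + norm b powr - \<beta>)"
  using norm_triangle_ineq4[of "K a" "K b"] by (simp add: algebra_simps)
 also have "\<dots> \<le> C' * norm (a - b) * (norm a powr - \<beta> + norm b powr - \<beta>)"
  using C_le_C' by (intro mult_right_mono) auto
 finally show ?thesis .
qed

lemma K_measurable [measurable]: "K \<in> borel_measurable borel"
proof -
 have "continuous_on (- {0}) K"
  by (rule has_derivative_continuous_on) (auto intro: has_derivative_at_withinI K_derivative)
 then have "(\<lambda>x. indicator (- {0}) x *\<^sub>R K x) \<in> borel_measurable borel"
  by (intro borel_measurable_continuous_on_indicator) auto
 then have "(\<lambda>x. indicator (- {0}) x *\<^sub>R K x + indicator {0} x *\<^sub>R K 0) \<in> borel_measurable borel"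
  by measurable
 also have "(\<lambda>x. indicator (- {0}) x *\<^sub>R K x + indicator {0} x *\<^sub>R K 0) = K"
  by (auto simp: indicator_def)
 finally show ?thesis .
qed

end

text \<open>For negative \<alpha> the kernel may grow at infinity, so its integrability against the
  density is assumed. Differences of kernels are always controlled by the singular integrals
  below.\<close>

locale kernel_density = singular_kernel K \<alpha> C + bounded_density f M
 for K :: "'a::euclidean_space \<Rightarrow> 'a" and \<alpha> C f M +
 assumes K_integrable: "\<And>x. integrable (density_measure f) (\<lambda>y. K (x - y))"
begin

definition A :: real where "A = singular_const (real DIM('a)) \<beta> * M + 1"

lemma A_ge_1: "1 \<le> A"
 using M_nonneg singular_const_pos[of \<beta> "real DIM('a)"] beta by (simp add: A_def)

lemma singular_int: "integrable (density_measure f) (\<lambda>y. norm (x - y) powr - \<beta>)"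
 and singular_int_le: "(LINT y|density_measure f. norm (x - y) powr - \<beta>) \<le> A"
 using singular_integrable[OF beta] singular_integral_le[OF beta] by (auto simp: A_def)

lemma K_diff_integral:
 "(LINT y|density_measure f. norm (K (x - y) - K (x' - y))) \<le> 2 * C' * A * norm (x - x')"
proof -
 have "(LINT y|density_measure f. norm (K (x - y) - K (x' - y))) \<le>
  (LINT y|density_measure f. C' * norm (x - x') * (norm (x - y) powr - \<beta> + norm (x' - y) powr - \<beta>))"
 proof (rule integral_mono_AE)
  show "AE y in density_measure f. norm (K (x - y) - K (x' - y)) \<le>
    C' * norm (x - x') * (norm (x - y) powr - \<beta> + norm (x' - y) powr - \<beta>)"
   using AE_density_neq[of x] AE_density_neq[of x']
  proof eventually_elim
   case (elim y)
   then show ?case using K_diff[of "x - y" "x' - y"] by simp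
  qed
 qed (use singular_int K_integrable in auto)
 also have "\<dots> = C' * norm (x - x') * ((LINT y|density_measure f. norm (x - y) powr - \<beta>) +
   (LINT y|density_measure f. norm (x' - y) powr - \<beta>))"
  using singular_int by simp
 also have "\<dots> \<le> C' * norm (x - x') * (A + A)"
  using singular_int_le C'_pos by (intro mult_left_mono add_mono) auto
 finally show ?thesis by (simp add: mult_ac)
qed

lemma kernel_conv_lipschitz:
 "norm (kernel_conv K (density_measure f) x - kernel_conv K (density_measure f) x') \<le> 2 * C' * A * norm (x - x')"
proof -
 have "kernel_conv K (density_measure f) x - kernel_conv K (density_measure f) x' =
  (LINT y|density_measure f. K (x - y) - K (x' - y))"
  unfolding kernel_conv_def using K_integrable by simp
 also have "norm \<dots> \<le> (LINT y|density_measure f. norm (K (x - y) - K (x' - y)))"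
  by (rule integral_norm_bound)
 finally show ?thesis using K_diff_integral[of x x'] by simp
qed

end

section \<open>Weak divergence of the kernel and of its convolutions\<close>

lemma integrable_indicator_cball: "integrable lborel (indicator (cball x r) :: 'a::euclidean_space \<Rightarrow> real)"
 using emeasure_bounded_finite[of "cball x r"] by (intro integrable_real_indicator) auto

lemma directional_derivative_LIMSEQ:
 fixes g :: "'a::euclidean_space \<Rightarrow> real"
 assumes g: "(g has_derivative g') (at x)"
 shows "(\<lambda>n. real (Suc n) * (g (x + (1 / real (Suc n)) *\<^sub>R v) - g x)) \<longlonglongrightarrow> g' v"
proof -
 have "((\<lambda>t. x + t *\<^sub>R v) has_derivative (\<lambda>t. t *\<^sub>R v)) (at 0)"
  by (auto intro!: derivative_eq_intros)
 from has_derivative_compose[OF this, of g g'] g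
 have "((\<lambda>t. g (x + t *\<^sub>R v)) has_derivative (\<lambda>t. g' (t *\<^sub>R v))) (at 0)" by simp
 moreover have "(\<lambda>t. g' (t *\<^sub>R v)) = (*) (g' v)"
  using linear_scale[OF bounded_linear.linear[OF has_derivative_bounded_linear[OF g]]]
  by (auto simp: mult.commute)
 ultimately have "((\<lambda>t. g (x + t *\<^sub>R v)) has_real_derivative g' v) (at 0)"
  by (simp add: has_field_derivative_def)
 then have "((\<lambda>t. (g (x + t *\<^sub>R v) - g x) / t) \<longlongrightarrow> g' v) (at 0)"
  by (simp add: DERIV_def)
 moreover have "filterlim (\<lambda>n. 1 / real (Suc n)) (at 0) sequentially"
  unfolding filterlim_at using LIMSEQ_inverse_real_of_nat by (auto simp: inverse_eq_divide)
 ultimately have "(\<lambda>n. (g (x + (1 / real (Suc n)) *\<^sub>R v) - g x) / (1 / real (Suc n))) \<longlonglongrightarrow> g' v"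
  by (rule filterlim_compose)
 then show ?thesis by (simp add: mult.commute)
qed

text \<open>Stated for a derivative that need not be continuous, as nothing more is known of
  \<open>K\<close> off the origin. The difference quotients have integral 0 by translation
  invariance, are bounded by the Lipschitz constant and live in a fixed ball, so dominated
  convergence gives the claim; measurability of the derivative comes from the same limit.\<close>

lemma integral_derivative_compact_support:
 fixes g :: "'a::euclidean_space \<Rightarrow> real"
 assumes g: "\<And>x. (g has_derivative g' x) (at x)" and supp: "\<And>x. R < norm x \<Longrightarrow> g x = 0"
  and G: "\<And>x. \<bar>g' x v\<bar> \<le> G" "\<And>x. onorm (g' x) \<le> G"
 shows "(\<lambda>x. g' x v) \<in> borel_measurable borel" "(LINT x|lborel. g' x v) = 0"
proof -
 define q where "q n x = real (Suc n) * (g (x + (1 / real (Suc n)) *\<^sub>R v) - g x)" for n x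
 have cont: "continuous_on UNIV g"
  by (rule has_derivative_continuous_on) (rule has_derivative_at_withinI[OF g])
 have shift: "(\<lambda>x. g (x + w)) \<in> borel_measurable borel" for w
  by (intro borel_measurable_continuous_onI continuous_on_compose2[OF cont] continuous_intros) auto
 have [measurable]: "g \<in> borel_measurable borel" using shift[of 0] by simp
 have qm [measurable]: "q n \<in> borel_measurable borel" for n
  unfolding q_def using shift by measurable
 have lim: "(\<lambda>n. q n x) \<longlonglongrightarrow> g' x v" for x
  unfolding q_def by (rule directional_derivative_LIMSEQ[OF g])
 show m: "(\<lambda>x. g' x v) \<in> borel_measurable borel"
  by (rule borel_measurable_LIMSEQ_real[OF lim qm])
 have "0 \<le> G" using G(1)[of 0] by linarith
 have lip: "\<bar>g x - g y\<bar> \<le> G * norm (x - y)" for x y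
  using differentiable_bound[of UNIV g g' G x y] g G(2) by simp
 have bound: "\<bar>q n x\<bar> \<le> G * norm v * indicator (cball 0 (\<bar>R\<bar> + norm v)) x" for n x
 proof (cases "norm x \<le> \<bar>R\<bar> + norm v")
  case True
  have "\<bar>q n x\<bar> \<le> real (Suc n) * (G * norm ((1 / real (Suc n)) *\<^sub>R v))"
   unfolding q_def abs_mult using lip[of "x + (1 / real (Suc n)) *\<^sub>R v" x] by (intro mult_mono) auto
  then show ?thesis using True by (simp add: dist_norm)
 next
  case False
  have "norm v / real (Suc n) \<le> norm v" using frac_le[of "norm v" "norm v" 1 "real (Suc n)"] by simp
  then have "R < norm (x + (1 / real (Suc n)) *\<^sub>R v)"
   using False norm_triangle_ineq4[of "x + (1 / real (Suc n)) *\<^sub>R v" "(1 / real (Suc n)) *\<^sub>R v"] by simp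
  moreover have "R < norm x" using False norm_ge_zero[of v] by linarith
  ultimately show ?thesis using supp False by (simp add: q_def)
 qed
 have gint: "integrable lborel g"
 proof -
  have "integrable lborel (\<lambda>x. indicator (cball 0 R) x *\<^sub>R g x)"
   using borel_integrable_compact[OF compact_cball continuous_on_subset[OF cont], of 0 R] by simp
  also have "(\<lambda>x. indicator (cball 0 R) x *\<^sub>R g x) = g"
  proof
   fix x show "indicator (cball 0 R) x *\<^sub>R g x = g x"
    using supp[of x] by (cases "norm x \<le> R") auto
  qed
  finally show ?thesis .
 qed
 have "integrable lborel (\<lambda>x. g (w + x)) \<and> (LINT x|lborel. g (w + x)) = (LINT x|lborel. g x)" for w
  using gint integrable_distr_eq[of "(+) w" lborel borel g] integral_distr[of "(+) w" lborel borel g]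
  by (simp add: lborel_distr_plus)
 then have "integrable lborel (\<lambda>x. g (x + w)) \<and> (LINT x|lborel. g (x + w)) = (LINT x|lborel. g x)" for w
  by (subst (1 2) add.commute)
 then have "(LINT x|lborel. q n x) = 0" for n
  using gint by (simp add: q_def Bochner_Integration.integral_diff)
 moreover have "(\<lambda>n. LINT x|lborel. q n x) \<longlonglongrightarrow> (LINT x|lborel. g' x v)"
 proof (rule integral_dominated_convergence[where w = "\<lambda>x. G * norm v * indicator (cball 0 (\<bar>R\<bar> + norm v)) x"])
  show "integrable lborel (\<lambda>x. G * norm v * indicator (cball 0 (\<bar>R\<bar> + norm v)) x)"
   by (intro integrable_mult_right integrable_indicator_cball)
 qed (use m lim bound in auto)
 ultimately show "(LINT x|lborel. g' x v) = 0"
  using LIMSEQ_unique[OF tendsto_const] by force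
qed

lemma integrable_bounded_support:
 fixes f :: "'a::euclidean_space \<Rightarrow> real"
 assumes "f \<in> borel_measurable borel" "\<And>x. \<bar>f x\<bar> \<le> B" "\<And>x. R < norm x \<Longrightarrow> f x = 0"
 shows "integrable lborel f"
proof (rule Bochner_Integration.integrable_bound)
 show "integrable lborel (\<lambda>x::'a. B * indicator (cball 0 R) x)"
  by (intro integrable_mult_right integrable_indicator_cball)
 show "AE x in lborel. norm (f x) \<le> norm (B * indicator (cball 0 R) x)"
 proof (rule always_eventually, rule allI)
  fix x show "norm (f x) \<le> norm (B * indicator (cball 0 R) x)"
   using assms(2)[of x] assms(3)[of x] by (cases "norm x \<le> R") auto
 qed
qed (use assms in simp)

context singular_kernel begin

lemma K_local_integral:
 assumes "0 < r"
 shows "integrable lborel (\<lambda>x. indicator (ball 0 r) x * norm (x::'a) powr - \<beta>)"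
  and "(LINT x|lborel. indicator (ball 0 r) x * norm (x::'a) powr - \<beta>)
   \<le> singular_const (real DIM('a)) \<beta> * r powr (real DIM('a) - \<beta>)"
proof -
 have le: "(\<integral>\<^sup>+x. ennreal (indicator (ball 0 r) x * norm (x::'a) powr - \<beta>) \<partial>lborel) \<le>
   ennreal (singular_const (real DIM('a)) \<beta> * r powr (real DIM('a) - \<beta>))"
  using nn_integral_singular[OF beta \<open>0 < r\<close>, of "0::'a"]
  by (simp add: ennreal_mult' ennreal_indicator mult.commute)
 show int: "integrable lborel (\<lambda>x. indicator (ball 0 r) x * norm (x::'a) powr - \<beta>)"
  using le by (intro integrableI_nonneg borel_measurable_times borel_measurable_indicator) (auto simp: le_less_trans)
 show "(LINT x|lborel. indicator (ball 0 r) x * norm (x::'a) powr - \<beta>)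
   \<le> singular_const (real DIM('a)) \<beta> * r powr (real DIM('a) - \<beta>)"
  using le singular_const_pos[of \<beta> "real DIM('a)"] beta
  by (subst (asm) nn_integral_eq_integral[OF int]) auto
qed


text \<open>Integration by parts away from the singularity: \<xi> removes the ball of radius
  \<epsilon>, so that the product of \<psi>, \<xi> and \<open>K\<close> is differentiable
  everywhere, and only the term with the gradient of \<xi> is left over.\<close>

lemma K_weakly_divergence_free_cutoff:
 fixes \<xi> :: "'a \<Rightarrow> real" and \<xi>' :: "'a \<Rightarrow> 'a \<Rightarrow> real"
 assumes psi: "test_function \<psi>" and eps: "0 < \<epsilon>"
  and chi: "\<xi> = (\<lambda>x. 1 - bump 2 ((1 / \<epsilon>) *\<^sub>R x))"
  and chi': "\<xi>' = (\<lambda>x w. (1 / \<epsilon>) * (bump' 2 ((1 / \<epsilon>) *\<^sub>R x) * (((1 / \<epsilon>) *\<^sub>R x) \<bullet> w)))"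
 shows "integrable lborel (\<lambda>x. \<xi> x * grad \<psi> x (K x))"
  and "integrable lborel (\<lambda>x. \<psi> x * \<xi>' x (K x))"
  and "(LINT x|lborel. \<xi> x * grad \<psi> x (K x)) = - (LINT x|lborel. \<psi> x * \<xi>' x (K x))"
proof -
 note [measurable] = psi
 obtain R0 where R0: "R0 > 0" "\<And>x. R0 < norm x \<Longrightarrow> \<psi> x = 0" using test_function_support[OF psi] by blast
 define R where "R = R0 + \<epsilon>"
 have R: "R > \<epsilon>" "R > 0" and psi0: "\<And>x. R < norm x \<Longrightarrow> \<psi> x = 0" using R0 eps by (auto simp: R_def)
 have dpsi0: "R < norm x \<Longrightarrow> grad \<psi> x w = 0" for x w
  using frechet_derivative_outside[of R \<psi>, OF psi0] by metis
 obtain G where G0: "G > 0" and "\<And>x y. \<bar>\<psi> x - \<psi> y\<bar> \<le> G * dist x y"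
  and G1: "\<And>x. \<bar>\<psi> x\<bar> \<le> G" "\<And>x v. \<bar>grad \<psi> x v\<bar> \<le> G * norm v"
  using test_function_lipschitz[OF psi] by blast
 note G = G0 G1
 obtain G1 where G1: "G1 > 0" "\<And>x::'a. \<bar>bump' 2 x\<bar> \<le> G1"
  using test_function_bounded[OF test_function_bump'[of 2]] by auto
 define k1 where "k1 = C * R * \<epsilon> powr - \<beta>"
 define k2 where "k2 = C * \<epsilon> powr - \<beta>"
 define c where "c = 1 / \<epsilon>"
 have c: "c > 0" using eps by (simp add: c_def)
 have k: "k1 \<ge> 0" "k2 \<ge> 0" using C_pos R by (auto simp: k1_def k2_def)
 have chi0: "\<xi> x = 0" "\<xi>' x w = 0" if "norm x \<le> \<epsilon>" for x w
  using that eps by (auto simp: chi chi' bump_eq_1 bump'_eq_0)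
 have chi1: "0 \<le> \<xi> x" "\<xi> x \<le> 1" for x using bump_bounds[of 2] by (auto simp: chi)
 have chid: "(\<xi> has_derivative \<xi>' x) (at x)" for x
 proof -
  have "((\<lambda>x. bump 2 (c *\<^sub>R x)) has_derivative (\<lambda>w. - bump' 2 (c *\<^sub>R x) * ((c *\<^sub>R x) \<bullet> (c *\<^sub>R w)))) (at x)"
   by (rule has_derivative_compose[where f = "\<lambda>x. c *\<^sub>R x" and f' = "\<lambda>w. c *\<^sub>R w"], (auto intro!: derivative_eq_intros)[1])
    (rule bump_derivative, simp)
  then have "((\<lambda>x. 1 - bump 2 (c *\<^sub>R x)) has_derivative (\<lambda>w. 0 - (- bump' 2 (c *\<^sub>R x) * ((c *\<^sub>R x) \<bullet> (c *\<^sub>R w))))) (at x)"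
   by (intro has_derivative_diff has_derivative_const)
  then show ?thesis unfolding chi chi' c_def[symmetric] by (simp add: mult_ac)
 qed
 have chi'_bound: "\<bar>\<xi>' x w\<bar> \<le> c * (G1 * (c * R)) * norm w" if "norm x \<le> R" for x w
 proof -
  have "\<bar>\<xi>' x w\<bar> = c * (\<bar>bump' 2 (c *\<^sub>R x)\<bar> * \<bar>(c *\<^sub>R x) \<bullet> w\<bar>)"
   using c by (simp add: chi' c_def[symmetric] abs_mult)
  also have "\<dots> \<le> c * (G1 * (c * R * norm w))"
  proof (intro mult_left_mono mult_mono G1)
   have "\<bar>(c *\<^sub>R x) \<bullet> w\<bar> \<le> norm (c *\<^sub>R x) * norm w" by (rule Cauchy_Schwarz_ineq2)
   also have "\<dots> \<le> c * R * norm w" using c that by (auto intro!: mult_right_mono)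
   finally show "\<bar>(c *\<^sub>R x) \<bullet> w\<bar> \<le> c * R * norm w" .
  qed (use c G1 in auto)
  finally show ?thesis by (simp add: mult_ac)
 qed
 have singular_le: "norm x powr - \<beta> \<le> \<epsilon> powr - \<beta>" if "\<epsilon> \<le> norm x" for x :: 'a
  using that eps beta by (intro powr_mono2') auto
 have Kb: "norm (K x) \<le> k1" if "\<epsilon> \<le> norm x" "norm x \<le> R" for x
 proof -
  have "x \<noteq> 0" using that eps by auto
  then have "norm (K x) \<le> C * norm x * norm x powr - \<beta>" by (rule K_norm)
  also have "\<dots> \<le> C * R * \<epsilon> powr - \<beta>"
   using C_pos that singular_le[of x] R by (intro mult_mono) auto
  finally show ?thesis by (simp add: k1_def)
 qed
 have DKb: "norm (grad K x w) \<le> k2 * norm w" if "\<epsilon> \<le> norm x" for x w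
 proof -
  have "x \<noteq> 0" using that eps by auto
  have "onorm (grad K x) \<le> k2"
   unfolding k2_def using singular_le[OF that] C_pos
   by (intro order.trans[OF K_onorm[OF \<open>x \<noteq> 0\<close>]] mult_left_mono) auto
  moreover have "norm (grad K x w) \<le> onorm (grad K x) * norm w"
   by (rule onorm[OF has_derivative_bounded_linear[OF K_derivative[OF \<open>x \<noteq> 0\<close>]]])
  ultimately show ?thesis by (meson mult_right_mono norm_ge_zero order.trans)
 qed
 define g where "g b x = \<psi> x * (\<xi> x * (K x \<bullet> b))" for b x
 define g' where "g' b x w = grad \<psi> x w * (\<xi> x * (K x \<bullet> b)) +
  \<psi> x * (\<xi>' x w * (K x \<bullet> b) + \<xi> x * (grad K x w \<bullet> b))" for b x w
 have g0: "g' b x w = 0" "g b x = 0" if "norm x \<le> \<epsilon>" for b x w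
  using chi0[OF that] by (auto simp: g_def g'_def)
 have g0': "g' b x w = 0" "g b x = 0" if "R < norm x" for b x w
  using psi0[OF that] dpsi0[OF that] by (auto simp: g_def g'_def)
 have gd: "(g b has_derivative g' b x) (at x)" for b x
 proof (cases "norm x < \<epsilon>")
  case True
  have "(g b has_derivative (\<lambda>_. 0)) (at x)"
  proof (rule has_derivative_transform_within_open)
   show "((\<lambda>_. 0) has_derivative (\<lambda>_. 0)) (at x)" by simp
   show "open (ball (0::'a) \<epsilon>)" "x \<in> ball 0 \<epsilon>" using True by auto
  qed (use g0(2) in auto)
  also have "(\<lambda>_. 0) = g' b x" using g0 True by auto
  finally show ?thesis .
 next
  case False
  then have "x \<noteq> 0" using eps by auto
  have 1: "((\<lambda>x. K x \<bullet> b) has_derivative (\<lambda>w. grad K x w \<bullet> b)) (at x)"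
   by (rule has_derivative_inner_left[OF K_derivative[OF \<open>x \<noteq> 0\<close>]])
  show ?thesis unfolding g_def
   by (rule has_derivative_eq_rhs[OF has_derivative_mult[OF test_function_has_derivative[OF psi]
    has_derivative_mult[OF chid 1]]]) (auto simp: g'_def algebra_simps)
 qed
 define B where "B = G * k1 + G * (c * (G1 * (c * R)) * k1 + k2)"
 have B0: "B \<ge> 0" using G G1 c R k by (auto simp: B_def)
 have gb: "\<bar>g' b x w\<bar> \<le> B * norm w" if "b \<in> Basis" for b x w
 proof (cases "\<epsilon> \<le> norm x \<and> norm x \<le> R")
  case True
  have kb: "\<bar>K x \<bullet> b\<bar> \<le> k1" using Kb[of x] True Basis_le_norm[OF that, of "K x"] by linarith
  have db: "\<bar>grad K x w \<bullet> b\<bar> \<le> k2 * norm w"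
   using DKb[of x w] True Basis_le_norm[OF that, of "grad K x w"] by linarith
  have "\<bar>g' b x w\<bar> \<le> \<bar>grad \<psi> x w\<bar> * (\<bar>\<xi> x\<bar> * \<bar>K x \<bullet> b\<bar>) +
   \<bar>\<psi> x\<bar> * (\<bar>\<xi>' x w\<bar> * \<bar>K x \<bullet> b\<bar> + \<bar>\<xi> x\<bar> * \<bar>grad K x w \<bullet> b\<bar>)"
   unfolding g'_def by (auto simp: abs_mult intro!: order.trans[OF abs_triangle_ineq] add_mono mult_left_mono)
  also have "\<dots> \<le> (G * norm w) * (1 * k1) + G * ((c * (G1 * (c * R)) * norm w) * k1 + 1 * (k2 * norm w))"
   using G chi1 kb db chi'_bound[of x w] True k c G1 R by (intro add_mono mult_mono) auto
  finally show ?thesis by (simp add: B_def algebra_simps)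
 next
  case False
  then have "g' b x w = 0" using g0(1)[of x b w] g0'(1)[of x b w] by linarith
  then show ?thesis using B0 by simp
 qed
 have zero: "(\<lambda>x. g' b x b) \<in> borel_measurable borel" "(LINT x|lborel. g' b x b) = 0" if b: "b \<in> Basis" for b
 proof -
  have *: "\<bar>g' b x b\<bar> \<le> B" "onorm (g' b x) \<le> B" for x
   using gb[OF b, of x b] b gb[OF b] by (auto intro: onorm_le)
  show "(\<lambda>x. g' b x b) \<in> borel_measurable borel" "(LINT x|lborel. g' b x b) = 0"
   by (rule integral_derivative_compact_support[where R = R, OF gd g0'(2) *]; simp)+
 qed
 have int_g: "integrable lborel (\<lambda>x. g' b x b)" if b: "b \<in> Basis" for b
  by (rule integrable_bounded_support[where R = R and B = B]) (use zero(1)[OF b] g0' gb[OF b, of _ b] b in auto)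
 have Km: "K \<in> borel_measurable borel" by measurable
 have chim: "\<xi> \<in> borel_measurable borel"
  unfolding chi by (intro borel_measurable_diff borel_measurable_const measurable_compose[OF _ test_function_measurable[OF test_function_bump]]) auto
 have bm: "(\<lambda>x::'a. bump' 2 ((1 / \<epsilon>) *\<^sub>R x)) \<in> borel_measurable borel"
  by (intro measurable_compose[OF _ test_function_measurable[OF test_function_bump']]) auto
 note [measurable] = chim bm test_function_measurable[OF psi]
 have bound: "\<bar>grad \<psi> x (K x)\<bar> \<le> G * k1" "\<bar>\<xi>' x (K x)\<bar> \<le> c * (G1 * (c * R)) * k1"
  if "\<epsilon> \<le> norm x" "norm x \<le> R" for x
  using order.trans[OF G(3) mult_left_mono[OF Kb[OF that]]]
   order.trans[OF chi'_bound[OF that(2)] mult_left_mono[OF Kb[OF that]]] G G1 c R by auto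
 show int1: "integrable lborel (\<lambda>x. \<xi> x * grad \<psi> x (K x))"
 proof (rule integrable_bounded_support[where R = R and B = "1 * (G * k1)"])
  fix x show "\<bar>\<xi> x * grad \<psi> x (K x)\<bar> \<le> 1 * (G * k1)"
  proof (cases "\<epsilon> \<le> norm x \<and> norm x \<le> R")
   case True then show ?thesis unfolding abs_mult using chi1[of x] bound[of x] by (intro mult_mono) auto
  next
   case False
   then have "\<xi> x * grad \<psi> x (K x) = 0" using chi0(1)[of x] dpsi0[of x] by fastforce
   then show ?thesis using G(1) k by auto
  qed
 qed (auto simp: dpsi0)
 show int2: "integrable lborel (\<lambda>x. \<psi> x * \<xi>' x (K x))"
 proof (rule integrable_bounded_support[where R = R and B = "G * (c * (G1 * (c * R)) * k1)"])
  fix x show "\<bar>\<psi> x * \<xi>' x (K x)\<bar> \<le> G * (c * (G1 * (c * R)) * k1)"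
  proof (cases "\<epsilon> \<le> norm x \<and> norm x \<le> R")
   case True then show ?thesis unfolding abs_mult using G bound[of x] by (intro mult_mono) auto
  next
   case False
   then have "\<psi> x * \<xi>' x (K x) = 0" using chi0(2)[of x] psi0[of x] by fastforce
   then show ?thesis using G(1) k c G1(1) R by auto
  qed
  show "(\<lambda>x. \<psi> x * \<xi>' x (K x)) \<in> borel_measurable borel" unfolding chi' by measurable
 qed (auto simp: psi0)
 \<comment> \<open>The sum is the divergence of the product; the part containing the divergence of
   \<open>K\<close> vanishes off the origin by hypothesis and at the origin because \<xi>
   does.\<close>
 have sum: "(\<Sum>b\<in>Basis. g' b x b) = \<xi> x * grad \<psi> x (K x) + \<psi> x * \<xi>' x (K x)" for x
 proof -
  have 1: "(\<Sum>b\<in>Basis. grad \<psi> x b * (K x \<bullet> b)) = grad \<psi> x (K x)"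
   by (subst (2) test_function_frechet_basis[OF psi]) (simp add: mult.commute)
  have 2: "(\<Sum>b\<in>Basis. \<xi>' x b * (K x \<bullet> b)) = \<xi>' x (K x)"
   unfolding chi' euclidean_inner[of "(1 / \<epsilon>) *\<^sub>R x" "K x"] by (simp add: sum_distrib_left mult_ac)
  have 3: "\<xi> x * (\<Sum>b\<in>Basis. grad K x b \<bullet> b) = 0"
   using chi0[of x] kernel eps by (cases "x = 0") (auto simp: interaction_kernel_def divergence_at_def)
  have "(\<Sum>b\<in>Basis. g' b x b) = \<xi> x * (\<Sum>b\<in>Basis. grad \<psi> x b * (K x \<bullet> b)) +
   \<psi> x * ((\<Sum>b\<in>Basis. \<xi>' x b * (K x \<bullet> b)) + \<xi> x * (\<Sum>b\<in>Basis. grad K x b \<bullet> b))"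
   unfolding g'_def by (simp add: sum.distrib sum_distrib_left distrib_left mult_ac)
  then show ?thesis unfolding 1 2 3 by simp
 qed
 have "(LINT x|lborel. \<xi> x * grad \<psi> x (K x) + \<psi> x * \<xi>' x (K x)) = 0"
  unfolding sum[symmetric] using int_g zero(2) by (simp add: Bochner_Integration.integral_sum)
 then show "(LINT x|lborel. \<xi> x * grad \<psi> x (K x)) = - (LINT x|lborel. \<psi> x * \<xi>' x (K x))"
  using int1 int2 by simp
qed

text \<open>Let the cutoff radius tend to 0. The main term converges by domination with a locally
  integrable power, and the left-over term tends to 0.\<close>

lemma K_weakly_divergence_free: "weakly_divergence_free K"
 unfolding weakly_divergence_free_def
proof (intro allI impI)
 fix \<psi> :: "'a \<Rightarrow> real" assume psi: "test_function \<psi>"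
 define \<epsilon> where "\<epsilon> n = 1 / real (Suc n)" for n
 have eps: "\<epsilon> n > 0" for n by (simp add: \<epsilon>_def)
 have eps_lim: "\<epsilon> \<longlonglongrightarrow> 0" unfolding \<epsilon>_def using LIMSEQ_inverse_real_of_nat by (simp add: inverse_eq_divide)
 define \<xi> :: "nat \<Rightarrow> 'a \<Rightarrow> real" where "\<xi> n = (\<lambda>x. 1 - bump 2 ((1 / \<epsilon> n) *\<^sub>R x))" for n
 define \<xi>' :: "nat \<Rightarrow> 'a \<Rightarrow> 'a \<Rightarrow> real"
  where "\<xi>' n = (\<lambda>x w. (1 / \<epsilon> n) * (bump' 2 ((1 / \<epsilon> n) *\<^sub>R x) * (((1 / \<epsilon> n) *\<^sub>R x) \<bullet> w)))" for n
 note cut = K_weakly_divergence_free_cutoff[OF psi eps \<xi>_def \<xi>'_def]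
 obtain R where R: "R > 0" "\<And>x. R < norm x \<Longrightarrow> \<psi> x = 0" using test_function_support[OF psi] by blast
 obtain G where G0: "G > 0" and "\<And>x y. \<bar>\<psi> x - \<psi> y\<bar> \<le> G * dist x y"
  and G1: "\<And>x. \<bar>\<psi> x\<bar> \<le> G" "\<And>x v. \<bar>grad \<psi> x v\<bar> \<le> G * norm v"
  using test_function_lipschitz[OF psi] by blast
 note G = G0 G1
 obtain G1 where G1: "G1 > 0" "\<And>x::'a. \<bar>bump' 2 x\<bar> \<le> G1"
  using test_function_bounded[OF test_function_bump'[of 2]] by auto
 have chi1: "0 \<le> \<xi> n x" "\<xi> n x \<le> 1" for n x using bump_bounds[of 2] by (auto simp: \<xi>_def)
 note [measurable] = psi
 have L: "(\<lambda>n. LINT x|lborel. \<xi> n x * grad \<psi> x (K x)) \<longlonglongrightarrow>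
   (LINT x|lborel. grad \<psi> x (K x))"
 proof (rule integral_dominated_convergence[where w = "\<lambda>x. G * C * (R + 1) * (indicator (ball 0 (R + 1)) x * norm x powr - \<beta>)"])
  show "integrable lborel (\<lambda>x::'a. G * C * (R + 1) * (indicator (ball 0 (R + 1)) x * norm x powr - \<beta>))"
   using R by (intro integrable_mult_right K_local_integral) simp
  show "AE x in lborel. (\<lambda>n. \<xi> n x * grad \<psi> x (K x)) \<longlonglongrightarrow> grad \<psi> x (K x)"
   using AE_lborel_singleton[of "0::'a"]
  proof eventually_elim
   case (elim x)
   have "eventually (\<lambda>n. \<epsilon> n < norm x / 2) sequentially"
    using eps_lim elim by (intro order_tendstoD) auto
   then have "eventually (\<lambda>n. \<xi> n x * grad \<psi> x (K x) = grad \<psi> x (K x)) sequentially"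
   proof eventually_elim
    case (elim n)
    have "2 \<le> norm ((1 / \<epsilon> n) *\<^sub>R x)" using elim eps[of n] by (simp add: field_simps)
    then show ?case by (simp add: \<xi>_def bump_eq_0)
   qed
   then show ?case by (rule tendsto_eventually)
  qed
  show "AE x in lborel. norm (\<xi> n x * grad \<psi> x (K x)) \<le>
    G * C * (R + 1) * (indicator (ball 0 (R + 1)) x * norm x powr - \<beta>)" for n
   using AE_lborel_singleton[of "0::'a"]
  proof eventually_elim
   case (elim x)
   show ?case
   proof (cases "norm x \<le> R")
    case True
    have "\<bar>\<xi> n x * grad \<psi> x (K x)\<bar> \<le> 1 * (G * (C * (R + 1) * norm x powr - \<beta>))"
     unfolding abs_mult
    proof (intro mult_mono)
     have "norm (K x) \<le> C * norm x * norm x powr - \<beta>" using elim by (intro K_norm) auto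
     also have "\<dots> \<le> C * (R + 1) * norm x powr - \<beta>"
      using True C_pos by (intro mult_right_mono mult_left_mono) auto
     finally show "\<bar>grad \<psi> x (K x)\<bar> \<le> G * (C * (R + 1) * norm x powr - \<beta>)"
      using order.trans[OF G(3) mult_left_mono] G(1) by auto
    qed (use chi1[of n x] in auto)
    then show ?thesis using True by (simp add: mult_ac)
   next
    case False
    then show ?thesis using frechet_derivative_outside[of R \<psi> x, OF R(2)] R C_pos G by simp
   qed
  qed
 qed (use cut(1) in \<open>auto dest: borel_measurable_integrable\<close>)
 \<comment> \<open>The factor \<open>1 / \<epsilon> n\<close> in the gradient of the cutoff is
   absorbed by \<open>norm x < 2 * \<epsilon> n\<close> on its support. What remains is the
   integrable power over a shrinking ball.\<close>
 have Rb: "\<bar>LINT x|lborel. \<psi> x * \<xi>' n x (K x)\<bar> \<le>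
   4 * G * G1 * C * (singular_const (real DIM('a)) \<beta> * (3 * \<epsilon> n) powr (real DIM('a) - \<beta>))" for n
 proof -
  have "\<bar>LINT x|lborel. \<psi> x * \<xi>' n x (K x)\<bar> \<le>
    (LINT x|lborel. 4 * G * G1 * C * (indicator (ball 0 (3 * \<epsilon> n)) x * norm (x::'a) powr - \<beta>))"
  proof (rule integral_abs_bound_integral)
   show "integrable lborel (\<lambda>x. \<psi> x * \<xi>' n x (K x))" by (rule cut)
   show "integrable lborel (\<lambda>x::'a. 4 * G * G1 * C * (indicator (ball 0 (3 * \<epsilon> n)) x * norm x powr - \<beta>))"
    using eps[of n] by (intro integrable_mult_right K_local_integral) simp
   fix x :: 'a
   show "\<bar>\<psi> x * \<xi>' n x (K x)\<bar> \<le> 4 * G * G1 * C * (indicator (ball 0 (3 * \<epsilon> n)) x * norm x powr - \<beta>)"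
   proof (cases "x \<noteq> 0 \<and> norm x < 2 * \<epsilon> n")
    case True
    have nx: "norm ((1 / \<epsilon> n) *\<^sub>R x) \<le> 2" using True eps[of n] by (simp add: field_simps)
    have "norm (K x) \<le> C * norm x * norm x powr - \<beta>" using True by (intro K_norm) auto
    also have "\<dots> \<le> C * (2 * \<epsilon> n) * norm x powr - \<beta>"
     using True C_pos by (intro mult_right_mono mult_left_mono) auto
    finally have Kx: "norm (K x) \<le> C * (2 * \<epsilon> n) * norm x powr - \<beta>" .
    have "\<bar>((1 / \<epsilon> n) *\<^sub>R x) \<bullet> K x\<bar> \<le> norm ((1 / \<epsilon> n) *\<^sub>R x) * norm (K x)"
     by (rule Cauchy_Schwarz_ineq2)
    also have "\<dots> \<le> 2 * (C * (2 * \<epsilon> n) * norm x powr - \<beta>)"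
     using nx Kx by (intro mult_mono) auto
    finally have ip: "\<bar>((1 / \<epsilon> n) *\<^sub>R x) \<bullet> K x\<bar> \<le> 2 * (C * (2 * \<epsilon> n) * norm x powr - \<beta>)" .
    have "\<bar>\<psi> x * \<xi>' n x (K x)\<bar> = \<bar>\<psi> x\<bar> * ((1 / \<epsilon> n) * (\<bar>bump' 2 ((1 / \<epsilon> n) *\<^sub>R x)\<bar> * \<bar>((1 / \<epsilon> n) *\<^sub>R x) \<bullet> K x\<bar>))"
     unfolding \<xi>'_def abs_mult using eps[of n] by simp
    also have "\<dots> \<le> G * ((1 / \<epsilon> n) * (G1 * (2 * (C * (2 * \<epsilon> n) * norm x powr - \<beta>))))"
     using G G1 eps[of n] ip by (intro mult_mono) auto
    also have "\<dots> = 4 * G * G1 * C * norm x powr - \<beta>" using eps[of n] by (simp add: field_simps)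
    finally show ?thesis using True eps[of n] by simp
   next
    case False
    then have "\<xi>' n x (K x) = 0"
     using eps[of n] bump'_eq_0'[of 2 "(1 / \<epsilon> n) *\<^sub>R x"] by (auto simp: \<xi>'_def field_simps)
    then show ?thesis using G G1 C_pos by simp
   qed
  qed
  also have "\<dots> = 4 * G * G1 * C * (LINT x|lborel. indicator (ball 0 (3 * \<epsilon> n)) x * norm (x::'a) powr - \<beta>)"
   by simp
  also have "\<dots> \<le> 4 * G * G1 * C * (singular_const (real DIM('a)) \<beta> * (3 * \<epsilon> n) powr (real DIM('a) - \<beta>))"
   using G G1 C_pos eps[of n] by (intro mult_left_mono K_local_integral) auto
  finally show ?thesis .
 qed
 have "(\<lambda>n. 4 * G * G1 * C * (singular_const (real DIM('a)) \<beta> * (3 * \<epsilon> n) powr (real DIM('a) - \<beta>)))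
   \<longlonglongrightarrow> 4 * G * G1 * C * (singular_const (real DIM('a)) \<beta> * (3 * 0) powr (real DIM('a) - \<beta>))"
  using beta eps by (intro tendsto_intros eps_lim tendsto_powr') (auto intro: always_eventually less_imp_le)
 then have "(\<lambda>n. 4 * G * G1 * C * (singular_const (real DIM('a)) \<beta> * (3 * \<epsilon> n) powr (real DIM('a) - \<beta>))) \<longlonglongrightarrow> 0"
  by simp
 then have "(\<lambda>n. LINT x|lborel. \<psi> x * \<xi>' n x (K x)) \<longlonglongrightarrow> 0"
  by (rule Lim_null_comparison[rotated]) (use Rb in \<open>auto intro: always_eventually\<close>)
 then have "(\<lambda>n. - (LINT x|lborel. \<psi> x * \<xi>' n x (K x))) \<longlonglongrightarrow> - 0" by (rule tendsto_minus)
 then show "(LINT x|lborel. grad \<psi> x (K x)) = 0"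
  using LIMSEQ_unique[OF L] cut(3) by simp
qed

end

context kernel_density begin

lemma kernel_conv_measurable [measurable]: "kernel_conv K (density_measure f) \<in> borel_measurable borel"
proof -
 have "continuous_on UNIV (kernel_conv K (density_measure f))"
  by (rule lipschitz_on_continuous_on[OF lipschitz_onI[of _ _ "2 * C' * A"]])
   (use kernel_conv_lipschitz C'_pos A_ge_1 in \<open>auto simp: dist_norm\<close>)
 then show ?thesis by (rule borel_measurable_continuous_onI)
qed

text \<open>Fubini reduces the claim to translates of \<open>K\<close>, that is, to translated test
  functions. It is applicable because the integral of \<open>norm (K (x - y))\<close> grows at most
  linearly in \<open>x\<close>, by comparison with \<open>x = 0\<close>, and \<psi> has compact
  support.\<close>

lemma kernel_conv_weakly_divergence_free: "weakly_divergence_free (kernel_conv K (density_measure f))"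
 unfolding weakly_divergence_free_def
proof (intro allI impI)
 fix \<psi> :: "'a \<Rightarrow> real" assume psi: "test_function \<psi>"
 interpret mu: prob_space "density_measure f" by (rule prob_space_density)
 interpret P: pair_sigma_finite lborel "density_measure f" ..
 note [measurable] = psi
 obtain R where R: "R > 0" "\<And>x. R < norm x \<Longrightarrow> \<psi> x = 0" using test_function_support[OF psi] by blast
 obtain G where G: "G > 0" "\<And>x v. \<bar>grad \<psi> x v\<bar> \<le> G * norm v"
  using test_function_gradient_bounded[OF psi] by blast
 have bl: "bounded_linear (grad \<psi> x)" for x
  using test_function_has_derivative[OF psi] has_derivative_bounded_linear by blast
 define I0 where "I0 = (LINT y|density_measure f. norm (K (0 - y)))"
 have I: "(LINT y|density_measure f. norm (K (x - y))) \<le> I0 + 2 * C' * A * norm x" for x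
 proof -
  have "(LINT y|density_measure f. norm (K (x - y))) \<le>
    (LINT y|density_measure f. norm (K (0 - y)) + norm (K (x - y) - K (0 - y)))"
   using K_integrable K_integrable[of 0, simplified]
  proof (intro integral_mono integrable_add integrable_norm Bochner_Integration.integrable_diff)
   fix y show "norm (K (x - y)) \<le> norm (K (0 - y)) + norm (K (x - y) - K (0 - y))"
    using norm_triangle_sub by blast
  qed auto
  also have "\<dots> = I0 + (LINT y|density_measure f. norm (K (x - y) - K (0 - y)))"
   using K_integrable K_integrable[of 0] by (subst Bochner_Integration.integral_add) (auto simp: I0_def)
  finally show ?thesis using K_diff_integral[of x 0] by simp
 qed
 have "I0 \<ge> 0" by (simp add: I0_def)
 let ?h = "\<lambda>x y. grad \<psi> x (K (x - y))"
 have hm: "(\<lambda>(x, y). ?h x y) \<in> borel_measurable (lborel \<Otimes>\<^sub>M density_measure f)"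
  by measurable
 have hint: "integrable (density_measure f) (?h x)" for x
  using integrable_bounded_linear[OF bl K_integrable] .
 have int: "integrable (lborel \<Otimes>\<^sub>M density_measure f) (\<lambda>(x, y). ?h x y)"
 proof (rule P.Fubini_integrable)
  show "AE x in lborel. integrable (density_measure f) (\<lambda>y. case (x, y) of (x, y) \<Rightarrow> ?h x y)"
   using hint by simp
  have b: "(LINT y|density_measure f. \<bar>?h x y\<bar>) \<le> G * (I0 + 2 * C' * A * R) * indicator (cball 0 R) x" for x
  proof (cases "norm x \<le> R")
   case True
   have "(LINT y|density_measure f. \<bar>?h x y\<bar>) \<le> (LINT y|density_measure f. G * norm (K (x - y)))"
    using hint K_integrable G by (intro integral_mono) auto
   also have "\<dots> \<le> G * (I0 + 2 * C' * A * norm x)"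
    using I[of x] G by simp
   also have "\<dots> \<le> G * (I0 + 2 * C' * A * R)"
    using G True C'_pos A_ge_1 by (intro mult_left_mono add_left_mono) auto
   finally show ?thesis using True by simp
  next
   case False
   then show ?thesis using frechet_derivative_outside[of R \<psi> x] R by simp
  qed
  show "integrable lborel (\<lambda>x. LINT y|density_measure f. norm (case (x, y) of (x, y) \<Rightarrow> ?h x y))"
  proof (rule Bochner_Integration.integrable_bound)
   show "integrable lborel (\<lambda>x::'a. G * (I0 + 2 * C' * A * R) * indicator (cball 0 R) x)"
    by (intro integrable_mult_right integrable_indicator_cball)
   show "(\<lambda>x. LINT y|density_measure f. norm (case (x, y) of (x, y) \<Rightarrow> ?h x y)) \<in> borel_measurable lborel"
    by measurable
   show "AE x in lborel. norm (LINT y|density_measure f. norm (case (x, y) of (x, y) \<Rightarrow> ?h x y))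
     \<le> norm (G * (I0 + 2 * C' * A * R) * indicator (cball 0 R) x)"
    using b by (auto intro!: always_eventually order.trans[OF _ abs_ge_self])
  qed
 qed (use hm in simp)
 have z: "(LINT x|lborel. ?h x y) = 0" for y
 proof -
  have psi': "test_function (\<lambda>z. \<psi> (z + y))" using test_function_affine[OF psi, of 1 y] by simp
  have d: "frechet_derivative (\<lambda>z. \<psi> (z + y)) (at z) = grad \<psi> (z + y)" for z
  proof (rule frechet_derivative_at[symmetric])
   show "((\<lambda>z. \<psi> (z + y)) has_derivative grad \<psi> (z + y)) (at z)"
    by (rule has_derivative_compose[where f = "\<lambda>z. z + y" and f' = "\<lambda>v. v"])
     (auto intro!: derivative_eq_intros test_function_has_derivative[OF psi])
  qed
  have "(LINT x|lborel. ?h x y) = (LINT x|distr lborel borel ((+) y). ?h x y)"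
   by (simp add: lborel_distr_plus)
  also have "\<dots> = (LINT z|lborel. ?h (y + z) y)"
   by (rule integral_distr) measurable
  also have "\<dots> = (LINT z|lborel. frechet_derivative (\<lambda>z. \<psi> (z + y)) (at z) (K z))"
   by (simp add: d add.commute)
  also have "\<dots> = 0"
   using K_weakly_divergence_free psi' unfolding weakly_divergence_free_def by blast
  finally show ?thesis .
 qed
 have "(LINT x|lborel. grad \<psi> x (kernel_conv K (density_measure f) x)) =
   (LINT x|lborel. LINT y|density_measure f. ?h x y)"
  unfolding kernel_conv_def using integral_bounded_linear[OF bl K_integrable] by simp
 also have "\<dots> = (LINT y|density_measure f. LINT x|lborel. ?h x y)"
  using P.Fubini_integral[OF int] by simp
 finally show "(LINT x|lborel. grad \<psi> x (kernel_conv K (density_measure f) x)) = 0"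
  by (simp add: z)
qed

end

section \<open>Hall's theorem and the infinite Wasserstein distance\<close>

text \<open>Along one edge send the largest amount that keeps all inequalities valid. Then the
  source or the sink is exhausted, or a set of sources becomes tight, and a tight set splits the
  problem into two independent ones. Each time the number of sources plus the number of edges
  drops.\<close>

lemma fractional_hall:
 fixes a :: "'i \<Rightarrow> real" and m :: "'j \<Rightarrow> real"
 assumes "finite I" "finite J" "\<And>i. i \<in> I \<Longrightarrow> 0 \<le> a i" "\<And>j. j \<in> J \<Longrightarrow> 0 \<le> m j"
  and hall: "\<And>A. A \<subseteq> I \<Longrightarrow> sum a A \<le> sum m {j \<in> J. \<exists>i\<in>A. E i j}"
 shows "\<exists>x. (\<forall>i\<in>I. \<forall>j\<in>J. 0 \<le> x i j \<and> (x i j \<noteq> 0 \<longrightarrow> E i j)) \<and>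
  (\<forall>i\<in>I. (\<Sum>j\<in>J. x i j) = a i) \<and> (\<forall>j\<in>J. (\<Sum>i\<in>I. x i j) \<le> m j)"
 using assms
proof (induction "card I + card {(i, j). i \<in> I \<and> j \<in> J \<and> E i j}" arbitrary: I J a m E rule: less_induct)
 case less
 note fin = less.prems(1,2) and a0 = less.prems(3) and m0 = less.prems(4) and hall = less.prems(5)
 let ?P = "\<lambda>I J a m E x. (\<forall>i\<in>I. \<forall>j\<in>J. 0 \<le> x i j \<and> (x i j \<noteq> 0 \<longrightarrow> E i j)) \<and>
  (\<forall>i\<in>I. (\<Sum>j\<in>J. x i j) = a i) \<and> (\<forall>j\<in>J. (\<Sum>i\<in>I. x i j) \<le> (m j :: real))"
 let ?E = "\<lambda>I J E. {(i, j). i \<in> I \<and> j \<in> J \<and> E i j}"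
 have finE: "finite (?E I J E)" for E
 proof (rule finite_subset)
  show "?E I J E \<subseteq> I \<times> J" by auto
 qed (use fin in simp)
 show ?case
 proof (cases "\<exists>i0\<in>I. \<exists>j0\<in>J. E i0 j0")
  case False
  have "a i = 0" if "i \<in> I" for i
  proof -
   have "sum a {i} \<le> sum m {j \<in> J. \<exists>i'\<in>{i}. E i' j}" using that by (intro hall) auto
   also have "{j \<in> J. \<exists>i'\<in>{i}. E i' j} = {}" using that False by auto
   finally show ?thesis using a0[OF that] by simp
  qed
  then show ?thesis using m0 by (intro exI[of _ "\<lambda>_ _. 0"]) auto
 next
  case True
  then obtain i0 j0 where ij: "i0 \<in> I" "j0 \<in> J" "E i0 j0" by blast
  \<comment> \<open>Sending mass from \<open>i0\<close> to \<open>j0\<close> endangers exactly the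
    sets that lose capacity at \<open>j0\<close> without losing the demand of
    \<open>i0\<close>.\<close>
  define crit where "crit = {A. A \<subseteq> I \<and> i0 \<notin> A \<and> (\<exists>i\<in>A. E i j0)}"
  define slack where "slack A = sum m {j \<in> J. \<exists>i\<in>A. E i j} - sum a A" for A
  have fincrit: "finite crit" unfolding crit_def by (rule finite_subset[of _ "Pow I"]) (use fin in auto)
  define \<delta> where "\<delta> = Min (insert (a i0) (insert (m j0) (slack ` crit)))"
  have d_le: "\<delta> \<le> a i0" "\<delta> \<le> m j0" "\<And>A. A \<in> crit \<Longrightarrow> \<delta> \<le> slack A"
   unfolding \<delta>_def by (intro Min_le; use fincrit in simp)+
  have "\<delta> \<in> insert (a i0) (insert (m j0) (slack ` crit))"
   unfolding \<delta>_def using fincrit by (intro Min_in) auto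
  then consider (source) "\<delta> = a i0" | (sink) "\<delta> = m j0" | (tight) A where "A \<in> crit" "\<delta> = slack A" by auto
  note cases = this
  have d0: "0 \<le> \<delta>"
  proof -
   have "0 \<le> slack A" if "A \<in> crit" for A
    using hall[of A] that by (auto simp: slack_def crit_def)
   then show ?thesis using fincrit a0 m0 ij by (auto simp: \<delta>_def Min_ge_iff)
  qed
  define a' where "a' = a(i0 := a i0 - \<delta>)"
  define m' where "m' = m(j0 := m j0 - \<delta>)"
  have a'0: "0 \<le> a' i" if "i \<in> I" for i using a0[OF that] d_le by (auto simp: a'_def)
  have m'0: "0 \<le> m' j" if "j \<in> J" for j using m0[OF that] d_le by (auto simp: m'_def)
  have suma: "sum a' A = sum a A - (if i0 \<in> A then \<delta> else 0)" if "A \<subseteq> I" for A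
  proof -
   have "finite A" using that fin finite_subset by blast
   have "sum a' A = (\<Sum>i\<in>A. a i - (if i = i0 then \<delta> else 0))"
    by (rule sum.cong) (auto simp: a'_def)
   then show ?thesis using \<open>finite A\<close> by (simp add: sum_subtractf sum.delta)
  qed
  have summ: "sum m' B = sum m B - (if j0 \<in> B then \<delta> else 0)" if "B \<subseteq> J" for B
  proof -
   have "finite B" using that fin finite_subset by blast
   have "sum m' B = (\<Sum>j\<in>B. m j - (if j = j0 then \<delta> else 0))"
    by (rule sum.cong) (auto simp: m'_def)
   then show ?thesis using \<open>finite B\<close> by (simp add: sum_subtractf sum.delta)
  qed
  have hall': "sum a' A \<le> sum m' {j \<in> J. \<exists>i\<in>A. E i j}" if A: "A \<subseteq> I" for A
  proof -
   consider "i0 \<in> A" | "i0 \<notin> A" "\<not> (\<exists>i\<in>A. E i j0)" | "A \<in> crit" using A by (auto simp: crit_def)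
   then show ?thesis
   proof cases
    case 1
    then show ?thesis using hall[OF A] ij d0 A by (subst suma, simp, subst summ) auto
   next
    case 2
    then show ?thesis using hall[OF A] A by (subst suma, simp, subst summ) auto
   next
    case 3
    then have "i0 \<notin> A" by (simp add: crit_def)
    then show ?thesis using d_le(3)[OF 3] A d0 by (subst suma, simp, subst summ) (auto simp: slack_def)
   qed
  qed
  \<comment> \<open>A solution for the reduced demands and capacities becomes one for the original
    data by adding \<delta> on the chosen edge.\<close>
  have lift: "\<exists>x. ?P I J a m E x" if x: "?P I J a' m' E x" for x
  proof -
   define y where "y = (\<lambda>i j. x i j + (if i = i0 \<and> j = j0 then \<delta> else 0))"
   have "(\<Sum>j\<in>J. y i j) = a i" if "i \<in> I" for i
    using x that fin ij by (cases "i = i0") (auto simp: y_def sum.distrib a'_def sum.delta)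
   moreover have "(\<Sum>i\<in>I. y i j) \<le> m j" if "j \<in> J" for j
   proof -
    have "(\<Sum>i\<in>I. x i j) \<le> m' j" using x that by blast
    then show ?thesis using that fin ij by (cases "j = j0") (auto simp: y_def sum.distrib m'_def sum.delta)
   qed
   moreover have "0 \<le> y i j \<and> (y i j \<noteq> 0 \<longrightarrow> E i j)" if "i \<in> I" "j \<in> J" for i j
    using x that d0 ij by (auto simp: y_def)
   ultimately have "?P I J a m E y" by blast
   then show ?thesis by blast
  qed
  show ?thesis
   using cases
  proof cases
   case source
   define I' where "I' = I - {i0}"
   have "card I' < card I" unfolding I'_def using fin(1) ij(1) by (rule card_Diff1_less)
   moreover have "card (?E I' J E) \<le> card (?E I J E)"
    by (rule card_mono[OF finE]) (auto simp: I'_def)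
   ultimately have "\<exists>x. ?P I' J a' m' E x"
    using fin a'0 m'0 hall' by (intro less.hyps) (auto simp: I'_def)
   then obtain x where x: "?P I' J a' m' E x" by blast
   define y where "y = (\<lambda>i j. if i = i0 then 0 else x i j)"
   have s: "(\<Sum>i\<in>I. y i j) = (\<Sum>i\<in>I'. x i j)" for j
    unfolding I'_def by (subst sum.remove[OF fin(1) ij(1)]) (auto simp: y_def intro!: sum.cong)
   have "?P I J a' m' E y"
    using x source unfolding s by (auto simp: y_def I'_def a'_def)
   then show ?thesis by (rule lift)
  next
   case sink
   \<comment> \<open>The exhausted sink stays, but all edges into it are deleted; its capacity is
     now 0, so the inequalities are not affected.\<close>
   define E' where "E' = (\<lambda>i j. E i j \<and> j \<noteq> j0)"
   have "card (?E I J E') < card (?E I J E)"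
    by (rule psubset_card_mono[OF finE]) (use ij in \<open>auto simp: E'_def\<close>)
   moreover have "sum a' A \<le> sum m' {j \<in> J. \<exists>i\<in>A. E' i j}" if "A \<subseteq> I" for A
   proof -
    have "sum m' {j \<in> J. \<exists>i\<in>A. E i j} = sum m' {j \<in> J. \<exists>i\<in>A. E' i j}"
     by (rule sum.mono_neutral_right) (use fin sink in \<open>auto simp: E'_def m'_def\<close>)
    then show ?thesis using hall'[OF that] by simp
   qed
   ultimately have "\<exists>x. ?P I J a' m' E' x"
    using fin a'0 m'0 by (intro less.hyps) auto
   then obtain x where x: "?P I J a' m' E' x" by blast
   then have "?P I J a' m' E x" by (auto simp: E'_def)
   then show ?thesis by (rule lift)
  next
   case tight
   define J1 where "J1 = {j \<in> J. \<exists>i\<in>A. E i j}"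
   have A: "A \<subseteq> I" "i0 \<notin> A" "j0 \<in> J1" using tight ij by (auto simp: crit_def J1_def)
   have J1: "J1 \<subseteq> J" by (auto simp: J1_def)
   have tight': "sum a' A = sum m' J1"
    using A tight J1 by (simp add: suma summ slack_def J1_def[symmetric])
   have "A \<noteq> {}" using tight by (auto simp: crit_def)
   have cA: "card A < card I" using fin A ij by (intro psubset_card_mono) auto
   have cB: "card (I - A) < card I"
    using fin A \<open>A \<noteq> {}\<close> by (intro psubset_card_mono) auto
   have "\<exists>x. ?P A J1 a' m' E x"
   proof (intro less.hyps)
    have "card (?E A J1 E) \<le> card (?E I J E)" by (rule card_mono[OF finE]) (use A J1 in auto)
    then show "card A + card (?E A J1 E) < card I + card (?E I J E)" using cA by simp
    fix B assume "B \<subseteq> A"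
    then have "{j \<in> J1. \<exists>i\<in>B. E i j} = {j \<in> J. \<exists>i\<in>B. E i j}" by (auto simp: J1_def)
    then show "sum a' B \<le> sum m' {j \<in> J1. \<exists>i\<in>B. E i j}"
     using hall'[of B] A \<open>B \<subseteq> A\<close> by auto
   qed (use A J1 a'0 m'0 finite_subset[OF A(1) fin(1)] finite_subset[OF J1 fin(2)] in auto)
   then obtain x1 where x1: "?P A J1 a' m' E x1" by blast
   \<comment> \<open>For the complement, subtract the equality for the tight set \<open>A\<close>
     from the inequality for \<open>A \<union> B\<close>: the sinks reached by \<open>B\<close>
     outside \<open>J1\<close> carry the demand of \<open>B\<close>.\<close>
   have "\<exists>x. ?P (I - A) (J - J1) a' m' E x"
   proof (intro less.hyps)
    have "card (?E (I - A) (J - J1) E) \<le> card (?E I J E)" by (rule card_mono[OF finE]) auto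
    then show "card (I - A) + card (?E (I - A) (J - J1) E) < card I + card (?E I J E)" using cB by simp
    fix B assume B: "B \<subseteq> I - A"
    have "sum a' A + sum a' B = sum a' (A \<union> B)"
     using B A fin by (intro sum.union_disjoint[symmetric]) (auto intro: finite_subset)
    also have "\<dots> \<le> sum m' {j \<in> J. \<exists>i\<in>A \<union> B. E i j}" using A B by (intro hall') auto
    also have "{j \<in> J. \<exists>i\<in>A \<union> B. E i j} = J1 \<union> {j \<in> J - J1. \<exists>i\<in>B. E i j}" by (auto simp: J1_def)
    also have "sum m' \<dots> = sum m' J1 + sum m' {j \<in> J - J1. \<exists>i\<in>B. E i j}"
     using fin J1 by (intro sum.union_disjoint) (auto intro: finite_subset)
    finally show "sum a' B \<le> sum m' {j \<in> J - J1. \<exists>i\<in>B. E i j}" using tight' by simp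
   qed (use A J1 a'0 m'0 fin in auto)
   then obtain x2 where x2: "?P (I - A) (J - J1) a' m' E x2" by blast
   define x where "x = (\<lambda>i j. if i \<in> A \<and> j \<in> J1 then x1 i j else if i \<notin> A \<and> j \<notin> J1 then x2 i j else 0)"
   have row: "(\<Sum>j\<in>J. x i j) = a' i" if "i \<in> I" for i
   proof (cases "i \<in> A")
    case True
    have "(\<Sum>j\<in>J. x i j) = (\<Sum>j\<in>J1. x1 i j)"
     by (rule sum.mono_neutral_cong_right) (use fin J1 True in \<open>auto simp: x_def\<close>)
    then show ?thesis using x1 True by simp
   next
    case False
    have "(\<Sum>j\<in>J. x i j) = (\<Sum>j\<in>J - J1. x2 i j)"
     by (rule sum.mono_neutral_cong_right) (use fin False in \<open>auto simp: x_def\<close>)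
    then show ?thesis using x2 False that by simp
   qed
   have col: "(\<Sum>i\<in>I. x i j) \<le> m' j" if "j \<in> J" for j
   proof (cases "j \<in> J1")
    case True
    have "(\<Sum>i\<in>I. x i j) = (\<Sum>i\<in>A. x1 i j)"
     by (rule sum.mono_neutral_cong_right) (use fin A True in \<open>auto simp: x_def\<close>)
    then show ?thesis using x1 True by simp
   next
    case False
    have "(\<Sum>i\<in>I. x i j) = (\<Sum>i\<in>I - A. x2 i j)"
     by (rule sum.mono_neutral_cong_right) (use fin False in \<open>auto simp: x_def\<close>)
    then show ?thesis using x2 False that by simp
   qed
   have "0 \<le> x i j \<and> (x i j \<noteq> 0 \<longrightarrow> E i j)" if "i \<in> I" "j \<in> J" for i j
    using x1 x2 that by (auto simp: x_def)
   with row col have "?P I J a' m' E x" by blast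
   then show ?thesis by (rule lift)
  qed
 qed
qed

text \<open>By Hall's theorem this is equivalent to \<open>W_inf (empirical_measure N X) (density_measure f) \<le> r\<close>;
 unlike couplings, the condition is easily propagated along a flow.\<close>

definition hall_near :: "nat \<Rightarrow> (nat \<Rightarrow> 'a::euclidean_space) \<Rightarrow> ('a \<Rightarrow> real) \<Rightarrow> real \<Rightarrow> bool" where
 "hall_near N X f r \<longleftrightarrow>
  (\<forall>I\<subseteq>{..<N}. real (card I) / real N \<le> measure (density_measure f) (\<Union>i\<in>I. cball (X i) r))"

lemma empirical_measurable: "X \<in> uniform_count_measure {..<N::nat} \<rightarrow>\<^sub>M borel"
 by (simp add: measurable_def uniform_count_measure_def space_uniform_count_measure sets_uniform_count_measure)

lemma sets_empirical [simp]: "sets (empirical_measure N X) = sets borel"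
 by (simp add: empirical_measure_def)

lemma emeasure_empirical:
 assumes "N \<ge> 1" "A \<in> sets borel"
 shows "emeasure (empirical_measure N X) A = ennreal (real (card {i. i < N \<and> X i \<in> A}) / real N)"
proof -
 have "emeasure (empirical_measure N X) A = emeasure (uniform_count_measure {..<N}) (X -` A \<inter> {..<N})"
  unfolding empirical_measure_def using assms
  by (subst emeasure_distr[OF empirical_measurable]) (simp_all add: space_uniform_count_measure)
 also have "\<dots> = ennreal (real (card (X -` A \<inter> {..<N})) / real N)"
  by (subst emeasure_uniform_count_measure) auto
 also have "X -` A \<inter> {..<N} = {i. i < N \<and> X i \<in> A}" by auto
 finally show ?thesis .
qed

section \<open>Couplings and Hall's condition\<close>

context bounded_density begin

text \<open>The strict inequality provides one coupling with essential supremum below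
  \<open>r\<close>, without a compactness argument. It carries the mass sitting on the chosen
  particles into the union of their balls.\<close>

lemma hall_near_W_inf:
 assumes "N \<ge> 1" and less: "W_inf (empirical_measure N X) (density_measure f) < ennreal r"
 shows "hall_near N X f r"
 unfolding hall_near_def
proof (intro allI impI)
 fix I assume I: "I \<subseteq> {..<N}"
 interpret mu: prob_space "density_measure f" by (rule prob_space_density)
 obtain \<gamma> where g: "\<gamma> \<in> couplings (empirical_measure N X) (density_measure f)"
  and ess: "esssup \<gamma> (\<lambda>(x, y). ennreal (dist x y)) < ennreal r"
  using less unfolding W_inf_def INF_less_iff by blast
 have sets[measurable_cong]: "sets \<gamma> = sets (borel \<Otimes>\<^sub>M borel)"
  and d1: "distr \<gamma> borel fst = empirical_measure N X" and d2: "distr \<gamma> borel snd = density_measure f"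
  using g by (auto simp: couplings_def)
 have space: "space \<gamma> = UNIV" using sets_eq_imp_space_eq[OF sets] by (simp add: space_pair_measure)
 have fin: "finite I" using I finite_subset by blast
 let ?U = "\<Union>i\<in>I. cball (X i) r"
 have U: "?U \<in> sets borel" using fin by (intro sets.finite_UN) auto
 have XI: "X ` I \<in> sets borel" using fin by (intro borel_closed finite_imp_closed) auto
 have AE: "AE p in \<gamma>. fst p \<in> X ` I \<longrightarrow> snd p \<in> ?U"
  using esssup_AE[of "\<lambda>(x, y). ennreal (dist x y)" \<gamma>]
 proof eventually_elim
  case (elim p)
  then have "ennreal (dist (fst p) (snd p)) < ennreal r"
   using ess by (auto simp: case_prod_beta intro: le_less_trans)
  then have "dist (fst p) (snd p) < r" by (simp add: ennreal_less_iff)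
  then show ?case by (force intro: less_imp_le)
 qed
 \<comment> \<open>Only an inequality, since particles outside \<open>I\<close> may coincide with
   particles in \<open>I\<close>.\<close>
 have "ennreal (real (card I) / real N) \<le> ennreal (real (card {i. i < N \<and> X i \<in> X ` I}) / real N)"
  using I by (intro ennreal_leI divide_right_mono of_nat_mono card_mono) auto
 also have "\<dots> = emeasure (empirical_measure N X) (X ` I)"
  using assms XI by (simp add: emeasure_empirical)
 also have "\<dots> = emeasure \<gamma> (fst -` (X ` I) \<inter> space \<gamma>)"
  unfolding d1[symmetric] using XI by (intro emeasure_distr) auto
 also have "\<dots> \<le> emeasure \<gamma> (snd -` ?U \<inter> space \<gamma>)"
 proof (rule emeasure_mono_AE)
  show "AE x in \<gamma>. x \<in> fst -` X ` I \<inter> space \<gamma> \<longrightarrow> x \<in> snd -` ?U \<inter> space \<gamma>"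
   using AE by eventually_elim (auto simp: space)
  show "snd -` ?U \<inter> space \<gamma> \<in> sets \<gamma>"
   by (rule measurable_sets[OF _ U]) measurable
 qed
 also have "\<dots> = emeasure (density_measure f) ?U"
  unfolding d2[symmetric] using U by (intro emeasure_distr[symmetric]) auto
 finally show "real (card I) / real N \<le> measure (density_measure f) ?U"
  by (simp add: mu.emeasure_eq_measure)
qed

text \<open>The continuous problem becomes finite by grouping points according to the set of
  particles within reach. The weight \<open>w i y\<close> is the fraction of the density at
  \<open>y\<close> that is assigned to particle \<open>i\<close>; this form of a coupling is also
  convenient for the velocity estimates.\<close>

lemma hall_near_plan:
 assumes "N \<ge> 1" and near: "hall_near N X f r"
 obtains w :: "nat \<Rightarrow> 'a \<Rightarrow> real" where
  "\<And>i. w i \<in> borel_measurable borel" "\<And>i y. 0 \<le> w i y" "\<And>y. (\<Sum>i<N. w i y) \<le> 1"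
  "\<And>i y. w i y \<noteq> 0 \<Longrightarrow> dist (X i) y \<le> r"
  "\<And>i. i < N \<Longrightarrow> integrable (density_measure f) (w i)"
  "\<And>i. i < N \<Longrightarrow> (LINT y|density_measure f. w i y) = 1 / real N"
  "AE y in density_measure f. (\<Sum>i<N. w i y) = 1"
proof -
 interpret mu: prob_space "density_measure f" by (rule prob_space_density)
 \<comment> \<open>Points of one cell are within reach of the same particles, and the cell value, a
   set of indices, serves as the sink of the bipartite problem.\<close>
 define cell where "cell y = {i. i < N \<and> dist (X i) y \<le> r}" for y
 define m where "m c = measure (density_measure f) (cell -` {c})" for c
 have cell_sets: "cell -` {c} \<in> sets borel" for c
 proof (cases "c \<subseteq> {..<N}")
  case True
  have S: "{y. (i \<in> c) = (dist (X i) y \<le> r)} \<in> sets borel" for i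
  proof -
   have "{y. (i \<in> c) = (dist (X i) y \<le> r)} = (if i \<in> c then cball (X i) r else - cball (X i) r)" by auto
   then show ?thesis by simp
  qed
  have lt: "i < N" if "i \<in> c" for i using True that by auto
  have "cell y = c \<longleftrightarrow> (\<forall>i<N. (i \<in> c) = (dist (X i) y \<le> r))" for y
   unfolding cell_def set_eq_iff mem_Collect_eq using lt by blast
  then have "cell -` {c} = (\<Inter>i\<in>{..<N}. {y. (i \<in> c) = (dist (X i) y \<le> r)})"
   by (intro set_eqI) auto
  also have "\<dots> \<in> sets borel"
   using S \<open>N \<ge> 1\<close> by (intro sets.finite_INT) (auto simp: lessThan_empty_iff)
  finally show ?thesis .
 next
  case False
  then have "cell -` {c} = {}" by (auto simp: cell_def)
  then show ?thesis by simp
 qed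
 have cell_sub: "cell y \<in> Pow {..<N}" for y by (auto simp: cell_def)
 have sum_m: "sum m D = measure (density_measure f) (cell -` D)" if "D \<subseteq> Pow {..<N}" for D
 proof -
  have "finite D" using that finite_subset by blast
  then have "measure (density_measure f) (\<Union>c\<in>D. cell -` {c}) = (\<Sum>c\<in>D. measure (density_measure f) (cell -` {c}))"
   by (rule mu.finite_measure_finite_Union[where A = "\<lambda>c. cell -` {c}"])
    (auto simp: cell_sets disjoint_family_on_def sets_density)
  moreover have "(\<Union>c\<in>D. cell -` {c}) = cell -` D" by auto
  ultimately show ?thesis by (simp add: m_def)
 qed
 have "\<exists>x. (\<forall>i\<in>{..<N}. \<forall>c\<in>Pow {..<N}. 0 \<le> x i c \<and> (x i c \<noteq> 0 \<longrightarrow> i \<in> c)) \<and>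
  (\<forall>i\<in>{..<N}. (\<Sum>c\<in>Pow {..<N}. x i c) = 1 / real N) \<and> (\<forall>c\<in>Pow {..<N}. (\<Sum>i<N. x i c) \<le> m c)"
 proof (rule fractional_hall)
  fix A assume A: "A \<subseteq> {..<N}"
  have "cell -` {c \<in> Pow {..<N}. \<exists>i\<in>A. i \<in> c} = (\<Union>i\<in>A. cball (X i) r)"
   using A by (auto simp: cell_def)
  then show "(\<Sum>i\<in>A. 1 / real N) \<le> sum m {c \<in> Pow {..<N}. \<exists>i\<in>A. i \<in> c}"
   using near A by (subst sum_m) (auto simp: hall_near_def)
 qed (auto simp: m_def)
 then obtain x where X: "\<forall>i\<in>{..<N}. \<forall>c\<in>Pow {..<N}. 0 \<le> x i c \<and> (x i c \<noteq> 0 \<longrightarrow> i \<in> c)"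
  "\<forall>i\<in>{..<N}. (\<Sum>c\<in>Pow {..<N}. x i c) = 1 / real N"
  "\<forall>c\<in>Pow {..<N}. (\<Sum>i<N. x i c) \<le> m c" by blast
 have x: "\<And>i c. i < N \<Longrightarrow> c \<subseteq> {..<N} \<Longrightarrow> 0 \<le> x i c"
  "\<And>i c. i < N \<Longrightarrow> c \<subseteq> {..<N} \<Longrightarrow> x i c \<noteq> 0 \<Longrightarrow> i \<in> c"
  "\<And>i. i < N \<Longrightarrow> (\<Sum>c\<in>Pow {..<N}. x i c) = 1 / real N"
  "\<And>c. c \<subseteq> {..<N} \<Longrightarrow> (\<Sum>i<N. x i c) \<le> m c"
  using X by auto
 \<comment> \<open>The amount \<open>x i c\<close> is spread over the cell in proportion to the
   density; on a cell of measure 0 the quotient is 0, as division by 0 gives 0.\<close>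
 define w where "w i y = (if i < N then x i (cell y) / m (cell y) else 0)" for i y
 have m0: "0 \<le> m c" for c by (simp add: m_def)
 have w_sum: "w i y = (\<Sum>c\<in>Pow {..<N}. x i c / m c * indicator (cell -` {c}) y)" if "i < N" for i y
 proof -
  have "(\<Sum>c\<in>Pow {..<N}. x i c / m c * indicator (cell -` {c}) y) =
    (\<Sum>c\<in>Pow {..<N}. if c = cell y then x i c / m c else 0)"
   by (rule sum.cong) auto
  then show ?thesis using that cell_sub[of y] by (simp add: w_def sum.delta)
 qed
 have wm [measurable]: "w i \<in> borel_measurable borel" for i
 proof (cases "i < N")
  case True
  have "(\<lambda>y. \<Sum>c\<in>Pow {..<N}. x i c / m c * indicator (cell -` {c}) y) \<in> borel_measurable borel"
   using cell_sets by (intro borel_measurable_sum borel_measurable_times borel_measurable_indicator) auto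
  then show ?thesis using w_sum[OF True] by (simp cong: measurable_cong)
 next
  case False
  then have "w i = (\<lambda>_. 0)" by (auto simp: w_def)
  then show ?thesis by simp
 qed
 have w0: "0 \<le> w i y" for i y
  using x(1)[of i "cell y"] cell_sub[of y] m0 by (simp add: w_def)
 have w1: "(\<Sum>i<N. w i y) \<le> 1" for y
 proof -
  have "(\<Sum>i<N. w i y) = (\<Sum>i<N. x i (cell y)) / m (cell y)"
   by (simp add: w_def sum_divide_distrib)
  also have "\<dots> \<le> 1" using x(4)[of "cell y"] cell_sub[of y] m0[of "cell y"]
   by (cases "m (cell y) = 0") auto
  finally show ?thesis .
 qed
 have int_ind: "integrable (density_measure f) (indicator (cell -` {c}) :: 'a \<Rightarrow> real)" for c
  using cell_sets mu.emeasure_finite by (intro integrable_real_indicator) (auto simp: sets_density less_top[symmetric])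
 have wint: "integrable (density_measure f) (w i)" if "i < N" for i
  unfolding w_sum[OF that, abs_def] using int_ind by (intro Bochner_Integration.integrable_sum integrable_mult_right)
 have wval: "(LINT y|density_measure f. w i y) = 1 / real N" if i: "i < N" for i
 proof -
  have "(LINT y|density_measure f. w i y) = (\<Sum>c\<in>Pow {..<N}. x i c / m c * m c)"
   unfolding w_sum[OF i, abs_def] using int_ind cell_sets
   by (simp add: Bochner_Integration.integral_sum m_def sets_density)
  also have "\<dots> = (\<Sum>c\<in>Pow {..<N}. x i c)"
  proof (rule sum.cong)
   fix c assume c: "c \<in> Pow {..<N}"
   have "x i c \<le> (\<Sum>i<N. x i c)" using x(1) i c by (intro member_le_sum) auto
   also have "\<dots> \<le> m c" using x(4) c by auto
   finally have "m c = 0 \<Longrightarrow> x i c = 0" using x(1)[of i c] i c by force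
   then show "x i c / m c * m c = x i c" by auto
  qed simp
  finally show ?thesis using x(3)[OF i] by simp
 qed
 have sumint: "integrable (density_measure f) (\<lambda>y. \<Sum>i<N. w i y)"
  using wint by (intro Bochner_Integration.integrable_sum) auto
 \<comment> \<open>The masses \<open>1 / N\<close> add up to the total mass 1, so the bound by 1 is
   an equality almost everywhere.\<close>
 have "(LINT y|density_measure f. 1 - (\<Sum>i<N. w i y)) = 0"
  using wint wval \<open>N \<ge> 1\<close> sumint by (simp add: Bochner_Integration.integral_sum mu.prob_space[simplified])
 then have "AE y in density_measure f. 1 - (\<Sum>i<N. w i y) = 0"
  using w1 sumint by (subst (asm) integral_nonneg_eq_0_iff_AE) auto
 then have ae: "AE y in density_measure f. (\<Sum>i<N. w i y) = 1" by eventually_elim simp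
 have supp: "dist (X i) y \<le> r" if "w i y \<noteq> 0" for i y
 proof -
  have "i < N" using that by (auto simp: w_def split: if_splits)
  then have "i \<in> cell y" using that x(2)[of i "cell y"] cell_sub[of y] by (auto simp: w_def)
  then show ?thesis by (simp add: cell_def)
 qed
 show ?thesis by (rule that[OF wm w0 w1 supp wint wval ae])
qed

text \<open>The plan defines a measure on indices times space, and the coupling is its image under
  \<open>(i, y) \<mapsto> (X i, y)\<close>. Working with indices first keeps coinciding particles
  apart.\<close>

lemma W_inf_le_hall_near:
 assumes "N \<ge> 1" and near: "hall_near N X f r"
 shows "W_inf (empirical_measure N X) (density_measure f) \<le> ennreal r"
proof -
 interpret mu: prob_space "density_measure f" by (rule prob_space_density)
 obtain w :: "nat \<Rightarrow> 'a \<Rightarrow> real" where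
  w: "\<And>i. w i \<in> borel_measurable borel" "\<And>i y. 0 \<le> w i y" "\<And>y. (\<Sum>i<N. w i y) \<le> 1"
  "\<And>i y. w i y \<noteq> 0 \<Longrightarrow> dist (X i) y \<le> r"
  "\<And>i. i < N \<Longrightarrow> integrable (density_measure f) (w i)"
  "\<And>i. i < N \<Longrightarrow> (LINT y|density_measure f. w i y) = 1 / real N"
  "AE y in density_measure f. (\<Sum>i<N. w i y) = 1"
  by (rule hall_near_plan[OF assms]) (rule that)
 note [measurable] = w(1)
 let ?\<nu> = "count_space {..<N} \<Otimes>\<^sub>M density_measure f"
 define \<kappa> where "\<kappa> = density ?\<nu> (\<lambda>(i, y). ennreal (w i y))"
 define \<gamma> where "\<gamma> = distr \<kappa> (borel \<Otimes>\<^sub>M borel) (\<lambda>(i, y). (X i, y))"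
 have wm: "(\<lambda>(i, y). ennreal (w i y)) \<in> borel_measurable ?\<nu>"
  by (rule measurable_pair_measure_countable1) auto
 have Xm: "(\<lambda>(i, y). (X i, y)) \<in> \<kappa> \<rightarrow>\<^sub>M borel \<Otimes>\<^sub>M borel"
  unfolding \<kappa>_def measurable_density_eq1 by (rule measurable_pair_measure_countable1) auto
 have km: "\<kappa> = density ?\<nu> (\<lambda>(i, y). ennreal (w i y))" by (simp add: \<kappa>_def)
 have nu_integral: "(\<integral>\<^sup>+p. g p \<partial>?\<nu>) = (\<Sum>i<N. \<integral>\<^sup>+y. g (i, y) \<partial>density_measure f)"
  if "g \<in> borel_measurable ?\<nu>" for g
  using mu.nn_integral_fst[OF that] by (simp add: nn_integral_count_space_finite)
 have gint: "(\<integral>\<^sup>+p. g p \<partial>\<gamma>) = (\<Sum>i<N. \<integral>\<^sup>+y. ennreal (w i y) * g (X i, y) \<partial>density_measure f)"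
  if g: "g \<in> borel_measurable (borel \<Otimes>\<^sub>M borel)" for g
 proof -
  have Xm': "(\<lambda>(i, y). (X i, y)) \<in> ?\<nu> \<rightarrow>\<^sub>M borel \<Otimes>\<^sub>M borel"
   using Xm unfolding \<kappa>_def measurable_density_eq1 .
  have gX: "(\<lambda>p. g (case p of (i, y) \<Rightarrow> (X i, y))) \<in> borel_measurable ?\<nu>"
   by (rule measurable_compose[OF Xm' g])
  have "(\<integral>\<^sup>+p. g p \<partial>\<gamma>) = (\<integral>\<^sup>+p. g (case p of (i, y) \<Rightarrow> (X i, y)) \<partial>\<kappa>)"
   unfolding \<gamma>_def using g Xm by (intro nn_integral_distr) auto
  also have "\<dots> = (\<integral>\<^sup>+p. (case p of (i, y) \<Rightarrow> ennreal (w i y)) * g (case p of (i, y) \<Rightarrow> (X i, y)) \<partial>?\<nu>)"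
   unfolding \<kappa>_def using wm gX by (intro Nonnegative_Lebesgue_Integration.nn_integral_density)
  also have "\<dots> = (\<Sum>i<N. \<integral>\<^sup>+y. ennreal (w i y) * g (X i, y) \<partial>density_measure f)"
   using wm gX by (subst nu_integral) (auto intro: borel_measurable_times_ennreal)
  finally show ?thesis .
 qed
 have sets_g[measurable_cong]: "sets \<gamma> = sets (borel \<Otimes>\<^sub>M borel)" by (simp add: \<gamma>_def)
 have space_g: "space \<gamma> = UNIV" using sets_eq_imp_space_eq[OF sets_g] by (simp add: space_pair_measure)
 have em: "emeasure \<gamma> B = (\<Sum>i<N. \<integral>\<^sup>+y. ennreal (w i y) * indicator B (X i, y) \<partial>density_measure f)"
  if "B \<in> sets (borel \<Otimes>\<^sub>M borel)" for B
  using gint[of "indicator B"] that by (simp add: sets_g)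
 have "distr \<gamma> borel fst = empirical_measure N X"
 proof (rule measure_eqI)
  fix S assume "S \<in> sets (distr \<gamma> borel fst)"
  then have S: "S \<in> sets borel" by simp
  have "emeasure (distr \<gamma> borel fst) S = emeasure \<gamma> (fst -` S \<inter> space \<gamma>)"
   using S by (intro emeasure_distr) auto
  also have "\<dots> = (\<Sum>i<N. \<integral>\<^sup>+y. ennreal (w i y) * indicator (fst -` S \<inter> space \<gamma>) (X i, y) \<partial>density_measure f)"
   using S by (intro em measurable_sets[of fst \<gamma> borel, unfolded sets_g]) auto
  also have "\<dots> = (\<Sum>i<N. ennreal (1 / real N) * indicator S (X i))"
  proof (rule sum.cong)
   fix i assume i: "i \<in> {..<N}"
   have "(\<integral>\<^sup>+y. ennreal (w i y) * indicator (fst -` S \<inter> space \<gamma>) (X i, y) \<partial>density_measure f) =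
     (\<integral>\<^sup>+y. ennreal (w i y) \<partial>density_measure f) * indicator S (X i)"
    by (auto simp: indicator_def space_g)
   also have "(\<integral>\<^sup>+y. ennreal (w i y) \<partial>density_measure f) = ennreal (1 / real N)"
    using w i by (subst nn_integral_eq_integral) auto
   finally show "(\<integral>\<^sup>+y. ennreal (w i y) * indicator (fst -` S \<inter> space \<gamma>) (X i, y) \<partial>density_measure f) =
    ennreal (1 / real N) * indicator S (X i)" .
  qed simp
  also have "\<dots> = (\<Sum>i\<in>{i. i < N \<and> X i \<in> S}. ennreal (1 / real N))"
   by (rule sum.mono_neutral_cong_right) auto
  also have "\<dots> = ennreal (real (card {i. i < N \<and> X i \<in> S}) / real N)"
   by (simp add: ennreal_of_nat_eq_real_of_nat ennreal_mult[symmetric])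
  also have "\<dots> = emeasure (empirical_measure N X) S"
   using assms S by (simp add: emeasure_empirical)
  finally show "emeasure (distr \<gamma> borel fst) S = emeasure (empirical_measure N X) S" .
 qed simp
 moreover have "distr \<gamma> borel snd = density_measure f"
 proof (rule measure_eqI)
  fix S assume "S \<in> sets (distr \<gamma> borel snd)"
  then have S [measurable]: "S \<in> sets borel" by simp
  have "emeasure (distr \<gamma> borel snd) S = emeasure \<gamma> (snd -` S \<inter> space \<gamma>)"
   using S by (intro emeasure_distr) auto
  also have "\<dots> = (\<Sum>i<N. \<integral>\<^sup>+y. ennreal (w i y) * indicator (snd -` S \<inter> space \<gamma>) (X i, y) \<partial>density_measure f)"
   using S by (intro em measurable_sets[of snd \<gamma> borel, unfolded sets_g]) auto
  also have "\<dots> = (\<Sum>i<N. \<integral>\<^sup>+y. ennreal (w i y) * indicator S y \<partial>density_measure f)"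
   by (simp add: indicator_def space_g)
  also have "\<dots> = (\<integral>\<^sup>+y. (\<Sum>i<N. ennreal (w i y) * indicator S y) \<partial>density_measure f)"
   by (subst nn_integral_sum) auto
  also have "\<dots> = (\<integral>\<^sup>+y. indicator S y \<partial>density_measure f)"
  proof (rule nn_integral_cong_AE)
   show "AE y in density_measure f. (\<Sum>i<N. ennreal (w i y) * indicator S y) = indicator S y"
    using w(7)
   proof eventually_elim
    case (elim y)
    have "(\<Sum>i<N. ennreal (w i y) * indicator S y) = ennreal (\<Sum>i<N. w i y) * indicator S y"
     using w(2) by (simp add: sum_distrib_right[symmetric] sum_ennreal)
    then show ?case using elim by simp
   qed
  qed
  also have "\<dots> = emeasure (density_measure f) S" using S by (simp add: sets_density)
  finally show "emeasure (distr \<gamma> borel snd) S = emeasure (density_measure f) S" .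
 qed (simp add: sets_density)
 ultimately have "\<gamma> \<in> couplings (empirical_measure N X) (density_measure f)"
  by (simp add: couplings_def sets_g)
 moreover have "esssup \<gamma> (\<lambda>(x, y). ennreal (dist x y)) \<le> ennreal r"
 proof (rule esssup_I)
  show "(\<lambda>(x, y). ennreal (dist x y)) \<in> borel_measurable \<gamma>" by measurable
  have "{p \<in> space (borel \<Otimes>\<^sub>M borel). r < dist (fst p) (snd p)} \<in> sets (borel \<Otimes>\<^sub>M (borel :: 'a measure))"
   by measurable
  then have B: "{p. r < dist (fst p) (snd p)} \<in> sets (borel \<Otimes>\<^sub>M (borel :: 'a measure))"
   by (simp add: space_pair_measure)
  have "emeasure \<gamma> {p. r < dist (fst p) (snd p)} = 0"
  proof (subst em[OF B], rule sum.neutral, rule ballI)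
   fix i
   have z: "ennreal (w i y) * indicator {p. r < dist (fst p) (snd p)} (X i, y) = 0" for y
    using w(4)[of i y] by (cases "w i y = 0") auto
   show "(\<integral>\<^sup>+y. ennreal (w i y) * indicator {p. r < dist (fst p) (snd p)} (X i, y) \<partial>density_measure f) = 0"
    unfolding z by simp
  qed
  then show "AE p in \<gamma>. (case p of (x, y) \<Rightarrow> ennreal (dist x y)) \<le> ennreal r"
   using B by (intro AE_I[of _ _ "{p. r < dist (fst p) (snd p)}"]) (auto simp: sets_g intro!: ennreal_leI)
 qed
 ultimately show ?thesis
  unfolding W_inf_def by (rule INF_lower2)
qed

end

section \<open>Weak solutions of the continuity equation\<close>

text \<open>Over a partition that is fine for \<open>B\<close>, the sum of the squared increments is
  at most the largest increment times the total increment, hence arbitrarily small. This replaces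
  differentiation in time of functions that are only controlled by an integral.\<close>

lemma quadratic_increments_imp_le:
 fixes g B :: "real \<Rightarrow> real"
 assumes "0 \<le> T" and B: "continuous_on {0..T} B"
  and mono: "\<And>s t. 0 \<le> s \<Longrightarrow> s \<le> t \<Longrightarrow> t \<le> T \<Longrightarrow> B s \<le> B t"
  and step: "\<And>s t. 0 \<le> s \<Longrightarrow> s \<le> t \<Longrightarrow> t \<le> T \<Longrightarrow> g t - g s \<le> C * (B t - B s)\<^sup>2"
 shows "g T \<le> g 0"
proof (cases "T = 0")
 case False
 then have "T > 0" using assms(1) by simp
 have C: "g t - g s \<le> \<bar>C\<bar> * (B t - B s)\<^sup>2" if "0 \<le> s" "s \<le> t" "t \<le> T" for s t
  using step[OF that] mult_right_mono[OF abs_ge_self[of C], of "(B t - B s)\<^sup>2"] by simp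
 have small: "g T - g 0 \<le> \<epsilon> * (\<bar>C\<bar> * (B T - B 0))" if "\<epsilon> > 0" for \<epsilon>
 proof -
  have "uniformly_continuous_on {0..T} B" using B by (intro compact_uniformly_continuous) auto
  then obtain \<delta> where "\<delta> > 0" and d: "\<And>s t. s \<in> {0..T} \<Longrightarrow> t \<in> {0..T} \<Longrightarrow> dist t s < \<delta> \<Longrightarrow> dist (B t) (B s) < \<epsilon>"
   using \<open>\<epsilon> > 0\<close> by (auto simp: uniformly_continuous_on_def)
  obtain n :: nat where n: "T / \<delta> < real n" using reals_Archimedean2 by blast
  then have "n > 0" using \<open>T > 0\<close> \<open>\<delta> > 0\<close> by (cases n) (auto simp: divide_less_0_iff)
  define p where "p k = T * real k / real n" for k :: nat
  have p: "0 \<le> p k" "p k \<le> p (Suc k)" "p (Suc k) \<le> T" "p (Suc k) - p k < \<delta>" if "k < n" for k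
  proof -
   have "T * real (Suc k) \<le> T * real n" using that \<open>T > 0\<close> by (intro mult_left_mono) auto
   then show "0 \<le> p k" "p k \<le> p (Suc k)" "p (Suc k) \<le> T" "p (Suc k) - p k < \<delta>"
    using \<open>n > 0\<close> \<open>T > 0\<close> \<open>\<delta> > 0\<close> n by (auto simp: p_def divide_simps algebra_simps)
  qed
  have "g T - g 0 = (\<Sum>k<n. g (p (Suc k)) - g (p k))"
   using \<open>n > 0\<close> by (subst sum_lessThan_telescope[where f = "\<lambda>k. g (p k)"]) (simp add: p_def)
  also have "\<dots> \<le> (\<Sum>k<n. \<epsilon> * \<bar>C\<bar> * (B (p (Suc k)) - B (p k)))"
  proof (rule sum_mono)
   fix k assume "k \<in> {..<n}"
   then have k: "k < n" by simp
   define \<Delta> where "\<Delta> = B (p (Suc k)) - B (p k)"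
   have "\<Delta> \<ge> 0" using mono p[OF k] by (simp add: \<Delta>_def)
   moreover have "\<Delta> < \<epsilon>" using d[of "p k" "p (Suc k)"] p[OF k] by (auto simp: \<Delta>_def dist_real_def)
   ultimately have "\<bar>C\<bar> * \<Delta>\<^sup>2 \<le> \<bar>C\<bar> * (\<epsilon> * \<Delta>)"
    by (intro mult_left_mono) (auto simp: power2_eq_square intro!: mult_right_mono)
   then show "g (p (Suc k)) - g (p k) \<le> \<epsilon> * \<bar>C\<bar> * (B (p (Suc k)) - B (p k))"
    using C[of "p k" "p (Suc k)"] p[OF k] by (simp add: \<Delta>_def mult_ac)
  qed
  also have "\<dots> = \<epsilon> * \<bar>C\<bar> * (\<Sum>k<n. B (p (Suc k)) - B (p k))" by (simp add: sum_distrib_left)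
  also have "(\<Sum>k<n. B (p (Suc k)) - B (p k)) = B T - B 0"
   using \<open>n > 0\<close> by (subst sum_lessThan_telescope[where f = "\<lambda>k. B (p k)"]) (simp add: p_def)
  finally show ?thesis by (simp add: mult_ac)
 qed
 have "g T - g 0 \<le> 0"
 proof (rule ccontr)
  assume "\<not> g T - g 0 \<le> 0"
  then have pos: "g T - g 0 > 0" by simp
  define K where "K = \<bar>C\<bar> * (B T - B 0)"
  have "K \<ge> 0" using mono[of 0 T] assms(1) by (simp add: K_def)
  have "g T - g 0 \<le> (g T - g 0) / (2 * (K + 1)) * K"
   using small[of "(g T - g 0) / (2 * (K + 1))"] pos \<open>K \<ge> 0\<close> by (simp add: K_def)
  also have "\<dots> = (g T - g 0) * (K / (2 * (K + 1)))" by simp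
  also have "\<dots> \<le> (g T - g 0) * (1 / 2)"
   using pos \<open>K \<ge> 0\<close> by (intro mult_left_mono) (auto simp: divide_simps)
  finally show False using pos by simp
 qed
 then show ?thesis by simp
qed simp

lemma abs_integral_le_ball:
 fixes f :: "'a::euclidean_space \<Rightarrow> real"
 assumes "AE x in lborel. \<bar>f x\<bar> \<le> c * indicator (cball 0 R) x"
 shows "\<bar>LINT x|lborel. f x\<bar> \<le> c * measure lborel (cball 0 R :: 'a set)"
proof -
 have int: "integrable lborel (\<lambda>x::'a. c * indicator (cball 0 R) x)"
  using emeasure_bounded_finite[of "cball 0 R"] by (intro integrable_mult_right integrable_real_indicator) auto
 have "\<bar>LINT x|lborel. f x\<bar> \<le> (LINT x|lborel. \<bar>f x\<bar>)" by (rule integral_abs_bound)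
 also have "\<dots> \<le> (LINT x|lborel. c * indicator (cball (0::'a) R) x)"
  using assms by (intro integral_mono_AE' int) auto
 finally show ?thesis by simp
qed

definition continuity_solution ::
 "(real \<Rightarrow> 'a::euclidean_space \<Rightarrow> 'a) \<Rightarrow> real \<Rightarrow> real \<Rightarrow> (real \<Rightarrow> 'a \<Rightarrow> real) \<Rightarrow> bool" where
 "continuity_solution u T M \<rho> \<longleftrightarrow>
  (\<forall>t\<in>{0..T}. \<rho> t \<in> borel_measurable borel \<and> (AE x in lborel. 0 \<le> \<rho> t x \<and> \<rho> t x \<le> M)) \<and>
  (\<forall>\<psi> s t. test_function \<psi> \<longrightarrow> 0 \<le> s \<longrightarrow> s \<le> t \<longrightarrow> t \<le> T \<longrightarrow>
    set_integrable lborel {s..t} (\<lambda>q. LINT x|lborel. \<rho> q x * grad \<psi> x (u q x)) \<and>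
    (LINT x|lborel. \<psi> x * \<rho> t x) = (LINT x|lborel. \<psi> x * \<rho> s x) +
     (LINT q:{s..t}|lborel. (LINT x|lborel. \<rho> q x * grad \<psi> x (u q x))))"

lemma continuity_solution_density:
 assumes "continuity_solution u T M \<rho>" "t \<in> {0..T}"
 shows "\<rho> t \<in> borel_measurable borel" "AE x in lborel. 0 \<le> \<rho> t x \<and> \<rho> t x \<le> M"
 using assms unfolding continuity_solution_def by blast+

lemma continuity_solution_weak:
 assumes "continuity_solution u T M \<rho>" "test_function \<psi>" "0 \<le> s" "s \<le> t" "t \<le> T"
 shows "set_integrable lborel {s..t} (\<lambda>q. LINT x|lborel. \<rho> q x * grad \<psi> x (u q x))"
  "(LINT x|lborel. \<psi> x * \<rho> t x) = (LINT x|lborel. \<psi> x * \<rho> s x) +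
   (LINT q:{s..t}|lborel. (LINT x|lborel. \<rho> q x * grad \<psi> x (u q x)))"
 using assms(1)[unfolded continuity_solution_def, THEN conjunct2, rule_format, OF assms(2-5)] by blast+

text \<open>The velocity at the origin is controlled only by an integrable function of time. Its
  primitive \<open>B\<close> is the clock for all increments, and \<open>1 \<le> b\<close> makes
  this clock dominate elapsed time.\<close>

locale lipschitz_velocity =
 fixes u :: "real \<Rightarrow> 'a::euclidean_space \<Rightarrow> 'a" and T L :: real and b :: "real \<Rightarrow> real"
 assumes T_nonneg: "0 \<le> T" and L_nonneg: "0 \<le> L" and b_ge_1: "\<And>t. 1 \<le> b t"
  and b_integrable: "set_integrable lborel {0..T} b"
  and u_lipschitz: "AE t in lborel. t \<in> {0..T} \<longrightarrow>
   (\<forall>x y. norm (u t x - u t y) \<le> L * norm (x - y)) \<and> norm (u t 0) \<le> b t"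
begin

definition B :: "real \<Rightarrow> real" where "B t = integral {0..t} b"

lemma b_HK: "b integrable_on {0..T}"
 using set_borel_integral_eq_integral(1)[OF b_integrable] .

lemma b_integrable_sub: "0 \<le> s \<Longrightarrow> t \<le> T \<Longrightarrow> set_integrable lborel {s..t} b"
 by (rule set_integrable_subset[OF b_integrable]) auto

lemma B_diff: "0 \<le> s \<Longrightarrow> s \<le> t \<Longrightarrow> t \<le> T \<Longrightarrow> (LINT q:{s..t}|lborel. b q) = B t - B s"
proof -
 assume st: "0 \<le> s" "s \<le> t" "t \<le> T"
 have "integral {0..s} b + integral {s..t} b = integral {0..t} b"
  using st by (intro Henstock_Kurzweil_Integration.integral_combine integrable_subinterval_real[OF b_HK]) auto
 then show ?thesis
  using set_borel_integral_eq_integral(2)[OF b_integrable_sub[OF st(1,3)]] by (simp add: B_def)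
qed

lemma B_continuous: "continuous_on {0..T} B"
 unfolding B_def[abs_def] by (rule indefinite_integral_continuous_1[OF b_HK])

lemma B_diff_ge: "0 \<le> s \<Longrightarrow> s \<le> t \<Longrightarrow> t \<le> T \<Longrightarrow> t - s \<le> B t - B s"
proof -
 assume st: "0 \<le> s" "s \<le> t" "t \<le> T"
 have "(LINT q:{s..t}|lborel. 1) \<le> (LINT q:{s..t}|lborel. b q)"
  using st b_ge_1 by (intro set_integral_mono b_integrable_sub)
   (auto simp: set_integrable_def)
 then show ?thesis unfolding B_diff[OF st] using st by (simp add: set_lebesgue_integral_def)
qed

lemma B_mono: "0 \<le> s \<Longrightarrow> s \<le> t \<Longrightarrow> t \<le> T \<Longrightarrow> B s \<le> B t"
 using B_diff_ge[of s t] by simp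

text \<open>Time regularity of the tested density, linear in the increment of \<open>B\<close>. In
  \<open>psi_step\<close> it pays for replacing the density at an intermediate time by the one at
  the beginning of the step.\<close>

lemma weak_increment_le:
 assumes sol: "continuity_solution u T M \<rho>" and "0 \<le> M" and chi: "test_function \<xi>"
  and supp: "\<And>x. R < norm x \<Longrightarrow> \<xi> x = 0" and "0 \<le> R"
  and G: "\<And>x v. norm x \<le> R \<Longrightarrow> \<bar>grad \<xi> x v\<bar> \<le> G * norm v" and "0 \<le> G"
  and st: "0 \<le> s" "s \<le> t" "t \<le> T"
 shows "\<bar>(LINT x|lborel. \<xi> x * \<rho> t x) - (LINT x|lborel. \<xi> x * \<rho> s x)\<bar> \<le>
  M * G * (1 + L * R) * measure lborel (cball 0 R :: 'a set) * (B t - B s)"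
proof -
 let ?V = "measure lborel (cball 0 R :: 'a set)"
 let ?h = "\<lambda>q. LINT x|lborel. \<rho> q x * grad \<xi> x (u q x)"
 let ?c = "M * G * (1 + L * R) * ?V"
 have h: "set_integrable lborel {s..t} ?h"
  "(LINT x|lborel. \<xi> x * \<rho> t x) - (LINT x|lborel. \<xi> x * \<rho> s x) = (LINT q:{s..t}|lborel. ?h q)"
  using continuity_solution_weak[OF sol chi st] by auto
 have bound: "AE q\<in>{s..t} in lborel. \<bar>?h q\<bar> \<le> ?c * b q"
  using u_lipschitz
 proof eventually_elim
  case (elim q)
  show ?case
  proof
   assume q: "q \<in> {s..t}"
   then have qT: "q \<in> {0..T}" using st by auto
   have u: "norm (u q x) \<le> (1 + L * R) * b q" if "norm x \<le> R" for x
   proof -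
    have "norm (u q x - u q 0) \<le> L * norm (x - 0)" "norm (u q 0) \<le> b q" using elim qT by blast+
    then have "norm (u q x) \<le> b q + L * norm x" using norm_triangle_sub[of "u q x" "u q 0"] by simp
    also have "\<dots> \<le> b q + L * R * b q"
    proof -
     have "L * norm x \<le> L * R" using that L_nonneg by (rule mult_left_mono)
     also have "\<dots> \<le> L * R * b q" using mult_left_mono[OF b_ge_1[of q], of "L * R"] L_nonneg \<open>0 \<le> R\<close> by simp
     finally show ?thesis by simp
    qed
    finally show ?thesis by (simp add: distrib_right)
   qed
   have rho: "AE x in lborel. 0 \<le> \<rho> q x \<and> \<rho> q x \<le> M" using continuity_solution_density(2)[OF sol qT] .
   have "\<bar>?h q\<bar> \<le> M * (G * ((1 + L * R) * b q)) * ?V"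
   proof (rule abs_integral_le_ball)
    show "AE x in lborel. \<bar>\<rho> q x * grad \<xi> x (u q x)\<bar> \<le>
     M * (G * ((1 + L * R) * b q)) * indicator (cball 0 R) x"
     using rho
    proof eventually_elim
     case (elim x)
     show ?case
     proof (cases "norm x \<le> R")
      case True
      have "\<bar>grad \<xi> x (u q x)\<bar> \<le> G * ((1 + L * R) * b q)"
       using order.trans[OF G[OF True] mult_left_mono[OF u[OF True] \<open>0 \<le> G\<close>]] .
      then show ?thesis using True elim \<open>0 \<le> M\<close> unfolding abs_mult by (auto intro!: mult_mono)
     next
      case False
      then show ?thesis using frechet_derivative_outside[of R \<xi> x, OF supp] by simp
     qed
    qed
   qed
   then show "\<bar>?h q\<bar> \<le> ?c * b q" by (simp add: mult_ac)
  qed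
 qed
 have cb: "set_integrable lborel {s..t} (\<lambda>q. ?c * b q)"
  using b_integrable_sub[OF st(1,3)] by simp
 have "\<bar>LINT q:{s..t}|lborel. ?h q\<bar> \<le> (LINT q:{s..t}|lborel. \<bar>?h q\<bar>)"
  using set_integral_norm_bound[OF h(1)] by simp
 also have "\<dots> \<le> (LINT q:{s..t}|lborel. ?c * b q)"
  using bound h(1) cb by (intro set_integral_mono_AE set_integrable_abs) auto
 also have "\<dots> = ?c * (B t - B s)" using B_diff[OF st] by simp
 finally show ?thesis unfolding h(2) .
qed

end

lemma bump_constants:
 assumes "\<kappa> > 1"
 obtains G where "G \<ge> 1" "\<And>a::'a::euclidean_space. \<bar>bump' \<kappa> a\<bar> \<le> G"
  "\<And>a::'a. \<bar>bump' \<kappa> a\<bar> * norm a \<le> G"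
  "\<And>(a::'a) w. \<bar>grad (bump' \<kappa>) a w\<bar> \<le> G * norm w"
  "\<And>(a::'a) a'. \<bar>bump \<kappa> a' - bump \<kappa> a + bump' \<kappa> a * (a \<bullet> (a' - a))\<bar> \<le> G * (norm (a' - a))\<^sup>2"
  "\<And>(a::'a) a'. \<bar>bump \<kappa> a' - bump \<kappa> a\<bar> \<le> G * norm (a' - a)"
  "\<And>s. \<bar>smooth_step' s\<bar> \<le> G"
  "\<And>s w. \<bar>grad smooth_step' s w\<bar> \<le> G * \<bar>w\<bar>"
  "\<And>s s'. \<bar>smooth_step s' - smooth_step s - smooth_step' s * (s' - s)\<bar> \<le> G * (s' - s)\<^sup>2"
proof -
 let ?b = "bump \<kappa> :: 'a \<Rightarrow> real" and ?b' = "bump' \<kappa> :: 'a \<Rightarrow> real"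
 obtain G1 where G1: "G1 > 0" "\<And>x. \<bar>?b' x\<bar> \<le> G1"
  using test_function_bounded[OF test_function_bump'[OF assms]] by blast
 obtain G2 where G2: "G2 > 0" "\<And>x v. \<bar>frechet_derivative ?b' (at x) v\<bar> \<le> G2 * norm v"
  using test_function_gradient_bounded[OF test_function_bump'[OF assms]] by blast
 obtain G3 where G3: "G3 > 0" "\<And>x y. \<bar>?b y - ?b x - frechet_derivative ?b (at x) (y - x)\<bar> \<le> G3 * (dist x y)\<^sup>2"
  using test_function_taylor[OF test_function_bump[OF assms]] by blast
 obtain G4 where G4: "G4 > 0" "\<And>x y. \<bar>?b x - ?b y\<bar> \<le> G4 * dist x y"
  using test_function_lipschitz[OF test_function_bump[OF assms]] by metis
 obtain G5 where G5: "G5 > 0" "\<And>x y. \<bar>smooth_step' x - smooth_step' y\<bar> \<le> G5 * dist x y"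
  "\<And>x. \<bar>smooth_step' x\<bar> \<le> G5" "\<And>x v. \<bar>grad smooth_step' x v\<bar> \<le> G5 * norm v"
  using test_function_lipschitz[OF test_function_smooth_step'] by blast
 define G where "G = 1 + G1 + \<kappa> * G1 + G2 + G3 + G4 + G5"
 have "0 \<le> \<kappa> * G1" using assms G1 by simp
 then have le: "1 \<le> G" "G1 \<le> G" "\<kappa> * G1 \<le> G" "G2 \<le> G" "G3 \<le> G" "G4 \<le> G" "G5 \<le> G"
  using G1(1) G2(1) G3(1) G4(1) G5(1) unfolding G_def by linarith+
 have d: "frechet_derivative ?b (at a) = (\<lambda>w. - ?b' a * (a \<bullet> w))" for a
  using frechet_derivative_at[OF bump_derivative[OF assms], of a] by simp
 show ?thesis
 proof (rule that)
  show "1 \<le> G" by fact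
  show "\<bar>bump' \<kappa> a\<bar> \<le> G" for a :: 'a using G1(2)[of a] le by linarith
  show "\<bar>bump' \<kappa> a\<bar> * norm a \<le> G" for a :: 'a
  proof (cases "norm a \<le> \<kappa>")
   case True
   have "\<bar>bump' \<kappa> a\<bar> * norm a \<le> G1 * \<kappa>" using G1 True by (intro mult_mono) auto
   then show ?thesis using le(3) by (simp add: mult.commute)
  next
   case False then show ?thesis using bump'_eq_0'[OF assms, of a] le by simp
  qed
  show "\<bar>grad (bump' \<kappa>) a w\<bar> \<le> G * norm w" for a w :: 'a
   using G2(2)[of a w] mult_right_mono[OF le(4), of "norm w"] by simp
  show "\<bar>bump \<kappa> a' - bump \<kappa> a + bump' \<kappa> a * (a \<bullet> (a' - a))\<bar> \<le> G * (norm (a' - a))\<^sup>2" for a a' :: 'a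
   using G3(2)[of a' a] mult_right_mono[OF le(5), of "(norm (a' - a))\<^sup>2"]
   by (simp add: d dist_norm norm_minus_commute)
  show "\<bar>bump \<kappa> a' - bump \<kappa> a\<bar> \<le> G * norm (a' - a)" for a a' :: 'a
   using G4(2)[of a' a] mult_right_mono[OF le(6), of "norm (a' - a)"] by (simp add: dist_norm)
  show "\<bar>smooth_step' s\<bar> \<le> G" for s using G5(3)[of s] le by linarith
  show "\<bar>grad smooth_step' s w\<bar> \<le> G * \<bar>w\<bar>" for s w
   using G5(4)[of s w] mult_right_mono[OF le(7), of "\<bar>w\<bar>"] by simp
  show "\<bar>smooth_step s' - smooth_step s - smooth_step' s * (s' - s)\<bar> \<le> G * (s' - s)\<^sup>2" for s s'
  proof -
   have "\<bar>smooth_step s' - smooth_step s - smooth_step' s * (s' - s)\<bar> \<le> G5 * (dist s s')\<^sup>2"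
   proof (rule taylor_lipschitz_derivative[where f' = "\<lambda>s. (*) (smooth_step' s)"])
    show "(smooth_step has_derivative (*) (smooth_step' x)) (at x)" for x
     using smooth_step_deriv by (simp add: has_field_derivative_def)
    show "\<bar>smooth_step' x * v - smooth_step' y * v\<bar> \<le> G5 * dist x y * norm v" for x y v
     using mult_right_mono[OF G5(2)[of x y], of "\<bar>v\<bar>"]
     by (simp add: left_diff_distrib[symmetric] abs_mult)
   qed (use G5(1) in simp)
   also have "\<dots> \<le> G * (s' - s)\<^sup>2"
    using mult_right_mono[OF le(7), of "(s' - s)\<^sup>2"] by (simp add: dist_real_def power2_commute)
   finally show ?thesis .
  qed
 qed
qed

section \<open>Velocity errors of particle configurations\<close>

text \<open>Balls of radius \<open>d / 2\<close> around the points contribute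
  \<open>2 powr D\<close>; enlarging the comparison radius by \<open>3 / 2\<close> contributes
  \<open>(3 / 2) powr D\<close>.\<close>

definition packing_const :: "real \<Rightarrow> real \<Rightarrow> real" where
 "packing_const D \<beta> = singular_const D \<beta> * 3 powr D / unit_ball_vol D"

text \<open>The balls of radius \<open>d / 2\<close> are disjoint, and on each of them the integrand
  is comparable to the summand because the center is at distance at least \<open>d\<close> from
  \<open>x\<close>. So the sum times the volume of one ball is at most a singular integral over
  \<open>ball x (3 / 2 * \<rho>)\<close>.\<close>

lemma packing_singular_sum:
 fixes X :: "'i \<Rightarrow> 'a::euclidean_space"
 assumes beta: "0 \<le> \<beta>" "\<beta> < real DIM('a)" and d: "0 < d" and fin: "finite F"
  and sep: "\<And>j k. j \<in> F \<Longrightarrow> k \<in> F \<Longrightarrow> j \<noteq> k \<Longrightarrow> d \<le> dist (X j) (X k)"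
  and x: "\<And>k. k \<in> F \<Longrightarrow> d \<le> norm (x - X k)" "\<And>k. k \<in> F \<Longrightarrow> norm (x - X k) < \<rho>" and rho: "0 < \<rho>"
 shows "(\<Sum>k\<in>F. norm (x - X k) powr - \<beta>) \<le> packing_const (real DIM('a)) \<beta> * \<rho> powr (real DIM('a) - \<beta>) / d powr real DIM('a)"
proof -
 let ?D = "real DIM('a)"
 define g where "g k = norm (x - X k) powr - \<beta>" for k
 define vol where "vol = unit_ball_vol ?D * (d / 2) ^ DIM('a)"
 have vol: "vol > 0" using d by (simp add: vol_def)
 have g0: "0 \<le> g k" for k by (simp add: g_def)
 have ballm: "(\<lambda>z. ennreal c * indicator (ball y s) z) \<in> borel_measurable lborel" for c s and y :: 'a
  by (intro borel_measurable_times_ennreal borel_measurable_indicator) auto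
 have pt: "(\<Sum>k\<in>F. ennreal (g k) * indicator (ball (X k) (d / 2)) z) \<le>
   ennreal ((3 / 2) powr \<beta>) * (ennreal (norm (x - z) powr - \<beta>) * indicator (ball x (3 / 2 * \<rho>)) z)" for z
 proof (cases "\<exists>k\<in>F. z \<in> ball (X k) (d / 2)")
  case True
  then obtain k where k: "k \<in> F" "dist (X k) z < d / 2" by auto
  have "z \<notin> ball (X j) (d / 2)" if "j \<in> F" "j \<noteq> k" for j
  proof
   assume "z \<in> ball (X j) (d / 2)"
   then have "dist (X j) (X k) < d / 2 + d / 2" using k dist_triangle_less_add[of "X j" z "d/2" "X k" "d/2"] by simp
   then show False using sep[OF that(1) k(1) that(2)] by simp
  qed
  then have "(\<Sum>j\<in>F. ennreal (g j) * indicator (ball (X j) (d / 2)) z) = (\<Sum>j\<in>F. if j = k then ennreal (g k) else 0)"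
   using k by (intro sum.cong) auto
  then have s: "(\<Sum>j\<in>F. ennreal (g j) * indicator (ball (X j) (d / 2)) z) = ennreal (g k)"
   using fin k by simp
  have zk: "norm (X k - z) < d / 2" using k by (simp add: dist_norm)
  have 1: "norm (x - z) \<le> 3 / 2 * norm (x - X k)"
   using norm_triangle_ineq[of "x - X k" "X k - z"] zk x(1)[OF k(1)] by simp
  have 2: "0 < norm (x - z)"
  proof -
   have "norm (x - X k) - norm (z - X k) \<le> norm (x - z)"
    using norm_triangle_ineq2[of "x - X k" "z - X k"] by simp
   moreover have "norm (z - X k) < d / 2" using zk by (simp add: norm_minus_commute)
   ultimately show ?thesis using x(1)[OF k(1)] d by linarith
  qed
  have "g k \<le> (2 / 3 * norm (x - z)) powr - \<beta>"
   unfolding g_def using 1 2 beta by (intro powr_mono2') auto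
  also have "\<dots> = (3 / 2) powr \<beta> * norm (x - z) powr - \<beta>"
   by (simp add: powr_mult powr_minus powr_divide field_simps)
  finally have "ennreal (g k) \<le> ennreal ((3 / 2) powr \<beta>) * ennreal (norm (x - z) powr - \<beta>)"
   by (simp add: ennreal_mult'[symmetric] ennreal_leI)
  moreover have "z \<in> ball x (3 / 2 * \<rho>)" using 1 x(2)[OF k(1)] by (simp add: dist_norm)
  ultimately show ?thesis unfolding s by simp
 next
  case False
  then have "(\<Sum>k\<in>F. ennreal (g k) * indicator (ball (X k) (d / 2)) z) = 0" by (intro sum.neutral) auto
  then show ?thesis by simp
 qed
 have "ennreal ((\<Sum>k\<in>F. g k) * vol) = (\<Sum>k\<in>F. ennreal (g k) * emeasure lborel (ball (X k) (d / 2)))"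
  using d g0 vol by (simp add: emeasure_ball vol_def[symmetric] sum_distrib_right ennreal_mult[symmetric] sum_ennreal)
 also have "\<dots> = (\<integral>\<^sup>+z. (\<Sum>k\<in>F. ennreal (g k) * indicator (ball (X k) (d / 2)) z) \<partial>lborel)"
  using ballm by (subst nn_integral_sum) (auto simp: nn_integral_cmult_indicator)
 also have "\<dots> \<le> (\<integral>\<^sup>+z. ennreal ((3 / 2) powr \<beta>) * (ennreal (norm (x - z) powr - \<beta>) * indicator (ball x (3 / 2 * \<rho>)) z) \<partial>lborel)"
  by (intro nn_integral_mono pt)
 also have "\<dots> = ennreal ((3 / 2) powr \<beta>) * (\<integral>\<^sup>+z. ennreal (norm (x - z) powr - \<beta>) * indicator (ball x (3 / 2 * \<rho>)) z \<partial>lborel)"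
  by (intro nn_integral_cmult borel_measurable_times_ennreal borel_measurable_indicator) auto
 also have "\<dots> \<le> ennreal ((3 / 2) powr \<beta>) * ennreal (singular_const ?D \<beta> * (3 / 2 * \<rho>) powr (?D - \<beta>))"
  using beta rho by (intro mult_left_mono nn_integral_singular) auto
 also have "\<dots> = ennreal ((3 / 2) powr \<beta> * (singular_const ?D \<beta> * (3 / 2 * \<rho>) powr (?D - \<beta>)))"
  by (simp add: ennreal_mult')
 finally have "(\<Sum>k\<in>F. g k) * vol \<le> (3 / 2) powr \<beta> * (singular_const ?D \<beta> * (3 / 2 * \<rho>) powr (?D - \<beta>))"
  using singular_const_pos[of \<beta> ?D] beta by (subst (asm) ennreal_le_iff) auto
 also have "\<dots> = singular_const ?D \<beta> * (3 / 2) powr ?D * \<rho> powr (?D - \<beta>)"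
  using rho powr_add[of "3 / 2 :: real" \<beta> "?D - \<beta>"] by (simp only: powr_mult) (simp add: mult_ac)
 finally have "(\<Sum>k\<in>F. g k) \<le> singular_const ?D \<beta> * (3 / 2) powr ?D * \<rho> powr (?D - \<beta>) / vol"
  using vol by (simp add: pos_le_divide_eq)
 also have "\<dots> = packing_const ?D \<beta> * \<rho> powr (?D - \<beta>) / d powr ?D"
  using d by (simp add: packing_const_def vol_def powr_divide power_divide powr_realpow)
 finally show ?thesis by (simp add: g_def)
qed

context kernel_density begin

abbreviation "\<mu> \<equiv> density_measure f"

lemma M_pos: "0 < M"
proof (rule ccontr)
 assume "\<not> 0 < M"
 from density_le have "AE x in lborel. ennreal (f x) = 0"
  by eventually_elim (use \<open>\<not> 0 < M\<close> in \<open>simp add: ennreal_neg\<close>)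
 then have "(\<integral>\<^sup>+x. ennreal (f x) \<partial>lborel) = (\<integral>\<^sup>+(x::'a). 0 \<partial>lborel)" by (rule nn_integral_cong_AE)
 then show False using density by (simp add: prob_density_def)
qed

text \<open>Coefficient of the balanced terms in \<open>particle_singular_sum\<close>: the density
  contributes 1 and the nearby packing \<open>packing_const\<close>, both times a power of the bound
  for the mass of a ball of radius \<open>2 * r\<close>, without its power of
  \<open>r\<close>.\<close>

definition Cp :: real where
 "Cp = (1 + packing_const (real DIM('a)) \<beta>) * (M * unit_ball_vol (real DIM('a)) * 2 ^ DIM('a)) powr (1 - \<beta> / real DIM('a))"

lemma packing_nonneg: "0 \<le> packing_const (real DIM('a)) \<beta>"
 using singular_const_pos[of \<beta> "real DIM('a)"] beta by (simp add: packing_const_def)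

lemma Cp_nonneg: "0 \<le> Cp"
 using packing_nonneg by (simp add: Cp_def)

text \<open>Hauray's estimate: transported mass far from \<open>X i\<close> is compared with the density; the remaining
 mass is at most \<open>m\<close>, so that splitting at the distance \<open>\<rho>\<close> where \<open>m\<close> is exhausted by a
 packing with minimal distance \<open>d\<close> balances the two remaining contributions.\<close>

lemma particle_singular_sum:
 assumes N: "N \<ge> 1" and near: "hall_near N X f r" and r: "0 < r" and d: "0 < d" and i: "i < N"
  and sep: "\<And>j k. j < N \<Longrightarrow> k < N \<Longrightarrow> j \<noteq> k \<Longrightarrow> d \<le> dist (X j) (X k)"
 shows "(\<Sum>k\<in>{..<N} - {i}. norm (X i - X k) powr - \<beta>) / real N \<le>
  2 powr \<beta> * A + Cp * (r powr (real DIM('a) - \<beta>) / (d powr \<beta> * real N powr (\<beta> / real DIM('a))))"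
proof -
 let ?D = "real DIM('a)"
 interpret mu: prob_space \<mu> by (rule prob_space_density)
 obtain w :: "nat \<Rightarrow> 'a \<Rightarrow> real" where
  w: "\<And>i. w i \<in> borel_measurable borel" "\<And>i y. 0 \<le> w i y" "\<And>y. (\<Sum>i<N. w i y) \<le> 1"
  "\<And>i y. w i y \<noteq> 0 \<Longrightarrow> dist (X i) y \<le> r"
  "\<And>i. i < N \<Longrightarrow> integrable \<mu> (w i)"
  "\<And>i. i < N \<Longrightarrow> (LINT y|\<mu>. w i y) = 1 / real N"
  "AE y in \<mu>. (\<Sum>i<N. w i y) = 1"
  by (rule hall_near_plan[OF N near]) (rule that)
 define g where "g k = norm (X i - X k) powr - \<beta>" for k
 have g0: "0 \<le> g k" for k by (simp add: g_def)
 define m where "m = M * unit_ball_vol ?D * (2 * r) ^ DIM('a)"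
 have m: "0 < m" using M_pos r by (simp add: m_def)
 \<comment> \<open>The scale of a ball filled by \<open>real N * m\<close> points of spacing
   \<open>d\<close>, where \<open>m\<close> is the available mass and each particle carries
   \<open>1 / N\<close>.\<close>
 define \<rho> where "\<rho> = (real N * m) powr (1 / ?D) * d"
 have rho: "0 < \<rho>" using m d N by (simp add: \<rho>_def)
 define F where "F = {k\<in>{..<N} - {i}. norm (X i - X k) < \<rho>}"
 have Fsub: "F \<subseteq> {..<N} - {i}" by (auto simp: F_def)
 have wsub: "(\<Sum>k\<in>{..<N} - {i}. w k y) \<le> 1" for y
  using order.trans[OF sum_mono2 w(3)[of y], of "{..<N} - {i}"] w(2) by auto
 \<comment> \<open>At distance at least \<open>2 * r\<close> from \<open>X i\<close>, a particle to
   which \<open>y\<close> is assigned is at least half as far away as \<open>y\<close>. Closer in,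
   particles beyond \<rho> contribute at most \<open>\<rho> powr - \<beta>\<close>, and those in
   \<open>F\<close> are left to the packing estimate.\<close>
 have pt: "(\<Sum>k\<in>{..<N} - {i}. g k * w k y) \<le>
  2 powr \<beta> * norm (X i - y) powr - \<beta> + \<rho> powr - \<beta> * indicator (ball (X i) (2 * r)) y + (\<Sum>k\<in>F. g k * w k y)" for y
 proof (cases "2 * r \<le> norm (X i - y)")
  case True
  have "(\<Sum>k\<in>{..<N} - {i}. g k * w k y) \<le> (\<Sum>k\<in>{..<N} - {i}. (2 powr \<beta> * norm (X i - y) powr - \<beta>) * w k y)"
  proof (rule sum_mono)
   fix k
   show "g k * w k y \<le> (2 powr \<beta> * norm (X i - y) powr - \<beta>) * w k y"
   proof (cases "w k y = 0")
    case False
    then have "norm (X k - y) \<le> r" using w(4) by (simp add: dist_norm)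
    then have h: "norm (X i - y) / 2 \<le> norm (X i - X k)"
     using True norm_triangle_ineq[of "X i - X k" "X k - y"] by simp
    have "g k \<le> (norm (X i - y) / 2) powr - \<beta>"
     unfolding g_def using h True r beta by (intro powr_mono2') auto
    also have "\<dots> = 2 powr \<beta> * norm (X i - y) powr - \<beta>" by (simp add: powr_divide powr_minus field_simps)
    finally show ?thesis using w(2) by (intro mult_right_mono)
   qed simp
  qed
  also have "\<dots> = (2 powr \<beta> * norm (X i - y) powr - \<beta>) * (\<Sum>k\<in>{..<N} - {i}. w k y)" by (simp add: sum_distrib_left)
  also have "\<dots> \<le> 2 powr \<beta> * norm (X i - y) powr - \<beta>" using wsub[of y] by (intro mult_left_le) auto
  finally have "(\<Sum>k\<in>{..<N} - {i}. g k * w k y) \<le> 2 powr \<beta> * norm (X i - y) powr - \<beta>" .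
  moreover have "0 \<le> (\<Sum>k\<in>F. g k * w k y)" using g0 w(2) by (intro sum_nonneg) auto
  ultimately show ?thesis using True by (simp add: dist_norm)
 next
  case False
  have "(\<Sum>k\<in>{..<N} - {i}. g k * w k y) = (\<Sum>k\<in>F. g k * w k y) + (\<Sum>k\<in>{..<N} - {i} - F. g k * w k y)"
   using sum.subset_diff[OF Fsub, of "\<lambda>k. g k * w k y"] by simp
  moreover have "(\<Sum>k\<in>{..<N} - {i} - F. g k * w k y) \<le> (\<Sum>k\<in>{..<N} - {i} - F. \<rho> powr - \<beta> * w k y)"
  proof (intro sum_mono mult_right_mono w(2))
   fix k assume "k \<in> {..<N} - {i} - F"
   then show "g k \<le> \<rho> powr - \<beta>" unfolding g_def F_def using rho beta by (intro powr_mono2') auto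
  qed
  moreover have "(\<Sum>k\<in>{..<N} - {i} - F. \<rho> powr - \<beta> * w k y) \<le> \<rho> powr - \<beta>"
  proof -
   have "(\<Sum>k\<in>{..<N} - {i} - F. w k y) \<le> (\<Sum>k\<in>{..<N} - {i}. w k y)" using w(2) by (intro sum_mono2) auto
   then have "(\<Sum>k\<in>{..<N} - {i} - F. w k y) \<le> 1" using wsub[of y] by linarith
   then show ?thesis unfolding sum_distrib_left[symmetric] by (intro mult_left_le) auto
  qed
  moreover have "0 \<le> 2 powr \<beta> * norm (X i - y) powr - \<beta>" by simp
  moreover have "\<rho> powr - \<beta> * indicator (ball (X i) (2 * r)) y = \<rho> powr - \<beta>" using False by (simp add: dist_norm)
  ultimately show ?thesis by linarith
 qed
 have ball_int: "integrable \<mu> (indicator (ball (X i) (2 * r)) :: 'a \<Rightarrow> real)"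
  using mu.emeasure_finite by (intro integrable_real_indicator) (auto simp: sets_density less_top[symmetric])
 have "(\<Sum>k\<in>{..<N} - {i}. norm (X i - X k) powr - \<beta>) / real N = (LINT y|\<mu>. (\<Sum>k\<in>{..<N} - {i}. g k * w k y))"
  using w(5,6) by (subst Bochner_Integration.integral_sum) (auto simp: g_def sum_divide_distrib)
 also have "\<dots> \<le> (LINT y|\<mu>. 2 powr \<beta> * norm (X i - y) powr - \<beta> + \<rho> powr - \<beta> * indicator (ball (X i) (2 * r)) y + (\<Sum>k\<in>F. g k * w k y))"
  using w(5) Fsub singular_int ball_int
  by (intro integral_mono pt Bochner_Integration.integrable_sum Bochner_Integration.integrable_add integrable_mult_right) auto
 also have "\<dots> = 2 powr \<beta> * (LINT y|\<mu>. norm (X i - y) powr - \<beta>) + \<rho> powr - \<beta> * measure \<mu> (ball (X i) (2 * r)) + (\<Sum>k\<in>F. g k * (LINT y|\<mu>. w k y))"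
 proof -
  have 1: "integrable \<mu> (\<lambda>y. 2 powr \<beta> * norm (X i - y) powr - \<beta>)" using singular_int by simp
  have 2: "integrable \<mu> (\<lambda>y. \<rho> powr - \<beta> * indicator (ball (X i) (2 * r)) y)" using ball_int by (rule integrable_mult_right)
  have 3: "integrable \<mu> (\<lambda>y. \<Sum>k\<in>F. g k * w k y)"
   using w(5) Fsub by (intro Bochner_Integration.integrable_sum integrable_mult_right) auto
  have 4: "(LINT y|\<mu>. (\<Sum>k\<in>F. g k * w k y)) = (\<Sum>k\<in>F. g k * (LINT y|\<mu>. w k y))"
  proof (subst Bochner_Integration.integral_sum)
   show "\<And>k. k \<in> F \<Longrightarrow> integrable \<mu> (\<lambda>y. g k * w k y)" using w(5) Fsub by (intro integrable_mult_right) auto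
  qed simp
  have 5: "(LINT y|\<mu>. \<rho> powr - \<beta> * indicator (ball (X i) (2 * r)) y) = \<rho> powr - \<beta> * measure \<mu> (ball (X i) (2 * r))"
   by (subst integral_mult_right_zero) (simp add: sets_density)
  show ?thesis
   using 1 2 3 by (simp only: Bochner_Integration.integral_add[OF Bochner_Integration.integrable_add[OF 1 2] 3]
    Bochner_Integration.integral_add[OF 1 2] 4 5) simp
 qed
 also have "\<dots> \<le> 2 powr \<beta> * A + \<rho> powr - \<beta> * m + packing_const ?D \<beta> * \<rho> powr (?D - \<beta>) / d powr ?D / real N"
 proof (intro add_mono mult_left_mono singular_int_le)
  show "measure \<mu> (ball (X i) (2 * r)) \<le> m" using measure_ball_le(1)[of "2 * r" "X i"] r by (simp add: m_def)
  have "(\<Sum>k\<in>F. g k * (LINT y|\<mu>. w k y)) = (\<Sum>k\<in>F. g k) / real N"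
   using w(6) Fsub by (auto simp: sum_divide_distrib intro!: sum.cong)
  also have "\<dots> \<le> packing_const ?D \<beta> * \<rho> powr (?D - \<beta>) / d powr ?D / real N"
   unfolding g_def using i Fsub rho d
   by (intro divide_right_mono packing_singular_sum beta finite_subset[OF Fsub])
    (auto simp: F_def dist_norm[symmetric] intro!: sep)
  finally show "(\<Sum>k\<in>F. g k * (LINT y|\<mu>. w k y)) \<le> packing_const ?D \<beta> * \<rho> powr (?D - \<beta>) / d powr ?D / real N" .
 qed auto
 also have "\<dots> = 2 powr \<beta> * A + Cp * (r powr (?D - \<beta>) / (d powr \<beta> * real N powr (\<beta> / ?D)))"
 proof -
  have D: "?D > 0" by simp
  have m': "m powr (1 - \<beta> / ?D) = (M * unit_ball_vol ?D * 2 ^ DIM('a)) powr (1 - \<beta> / ?D) * r powr (?D - \<beta>)"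
  proof -
   have "m = (M * unit_ball_vol ?D * 2 ^ DIM('a)) * r powr ?D" using r by (simp add: m_def powr_realpow power_mult_distrib)
   moreover have "?D * (1 - \<beta> / ?D) = ?D - \<beta>" using D by (simp add: right_diff_distrib)
   ultimately show ?thesis by (simp only: powr_mult powr_powr)
  qed
  \<comment> \<open>With this \<rho> the remaining density term and the packing term have the same
    value up to \<open>packing_const\<close>, as \<open>e1\<close> and \<open>e2\<close>
    show.\<close>
  have e1: "\<rho> powr - \<beta> * m = m powr (1 - \<beta> / ?D) / (d powr \<beta> * real N powr (\<beta> / ?D))"
  proof -
   have "\<rho> powr - \<beta> = real N powr (- \<beta> / ?D) * m powr (- \<beta> / ?D) * d powr - \<beta>"
    unfolding \<rho>_def by (simp add: powr_mult powr_powr)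
   moreover have "m powr (- \<beta> / ?D) * m = m powr (1 - \<beta> / ?D)"
    using m powr_add[of m "- \<beta> / ?D" 1] by simp
   ultimately have "\<rho> powr - \<beta> * m = real N powr (- \<beta> / ?D) * m powr (1 - \<beta> / ?D) * d powr - \<beta>"
    by (simp add: mult_ac)
   then show ?thesis by (simp add: powr_minus divide_inverse mult_ac)
  qed
  have e2: "\<rho> powr (?D - \<beta>) / d powr ?D / real N = m powr (1 - \<beta> / ?D) / (d powr \<beta> * real N powr (\<beta> / ?D))"
  proof -
   have x: "1 / ?D * (?D - \<beta>) = 1 - \<beta> / ?D" using D by (simp add: field_simps)
   have "\<rho> powr (?D - \<beta>) = real N powr (1 - \<beta> / ?D) * m powr (1 - \<beta> / ?D) * d powr (?D - \<beta>)"
    unfolding \<rho>_def powr_mult powr_powr x by simp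
   moreover have "real N powr (1 - \<beta> / ?D) = real N / real N powr (\<beta> / ?D)"
    using N by (simp add: powr_diff)
   moreover have "d powr (?D - \<beta>) = d powr ?D / d powr \<beta>" by (simp add: powr_diff)
   ultimately show ?thesis using d N by simp
  qed
  have "packing_const ?D \<beta> * \<rho> powr (?D - \<beta>) / d powr ?D / real N = packing_const ?D \<beta> * (\<rho> powr (?D - \<beta>) / d powr ?D / real N)" by simp
  then show ?thesis unfolding e1 e2 m' Cp_def by (simp add: algebra_simps add_divide_distrib)
 qed
 finally show ?thesis .
qed

text \<open>The plan splits the density into portions of mass \<open>1 / N\<close>, and
  \<open>K_diff\<close> compares each portion with its particle at distance at most
  \<open>r\<close>. The portion \<open>w\<close> of the nearest particle is kept explicit, since
  \<open>x\<close> may be arbitrarily close to that particle. For the others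
  \<open>norm (x - X k)\<close> is at least half of \<open>norm (X k0 - X k)\<close>, which
  transfers the sum at a particle to \<open>x\<close>.\<close>

lemma kernel_conv_error:
 assumes N: "N \<ge> 1" and near: "hall_near N X f r" and r: "0 \<le> r" and k0: "k0 < N"
  and nearest: "\<And>k. k < N \<Longrightarrow> norm (x - X k0) \<le> norm (x - X k)"
  and distinct: "\<And>k. k < N \<Longrightarrow> k \<noteq> k0 \<Longrightarrow> X k \<noteq> X k0"
  and S: "(\<Sum>k\<in>{..<N} - {k0}. norm (X k0 - X k) powr - \<beta>) / real N \<le> S"
 obtains w where "w \<in> borel_measurable borel" "\<And>y. 0 \<le> w y" "\<And>y. w y \<le> 1"
  "\<And>y. w y \<noteq> 0 \<Longrightarrow> norm (X k0 - y) \<le> r" "integrable \<mu> w" "(LINT y|\<mu>. w y) = 1 / real N"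
  "integrable \<mu> (\<lambda>y. w y *\<^sub>R K (x - y))"
  "norm (kernel_conv K \<mu> x - (1 / real N) *\<^sub>R (\<Sum>k\<in>{..<N} - {k0}. K (x - X k)) - (LINT y|\<mu>. w y *\<^sub>R K (x - y)))
   \<le> C' * r * (A + 2 powr \<beta> * S)"
proof -
 obtain w :: "nat \<Rightarrow> 'a \<Rightarrow> real" where
  w: "\<And>i. w i \<in> borel_measurable borel" "\<And>i y. 0 \<le> w i y" "\<And>y. (\<Sum>i<N. w i y) \<le> 1"
  "\<And>i y. w i y \<noteq> 0 \<Longrightarrow> dist (X i) y \<le> r"
  "\<And>i. i < N \<Longrightarrow> integrable \<mu> (w i)"
  "\<And>i. i < N \<Longrightarrow> (LINT y|\<mu>. w i y) = 1 / real N"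
  "AE y in \<mu>. (\<Sum>i<N. w i y) = 1"
  by (rule hall_near_plan[OF N near]) (rule that)
 note [measurable] = w(1)
 let ?I = "{..<N} - {k0}"
 have w1: "w k y \<le> 1" if "k < N" for k y
 proof -
  have "w k y \<le> (\<Sum>i<N. w i y)" using that w(2) by (intro member_le_sum) auto
  then show ?thesis using w(3)[of y] by linarith
 qed
 have wK: "integrable \<mu> (\<lambda>y. w k y *\<^sub>R K (x - y))" if "k < N" for k
 proof (rule Bochner_Integration.integrable_bound[OF K_integrable[of x]])
  show "AE y in \<mu>. norm (w k y *\<^sub>R K (x - y)) \<le> norm (K (x - y))"
   using w(2) w1[OF that] by (auto intro!: always_eventually mult_left_le_one_le)
 qed measurable
 have ws: "integrable \<mu> (\<lambda>y. w k y * norm (x - y) powr - \<beta>)" if "k < N" for k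
 proof (rule Bochner_Integration.integrable_bound[OF singular_int[of x]])
  show "AE y in \<mu>. norm (w k y * norm (x - y) powr - \<beta>) \<le> norm (norm (x - y) powr - \<beta>)"
   using w(2) w1[OF that] by (auto intro!: always_eventually mult_left_le_one_le)
 qed measurable
 have "kernel_conv K \<mu> x = (LINT y|\<mu>. (\<Sum>k<N. w k y *\<^sub>R K (x - y)))"
  unfolding kernel_conv_def
 proof (rule integral_cong_AE)
  show "AE y in \<mu>. K (x - y) = (\<Sum>k<N. w k y *\<^sub>R K (x - y))"
   using w(7) by eventually_elim (simp add: scaleR_sum_left[symmetric])
 qed measurable
 also have "\<dots> = (\<Sum>k<N. (LINT y|\<mu>. w k y *\<^sub>R K (x - y)))"
  using wK by (intro Bochner_Integration.integral_sum) auto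
 also have "\<dots> = (LINT y|\<mu>. w k0 y *\<^sub>R K (x - y)) + (\<Sum>k\<in>?I. (LINT y|\<mu>. w k y *\<^sub>R K (x - y)))"
  using k0 by (subst sum.remove[of _ k0]) auto
 finally have V: "kernel_conv K \<mu> x = (LINT y|\<mu>. w k0 y *\<^sub>R K (x - y)) + (\<Sum>k\<in>?I. (LINT y|\<mu>. w k y *\<^sub>R K (x - y)))" .
 have "(1 / real N) *\<^sub>R (\<Sum>k\<in>?I. K (x - X k)) = (\<Sum>k\<in>?I. LINT y|\<mu>. w k y *\<^sub>R K (x - X k))"
  using w(5,6) by (auto simp: scaleR_sum_right intro!: sum.cong)
 then have "kernel_conv K \<mu> x - (1 / real N) *\<^sub>R (\<Sum>k\<in>?I. K (x - X k)) - (LINT y|\<mu>. w k0 y *\<^sub>R K (x - y)) =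
   (\<Sum>k\<in>?I. LINT y|\<mu>. w k y *\<^sub>R (K (x - y) - K (x - X k)))"
  using wK w(5) by (simp add: V sum_subtractf[symmetric] scaleR_diff_right)
 also have "norm \<dots> \<le> (\<Sum>k\<in>?I. C' * r * ((LINT y|\<mu>. w k y * norm (x - y) powr - \<beta>) + norm (x - X k) powr - \<beta> / real N))"
 proof (rule order.trans[OF norm_sum sum_mono])
  fix k assume k: "k \<in> ?I"
  have "X k \<noteq> x"
   using nearest[of k] distinct[of k] k by auto
  have "norm (LINT y|\<mu>. w k y *\<^sub>R (K (x - y) - K (x - X k))) \<le> (LINT y|\<mu>. norm (w k y *\<^sub>R (K (x - y) - K (x - X k))))"
   by (rule integral_norm_bound)
  also have "\<dots> \<le> (LINT y|\<mu>. C' * r * (w k y * norm (x - y) powr - \<beta> + w k y * norm (x - X k) powr - \<beta>))"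
  proof (rule integral_mono_AE)
   have "integrable \<mu> (\<lambda>y. w k y *\<^sub>R K (x - y) - w k y *\<^sub>R K (x - X k))"
    using wK[of k] w(5)[of k] k by (intro Bochner_Integration.integrable_diff) auto
   then show "integrable \<mu> (\<lambda>y. norm (w k y *\<^sub>R (K (x - y) - K (x - X k))))" by (simp add: scaleR_diff_right)
   show "integrable \<mu> (\<lambda>y. C' * r * (w k y * norm (x - y) powr - \<beta> + w k y * norm (x - X k) powr - \<beta>))"
    using ws[of k] w(5)[of k] k by auto
   show "AE y in \<mu>. norm (w k y *\<^sub>R (K (x - y) - K (x - X k))) \<le>
     C' * r * (w k y * norm (x - y) powr - \<beta> + w k y * norm (x - X k) powr - \<beta>)"
    using AE_density_neq[of x]
   proof eventually_elim
    case (elim y)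
    show ?case
    proof (cases "w k y = 0")
     case False
     have "norm (K (x - y) - K (x - X k)) \<le> C' * norm ((x - y) - (x - X k)) * (norm (x - y) powr - \<beta> + norm (x - X k) powr - \<beta>)"
      using elim \<open>X k \<noteq> x\<close> by (intro K_diff) auto
     also have "\<dots> \<le> C' * r * (norm (x - y) powr - \<beta> + norm (x - X k) powr - \<beta>)"
      using w(4)[OF False] C'_pos by (intro mult_right_mono mult_left_mono) (auto simp: dist_norm)
     finally have "w k y * norm (K (x - y) - K (x - X k)) \<le> w k y * (C' * r * (norm (x - y) powr - \<beta> + norm (x - X k) powr - \<beta>))"
      using w(2) by (rule mult_left_mono)
     also have "\<dots> = C' * r * (w k y * norm (x - y) powr - \<beta> + w k y * norm (x - X k) powr - \<beta>)"
      by (simp add: algebra_simps)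
     finally show ?thesis using w(2)[of k y] by simp
    qed simp
   qed
  qed
  also have "\<dots> = C' * r * ((LINT y|\<mu>. w k y * norm (x - y) powr - \<beta>) + norm (x - X k) powr - \<beta> / real N)"
   using ws[of k] w(5,6)[of k] k by simp
  finally show "norm (LINT y|\<mu>. w k y *\<^sub>R (K (x - y) - K (x - X k))) \<le>
    C' * r * ((LINT y|\<mu>. w k y * norm (x - y) powr - \<beta>) + norm (x - X k) powr - \<beta> / real N)" .
 qed
 also have "\<dots> = C' * r * ((\<Sum>k\<in>?I. (LINT y|\<mu>. w k y * norm (x - y) powr - \<beta>)) + (\<Sum>k\<in>?I. norm (x - X k) powr - \<beta>) / real N)"
  by (simp add: sum.distrib sum_distrib_left[symmetric] sum_divide_distrib)
 also have "\<dots> \<le> C' * r * (A + 2 powr \<beta> * S)"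
 proof (intro mult_left_mono add_mono)
  have "(\<Sum>k\<in>?I. (LINT y|\<mu>. w k y * norm (x - y) powr - \<beta>)) = (LINT y|\<mu>. (\<Sum>k\<in>?I. w k y * norm (x - y) powr - \<beta>))"
   using ws by (subst Bochner_Integration.integral_sum) auto
  also have "\<dots> \<le> (LINT y|\<mu>. norm (x - y) powr - \<beta>)"
  proof (rule integral_mono)
   fix y
   have "(\<Sum>k\<in>?I. w k y) \<le> (\<Sum>k<N. w k y)" using w(2) by (intro sum_mono2) auto
   then show "(\<Sum>k\<in>?I. w k y * norm (x - y) powr - \<beta>) \<le> norm (x - y) powr - \<beta>"
    unfolding sum_distrib_right[symmetric] using w(3)[of y] w(2) by (intro mult_left_le_one_le sum_nonneg) auto
  qed (use ws singular_int in auto)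
  also have "\<dots> \<le> A" by (rule singular_int_le)
  finally show "(\<Sum>k\<in>?I. (LINT y|\<mu>. w k y * norm (x - y) powr - \<beta>)) \<le> A" .
  have "(\<Sum>k\<in>?I. norm (x - X k) powr - \<beta>) \<le> (\<Sum>k\<in>?I. 2 powr \<beta> * norm (X k0 - X k) powr - \<beta>)"
  proof (rule sum_mono)
   fix k assume k: "k \<in> ?I"
   have "norm (X k0 - X k) / 2 \<le> norm (x - X k)"
    using nearest[of k] k norm_triangle_ineq4[of "x - X k" "x - X k0"] by simp
   then have "norm (x - X k) powr - \<beta> \<le> (norm (X k0 - X k) / 2) powr - \<beta>"
    using distinct[of k] k beta by (intro powr_mono2') auto
   then show "norm (x - X k) powr - \<beta> \<le> 2 powr \<beta> * norm (X k0 - X k) powr - \<beta>"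
    by (simp add: powr_divide powr_minus field_simps)
  qed
  also have "\<dots> = 2 powr \<beta> * (\<Sum>k\<in>?I. norm (X k0 - X k) powr - \<beta>)" by (simp add: sum_distrib_left)
  finally have "(\<Sum>k\<in>?I. norm (x - X k) powr - \<beta>) / real N \<le> 2 powr \<beta> * ((\<Sum>k\<in>?I. norm (X k0 - X k) powr - \<beta>) / real N)"
   by (simp add: divide_right_mono)
  also have "\<dots> \<le> 2 powr \<beta> * S" using S by (intro mult_left_mono) auto
  finally show "(\<Sum>k\<in>?I. norm (x - X k) powr - \<beta>) / real N \<le> 2 powr \<beta> * S" .
 qed (use C'_pos r in auto)
 finally have fin: "norm (kernel_conv K \<mu> x - (1 / real N) *\<^sub>R (\<Sum>k\<in>?I. K (x - X k)) - (LINT y|\<mu>. w k0 y *\<^sub>R K (x - y)))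
   \<le> C' * r * (A + 2 powr \<beta> * S)" .
 show ?thesis
  by (rule that[of "w k0"]) (use w(1,2,5,6) w(4)[of k0] w1 wK k0 fin in \<open>auto simp: dist_norm\<close>)
qed

text \<open>There is no self-interaction to compare with, so the own portion of the density is
  estimated by its size. It lies within \<open>r\<close>, and one factor of the norm in the bound
  for \<open>K\<close> becomes \<open>r\<close>.\<close>

lemma kernel_conv_error_particle:
 assumes N: "N \<ge> 1" and near: "hall_near N X f r" and r: "0 \<le> r" and i: "i < N"
  and distinct: "\<And>k. k < N \<Longrightarrow> k \<noteq> i \<Longrightarrow> X k \<noteq> X i"
  and S: "(\<Sum>k\<in>{..<N} - {i}. norm (X i - X k) powr - \<beta>) / real N \<le> S"
 shows "norm (kernel_conv K \<mu> (X i) - (1 / real N) *\<^sub>R (\<Sum>k\<in>{..<N} - {i}. K (X i - X k)))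
  \<le> C' * r * (2 * A + 2 powr \<beta> * S)"
proof -
 let ?x = "X i"
 obtain w where w: "w \<in> borel_measurable borel" "\<And>y. 0 \<le> w y" "\<And>y. w y \<le> 1"
  "\<And>y. w y \<noteq> 0 \<Longrightarrow> norm (X i - y) \<le> r" "integrable \<mu> w" "(LINT y|\<mu>. w y) = 1 / real N"
  "integrable \<mu> (\<lambda>y. w y *\<^sub>R K (?x - y))"
  and le: "norm (kernel_conv K \<mu> ?x - (1 / real N) *\<^sub>R (\<Sum>k\<in>{..<N} - {i}. K (?x - X k)) - (LINT y|\<mu>. w y *\<^sub>R K (?x - y)))
   \<le> C' * r * (A + 2 powr \<beta> * S)"
  by (rule kernel_conv_error[OF N near r i _ distinct S, of ?x]) (simp, assumption+, rule that)
 have "norm (LINT y|\<mu>. w y *\<^sub>R K (?x - y)) \<le> (LINT y|\<mu>. norm (w y *\<^sub>R K (?x - y)))" by (rule integral_norm_bound)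
 also have "\<dots> \<le> (LINT y|\<mu>. C' * r * norm (?x - y) powr - \<beta>)"
 proof (rule integral_mono_AE)
  show "AE y in \<mu>. norm (w y *\<^sub>R K (?x - y)) \<le> C' * r * norm (?x - y) powr - \<beta>"
   using AE_density_neq[of ?x]
  proof eventually_elim
   case (elim y)
   show ?case
   proof (cases "w y = 0")
    case False
    have "norm (K (?x - y)) \<le> C * norm (?x - y) * norm (?x - y) powr - \<beta>" using elim by (intro K_norm) auto
    also have "\<dots> \<le> C' * r * norm (?x - y) powr - \<beta>"
     using w(4)[OF False] C_le_C' C_pos by (intro mult_right_mono mult_mono) auto
    finally have "w y * norm (K (?x - y)) \<le> 1 * (C' * r * norm (?x - y) powr - \<beta>)"
     using w(2,3)[of y] by (intro mult_mono) auto
    then show ?thesis using w(2)[of y] by simp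
   qed (use C'_pos r in simp)
  qed
 qed (rule integrable_norm[OF w(7)], use singular_int in simp)
 also have "\<dots> = C' * r * (LINT y|\<mu>. norm (?x - y) powr - \<beta>)" by simp
 also have "\<dots> \<le> C' * r * A" using singular_int_le C'_pos r by (intro mult_left_mono) auto
 finally have "norm (LINT y|\<mu>. w y *\<^sub>R K (?x - y)) \<le> C' * r * A" .
 with le show ?thesis
  using norm_triangle_ineq[of "kernel_conv K \<mu> ?x - (1 / real N) *\<^sub>R (\<Sum>k\<in>{..<N} - {i}. K (?x - X k)) - (LINT y|\<mu>. w y *\<^sub>R K (?x - y))"
   "LINT y|\<mu>. w y *\<^sub>R K (?x - y)"]
  by (simp add: algebra_simps)
qed

text \<open>It remains to compare the portion of the nearest particle with the particle itself.
  Where \<open>y\<close> is closer to the particle than \<open>x\<close> is, \<open>K_diff\<close>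
  applies; otherwise \<open>norm (x - y)\<close> is at most \<open>2 * r\<close> and the two kernels
  are bounded separately. The value at the particle causes the term with
  \<open>1 / N\<close>.\<close>

lemma kernel_conv_error_outside:
 assumes N: "N \<ge> 1" and near: "hall_near N X f r" and r: "0 \<le> r" and k0: "k0 < N"
  and nearest: "\<And>k. k < N \<Longrightarrow> norm (x - X k0) \<le> norm (x - X k)"
  and distinct: "\<And>k. k < N \<Longrightarrow> k \<noteq> k0 \<Longrightarrow> X k \<noteq> X k0"
  and S: "(\<Sum>k\<in>{..<N} - {k0}. norm (X k0 - X k) powr - \<beta>) / real N \<le> S"
  and x: "x \<noteq> X k0"
 shows "norm (kernel_conv K \<mu> x - (1 / real N) *\<^sub>R (\<Sum>k<N. K (x - X k)))
  \<le> C' * norm (x - X k0) powr - \<alpha> / real N + C' * r * (2 * A + 2 powr \<beta> * S)"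
proof -
 obtain w where w: "w \<in> borel_measurable borel" "\<And>y. 0 \<le> w y" "\<And>y. w y \<le> 1"
  "\<And>y. w y \<noteq> 0 \<Longrightarrow> norm (X k0 - y) \<le> r" "integrable \<mu> w" "(LINT y|\<mu>. w y) = 1 / real N"
  "integrable \<mu> (\<lambda>y. w y *\<^sub>R K (x - y))"
  and le: "norm (kernel_conv K \<mu> x - (1 / real N) *\<^sub>R (\<Sum>k\<in>{..<N} - {k0}. K (x - X k)) - (LINT y|\<mu>. w y *\<^sub>R K (x - y)))
   \<le> C' * r * (A + 2 powr \<beta> * S)"
  by (rule kernel_conv_error[OF N near r k0 nearest distinct S]) (assumption+, rule that)
 define \<delta> where "\<delta> = norm (x - X k0)"
 have \<delta>: "\<delta> > 0" using x by (simp add: \<delta>_def)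
 have pa: "\<delta> powr - \<alpha> = \<delta> * \<delta> powr - \<beta>" unfolding \<delta>_def by (rule powr_alpha)
 have Kx: "norm (K (x - X k0)) \<le> C * \<delta> powr - \<alpha>"
  using K_norm_powr_alpha[of "x - X k0"] x by (simp add: \<delta>_def)
 have int2: "integrable \<mu> (\<lambda>y. w y *\<^sub>R K (x - X k0))" using w(5) by simp
 have "(LINT y|\<mu>. w y *\<^sub>R K (x - y)) - (1 / real N) *\<^sub>R K (x - X k0) = (LINT y|\<mu>. w y *\<^sub>R (K (x - y) - K (x - X k0)))"
  using w(5,6,7) by (simp add: scaleR_diff_right)
 also have "norm \<dots> \<le> (LINT y|\<mu>. norm (w y *\<^sub>R (K (x - y) - K (x - X k0))))" by (rule integral_norm_bound)
 also have "\<dots> \<le> (LINT y|\<mu>. C' * (\<delta> powr - \<alpha>) * w y + C' * r * norm (x - y) powr - \<beta>)"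
 proof (rule integral_mono_AE)
  have "integrable \<mu> (\<lambda>y. w y *\<^sub>R K (x - y) - w y *\<^sub>R K (x - X k0))"
   using w(7) int2 by (rule Bochner_Integration.integrable_diff)
  then show "integrable \<mu> (\<lambda>y. norm (w y *\<^sub>R (K (x - y) - K (x - X k0))))" by (simp add: scaleR_diff_right)
  show "integrable \<mu> (\<lambda>y. C' * (\<delta> powr - \<alpha>) * w y + C' * r * norm (x - y) powr - \<beta>)"
   using w(5) singular_int by auto
  show "AE y in \<mu>. norm (w y *\<^sub>R (K (x - y) - K (x - X k0))) \<le> C' * (\<delta> powr - \<alpha>) * w y + C' * r * norm (x - y) powr - \<beta>"
   using AE_density_neq[of x]
  proof eventually_elim
   case (elim y)
   show ?case
   proof (cases "w y = 0")
    case False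
    let ?s = "norm (x - y) powr - \<beta>"
    have yr: "norm (X k0 - y) \<le> r" using w(4)[OF False] .
    have "norm (K (x - y) - K (x - X k0)) \<le> C' * \<delta> powr - \<alpha> + C' * r * ?s"
    proof (cases "norm (X k0 - y) \<le> \<delta>")
     case True
     have "norm (K (x - y) - K (x - X k0)) \<le> C' * norm ((x - y) - (x - X k0)) * (?s + norm (x - X k0) powr - \<beta>)"
      using elim x by (intro K_diff) auto
     also have "\<dots> = C' * norm (X k0 - y) * ?s + C' * norm (X k0 - y) * \<delta> powr - \<beta>"
      by (simp add: \<delta>_def algebra_simps)
     also have "\<dots> \<le> C' * r * ?s + C' * \<delta> * \<delta> powr - \<beta>"
      using yr True C'_pos by (intro add_mono mult_right_mono mult_left_mono) auto
     finally show ?thesis by (simp add: pa)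
    next
     case far: False
     have "norm (x - y) \<le> \<delta> + norm (X k0 - y)" using norm_triangle_ineq[of "x - X k0" "X k0 - y"] by (simp add: \<delta>_def)
     then have "norm (x - y) \<le> 2 * r" using far yr by linarith
     have "norm (K (x - y)) \<le> C * norm (x - y) * ?s" using elim by (intro K_norm) auto
     also have "\<dots> \<le> C * (2 * r) * ?s" using \<open>norm (x - y) \<le> 2 * r\<close> C_pos by (intro mult_right_mono mult_left_mono) auto
     also have "\<dots> \<le> C' * r * ?s"
      using mult_right_mono[of "2 * C" C' "r * ?s"] C_le_C' C_pos r by (simp add: mult_ac)
     finally have "norm (K (x - y)) \<le> C' * r * ?s" .
     moreover have "C * \<delta> powr - \<alpha> \<le> C' * \<delta> powr - \<alpha>" using C_le_C' C_pos by (intro mult_right_mono) auto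
     ultimately show ?thesis using Kx norm_triangle_ineq4[of "K (x - y)" "K (x - X k0)"] by linarith
    qed
    then have "w y * norm (K (x - y) - K (x - X k0)) \<le> w y * (C' * \<delta> powr - \<alpha> + C' * r * ?s)"
     using w(2) by (rule mult_left_mono)
    moreover have "w y * (C' * r * ?s) \<le> C' * r * ?s"
     using w(2,3)[of y] C'_pos r by (intro mult_left_le_one_le) auto
    moreover have "w y * (C' * \<delta> powr - \<alpha> + C' * r * ?s) = C' * \<delta> powr - \<alpha> * w y + w y * (C' * r * ?s)"
     by (simp add: distrib_left mult_ac)
    moreover have "norm (w y *\<^sub>R (K (x - y) - K (x - X k0))) = w y * norm (K (x - y) - K (x - X k0))"
     using w(2)[of y] by simp
    ultimately show ?thesis by linarith
   qed (use C'_pos r in simp)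
  qed
 qed
 also have "\<dots> = C' * (\<delta> powr - \<alpha>) * (1 / real N) + C' * r * (LINT y|\<mu>. norm (x - y) powr - \<beta>)"
  using w(5,6) singular_int by (subst Bochner_Integration.integral_add) auto
 also have "\<dots> \<le> C' * (\<delta> powr - \<alpha>) * (1 / real N) + C' * r * A"
  using singular_int_le C'_pos r by (intro add_left_mono mult_left_mono) auto
 finally have 2: "norm ((LINT y|\<mu>. w y *\<^sub>R K (x - y)) - (1 / real N) *\<^sub>R K (x - X k0)) \<le> C' * (\<delta> powr - \<alpha>) * (1 / real N) + C' * r * A" .
 have "(\<Sum>k<N. K (x - X k)) = K (x - X k0) + (\<Sum>k\<in>{..<N} - {k0}. K (x - X k))"
  using k0 by (subst sum.remove[of _ k0]) auto
 then have "kernel_conv K \<mu> x - (1 / real N) *\<^sub>R (\<Sum>k<N. K (x - X k)) =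
   (kernel_conv K \<mu> x - (1 / real N) *\<^sub>R (\<Sum>k\<in>{..<N} - {k0}. K (x - X k)) - (LINT y|\<mu>. w y *\<^sub>R K (x - y))) +
   ((LINT y|\<mu>. w y *\<^sub>R K (x - y)) - (1 / real N) *\<^sub>R K (x - X k0))"
  by (simp add: scaleR_add_right)
 also have "norm \<dots> \<le> C' * r * (A + 2 powr \<beta> * S) + (C' * (\<delta> powr - \<alpha>) * (1 / real N) + C' * r * A)"
  using norm_triangle_mono[OF le 2] .
 finally show ?thesis by (simp add: \<delta>_def algebra_simps)
qed

end

section \<open>Transport of unions of moving balls\<close>

lemma exp_diff_linear_le:
 fixes z :: real
 assumes "0 \<le> z"
 shows "exp z - 1 \<le> z * exp z" "\<bar>exp z - 1 - z\<bar> \<le> z\<^sup>2 * exp z"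
proof -
 have "1 - z \<le> exp (- z)" using exp_ge_add_one_self[of "- z"] by simp
 then have "exp z * (1 - z) \<le> exp z * exp (- z)" by (intro mult_left_mono) auto
 then show 1: "exp z - 1 \<le> z * exp z" by (simp add: exp_minus algebra_simps)
 have "z * 1 \<le> z * exp z" using assms by (intro mult_left_mono) auto
 have "exp z - 1 - z \<le> z * (exp z - 1)" using 1 by (simp add: algebra_simps)
 also have "\<dots> \<le> z * (z * exp z)" using 1 assms by (intro mult_left_mono) auto
 finally have "exp z - 1 - z \<le> z\<^sup>2 * exp z" by (simp add: power2_eq_square mult.assoc)
 moreover have "0 \<le> exp z - 1 - z" using exp_ge_add_one_self[of z] by linarith
 ultimately show "\<bar>exp z - 1 - z\<bar> \<le> z\<^sup>2 * exp z" by simp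
qed

text \<open>The velocity may vary by \<L>ipschitz constant \<open>L\<close> times the radius across
  a ball, and it may differ from the velocity of the center by \<open>\<Lambda> - L\<close> times
  the radius. Together this is the growth rate of the radius, so the flow cannot leave the
  balls.\<close>

locale moving_balls = lipschitz_velocity u T L b for u :: "real \<Rightarrow> 'a::euclidean_space \<Rightarrow> 'a" and T L b +
 fixes \<rho> :: "real \<Rightarrow> 'a \<Rightarrow> real" and M r \<Lambda> \<kappa> :: real and I :: "'i set" and Z v :: "'i \<Rightarrow> real \<Rightarrow> 'a"
 assumes solution: "continuity_solution u T M \<rho>" and M_nonneg: "0 \<le> M"
  and r_pos: "0 < r" and Lambda: "0 \<le> \<Lambda>" and kappa: "1 < \<kappa>" and finite_I: "finite I"
  and v_integrable: "\<And>i. i \<in> I \<Longrightarrow> set_integrable lborel {0..T} (v i)"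
  and Z_eq: "\<And>i s t. i \<in> I \<Longrightarrow> 0 \<le> s \<Longrightarrow> s \<le> t \<Longrightarrow> t \<le> T \<Longrightarrow> Z i t = Z i s + (LINT q:{s..t}|lborel. v i q)"
  and v_le: "AE q\<in>{0..T} in lborel. (\<forall>i\<in>I. norm (v i q) \<le> b q)"
  and error: "AE q\<in>{0..T} in lborel. (\<forall>i\<in>I. norm (u q (Z i q) - v i q) \<le> (\<Lambda> - L) * (r * exp (\<Lambda> * q)))"
begin

text \<open>Reciprocal of the current radius, so that \<open>a i t\<close> maps the ball with index
  \<open>i\<close> onto the unit ball.\<close>

definition c :: "real \<Rightarrow> real" where "c t = exp (- \<Lambda> * t) / r"
definition a :: "'i \<Rightarrow> real \<Rightarrow> 'a \<Rightarrow> 'a" where "a i t x = c t *\<^sub>R (x - Z i t)"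
definition p :: "real \<Rightarrow> 'a \<Rightarrow> real" where "p t x = (\<Sum>i\<in>I. bump \<kappa> (a i t x))"
text \<open>Where balls overlap \<open>p\<close> exceeds 1. Composition with
  \<open>smooth_step\<close> gives the value 1 on the whole union and keeps the values between 0 and
  1.\<close>

definition \<psi> :: "real \<Rightarrow> 'a \<Rightarrow> real" where "\<psi> t x = smooth_step (p t x)"
definition k :: "'i \<Rightarrow> real \<Rightarrow> 'a \<Rightarrow> real" where "k i t x = smooth_step' (p t x) * bump' \<kappa> (a i t x)"
text \<open>For \<open>w i = v i q\<close> and \<open>l = \<Lambda>\<close>, this is \<open>- \<partial>\<^sub>t \<psi> t\<close> with the velocities of the centers frozen at time \<open>q\<close>.\<close>
definition \<xi> :: "('i \<Rightarrow> 'a) \<Rightarrow> real \<Rightarrow> real \<Rightarrow> 'a \<Rightarrow> real" where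
 "\<xi> w l t x = (\<Sum>i\<in>I. (c t)\<^sup>2 * (k i t x * ((x - Z i t) \<bullet> (w i + l *\<^sub>R (x - Z i t)))))"

lemma c_pos: "0 < c t" using r_pos by (simp add: c_def)

lemma c_le: "0 \<le> t \<Longrightarrow> c t \<le> 1 / r"
 using r_pos Lambda by (simp add: c_def divide_right_mono)

lemma c_eq: "c s = c t * exp (\<Lambda> * (t - s))"
 by (simp add: c_def exp_add[symmetric] algebra_simps)

lemma c_diff:
 assumes "0 \<le> s" "s \<le> t"
 shows "\<bar>c s - c t\<bar> \<le> 1 / r * (\<Lambda> * (t - s))" "\<bar>c s - c t - c t * (\<Lambda> * (t - s))\<bar> \<le> 1 / r * (\<Lambda> * (t - s))\<^sup>2"
proof -
 define z where "z = \<Lambda> * (t - s)"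
 have z: "z \<ge> 0" using Lambda assms by (simp add: z_def)
 have cs: "c s = c t * exp z" by (simp add: z_def c_eq[of s t])
 have e1: "c s - c t = c t * (exp z - 1)" by (simp add: cs algebra_simps)
 have "\<bar>c s - c t\<bar> = c t * (exp z - 1)" unfolding e1 using c_pos[of t] z by (simp add: abs_mult)
 also have "\<dots> \<le> c t * (z * exp z)" using exp_diff_linear_le(1)[OF z] c_pos[of t] by (intro mult_left_mono) auto
 also have "\<dots> = c s * z" by (simp add: cs)
 also have "\<dots> \<le> 1 / r * z" using c_le[OF assms(1)] z by (intro mult_right_mono) auto
 finally show "\<bar>c s - c t\<bar> \<le> 1 / r * (\<Lambda> * (t - s))" by (simp add: z_def)
 have e2: "c s - c t - c t * z = c t * (exp z - 1 - z)" by (simp add: cs algebra_simps)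
 have "\<bar>c s - c t - c t * z\<bar> = c t * \<bar>exp z - 1 - z\<bar>" unfolding e2 using c_pos[of t] by (simp add: abs_mult)
 also have "\<dots> \<le> c t * (z\<^sup>2 * exp z)" using exp_diff_linear_le(2)[OF z] c_pos[of t] by (intro mult_left_mono) auto
 also have "\<dots> = c s * z\<^sup>2" by (simp add: cs)
 also have "\<dots> \<le> 1 / r * z\<^sup>2" using c_le[OF assms(1)] by (intro mult_right_mono) auto
 finally show "\<bar>c s - c t - c t * (\<Lambda> * (t - s))\<bar> \<le> 1 / r * (\<Lambda> * (t - s))\<^sup>2" by (simp add: z_def)
qed

lemma Z_diff:
 assumes "i \<in> I" "0 \<le> s" "s \<le> t" "t \<le> T"
 shows "norm (Z i t - Z i s) \<le> B t - B s"
proof -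
 have vi: "set_integrable lborel {s..t} (v i)"
  by (rule set_integrable_subset[OF v_integrable]) (use assms in auto)
 have "norm (Z i t - Z i s) = norm (LINT q:{s..t}|lborel. v i q)" using Z_eq[OF assms] by simp
 also have "\<dots> \<le> (LINT q:{s..t}|lborel. norm (v i q))" by (rule set_integral_norm_bound[OF vi])
 also have "\<dots> \<le> (LINT q:{s..t}|lborel. b q)"
 proof (rule set_integral_mono_AE)
  show "set_integrable lborel {s..t} (\<lambda>q. norm (v i q))" by (rule set_integrable_norm[OF vi])
  show "set_integrable lborel {s..t} b" by (rule b_integrable_sub) (use assms in auto)
  show "AE q\<in>{s..t} in lborel. norm (v i q) \<le> b q"
   using v_le by eventually_elim (use assms in auto)
 qed
 finally show ?thesis using B_diff assms by simp
qed

text \<open>Radius of a ball around the origin that contains all supports up to time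
  \<open>T\<close>: initial centers, distance travelled, and final radius of the bumps.\<close>

definition R :: real where "R = (\<Sum>i\<in>I. norm (Z i 0)) + (B T - B 0) + \<kappa> * r * exp (\<Lambda> * T)"

lemma R_nonneg: "0 \<le> R"
 unfolding R_def using B_mono[of 0 T] T_nonneg r_pos kappa by (intro add_nonneg_nonneg sum_nonneg) auto

lemma Z_le: "i \<in> I \<Longrightarrow> t \<in> {0..T} \<Longrightarrow> norm (Z i t) + \<kappa> * r * exp (\<Lambda> * T) \<le> R"
proof -
 assume i: "i \<in> I" and t: "t \<in> {0..T}"
 have "norm (Z i 0) \<le> (\<Sum>i\<in>I. norm (Z i 0))" using i finite_I by (intro member_le_sum) auto
 moreover have "norm (Z i t - Z i 0) \<le> B t - B 0" using i t by (intro Z_diff) auto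
 moreover have "B t \<le> B T" using t by (intro B_mono) auto
 ultimately show ?thesis using norm_triangle_sub[of "Z i t" "Z i 0"] by (simp add: R_def)
qed

lemma Z_le_R: "i \<in> I \<Longrightarrow> t \<in> {0..T} \<Longrightarrow> norm (Z i t) \<le> R"
proof -
 assume "i \<in> I" "t \<in> {0..T}"
 moreover have "0 \<le> \<kappa> * r * exp (\<Lambda> * T)" using kappa r_pos by simp
 ultimately show ?thesis using Z_le[of i t] by linarith
qed

lemma a_outside: "i \<in> I \<Longrightarrow> t \<in> {0..T} \<Longrightarrow> R < norm x \<Longrightarrow> \<kappa> \<le> norm (a i t x)"
proof -
 assume i: "i \<in> I" and t: "t \<in> {0..T}" and x: "R < norm x"
 have "\<kappa> * r * exp (\<Lambda> * t) \<le> \<kappa> * r * exp (\<Lambda> * T)"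
  using t Lambda kappa r_pos by (intro mult_left_mono) (auto intro!: mult_left_mono)
 then have "\<kappa> * r * exp (\<Lambda> * t) \<le> norm (x - Z i t)"
  using Z_le[OF i t] x norm_triangle_sub[of x "Z i t"] by linarith
 then have "c t * (\<kappa> * r * exp (\<Lambda> * t)) \<le> c t * norm (x - Z i t)"
  using c_pos[of t] by (intro mult_left_mono) auto
 moreover have "c t * (\<kappa> * r * exp (\<Lambda> * t)) = \<kappa>" using r_pos by (simp add: c_def exp_minus)
 ultimately show ?thesis using c_pos[of t] by (simp add: a_def)
qed

lemma outside: "t \<in> {0..T} \<Longrightarrow> R < norm x \<Longrightarrow> p t x = 0"
 "t \<in> {0..T} \<Longrightarrow> R < norm x \<Longrightarrow> \<psi> t x = 0"
 "t \<in> {0..T} \<Longrightarrow> R < norm x \<Longrightarrow> i \<in> I \<Longrightarrow> k i t x = 0"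
 "t \<in> {0..T} \<Longrightarrow> R < norm x \<Longrightarrow> \<xi> w l t x = 0"
 using a_outside kappa by (auto simp: p_def \<psi>_def k_def \<xi>_def bump_eq_0 bump'_eq_0' smooth_step_0 intro!: sum.neutral)

lemma a_eq: "a i t = (\<lambda>x. c t *\<^sub>R x + (- c t *\<^sub>R Z i t))"
 by (auto simp: a_def algebra_simps)

lemma times_differentiable_p: "times_differentiable n (p t)"
proof -
 have "p t = (\<lambda>x. \<Sum>i\<in>I. bump \<kappa> (c t *\<^sub>R x + (- c t *\<^sub>R Z i t)))" by (auto simp: p_def a_eq)
 then show ?thesis
  by (simp only:) (intro times_differentiable_sum times_differentiable_affine
   test_function_times_differentiable test_function_bump kappa)
qed

lemma times_differentiable_k: "times_differentiable n (k i t)"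
proof -
 have "k i t = (\<lambda>x. smooth_step' (p t x) * bump' \<kappa> (c t *\<^sub>R x + (- c t *\<^sub>R Z i t)))" by (auto simp: k_def a_eq)
 then show ?thesis
  by (simp only:) (intro times_differentiable_mult times_differentiable_compose[OF times_differentiable_smooth_step']
   times_differentiable_p times_differentiable_affine test_function_times_differentiable test_function_bump' kappa)
qed

lemma test_function_psi: "t \<in> {0..T} \<Longrightarrow> test_function (\<psi> t)"
 unfolding \<psi>_def[abs_def]
 by (rule test_functionI[where R = R])
  (auto simp: outside smooth_step_0 intro!: times_differentiable_compose[OF times_differentiable_smooth_step] times_differentiable_p)

lemma test_function_xi: "t \<in> {0..T} \<Longrightarrow> test_function (\<xi> w l t)"
proof (rule test_functionI[where R = R])
 fix n
 have eq: "\<xi> w l t = (\<lambda>x. \<Sum>i\<in>I. (c t)\<^sup>2 * (k i t x * ((x \<bullet> w i + - (Z i t \<bullet> w i)) +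
   l * ((\<lambda>y. y \<bullet> y) (1 *\<^sub>R x + (- Z i t))))))"
  by (auto simp: \<xi>_def inner_add_right inner_diff_left intro!: sum.cong)
 show "times_differentiable n (\<xi> w l t)" unfolding eq
  by (intro times_differentiable_sum times_differentiable_mult times_differentiable_const times_differentiable_k
   times_differentiable_add times_differentiable_linear bounded_linear_inner_left
   times_differentiable_affine[OF times_differentiable_inner_self])
qed (rule outside)

lemma a_derivative: "(a i t has_derivative (\<lambda>w. c t *\<^sub>R w)) (at x)"
 unfolding a_eq by (auto intro!: derivative_eq_intros)

lemma bump_a_derivative:
 "((\<lambda>x. bump \<kappa> (a i t x)) has_derivative (\<lambda>w. - bump' \<kappa> (a i t x) * (a i t x \<bullet> (c t *\<^sub>R w)))) (at x)"
 by (rule has_derivative_compose[OF a_derivative bump_derivative[OF kappa]])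

lemma p_derivative:
 "(p t has_derivative (\<lambda>w. \<Sum>i\<in>I. - bump' \<kappa> (a i t x) * (a i t x \<bullet> (c t *\<^sub>R w)))) (at x)"
 unfolding p_def[abs_def] by (rule has_derivative_sum) (rule bump_a_derivative)

lemma psi_derivative:
 "grad (\<psi> t) x w = - (\<Sum>i\<in>I. (c t)\<^sup>2 * (k i t x * ((x - Z i t) \<bullet> w)))"
proof -
 have "(\<psi> t has_derivative (\<lambda>w. smooth_step' (p t x) * (\<Sum>i\<in>I. - bump' \<kappa> (a i t x) * (a i t x \<bullet> (c t *\<^sub>R w))))) (at x)"
  unfolding \<psi>_def[abs_def]
  by (rule has_derivative_compose[OF p_derivative smooth_step_deriv[unfolded has_field_derivative_def]])
 from frechet_derivative_at[OF this, symmetric] show ?thesis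
  by (simp add: sum_distrib_left sum_negf k_def a_def power2_eq_square mult_ac)
qed

lemma rho_integrable:
 assumes t: "t \<in> {0..T}" and gm: "g \<in> borel_measurable borel" and g: "\<And>x. \<bar>g x\<bar> \<le> m" "\<And>x. R < norm x \<Longrightarrow> g x = 0"
 shows "integrable lborel (\<lambda>x. g x * \<rho> t x)"
proof (rule Bochner_Integration.integrable_bound)
 note [measurable] = continuity_solution_density(1)[OF solution t] gm
 show "integrable lborel (\<lambda>x::'a. m * M * indicator (cball 0 R) x)"
  by (intro integrable_mult_right integrable_indicator_cball)
 show "(\<lambda>x. g x * \<rho> t x) \<in> borel_measurable lborel" by measurable
 have "0 \<le> m" using g(1)[of 0] by linarith
 show "AE x in lborel. norm (g x * \<rho> t x) \<le> norm (m * M * indicator (cball 0 R) x)"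
  using continuity_solution_density(2)[OF solution t]
 proof eventually_elim
  case (elim x)
  then show ?case
   using g(1)[of x] g(2)[of x] \<open>0 \<le> m\<close> M_nonneg
   by (cases "norm x \<le> R") (auto simp: abs_mult intro!: mult_mono)
 qed
qed

lemma test_rho_integrable:
 assumes t: "t \<in> {0..T}" and "test_function g" "\<And>x. R < norm x \<Longrightarrow> g x = 0"
 shows "integrable lborel (\<lambda>x. g x * \<rho> t x)"
proof -
 obtain m where "m > 0" "\<And>x. \<bar>g x\<bar> \<le> m" using test_function_bounded[OF assms(2)] by blast
 then show ?thesis by (intro rho_integrable[OF t test_function_measurable[OF assms(2)]] assms(3))
qed

context
 fixes G :: real
 assumes G1: "1 \<le> G" and G_bump': "\<And>a::'a. \<bar>bump' \<kappa> a\<bar> \<le> G"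
  and G_bump'_norm: "\<And>a::'a. \<bar>bump' \<kappa> a\<bar> * norm a \<le> G"
  and G_dbump': "\<And>(a::'a) w. \<bar>grad (bump' \<kappa>) a w\<bar> \<le> G * norm w"
  and G_bump_taylor: "\<And>(a::'a) a'. \<bar>bump \<kappa> a' - bump \<kappa> a + bump' \<kappa> a * (a \<bullet> (a' - a))\<bar> \<le> G * (norm (a' - a))\<^sup>2"
  and G_bump: "\<And>(a::'a) a'. \<bar>bump \<kappa> a' - bump \<kappa> a\<bar> \<le> G * norm (a' - a)"
  and G_step': "\<And>s. \<bar>smooth_step' s\<bar> \<le> G"
  and G_dstep': "\<And>s w. \<bar>grad smooth_step' s w\<bar> \<le> G * \<bar>w\<bar>"
  and G_step_taylor: "\<And>s s'. \<bar>smooth_step s' - smooth_step s - smooth_step' s * (s' - s)\<bar> \<le> G * (s' - s)\<^sup>2"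
begin

lemma k_le: "\<bar>k i t x\<bar> \<le> G * G"
 unfolding k_def abs_mult using G1 by (intro mult_mono G_step' G_bump') auto

lemma k_nonneg: "0 \<le> k i t x"
 unfolding k_def by (intro mult_nonneg_nonneg smooth_step'_nonneg bump'_nonneg kappa)

lemma k_derivative_le:
 assumes "0 \<le> t"
 shows "\<bar>grad (k i t) x w\<bar> \<le> (G * G / r + G * (real (card I) * G / r) * G) * norm w"
proof -
 let ?dp = "\<lambda>w. \<Sum>i\<in>I. - bump' \<kappa> (a i t x) * (a i t x \<bullet> (c t *\<^sub>R w))"
 have 1: "((\<lambda>x. smooth_step' (p t x)) has_derivative (\<lambda>w. grad smooth_step' (p t x) (?dp w))) (at x)"
  by (rule has_derivative_compose[OF p_derivative test_function_has_derivative[OF test_function_smooth_step']])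
 have 2: "((\<lambda>x. bump' \<kappa> (a i t x)) has_derivative (\<lambda>w. grad (bump' \<kappa>) (a i t x) (c t *\<^sub>R w))) (at x)"
  by (rule has_derivative_compose[OF a_derivative test_function_has_derivative[OF test_function_bump'[OF kappa]]])
 have eq: "grad (k i t) x w = smooth_step' (p t x) * grad (bump' \<kappa>) (a i t x) (c t *\<^sub>R w) +
   grad smooth_step' (p t x) (?dp w) * bump' \<kappa> (a i t x)"
  using frechet_derivative_at[OF has_derivative_mult[OF 1 2]] by (simp add: k_def[abs_def] fun_eq_iff)
 have cw: "norm (c t *\<^sub>R w) \<le> norm w / r"
  using mult_right_mono[OF c_le[OF assms] norm_ge_zero, of w] c_pos[of t] by simp
 have "\<bar>?dp w\<bar> \<le> (\<Sum>i\<in>I. \<bar>- bump' \<kappa> (a i t x) * (a i t x \<bullet> (c t *\<^sub>R w))\<bar>)" by (rule sum_abs)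
 also have "\<dots> \<le> (\<Sum>i\<in>I. G * (norm w / r))"
 proof (rule sum_mono)
  fix j
  have "\<bar>- bump' \<kappa> (a j t x) * (a j t x \<bullet> (c t *\<^sub>R w))\<bar> \<le> \<bar>bump' \<kappa> (a j t x)\<bar> * (norm (a j t x) * norm (c t *\<^sub>R w))"
   unfolding abs_mult abs_minus_cancel by (intro mult_left_mono Cauchy_Schwarz_ineq2) auto
  also have "\<dots> \<le> G * (norm w / r)"
   unfolding mult.assoc[symmetric] using cw G1 by (intro mult_mono G_bump'_norm) auto
  finally show "\<bar>- bump' \<kappa> (a j t x) * (a j t x \<bullet> (c t *\<^sub>R w))\<bar> \<le> G * (norm w / r)" .
 qed
 finally have dp: "\<bar>?dp w\<bar> \<le> real (card I) * G / r * norm w" by simp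
 have "\<bar>grad (k i t) x w\<bar> \<le>
   G * (G * (norm w / r)) + (G * (real (card I) * G / r * norm w)) * G"
  unfolding eq using G1 r_pos
  by (intro order.trans[OF abs_triangle_ineq] add_mono; unfold abs_mult;
    intro mult_mono G_step' G_bump' order.trans[OF G_dbump' mult_left_mono[OF cw]] order.trans[OF G_dstep' mult_left_mono[OF dp]]) auto
 then show ?thesis by (simp add: algebra_simps)
qed

definition Cx :: real where
 "Cx = real (card I) * ((1 / r)\<^sup>2 * ((G * G / r + G * (real (card I) * G / r) * G) * (2 * R * (1 + \<Lambda> * (2 * R))) +
  G * G * (1 + 4 * \<Lambda> * R)))"

lemma xi_derivative_le:
 assumes t: "t \<in> {0..T}" and x: "norm x \<le> R" and w: "\<And>i. i \<in> I \<Longrightarrow> norm (w i) \<le> \<beta>" "1 \<le> \<beta>"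
 shows "\<bar>grad (\<xi> w \<Lambda> t) x h\<bar> \<le> Cx * \<beta> * norm h"
proof -
 let ?y = "\<lambda>i. x - Z i t" and ?Gk = "G * G / r + G * (real (card I) * G / r) * G"
 let ?q = "\<lambda>i x. (x - Z i t) \<bullet> (w i + \<Lambda> *\<^sub>R (x - Z i t))"
 let ?dq = "\<lambda>i h. ?y i \<bullet> (\<Lambda> *\<^sub>R h) + h \<bullet> (w i + \<Lambda> *\<^sub>R ?y i)"
 have Gk0: "0 \<le> ?Gk" using G1 r_pos by simp
 have 1: "((?q i) has_derivative ?dq i) (at x)" for i
  by (auto intro!: derivative_eq_intros)
 have 2: "(k i t has_derivative grad (k i t) x) (at x)" for i
  by (rule has_derivative_frechet[OF times_differentiable_k])
 have D: "(\<xi> w \<Lambda> t has_derivative (\<lambda>h. \<Sum>i\<in>I. (c t)\<^sup>2 * (k i t x * ?dq i h + grad (k i t) x h * ?q i x))) (at x)"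
  unfolding \<xi>_def[abs_def] by (intro has_derivative_sum has_derivative_mult_right has_derivative_mult 1 2)
 have eq: "grad (\<xi> w \<Lambda> t) x h =
   (\<Sum>i\<in>I. (c t)\<^sup>2 * (k i t x * ?dq i h + grad (k i t) x h * ?q i x))"
  using fun_cong[OF frechet_derivative_at[OF D, symmetric], of h] .
 have "\<bar>(c t)\<^sup>2 * (k i t x * ?dq i h + grad (k i t) x h * ?q i x)\<bar> \<le>
   (1 / r)\<^sup>2 * ((G * G) * ((1 + 4 * \<Lambda> * R) * \<beta> * norm h) + (?Gk * norm h) * (2 * R * (1 + \<Lambda> * (2 * R)) * \<beta>))" if i: "i \<in> I" for i
 proof -
  have y: "norm (?y i) \<le> 2 * R" using Z_le_R[OF i t] x norm_triangle_ineq4[of x "Z i t"] by linarith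
  have Ly: "norm (\<Lambda> *\<^sub>R ?y i) \<le> \<Lambda> * (2 * R)" using y Lambda by (auto intro: mult_left_mono)
  have LRb: "\<Lambda> * R \<le> \<Lambda> * R * \<beta>" using mult_left_mono[OF w(2), of "\<Lambda> * R"] Lambda R_nonneg by simp
  have wy: "norm (w i + \<Lambda> *\<^sub>R ?y i) \<le> (1 + \<Lambda> * (2 * R)) * \<beta>"
  proof -
   have "norm (w i + \<Lambda> *\<^sub>R ?y i) \<le> \<beta> + \<Lambda> * (2 * R)"
    using norm_triangle_ineq[of "w i" "\<Lambda> *\<^sub>R ?y i"] w(1)[OF i] Ly by linarith
   also have "\<dots> \<le> (1 + \<Lambda> * (2 * R)) * \<beta>" using LRb by (simp add: algebra_simps)
   finally show ?thesis .
  qed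
  have q: "\<bar>?q i x\<bar> \<le> 2 * R * (1 + \<Lambda> * (2 * R)) * \<beta>"
  proof -
   have "\<bar>?q i x\<bar> \<le> norm (?y i) * norm (w i + \<Lambda> *\<^sub>R ?y i)" by (rule Cauchy_Schwarz_ineq2)
   also have "\<dots> \<le> (2 * R) * ((1 + \<Lambda> * (2 * R)) * \<beta>)" using y wy R_nonneg by (intro mult_mono) auto
   finally show ?thesis by (simp add: mult_ac)
  qed
  have dq: "\<bar>?dq i h\<bar> \<le> (1 + 4 * \<Lambda> * R) * \<beta> * norm h"
  proof -
   have "\<bar>?y i \<bullet> (\<Lambda> *\<^sub>R h)\<bar> \<le> norm (?y i) * norm (\<Lambda> *\<^sub>R h)" by (rule Cauchy_Schwarz_ineq2)
   also have "\<dots> \<le> (2 * R) * (\<Lambda> * norm h)" using y Lambda R_nonneg by (intro mult_mono) auto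
   also have "\<dots> \<le> 2 * (\<Lambda> * R * \<beta>) * norm h"
    using mult_right_mono[OF LRb norm_ge_zero, of h] by (simp add: algebra_simps)
   finally have 1: "\<bar>?y i \<bullet> (\<Lambda> *\<^sub>R h)\<bar> \<le> 2 * (\<Lambda> * R * \<beta>) * norm h" .
   have "\<bar>h \<bullet> (w i + \<Lambda> *\<^sub>R ?y i)\<bar> \<le> norm h * norm (w i + \<Lambda> *\<^sub>R ?y i)" by (rule Cauchy_Schwarz_ineq2)
   also have "\<dots> \<le> norm h * ((1 + \<Lambda> * (2 * R)) * \<beta>)" using wy by (intro mult_left_mono) auto
   finally show ?thesis using 1 by (simp add: algebra_simps)
  qed
  have c2: "(c t)\<^sup>2 \<le> (1 / r)\<^sup>2" using c_le[of t] t c_pos[of t] by (intro power_mono) auto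
  have "\<bar>k i t x * ?dq i h + grad (k i t) x h * ?q i x\<bar> \<le>
   (G * G) * ((1 + 4 * \<Lambda> * R) * \<beta> * norm h) + (?Gk * norm h) * (2 * R * (1 + \<Lambda> * (2 * R)) * \<beta>)"
   using G1 Gk0 t
   by (intro order.trans[OF abs_triangle_ineq] add_mono; unfold abs_mult; intro mult_mono k_le dq q k_derivative_le) auto
  then show ?thesis unfolding abs_mult power2_abs using c2 by (intro mult_mono) auto
 qed
 then have "\<bar>grad (\<xi> w \<Lambda> t) x h\<bar> \<le> (\<Sum>i\<in>I. (1 / r)\<^sup>2 * ((G * G) * ((1 + 4 * \<Lambda> * R) * \<beta> * norm h) + (?Gk * norm h) * (2 * R * (1 + \<Lambda> * (2 * R)) * \<beta>)))"
  unfolding eq by (intro order.trans[OF sum_abs sum_mono])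
 then show ?thesis by (simp add: Cx_def algebra_simps)
qed

lemma Cx_nonneg: "0 \<le> Cx"
 unfolding Cx_def using G1 r_pos R_nonneg Lambda
 by (intro mult_nonneg_nonneg add_nonneg_nonneg) auto

text \<open>Per unit of \<open>B\<close>, \<open>D1\<close> bounds the change of the rescaled
  position \<open>a i\<close>, and \<open>D2\<close> bounds the second-order remainder after its
  linearization.\<close>

definition D1 :: real where "D1 = 1 / r * (2 * R * \<Lambda> + 1)"
definition D2 :: real where "D2 = 1 / r * (2 * R * \<Lambda>\<^sup>2 + \<Lambda>)"
definition Ct :: real where
 "Ct = real (card I) * G * G * D1\<^sup>2 + G * (real (card I) * G * D1)\<^sup>2 + real (card I) * G * G * D2"

text \<open>The expansion is around the later time and uses the displacements of the centers rather
  than their velocities, which are merely integrable. As \<xi> is linear in the displacement and the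
  time factor jointly, velocities can be introduced afterwards under the time integral.\<close>

lemma psi_taylor:
 assumes st: "0 \<le> s" "s \<le> t" "t \<le> T" and x: "norm x \<le> R"
 shows "\<psi> s x - \<psi> t x \<le> - \<xi> (\<lambda>i. Z i t - Z i s) (\<Lambda> * (t - s)) t x + Ct * (B t - B s)\<^sup>2"
proof -
 define \<Delta> where "\<Delta> = B t - B s"
 have Delta: "t - s \<le> \<Delta>" "0 \<le> \<Delta>" using B_diff_ge[OF st] st by (auto simp: \<Delta>_def)
 define \<delta> where "\<delta> i = a i s x - a i t x" for i
 define e where "e i = (Z i t - Z i s) + (\<Lambda> * (t - s)) *\<^sub>R (x - Z i t)" for i
 have tT: "t \<in> {0..T}" using st by auto
 have y: "norm (x - Z i t) \<le> 2 * R" if "i \<in> I" for i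
  using Z_le_R[OF that tT] x norm_triangle_ineq4[of x "Z i t"] by linarith
 have dZ: "norm (Z i t - Z i s) \<le> \<Delta>" if "i \<in> I" for i using Z_diff[OF that st] by (simp add: \<Delta>_def)
 have Lt: "\<Lambda> * (t - s) \<le> \<Lambda> * \<Delta>" "0 \<le> \<Lambda> * (t - s)" using Delta Lambda st by (auto intro: mult_left_mono)
 have cd: "\<bar>c s - c t\<bar> \<le> 1 / r * (\<Lambda> * \<Delta>)"
  using c_diff(1)[OF st(1,2)] mult_left_mono[OF Lt(1), of "1 / r"] r_pos by simp
 have cd2: "\<bar>c s - c t - c t * (\<Lambda> * (t - s))\<bar> \<le> 1 / r * (\<Lambda> * \<Delta>)\<^sup>2"
  using c_diff(2)[OF st(1,2)] mult_left_mono[OF power_mono[OF Lt], of "1 / r" 2] r_pos by simp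
 have r0: "0 \<le> 1 / r" using r_pos by simp
 have \<delta>: "norm (\<delta> i) \<le> D1 * \<Delta>" if i: "i \<in> I" for i
 proof -
  have eq: "\<delta> i = (c s - c t) *\<^sub>R (x - Z i t) + c s *\<^sub>R (Z i t - Z i s)" by (simp add: \<delta>_def a_def algebra_simps)
  have "norm (\<delta> i) \<le> \<bar>c s - c t\<bar> * norm (x - Z i t) + c s * norm (Z i t - Z i s)"
   unfolding eq using c_pos[of s] by (intro order.trans[OF norm_triangle_ineq]) simp
  also have "\<dots> \<le> 1 / r * (\<Lambda> * \<Delta>) * (2 * R) + 1 / r * \<Delta>"
   using cd y[OF i] dZ[OF i] c_le[OF st(1)] c_pos[of s] r0 Lambda Delta R_nonneg by (intro add_mono mult_mono) auto
  finally show ?thesis by (simp add: D1_def algebra_simps)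
 qed
 have res: "norm (\<delta> i - c t *\<^sub>R e i) \<le> D2 * \<Delta>\<^sup>2" if i: "i \<in> I" for i
 proof -
  have eq: "\<delta> i - c t *\<^sub>R e i = (c s - c t - c t * (\<Lambda> * (t - s))) *\<^sub>R (x - Z i t) + (c s - c t) *\<^sub>R (Z i t - Z i s)"
   by (simp add: \<delta>_def a_def e_def algebra_simps)
  have "norm (\<delta> i - c t *\<^sub>R e i) \<le> \<bar>c s - c t - c t * (\<Lambda> * (t - s))\<bar> * norm (x - Z i t) + \<bar>c s - c t\<bar> * norm (Z i t - Z i s)"
   unfolding eq by (intro order.trans[OF norm_triangle_ineq]) simp
  also have "\<dots> \<le> 1 / r * (\<Lambda> * \<Delta>)\<^sup>2 * (2 * R) + 1 / r * (\<Lambda> * \<Delta>) * \<Delta>"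
   using cd cd2 y[OF i] dZ[OF i] r0 Lambda Delta R_nonneg by (intro add_mono mult_mono) auto
  also have "\<dots> = D2 * \<Delta>\<^sup>2"
   by (simp add: D2_def algebra_simps power2_eq_square)
  finally show ?thesis .
 qed
 have D1: "0 \<le> D1" using r_pos R_nonneg Lambda by (simp add: D1_def)
 have dp: "\<bar>p s x - p t x\<bar> \<le> real (card I) * G * D1 * \<Delta>"
 proof -
  have "\<bar>p s x - p t x\<bar> \<le> (\<Sum>i\<in>I. \<bar>bump \<kappa> (a i s x) - bump \<kappa> (a i t x)\<bar>)"
   unfolding p_def sum_subtractf[symmetric] by (rule sum_abs)
  also have "\<dots> \<le> (\<Sum>i\<in>I. G * (D1 * \<Delta>))"
   using G1 \<delta> by (intro sum_mono order.trans[OF G_bump mult_left_mono]) (auto simp: \<delta>_def)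
  finally show ?thesis by (simp add: mult_ac)
 qed
 have dp2: "p s x - p t x \<le> (\<Sum>i\<in>I. - bump' \<kappa> (a i t x) * (a i t x \<bullet> \<delta> i)) + real (card I) * G * (D1 * \<Delta>)\<^sup>2"
 proof -
  have "p s x - p t x = (\<Sum>i\<in>I. bump \<kappa> (a i s x) - bump \<kappa> (a i t x))" by (simp add: p_def sum_subtractf)
  also have "\<dots> \<le> (\<Sum>i\<in>I. - bump' \<kappa> (a i t x) * (a i t x \<bullet> \<delta> i) + G * (D1 * \<Delta>)\<^sup>2)"
  proof (rule sum_mono)
   fix i assume i: "i \<in> I"
   have "G * (norm (\<delta> i))\<^sup>2 \<le> G * (D1 * \<Delta>)\<^sup>2" using G1 \<delta>[OF i] by (intro mult_left_mono power_mono) auto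
   then show "bump \<kappa> (a i s x) - bump \<kappa> (a i t x) \<le> - bump' \<kappa> (a i t x) * (a i t x \<bullet> \<delta> i) + G * (D1 * \<Delta>)\<^sup>2"
    using G_bump_taylor[of "a i s x" "a i t x"] unfolding \<delta>_def by (simp add: abs_le_iff)
  qed
  finally show ?thesis unfolding sum.distrib by (simp add: mult.assoc)
 qed
 have lin: "- (k i t x * (a i t x \<bullet> \<delta> i)) \<le> - ((c t)\<^sup>2 * (k i t x * ((x - Z i t) \<bullet> e i))) + G * G * (D2 * \<Delta>\<^sup>2)" if i: "i \<in> I" for i
 proof -
  have "a i t x \<bullet> \<delta> i = a i t x \<bullet> (c t *\<^sub>R e i) + a i t x \<bullet> (\<delta> i - c t *\<^sub>R e i)" by (simp add: inner_diff_right)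
  then have "k i t x * (a i t x \<bullet> \<delta> i) = (c t)\<^sup>2 * (k i t x * ((x - Z i t) \<bullet> e i)) + k i t x * (a i t x \<bullet> (\<delta> i - c t *\<^sub>R e i))"
   by (simp add: distrib_left) (simp add: a_def power2_eq_square mult_ac)
  moreover have "\<bar>k i t x * (a i t x \<bullet> (\<delta> i - c t *\<^sub>R e i))\<bar> \<le> G * (G * (D2 * \<Delta>\<^sup>2))"
  proof -
   have "\<bar>k i t x * (a i t x \<bullet> (\<delta> i - c t *\<^sub>R e i))\<bar> \<le>
     \<bar>smooth_step' (p t x)\<bar> * (\<bar>bump' \<kappa> (a i t x)\<bar> * (norm (a i t x) * norm (\<delta> i - c t *\<^sub>R e i)))"
    unfolding k_def abs_mult mult.assoc by (intro mult_left_mono Cauchy_Schwarz_ineq2) auto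
   also have "\<dots> \<le> G * (G * (D2 * \<Delta>\<^sup>2))"
    unfolding mult.assoc[of "\<bar>bump' \<kappa> (a i t x)\<bar>", symmetric]
    using G1 res[OF i] by (intro mult_mono G_step' G_bump'_norm) auto
   finally show ?thesis .
  qed
  ultimately show ?thesis by (simp add: abs_le_iff mult.assoc)
 qed
 have S0: "0 \<le> smooth_step' (p t x)" by (rule smooth_step'_nonneg)
 have "\<psi> s x - \<psi> t x \<le> smooth_step' (p t x) * (p s x - p t x) + G * (p s x - p t x)\<^sup>2"
  using G_step_taylor[of "p s x" "p t x"] by (simp add: \<psi>_def abs_le_iff)
 also have "\<dots> \<le> smooth_step' (p t x) * ((\<Sum>i\<in>I. - bump' \<kappa> (a i t x) * (a i t x \<bullet> \<delta> i)) + real (card I) * G * (D1 * \<Delta>)\<^sup>2)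
   + G * (real (card I) * G * D1 * \<Delta>)\<^sup>2"
  using dp2 dp S0 G1 power_mono[OF dp, of 2] by (intro add_mono mult_left_mono) auto
 also have "\<dots> = (\<Sum>i\<in>I. - (k i t x * (a i t x \<bullet> \<delta> i))) + smooth_step' (p t x) * (real (card I) * G * (D1 * \<Delta>)\<^sup>2)
   + G * (real (card I) * G * D1 * \<Delta>)\<^sup>2"
  by (simp add: distrib_left sum_distrib_left k_def mult.assoc)
 also have "\<dots> \<le> (\<Sum>i\<in>I. - ((c t)\<^sup>2 * (k i t x * ((x - Z i t) \<bullet> e i))) + G * G * (D2 * \<Delta>\<^sup>2))
   + G * (real (card I) * G * (D1 * \<Delta>)\<^sup>2) + G * (real (card I) * G * D1 * \<Delta>)\<^sup>2"
  using lin G_step'[of "p t x"] G1 by (intro add_mono sum_mono mult_right_mono) auto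
 also have "\<dots> = - \<xi> (\<lambda>i. Z i t - Z i s) (\<Lambda> * (t - s)) t x + Ct * \<Delta>\<^sup>2"
 proof -
  have xi: "\<xi> (\<lambda>i. Z i t - Z i s) (\<Lambda> * (t - s)) t x = (\<Sum>i\<in>I. (c t)\<^sup>2 * (k i t x * ((x - Z i t) \<bullet> e i)))"
   by (simp add: \<xi>_def e_def)
  show ?thesis unfolding xi sum.distrib sum_negf by (simp add: Ct_def power_mult_distrib distrib_right mult_ac) (simp add: distrib_left mult_ac)
 qed
 finally show ?thesis by (simp add: \<Delta>_def)
qed

lemma Ct_nonneg: "0 \<le> Ct"
 unfolding Ct_def D2_def using G1 r_pos R_nonneg Lambda
 by (intro add_nonneg_nonneg mult_nonneg_nonneg) auto

text \<open>The supersolution inequality. Up to freezing the velocities, the left side is minus the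
  material derivative of \<psi>. At \<open>y = x - Z i t\<close> the growth
  \<open>\<Lambda> * norm y\<close> outweighs the relative velocity, and the only defect is the
  displacement of the center between \<open>q\<close> and \<open>t\<close>.\<close>

lemma xi_psi_le:
 assumes q: "0 \<le> q" "q \<le> t" "t \<le> T" and x: "norm x \<le> R" and d: "B t - B q \<le> \<Delta>" "0 \<le> \<Delta>"
  and lip: "\<And>x y. norm (u q x - u q y) \<le> L * norm (x - y)"
  and err: "\<And>i. i \<in> I \<Longrightarrow> norm (u q (Z i q) - v i q) \<le> (\<Lambda> - L) * (r * exp (\<Lambda> * q))"
 shows "- \<xi> (\<lambda>i. v i q) \<Lambda> t x - grad (\<psi> t) x (u q x)
  \<le> real (card I) * ((1 / r)\<^sup>2 * (G * G * (2 * R * (L * \<Delta>))))"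
proof -
 have tT: "t \<in> {0..T}" using q by auto
 have "- \<xi> (\<lambda>i. v i q) \<Lambda> t x - grad (\<psi> t) x (u q x) =
   (\<Sum>i\<in>I. (c t)\<^sup>2 * (k i t x * ((x - Z i t) \<bullet> (u q x - v i q - \<Lambda> *\<^sub>R (x - Z i t)))))"
  by (simp add: \<xi>_def psi_derivative sum_negf[symmetric] sum_subtractf[symmetric] algebra_simps inner_diff_right inner_add_right)
 also have "\<dots> \<le> (\<Sum>i\<in>I. (1 / r)\<^sup>2 * (G * G * (2 * R * (L * \<Delta>))))"
 proof (rule sum_mono)
  fix i assume i: "i \<in> I"
  let ?y = "x - Z i t"
  have y: "norm ?y \<le> 2 * R" using Z_le_R[OF i tT] x norm_triangle_ineq4[of x "Z i t"] by linarith
  have c2: "(c t)\<^sup>2 \<le> (1 / r)\<^sup>2" using c_le[of t] tT c_pos[of t] by (intro power_mono) auto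
  have kk: "k i t x \<le> G * G" using k_le[of i t x] by linarith
  \<comment> \<open>Inside the ball the weight \<open>k\<close> vanishes. Outside, the current
    radius is at most \<open>norm ?y\<close>, so the error allowed at the center is at most
    \<open>(\<Lambda> - L) * norm ?y\<close>.\<close>
  have "k i t x * (?y \<bullet> (u q x - v i q - \<Lambda> *\<^sub>R ?y)) \<le> G * G * (2 * R * (L * \<Delta>))"
  proof (cases "norm (a i t x) \<le> 1")
   case True
   then have "k i t x = 0" using bump'_eq_0[OF kappa, of "a i t x"] by (simp add: k_def)
   then show ?thesis using G1 R_nonneg L_nonneg d by simp
  next
   case False
   have "exp (\<Lambda> * q) \<le> exp (\<Lambda> * t)" using q Lambda by (auto intro: mult_left_mono)
   moreover have "r * exp (\<Lambda> * t) \<le> norm ?y"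
   proof -
    have "1 \<le> c t * norm ?y" using False c_pos[of t] by (simp add: a_def)
    then have "r * exp (\<Lambda> * t) * 1 \<le> r * exp (\<Lambda> * t) * (c t * norm ?y)"
     using r_pos by (intro mult_left_mono) auto
    also have "\<dots> = norm ?y" using r_pos by (simp add: c_def exp_minus)
    finally show ?thesis by simp
   qed
   ultimately have ry: "r * exp (\<Lambda> * q) \<le> norm ?y"
    using mult_left_mono[of "exp (\<Lambda> * q)" "exp (\<Lambda> * t)" r] r_pos by linarith
   have LL: "0 \<le> \<Lambda> - L"
   proof -
    have "0 \<le> (\<Lambda> - L) * (r * exp (\<Lambda> * q))" using err[OF i] norm_ge_zero order.trans by blast
    moreover have "0 < r * exp (\<Lambda> * q)" using r_pos by simp
    ultimately show ?thesis using mult_neg_pos[of "\<Lambda> - L" "r * exp (\<Lambda> * q)"] by linarith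
   qed
   have dist: "norm (x - Z i q) \<le> norm ?y + \<Delta>"
    using Z_diff[OF i q] d norm_triangle_ineq[of ?y "Z i t - Z i q"] by simp
   have "norm (u q x - v i q) \<le> norm (u q x - u q (Z i q)) + norm (u q (Z i q) - v i q)"
    using norm_triangle_ineq[of "u q x - u q (Z i q)" "u q (Z i q) - v i q"] by simp
   also have "\<dots> \<le> L * (norm ?y + \<Delta>) + (\<Lambda> - L) * norm ?y"
    using order.trans[OF lip mult_left_mono[OF dist L_nonneg]] order.trans[OF err[OF i] mult_left_mono[OF ry LL]]
    by (intro add_mono)
   also have "\<dots> = \<Lambda> * norm ?y + L * \<Delta>" by (simp add: algebra_simps)
   finally have uv: "norm (u q x - v i q) \<le> \<Lambda> * norm ?y + L * \<Delta>" .
   have "?y \<bullet> (u q x - v i q - \<Lambda> *\<^sub>R ?y) = ?y \<bullet> (u q x - v i q) - \<Lambda> * (norm ?y)\<^sup>2"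
    by (simp add: inner_diff_right power2_norm_eq_inner)
   also have "\<dots> \<le> norm ?y * (\<Lambda> * norm ?y + L * \<Delta>) - \<Lambda> * (norm ?y)\<^sup>2"
    using order.trans[OF norm_cauchy_schwarz mult_left_mono[OF uv norm_ge_zero]] by simp
   also have "\<dots> = norm ?y * (L * \<Delta>)" by (simp add: algebra_simps power2_eq_square)
   also have "\<dots> \<le> 2 * R * (L * \<Delta>)" using y L_nonneg d by (intro mult_right_mono) auto
   finally have 1: "?y \<bullet> (u q x - v i q - \<Lambda> *\<^sub>R ?y) \<le> 2 * R * (L * \<Delta>)" .
   have "k i t x * (?y \<bullet> (u q x - v i q - \<Lambda> *\<^sub>R ?y)) \<le> k i t x * (2 * R * (L * \<Delta>))"
    using 1 k_nonneg by (intro mult_left_mono) auto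
   also have "\<dots> \<le> G * G * (2 * R * (L * \<Delta>))" using kk R_nonneg L_nonneg d by (intro mult_right_mono) auto
   finally show ?thesis .
  qed
  then have "(c t)\<^sup>2 * (k i t x * (?y \<bullet> (u q x - v i q - \<Lambda> *\<^sub>R ?y))) \<le> (c t)\<^sup>2 * (G * G * (2 * R * (L * \<Delta>)))"
   by (intro mult_left_mono) auto
  also have "\<dots> \<le> (1 / r)\<^sup>2 * (G * G * (2 * R * (L * \<Delta>)))"
   using c2 G1 R_nonneg L_nonneg d by (intro mult_right_mono) auto
  finally show "(c t)\<^sup>2 * (k i t x * (?y \<bullet> (u q x - v i q - \<Lambda> *\<^sub>R ?y))) \<le> (1 / r)\<^sup>2 * (G * G * (2 * R * (L * \<Delta>)))" .
 qed
 finally show ?thesis by simp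
qed

lemma k_measurable: "k i t \<in> borel_measurable borel"
proof -
 have "(k i t has_derivative grad (k i t) x) (at x)" for x
  by (rule has_derivative_frechet[OF times_differentiable_k])
 then have "continuous_on UNIV (k i t)" by (intro has_derivative_continuous_on) (rule has_derivative_at_withinI)
 then show ?thesis by (rule borel_measurable_continuous_onI)
qed

text \<open>\<open>J\<close> and \<open>Q\<close> are the coefficients of the linear functional that
  takes center velocities and a growth rate to the integral of \<xi> against the density. They do
  not depend on the time at which the velocities are taken.\<close>

definition J :: "real \<Rightarrow> real \<Rightarrow> 'i \<Rightarrow> 'a" where
 "J s t i = (LINT x|lborel. ((c t)\<^sup>2 * k i t x * \<rho> s x) *\<^sub>R (x - Z i t))"
definition Q :: "real \<Rightarrow> real \<Rightarrow> 'i \<Rightarrow> real" where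
 "Q s t i = (LINT x|lborel. (c t)\<^sup>2 * k i t x * ((x - Z i t) \<bullet> (x - Z i t)) * \<rho> s x)"

lemma xi_integral:
 assumes s: "s \<in> {0..T}" and t: "t \<in> {0..T}"
 shows "(LINT x|lborel. \<xi> w l t x * \<rho> s x) = (\<Sum>i\<in>I. J s t i \<bullet> w i + l * Q s t i)"
proof -
 note [measurable] = continuity_solution_density(1)[OF solution s] k_measurable
 have y: "norm (x - Z i t) \<le> 2 * R" if "i \<in> I" "norm x \<le> R" for i x
  using Z_le_R[OF that(1) t] that norm_triangle_ineq4[of x "Z i t"] by linarith
 have Jint: "integrable lborel (\<lambda>x. ((c t)\<^sup>2 * k i t x * \<rho> s x) *\<^sub>R (x - Z i t))" if i: "i \<in> I" for i
 proof (rule Bochner_Integration.integrable_bound)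
  show "integrable lborel (\<lambda>x::'a. ((c t)\<^sup>2 * (G * G) * M) * (2 * R) * indicator (cball 0 R) x)"
   by (intro integrable_mult_right integrable_indicator_cball)
  show "(\<lambda>x. ((c t)\<^sup>2 * k i t x * \<rho> s x) *\<^sub>R (x - Z i t)) \<in> borel_measurable lborel" by measurable
  show "AE x in lborel. norm (((c t)\<^sup>2 * k i t x * \<rho> s x) *\<^sub>R (x - Z i t)) \<le>
    norm (((c t)\<^sup>2 * (G * G) * M) * (2 * R) * indicator (cball 0 R) x)"
   using continuity_solution_density(2)[OF solution s]
  proof eventually_elim
   case (elim x)
   show ?case
   proof (cases "norm x \<le> R")
    case True
    have "\<bar>(c t)\<^sup>2 * k i t x * \<rho> s x\<bar> * norm (x - Z i t) \<le> ((c t)\<^sup>2 * (G * G) * M) * (2 * R)"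
     using elim k_le[of i t x] y[OF i True] M_nonneg R_nonneg G1
     unfolding abs_mult by (intro mult_mono) auto
    then show ?thesis using True M_nonneg R_nonneg G1 by simp
   next
    case False
    then show ?thesis using outside(3)[OF t _ i, of x] by simp
   qed
  qed
 qed
 have Qint: "integrable lborel (\<lambda>x. (c t)\<^sup>2 * k i t x * ((x - Z i t) \<bullet> (x - Z i t)) * \<rho> s x)" if i: "i \<in> I" for i
 proof (rule rho_integrable[OF s, where m = "(c t)\<^sup>2 * (G * G) * (2 * R)\<^sup>2"])
  fix x show "\<bar>(c t)\<^sup>2 * k i t x * ((x - Z i t) \<bullet> (x - Z i t))\<bar> \<le> (c t)\<^sup>2 * (G * G) * (2 * R)\<^sup>2"
  proof (cases "norm x \<le> R")
   case True
   have "(norm (x - Z i t))\<^sup>2 \<le> (2 * R)\<^sup>2" using y[OF i True] by (intro power_mono) auto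
   then show ?thesis
    using k_le[of i t x] G1 unfolding abs_mult dot_square_norm by (intro mult_mono) auto
  next
   case False
   then have "k i t x = 0" using outside(3)[OF t _ i, of x] by simp
   then show ?thesis using G1 by simp
  qed
 next
  fix x show "R < norm x \<Longrightarrow> (c t)\<^sup>2 * k i t x * ((x - Z i t) \<bullet> (x - Z i t)) = 0"
   using outside(3)[OF t _ i, of x] by simp
 qed measurable
 have Jw1: "integrable lborel (\<lambda>x. (((c t)\<^sup>2 * k i t x * \<rho> s x) *\<^sub>R (x - Z i t)) \<bullet> w i)" if "i \<in> I" for i
  by (rule integrable_inner_left) (rule Jint[OF that])
 have Jw2: "(LINT x|lborel. (((c t)\<^sup>2 * k i t x * \<rho> s x) *\<^sub>R (x - Z i t)) \<bullet> w i) = J s t i \<bullet> w i" if "i \<in> I" for i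
  unfolding J_def by (rule integral_inner_left) (rule Jint[OF that])
 note Jw = Jw1 Jw2
 have "(LINT x|lborel. \<xi> w l t x * \<rho> s x) = (LINT x|lborel. (\<Sum>i\<in>I. (((c t)\<^sup>2 * k i t x * \<rho> s x) *\<^sub>R (x - Z i t)) \<bullet> w i +
   l * ((c t)\<^sup>2 * k i t x * ((x - Z i t) \<bullet> (x - Z i t)) * \<rho> s x)))"
  by (intro Bochner_Integration.integral_cong) (auto simp: \<xi>_def sum_distrib_right sum_distrib_left inner_add_right distrib_left distrib_right mult_ac intro!: sum.cong)
 also have "\<dots> = (\<Sum>i\<in>I. (LINT x|lborel. (((c t)\<^sup>2 * k i t x * \<rho> s x) *\<^sub>R (x - Z i t)) \<bullet> w i +
   l * ((c t)\<^sup>2 * k i t x * ((x - Z i t) \<bullet> (x - Z i t)) * \<rho> s x)))"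
  using Jw Qint by (intro Bochner_Integration.integral_sum Bochner_Integration.integrable_add integrable_mult_right) auto
 also have "\<dots> = (\<Sum>i\<in>I. J s t i \<bullet> w i + l * Q s t i)"
 proof (rule sum.cong)
  fix i assume i: "i \<in> I"
  show "(LINT x|lborel. (((c t)\<^sup>2 * k i t x * \<rho> s x) *\<^sub>R (x - Z i t)) \<bullet> w i +
   l * ((c t)\<^sup>2 * k i t x * ((x - Z i t) \<bullet> (x - Z i t)) * \<rho> s x)) = J s t i \<bullet> w i + l * Q s t i"
   using Jw[OF i] Qint[OF i] by (subst Bochner_Integration.integral_add) (auto simp: Q_def)
 qed simp
 finally show ?thesis .
qed

text \<open>One step of the partition: the tested mass decreases by at most a multiple of the
  squared increment of \<open>B\<close>. First-order terms cancel by the supersolution inequality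
  and the weak equation for the fixed test function \<open>\<psi> t\<close>.\<close>

lemma psi_step:
 assumes st: "0 \<le> s" "s \<le> t" "t \<le> T"
 shows "(LINT x|lborel. \<psi> s x * \<rho> s x) - (LINT x|lborel. \<psi> t x * \<rho> t x) \<le>
  (Ct * M * measure lborel (cball 0 R :: 'a set) + M * Cx * (1 + L * R) * measure lborel (cball 0 R :: 'a set) +
  M * (real (card I) * ((1 / r)\<^sup>2 * (G * G * (2 * R * L)))) * measure lborel (cball 0 R :: 'a set)) * (B t - B s)\<^sup>2"
proof -
 let ?V = "measure lborel (cball 0 R :: 'a set)"
 define \<Delta> where "\<Delta> = B t - B s"
 have Delta: "0 \<le> \<Delta>" using B_mono[OF st] by (simp add: \<Delta>_def)
 have sT: "s \<in> {0..T}" and tT: "t \<in> {0..T}" using st by auto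
 let ?h = "\<lambda>q. LINT x|lborel. \<rho> q x * grad (\<psi> t) x (u q x)"
 let ?w = "\<lambda>i. Z i t - Z i s"
 define A1 where "A1 = M * Cx * (1 + L * R) * ?V"
 define A2 where "A2 = M * (real (card I) * ((1 / r)\<^sup>2 * (G * G * (2 * R * L)))) * ?V"
 have A1: "0 \<le> A1" unfolding A1_def using M_nonneg Cx_nonneg L_nonneg R_nonneg by simp
 have A2: "0 \<le> A2" unfolding A2_def using M_nonneg G1 L_nonneg R_nonneg by simp
 have xi_int: "integrable lborel (\<lambda>x. \<xi> w l t x * \<rho> q x)" if "q \<in> {0..T}" for w l q
  by (rule test_rho_integrable[OF that test_function_xi[OF tT] outside(4)[OF tT]])
 \<comment> \<open>Change of the test function with the density held at time
   \<open>s\<close>.\<close>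
 have 1: "(LINT x|lborel. \<psi> s x * \<rho> s x) - (LINT x|lborel. \<psi> t x * \<rho> s x) \<le>
   - (LINT x|lborel. \<xi> ?w (\<Lambda> * (t - s)) t x * \<rho> s x) + Ct * \<Delta>\<^sup>2 * M * ?V"
 proof -
  note i1 = test_rho_integrable[OF sT test_function_psi[OF sT] outside(2)[OF sT]]
   test_rho_integrable[OF sT test_function_psi[OF tT] outside(2)[OF tT]]
  note i2 = xi_int[OF sT, of ?w "\<Lambda> * (t - s)"]
  have "(LINT x|lborel. \<psi> s x * \<rho> s x - \<psi> t x * \<rho> s x + \<xi> ?w (\<Lambda> * (t - s)) t x * \<rho> s x) \<le>
   (LINT x|lborel. Ct * \<Delta>\<^sup>2 * M * indicator (cball (0::'a) R) x)"
  proof (rule integral_mono_AE)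
   show "AE x in lborel. \<psi> s x * \<rho> s x - \<psi> t x * \<rho> s x + \<xi> ?w (\<Lambda> * (t - s)) t x * \<rho> s x \<le>
     Ct * \<Delta>\<^sup>2 * M * indicator (cball (0::'a) R) x"
    using continuity_solution_density(2)[OF solution sT]
   proof eventually_elim
    case (elim x)
    show ?case
    proof (cases "norm x \<le> R")
     case True
     have "\<psi> s x - \<psi> t x + \<xi> ?w (\<Lambda> * (t - s)) t x \<le> Ct * \<Delta>\<^sup>2"
      using psi_taylor[OF st True] by (simp add: \<Delta>_def)
     then have "(\<psi> s x - \<psi> t x + \<xi> ?w (\<Lambda> * (t - s)) t x) * \<rho> s x \<le> Ct * \<Delta>\<^sup>2 * M"
      using elim Ct_nonneg by (intro order.trans[OF mult_right_mono mult_left_mono]) auto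
     then show ?thesis using True by (simp add: algebra_simps)
    next
     case False
     then show ?thesis using outside(2)[OF sT, of x] outside(2)[OF tT, of x] outside(4)[OF tT, of x] by simp
    qed
   qed
  qed (use i1 i2 integrable_indicator_cball in auto)
  then show ?thesis using i1 i2 by simp
 qed
 \<comment> \<open>The comparison with the flux at an intermediate time: \<open>A1\<close> pays for
   moving the density from \<open>q\<close> to \<open>s\<close>, \<open>A2\<close> for the defect in
   the supersolution inequality.\<close>
 have 2: "- (\<Sum>i\<in>I. J s t i \<bullet> v i q + \<Lambda> * Q s t i) \<le> ?h q + (A1 + A2) * \<Delta> * b q"
  if q: "q \<in> {s..t}" and lip: "\<And>x y. norm (u q x - u q y) \<le> L * norm (x - y)" and u0: "norm (u q 0) \<le> b q"
   and err: "\<And>i. i \<in> I \<Longrightarrow> norm (u q (Z i q) - v i q) \<le> (\<Lambda> - L) * (r * exp (\<Lambda> * q))"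
   and vb: "\<And>i. i \<in> I \<Longrightarrow> norm (v i q) \<le> b q" for q
 proof -
  let ?v = "\<lambda>i. v i q"
  have qT: "q \<in> {0..T}" using q st by auto
  have Bq: "B t - B q \<le> \<Delta>" "B q - B s \<le> \<Delta>"
   using B_mono[of s q] B_mono[of q t] q st by (auto simp: \<Delta>_def)
  have "\<bar>(LINT x|lborel. \<xi> ?v \<Lambda> t x * \<rho> q x) - (LINT x|lborel. \<xi> ?v \<Lambda> t x * \<rho> s x)\<bar> \<le>
    M * (Cx * b q) * (1 + L * R) * ?V * (B q - B s)"
   by (rule weak_increment_le[OF solution M_nonneg test_function_xi[OF tT] outside(4)[OF tT] R_nonneg])
    (use xi_derivative_le[OF tT _ vb b_ge_1] q st Cx_nonneg b_ge_1[of q] in auto)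
  also have "\<dots> \<le> M * (Cx * b q) * (1 + L * R) * ?V * \<Delta>"
   using Bq M_nonneg Cx_nonneg b_ge_1[of q] L_nonneg R_nonneg by (intro mult_left_mono) auto
  also have "\<dots> = A1 * \<Delta> * b q" by (simp add: A1_def mult_ac)
  finally have 3: "- (LINT x|lborel. \<xi> ?v \<Lambda> t x * \<rho> s x) \<le> - (LINT x|lborel. \<xi> ?v \<Lambda> t x * \<rho> q x) + A1 * \<Delta> * b q" by linarith
  have um: "u q \<in> borel_measurable borel"
   using lip L_nonneg by (intro borel_measurable_continuous_onI lipschitz_on_continuous_on[OF lipschitz_onI[of _ _ L]]) (auto simp: dist_norm)
  have "integrable lborel (\<lambda>x. grad (\<psi> t) x (u q x) * \<rho> q x)"
  proof -
   obtain g where g: "g > 0" "\<And>x w. \<bar>grad (\<psi> t) x w\<bar> \<le> g * norm w"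
    using test_function_gradient_bounded[OF test_function_psi[OF tT]] by blast
   show ?thesis
   proof (rule rho_integrable[OF qT, where m = "g * (b q + L * R)"])
    show "(\<lambda>x. grad (\<psi> t) x (u q x)) \<in> borel_measurable borel"
     using test_function_psi[OF tT] um by measurable
    fix x show "\<bar>grad (\<psi> t) x (u q x)\<bar> \<le> g * (b q + L * R)"
    proof (cases "norm x \<le> R")
     case True
     have "norm (u q x) \<le> b q + L * norm x" using lip[of x 0] u0 norm_triangle_sub[of "u q x" "u q 0"] by simp
     also have "\<dots> \<le> b q + L * R" using True L_nonneg by (simp add: mult_left_mono)
     finally show ?thesis using order.trans[OF g(2) mult_left_mono] g(1) by simp
    next
     case False
     then show ?thesis using frechet_derivative_outside[of R "\<psi> t" x, OF outside(2)[OF tT]] g b_ge_1[of q] L_nonneg R_nonneg by simp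
    qed
    show "R < norm x \<Longrightarrow> grad (\<psi> t) x (u q x) = 0"
     using frechet_derivative_outside[of R "\<psi> t" x, OF outside(2)[OF tT]] by simp
   qed
  qed
  then have hint: "integrable lborel (\<lambda>x. \<rho> q x * grad (\<psi> t) x (u q x))" by (simp add: mult.commute)
  have "(LINT x|lborel. - (\<xi> ?v \<Lambda> t x * \<rho> q x) - \<rho> q x * grad (\<psi> t) x (u q x)) \<le>
   (LINT x|lborel. (real (card I) * ((1 / r)\<^sup>2 * (G * G * (2 * R * (L * \<Delta>))))) * M * indicator (cball (0::'a) R) x)"
  proof (rule integral_mono_AE)
   show "AE x in lborel. - (\<xi> ?v \<Lambda> t x * \<rho> q x) - \<rho> q x * grad (\<psi> t) x (u q x) \<le>
     (real (card I) * ((1 / r)\<^sup>2 * (G * G * (2 * R * (L * \<Delta>))))) * M * indicator (cball (0::'a) R) x"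
    using continuity_solution_density(2)[OF solution qT]
   proof eventually_elim
    case (elim x)
    show ?case
    proof (cases "norm x \<le> R")
     case True
     have "- \<xi> ?v \<Lambda> t x - grad (\<psi> t) x (u q x) \<le> real (card I) * ((1 / r)\<^sup>2 * (G * G * (2 * R * (L * \<Delta>))))"
      using q st by (intro xi_psi_le True Bq Delta lip err) auto
     then have "(- \<xi> ?v \<Lambda> t x - grad (\<psi> t) x (u q x)) * \<rho> q x \<le> real (card I) * ((1 / r)\<^sup>2 * (G * G * (2 * R * (L * \<Delta>)))) * M"
      using elim G1 R_nonneg L_nonneg Delta by (intro order.trans[OF mult_right_mono mult_left_mono]) auto
     then show ?thesis using True by (simp add: algebra_simps)
    next
     case False
     then show ?thesis using outside(4)[OF tT, of x] frechet_derivative_outside[of R "\<psi> t" x, OF outside(2)[OF tT]] by simp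
    qed
   qed
  qed (use hint xi_int[OF qT] integrable_indicator_cball in auto)
  then have "- (LINT x|lborel. \<xi> ?v \<Lambda> t x * \<rho> q x) \<le> ?h q + A2 * \<Delta>"
   using hint xi_int[OF qT, of ?v \<Lambda>] by (simp add: A2_def algebra_simps)
  moreover have "A2 * \<Delta> \<le> A2 * \<Delta> * b q"
   using mult_left_mono[OF b_ge_1[of q], of "A2 * \<Delta>"] A2 Delta by simp
  ultimately show ?thesis using 3 unfolding xi_integral[OF sT tT] by (simp add: algebra_simps)
 qed
 have vint: "set_integrable lborel {s..t} (v i)" if "i \<in> I" for i
  by (rule set_integrable_subset[OF v_integrable[OF that]]) (use st in auto)
 \<comment> \<open>Linearity turns the time integral of the velocities into the displacement that
   occurs in the Taylor expansion.\<close>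
 have Jv: "set_integrable lborel {s..t} (\<lambda>q. J s t i \<bullet> v i q + \<Lambda> * Q s t i)"
  "(LINT q:{s..t}|lborel. J s t i \<bullet> v i q + \<Lambda> * Q s t i) = J s t i \<bullet> (Z i t - Z i s) + \<Lambda> * (t - s) * Q s t i" if i: "i \<in> I" for i
 proof -
  have vi: "integrable lborel (\<lambda>q. indicator {s..t} q *\<^sub>R v i q)" using vint[OF i] by (simp add: set_integrable_def)
  have e: "indicator {s..t} q *\<^sub>R (J s t i \<bullet> v i q) = J s t i \<bullet> (indicator {s..t} q *\<^sub>R v i q)" for q by simp
  have 1: "set_integrable lborel {s..t} (\<lambda>q. J s t i \<bullet> v i q)"
   unfolding set_integrable_def e using vi by (rule integrable_inner_right)
  have 2: "set_integrable lborel {s..t} (\<lambda>q. \<Lambda> * Q s t i)" by (rule borel_integrable_atLeastAtMost') simp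
  show "set_integrable lborel {s..t} (\<lambda>q. J s t i \<bullet> v i q + \<Lambda> * Q s t i)" by (rule set_integral_add(1)[OF 1 2])
  have "(LINT q:{s..t}|lborel. J s t i \<bullet> v i q) = J s t i \<bullet> (LINT q:{s..t}|lborel. v i q)"
   unfolding set_lebesgue_integral_def e using vi by (intro integral_inner_right) auto
  also have "(LINT q:{s..t}|lborel. v i q) = Z i t - Z i s" using Z_eq[OF i st] by simp
  finally show "(LINT q:{s..t}|lborel. J s t i \<bullet> v i q + \<Lambda> * Q s t i) = J s t i \<bullet> (Z i t - Z i s) + \<Lambda> * (t - s) * Q s t i"
   using st by (simp add: set_integral_add(2)[OF 1 2]) (simp add: set_lebesgue_integral_def)
 qed
 have Jsum: "set_integrable lborel {s..t} (\<lambda>q. - (\<Sum>i\<in>I. J s t i \<bullet> v i q + \<Lambda> * Q s t i))"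
 proof -
  have e: "indicator {s..t} q *\<^sub>R (- (\<Sum>i\<in>I. J s t i \<bullet> v i q + \<Lambda> * Q s t i)) =
    - (\<Sum>i\<in>I. indicator {s..t} q *\<^sub>R (J s t i \<bullet> v i q + \<Lambda> * Q s t i))" for q :: real
   by (simp only: scaleR_minus_right scaleR_sum_right)
  show ?thesis unfolding set_integrable_def e
   by (intro Bochner_Integration.integrable_minus Bochner_Integration.integrable_sum)
    (use Jv(1) in \<open>simp only: set_integrable_def\<close>)
 qed
 have "(LINT q:{s..t}|lborel. - (\<Sum>i\<in>I. J s t i \<bullet> v i q + \<Lambda> * Q s t i)) \<le>
   (LINT q:{s..t}|lborel. ?h q + (A1 + A2) * \<Delta> * b q)"
 proof (rule set_integral_mono_AE[OF Jsum])
  show "set_integrable lborel {s..t} (\<lambda>q. ?h q + (A1 + A2) * \<Delta> * b q)"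
   using continuity_solution_weak(1)[OF solution test_function_psi[OF tT] st] b_integrable_sub[OF st(1,3)]
   by (intro set_integral_add) auto
  show "AE q\<in>{s..t} in lborel. - (\<Sum>i\<in>I. J s t i \<bullet> v i q + \<Lambda> * Q s t i) \<le> ?h q + (A1 + A2) * \<Delta> * b q"
   using u_lipschitz v_le error
  proof eventually_elim
   case (elim q)
   show ?case
   proof
    assume q: "q \<in> {s..t}"
    then have "q \<in> {0..T}" using st by auto
    then show "- (\<Sum>i\<in>I. J s t i \<bullet> v i q + \<Lambda> * Q s t i) \<le> ?h q + (A1 + A2) * \<Delta> * b q"
     using elim by (intro 2[OF q]) auto
   qed
  qed
 qed
 also have "(LINT q:{s..t}|lborel. ?h q + (A1 + A2) * \<Delta> * b q) = (LINT q:{s..t}|lborel. ?h q) + (A1 + A2) * \<Delta> * \<Delta>"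
  using continuity_solution_weak(1)[OF solution test_function_psi[OF tT] st] b_integrable_sub[OF st(1,3)] B_diff[OF st]
  by (subst set_integral_add) (auto simp: \<Delta>_def)
 also have "(LINT q:{s..t}|lborel. ?h q) = (LINT x|lborel. \<psi> t x * \<rho> t x) - (LINT x|lborel. \<psi> t x * \<rho> s x)"
  using continuity_solution_weak(2)[OF solution test_function_psi[OF tT] st] by simp
 also have "(LINT q:{s..t}|lborel. - (\<Sum>i\<in>I. J s t i \<bullet> v i q + \<Lambda> * Q s t i)) = - (\<Sum>i\<in>I. (LINT q:{s..t}|lborel. J s t i \<bullet> v i q + \<Lambda> * Q s t i))"
  using Jv(1) unfolding set_integrable_def set_lebesgue_integral_def
  by (simp add: sum_distrib_left Bochner_Integration.integral_sum)
 also have "\<dots> = - (LINT x|lborel. \<xi> ?w (\<Lambda> * (t - s)) t x * \<rho> s x)"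
  using Jv(2) by (simp add: xi_integral[OF sT tT])
 finally have "- (LINT x|lborel. \<xi> ?w (\<Lambda> * (t - s)) t x * \<rho> s x) \<le>
   (LINT x|lborel. \<psi> t x * \<rho> t x) - (LINT x|lborel. \<psi> t x * \<rho> s x) + (A1 + A2) * \<Delta> * \<Delta>" by simp
 with 1 have "(LINT x|lborel. \<psi> s x * \<rho> s x) - (LINT x|lborel. \<psi> t x * \<rho> t x) \<le> Ct * \<Delta>\<^sup>2 * M * ?V + (A1 + A2) * \<Delta> * \<Delta>" by simp
 then show ?thesis by (simp add: A1_def A2_def \<Delta>_def power2_eq_square algebra_simps)
qed

end

lemma psi_integral_mono: "(LINT x|lborel. \<psi> 0 x * \<rho> 0 x) \<le> (LINT x|lborel. \<psi> T x * \<rho> T x)"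
proof -
 obtain G where G: "1 \<le> G" "\<And>a::'a. \<bar>bump' \<kappa> a\<bar> \<le> G"
  "\<And>a::'a. \<bar>bump' \<kappa> a\<bar> * norm a \<le> G"
  "\<And>(a::'a) w. \<bar>grad (bump' \<kappa>) a w\<bar> \<le> G * norm w"
  "\<And>(a::'a) a'. \<bar>bump \<kappa> a' - bump \<kappa> a + bump' \<kappa> a * (a \<bullet> (a' - a))\<bar> \<le> G * (norm (a' - a))\<^sup>2"
  "\<And>(a::'a) a'. \<bar>bump \<kappa> a' - bump \<kappa> a\<bar> \<le> G * norm (a' - a)"
  "\<And>s. \<bar>smooth_step' s\<bar> \<le> G"
  "\<And>s w. \<bar>grad smooth_step' s w\<bar> \<le> G * \<bar>w\<bar>"
  "\<And>s s'. \<bar>smooth_step s' - smooth_step s - smooth_step' s * (s' - s)\<bar> \<le> G * (s' - s)\<^sup>2"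
  by (rule bump_constants[OF kappa]) (rule that)
 have "- (LINT x|lborel. \<psi> T x * \<rho> T x) \<le> - (LINT x|lborel. \<psi> 0 x * \<rho> 0 x)"
  by (rule quadratic_increments_imp_le[OF T_nonneg B_continuous B_mono,
    where g = "\<lambda>t. - (LINT x|lborel. \<psi> t x * \<rho> t x)"]) (use psi_step[OF G] in auto)
 then show ?thesis by simp
qed

lemma psi_final:
 "0 \<le> \<psi> T x" "\<psi> T x \<le> indicator (\<Union>i\<in>I. ball (Z i T) (\<kappa> * r * exp (\<Lambda> * T))) x"
proof -
 show "0 \<le> \<psi> T x" by (simp add: \<psi>_def smooth_step_bounds)
 have out: "\<psi> T x = 0" if "x \<notin> (\<Union>i\<in>I. ball (Z i T) (\<kappa> * r * exp (\<Lambda> * T)))"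
 proof -
  have "bump \<kappa> (a i T x) = 0" if i: "i \<in> I" for i
  proof (rule bump_eq_0[OF kappa])
   have "\<kappa> * r * exp (\<Lambda> * T) \<le> norm (x - Z i T)"
    using \<open>x \<notin> _\<close> i by (auto simp: dist_norm norm_minus_commute)
   then have "c T * (\<kappa> * r * exp (\<Lambda> * T)) \<le> c T * norm (x - Z i T)"
    using c_pos[of T] by (intro mult_left_mono) auto
   moreover have "c T * (\<kappa> * r * exp (\<Lambda> * T)) = \<kappa>" using r_pos by (simp add: c_def exp_minus)
   ultimately show "\<kappa> \<le> norm (a i T x)" using c_pos[of T] by (simp add: a_def)
  qed
  then show ?thesis by (simp add: \<psi>_def p_def smooth_step_0)
 qed
 have "\<psi> T x \<le> 1" by (simp add: \<psi>_def smooth_step_bounds)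
 then show "\<psi> T x \<le> indicator (\<Union>i\<in>I. ball (Z i T) (\<kappa> * r * exp (\<Lambda> * T))) x"
  using out by (cases "x \<in> (\<Union>i\<in>I. ball (Z i T) (\<kappa> * r * exp (\<Lambda> * T)))") auto
qed

lemma psi_rho_integrable: "t \<in> {0..T} \<Longrightarrow> integrable lborel (\<lambda>x. \<psi> t x * \<rho> t x)"
 by (rule rho_integrable[OF _ test_function_measurable[OF test_function_psi], where m = 1])
  (auto simp: outside \<psi>_def smooth_step_bounds smooth_step_0)

text \<open>Kept with the smooth function on the right, because the maximum principle compares the
  initial density only against test functions.\<close>

lemma initial_balls_le_psi:
 "(LINT x|lborel. indicator (\<Union>i\<in>I. cball (Z i 0) r) x * \<rho> 0 x) \<le> (LINT x|lborel. \<psi> T x * \<rho> T x)"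
proof -
 have z: "0 \<in> {0..T}" using T_nonneg by auto
 have in1: "\<psi> 0 x = 1" if "i \<in> I" "x \<in> cball (Z i 0) r" for i x
 proof -
  have "norm (a i 0 x) \<le> 1"
   using that r_pos by (simp add: a_def c_def dist_norm norm_minus_commute divide_simps)
  then have "bump \<kappa> (a i 0 x) = 1" by (rule bump_eq_1[OF kappa])
  moreover have "bump \<kappa> (a i 0 x) \<le> p 0 x"
   unfolding p_def using finite_I that(1) bump_bounds by (intro member_le_sum) auto
  ultimately show ?thesis by (simp add: \<psi>_def smooth_step_1)
 qed
 have psi01: "0 \<le> \<psi> t x" for t x by (simp add: \<psi>_def smooth_step_bounds)
 have "(LINT x|lborel. indicator (\<Union>i\<in>I. cball (Z i 0) r) x * \<rho> 0 x) \<le> (LINT x|lborel. \<psi> 0 x * \<rho> 0 x)"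
 proof (rule integral_mono_AE')
  show "AE x in lborel. indicator (\<Union>i\<in>I. cball (Z i 0) r) x * \<rho> 0 x \<le> \<psi> 0 x * \<rho> 0 x"
   using continuity_solution_density(2)[OF solution z]
   by eventually_elim (use in1 psi01 in \<open>auto simp: indicator_def intro!: mult_nonneg_nonneg\<close>)
  show "AE x in lborel. 0 \<le> \<psi> 0 x * \<rho> 0 x"
   using continuity_solution_density(2)[OF solution z]
   by eventually_elim (use psi01 in auto)
 qed (rule psi_rho_integrable[OF z])
 then show ?thesis using psi_integral_mono by simp
qed

theorem moving_balls_mono:
 "(LINT x|lborel. indicator (\<Union>i\<in>I. cball (Z i 0) r) x * \<rho> 0 x) \<le>
 (LINT x|lborel. indicator (\<Union>i\<in>I. ball (Z i T) (\<kappa> * r * exp (\<Lambda> * T))) x * \<rho> T x)"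
proof -
 have z: "T \<in> {0..T}" using T_nonneg by auto
 note initial_balls_le_psi
 also have "(LINT x|lborel. \<psi> T x * \<rho> T x) \<le> (LINT x|lborel. indicator (\<Union>i\<in>I. ball (Z i T) (\<kappa> * r * exp (\<Lambda> * T))) x * \<rho> T x)"
 proof (rule integral_mono_AE')
  show "integrable lborel (\<lambda>x. indicator (\<Union>i\<in>I. ball (Z i T) (\<kappa> * r * exp (\<Lambda> * T))) x * \<rho> T x)"
  proof (rule rho_integrable[OF z, where m = 1])
   show "(indicator (\<Union>i\<in>I. ball (Z i T) (\<kappa> * r * exp (\<Lambda> * T))) :: 'a \<Rightarrow> real) \<in> borel_measurable borel"
    by (intro borel_measurable_indicator borel_open open_UN) auto
   fix x :: 'a assume x: "R < norm x"
   have "x \<notin> ball (Z i T) (\<kappa> * r * exp (\<Lambda> * T))" if "i \<in> I" for i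
    using Z_le[OF that z] x norm_triangle_sub[of x "Z i T"] by (auto simp: dist_norm norm_minus_commute)
   then show "indicator (\<Union>i\<in>I. ball (Z i T) (\<kappa> * r * exp (\<Lambda> * T))) x = (0::real)" by auto
  qed auto
  show "AE x in lborel. \<psi> T x * \<rho> T x \<le> indicator (\<Union>i\<in>I. ball (Z i T) (\<kappa> * r * exp (\<Lambda> * T))) x * \<rho> T x"
   using continuity_solution_density(2)[OF solution z]
   by eventually_elim (use psi_final in \<open>auto intro: mult_right_mono\<close>)
  show "AE x in lborel. 0 \<le> indicator (\<Union>i\<in>I. ball (Z i T) (\<kappa> * r * exp (\<Lambda> * T))) x * \<rho> T x"
   using continuity_solution_density(2)[OF solution z]
   by eventually_elim auto
 qed
 finally show ?thesis .
qed

end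

section \<open>Maximum principle\<close>

lemma AE_reflect:
 assumes "AE t in lborel. P (t :: real)"
 shows "AE t in lborel. P (T - t)"
proof -
 obtain N where N: "{t. \<not> P t} \<subseteq> N" "N \<in> null_sets lborel"
  using assms by (auto simp: eventually_ae_filter)
 have "AE t in lborel. t \<notin> N" using N(2) by (rule AE_not_in)
 then have "AE t in lborel. T + (-1) * t \<notin> N"
  using N(2) by (intro AE_borel_affine) (auto simp: null_sets_def)
 then show ?thesis by eventually_elim (use N(1) in auto)
qed

lemma set_integral_reflect:
 fixes f :: "real \<Rightarrow> 'b::euclidean_space"
 shows "set_integrable lborel {s..t} (\<lambda>q. f (T - q)) \<longleftrightarrow> set_integrable lborel {T - t..T - s} f"
  "(LINT q:{s..t}|lborel. f (T - q)) = (LINT q:{T - t..T - s}|lborel. f q)"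
proof -
 have e: "indicator {s..t} q *\<^sub>R f (T - q) = (\<lambda>q. indicator {T - t..T - s} q *\<^sub>R f q) (T + (-1) * q)" for q
  by (auto simp: indicator_def)
 show "set_integrable lborel {s..t} (\<lambda>q. f (T - q)) \<longleftrightarrow> set_integrable lborel {T - t..T - s} f"
  unfolding set_integrable_def e by (rule lborel_integrable_real_affine_iff) simp
 show "(LINT q:{s..t}|lborel. f (T - q)) = (LINT q:{T - t..T - s}|lborel. f q)"
  unfolding set_lebesgue_integral_def e
  using lborel_integral_real_affine[of "-1" "\<lambda>q. indicator {T - t..T - s} q *\<^sub>R f q" T] by simp
qed

text \<open>Joint measurability makes the velocity along a measurable curve measurable in time, as
  the Picard iteration requires.\<close>

locale measurable_velocity = lipschitz_velocity u T L b for u :: "real \<Rightarrow> 'a::euclidean_space \<Rightarrow> 'a" and T L b +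
 assumes u_measurable: "(\<lambda>(t, x). u t x) \<in> borel_measurable (borel \<Otimes>\<^sub>M borel)"
begin

lemma u_along_measurable: "Z \<in> borel_measurable borel \<Longrightarrow> (\<lambda>q. u q (Z q)) \<in> borel_measurable borel"
 using measurable_compose[OF _ u_measurable, of "\<lambda>q. (q, Z q)" borel] by simp

lemma u_le: "AE q\<in>{0..T} in lborel. (\<forall>x. norm (u q x) \<le> b q + L * norm x)"
 using u_lipschitz
proof eventually_elim
 case (elim q)
 show ?case
 proof (intro impI allI)
  fix x assume "q \<in> {0..T}"
  then have "norm (u q x - u q 0) \<le> L * norm (x - 0)" "norm (u q 0) \<le> b q" using elim by blast+
  then show "norm (u q x) \<le> b q + L * norm x" using norm_triangle_sub[of "u q x" "u q 0"] by simp
 qed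
qed

section \<open>Approximate trajectories by Picard iteration\<close>

lemma curve:
 assumes Zm: "continuous_on {0..T} Z"
 obtains R where "0 \<le> R" "set_integrable lborel {0..T} (\<lambda>q. u q (Z q))"
  "AE q\<in>{0..T} in lborel. norm (u q (Z q)) \<le> b q + R"
  "continuous_on {0..T} (\<lambda>t. y + (LINT q:{0..t}|lborel. u q (Z q)))"
proof -
 define Z' where "Z' q = indicator {0..T} q *\<^sub>R Z q" for q
 have Z'm: "Z' \<in> borel_measurable borel"
  unfolding Z'_def[abs_def] using Zm by (intro borel_measurable_continuous_on_indicator) auto
 have "bounded (Z ` {0..T})" by (intro compact_imp_bounded compact_continuous_image Zm) simp
 then obtain R0 where R0: "R0 > 0" "\<And>q. q \<in> {0..T} \<Longrightarrow> norm (Z q) \<le> R0"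
  by (auto simp: bounded_pos)
 have bd: "AE q\<in>{0..T} in lborel. norm (u q (Z q)) \<le> b q + L * R0"
  using u_le
 proof eventually_elim
  case (elim q)
  show ?case
  proof
   assume q: "q \<in> {0..T}"
   then have "norm (u q (Z q)) \<le> b q + L * norm (Z q)" using elim by blast
   then show "norm (u q (Z q)) \<le> b q + L * R0" using mult_left_mono[OF R0(2)[OF q] L_nonneg] by linarith
  qed
 qed
 have int: "set_integrable lborel {0..T} (\<lambda>q. u q (Z q))"
 proof -
  have "set_integrable lborel {0..T} (\<lambda>q. b q + L * R0)"
   by (intro set_integral_add b_integrable borel_integrable_atLeastAtMost') simp
  then have "integrable lborel (\<lambda>q. indicator {0..T} q *\<^sub>R (b q + L * R0))" by (simp add: set_integrable_def)
  then have "integrable lborel (\<lambda>q. indicator {0..T} q *\<^sub>R u q (Z' q))"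
  proof (rule Bochner_Integration.integrable_bound)
   show "(\<lambda>q. indicator {0..T} q *\<^sub>R u q (Z' q)) \<in> borel_measurable lborel"
    using u_along_measurable[OF Z'm] by simp
   show "AE q in lborel. norm (indicator {0..T} q *\<^sub>R u q (Z' q)) \<le> norm (indicator {0..T} q *\<^sub>R (b q + L * R0))"
    using bd
   proof eventually_elim
    case (elim q)
    then show ?case by (cases "q \<in> {0..T}") (auto simp: Z'_def intro: order.trans[OF _ abs_ge_self])
   qed
  qed
  also have "(\<lambda>q. indicator {0..T} q *\<^sub>R u q (Z' q)) = (\<lambda>q. indicator {0..T} q *\<^sub>R u q (Z q))"
   by (auto simp: Z'_def indicator_def)
  finally show ?thesis by (simp add: set_integrable_def)
 qed
 have cont: "continuous_on {0..T} (\<lambda>t. y + integral {0..t} (\<lambda>q. u q (Z q)))"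
  by (intro continuous_intros indefinite_integral_continuous_1 set_borel_integral_eq_integral(1)[OF int])
 have e: "(LINT q:{0..t}|lborel. u q (Z q)) = integral {0..t} (\<lambda>q. u q (Z q))" if "t \<in> {0..T}" for t
  by (rule set_borel_integral_eq_integral(2), rule set_integrable_subset[OF int]) (use that in auto)
 have "continuous_on {0..T} (\<lambda>t. y + (LINT q:{0..t}|lborel. u q (Z q)))"
  by (rule continuous_on_eq[OF cont]) (simp add: e)
 then show ?thesis using R0 L_nonneg bd int by (intro that[of "L * R0"]) auto
qed

fun picard :: "'a \<Rightarrow> nat \<Rightarrow> real \<Rightarrow> 'a" where
 "picard y 0 = (\<lambda>t. y)"
| "picard y (Suc n) = (\<lambda>t. y + (LINT q:{0..t}|lborel. u q (picard y n q)))"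

lemma picard_continuous: "continuous_on {0..T} (picard y n)"
proof (induction n)
 case (Suc n)
 show ?case using curve[OF Suc, of y] by simp metis
qed simp

lemma picard_integrable: "set_integrable lborel {0..T} (\<lambda>q. u q (picard y n q))"
 using curve[OF picard_continuous[of y n]] by metis

lemma set_integral_norm_le:
 assumes "set_integrable lborel {0..t} f" "set_integrable lborel {0..t} g" "t \<in> {0..T}"
  "AE q\<in>{0..T} in lborel. norm (f q :: 'a) \<le> g q"
 shows "norm (LINT q:{0..t}|lborel. f q) \<le> (LINT q:{0..t}|lborel. (g q :: real))"
proof -
 have "norm (LINT q:{0..t}|lborel. f q) \<le> (LINT q:{0..t}|lborel. norm (f q))"
  by (rule set_integral_norm_bound[OF assms(1)])
 also have "\<dots> \<le> (LINT q:{0..t}|lborel. g q)"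
 proof (rule set_integral_mono_AE[OF set_integrable_norm[OF assms(1)] assms(2)])
  show "AE q\<in>{0..t} in lborel. norm (f q) \<le> g q"
   using assms(4) by eventually_elim (use assms(3) in auto)
 qed
 finally show ?thesis .
qed

lemma integrable_initial:
 fixes f :: "real \<Rightarrow> 'c::{banach,second_countable_topology}"
 shows "set_integrable lborel {0..T} f \<Longrightarrow> t \<in> {0..T} \<Longrightarrow> set_integrable lborel {0..t} f"
 by (erule set_integrable_subset) auto

lemma picard_diff:
 obtains D where "0 \<le> D"
  "\<And>n t. t \<in> {0..T} \<Longrightarrow> norm (picard y (Suc n) t - picard y n t) \<le> D * (L * t) ^ n / fact n"
proof -
 define D where "D = (LINT q:{0..T}|lborel. b q + L * norm y)"
 have bi: "set_integrable lborel {0..T} (\<lambda>q. b q + L * norm y)"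
  by (intro set_integral_add b_integrable borel_integrable_atLeastAtMost') simp
 have bpos: "0 \<le> b q + L * norm y" for q using b_ge_1[of q] L_nonneg by simp
 have "0 \<le> D" unfolding D_def set_lebesgue_integral_def using bpos by (intro Bochner_Integration.integral_nonneg) auto
 note sub = integrable_initial
 have "norm (picard y (Suc n) t - picard y n t) \<le> D * (L * t) ^ n / fact n" if "t \<in> {0..T}" for n t
  using that
 proof (induction n arbitrary: t)
  case 0
  have "norm (LINT q:{0..t}|lborel. u q y) \<le> (LINT q:{0..t}|lborel. b q + L * norm y)"
  proof (rule set_integral_norm_le[OF _ sub[OF bi 0] 0])
   show "set_integrable lborel {0..t} (\<lambda>q. u q y)" using sub[OF picard_integrable[of y 0] 0] by simp
   show "AE q\<in>{0..T} in lborel. norm (u q y) \<le> b q + L * norm y"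
    using u_le by eventually_elim blast
  qed
  also have "\<dots> \<le> D"
   unfolding D_def set_lebesgue_integral_def using bi sub[OF bi 0] bpos 0
   by (intro integral_mono) (auto simp: set_integrable_def indicator_def)
  finally show ?case by simp
 next
  case (Suc n)
  have i1: "set_integrable lborel {0..t} (\<lambda>q. u q (picard y (Suc n) q))" "set_integrable lborel {0..t} (\<lambda>q. u q (picard y n q))"
   using sub[OF picard_integrable Suc.prems] by blast+
  have pw: "set_integrable lborel {0..t} (\<lambda>q. L * (D * (L * q) ^ n / fact n))"
   by (intro borel_integrable_atLeastAtMost' continuous_intros) auto
  have "picard y (Suc (Suc n)) t - picard y (Suc n) t =
    (LINT q:{0..t}|lborel. u q (picard y (Suc n) q) - u q (picard y n q))"
   using i1 by (simp add: set_integral_diff)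
  also have "norm \<dots> \<le> (LINT q:{0..t}|lborel. L * (D * (L * q) ^ n / fact n))"
  proof (rule set_integral_norm_le[OF _ pw Suc.prems])
   show "set_integrable lborel {0..t} (\<lambda>q. u q (picard y (Suc n) q) - u q (picard y n q))"
    using i1 by (rule set_integral_diff)
   show "AE q\<in>{0..T} in lborel. norm (u q (picard y (Suc n) q) - u q (picard y n q)) \<le> L * (D * (L * q) ^ n / fact n)"
    using u_lipschitz
   proof eventually_elim
    case (elim q)
    show ?case
    proof
     assume q: "q \<in> {0..T}"
     then have "norm (u q (picard y (Suc n) q) - u q (picard y n q)) \<le> L * norm (picard y (Suc n) q - picard y n q)"
      using elim by blast
     also have "\<dots> \<le> L * (D * (L * q) ^ n / fact n)"
      using Suc.IH[OF q] L_nonneg by (rule mult_left_mono)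
     finally show "norm (u q (picard y (Suc n) q) - u q (picard y n q)) \<le> L * (D * (L * q) ^ n / fact n)" .
    qed
   qed
  qed
  also have "\<dots> = L ^ Suc n * D / fact n * (LINT q|lborel. q ^ n * indicator {0..t} q)"
   unfolding set_lebesgue_integral_def
   by (subst integral_mult_right_zero[symmetric]) (intro Bochner_Integration.integral_cong, auto simp: power_mult_distrib)
  also have "(LINT q|lborel. q ^ n * indicator {0..t} q) = t ^ Suc n / Suc n"
   using Suc.prems by (subst integral_power) auto
  also have "L ^ Suc n * D / fact n * (t ^ Suc n / Suc n) = D * (L * t) ^ Suc n / fact (Suc n)"
   by (simp add: power_mult_distrib field_simps)
  finally show ?case .
 qed
 with \<open>0 \<le> D\<close> show ?thesis by (rule that)
qed

text \<open>Moving balls tolerate a small velocity error, so no limit of the iteration is taken. The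
  curve is one iterate and its velocity is the field along the preceding iterate; the Lipschitz
  bound and the factorial decay of their difference make the error small.\<close>

lemma approximate_trajectory:
 assumes "\<epsilon> > 0"
 obtains Z v R where "Z 0 = y" "0 \<le> R" "set_integrable lborel {0..T} v"
  "\<And>s t. 0 \<le> s \<Longrightarrow> s \<le> t \<Longrightarrow> t \<le> T \<Longrightarrow> Z t = Z s + (LINT q:{s..t}|lborel. v q)"
  "AE q\<in>{0..T} in lborel. norm (v q) \<le> b q + R"
  "AE q\<in>{0..T} in lborel. norm (u q (Z q) - v q) \<le> \<epsilon>"
proof -
 obtain D where D: "0 \<le> D"
  "\<And>n t. t \<in> {0..T} \<Longrightarrow> norm (picard y (Suc n) t - picard y n t) \<le> D * (L * t) ^ n / fact n"
  by (rule picard_diff[of y]) (rule that)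
 have "(\<lambda>n. (L * T) ^ n /\<^sub>R fact n) \<longlonglongrightarrow> 0" by (intro summable_LIMSEQ_zero summable_exp_generic)
 then have "(\<lambda>n. L * D * ((L * T) ^ n /\<^sub>R fact n)) \<longlonglongrightarrow> L * D * 0" by (intro tendsto_mult tendsto_const)
 then have "eventually (\<lambda>n. L * D * ((L * T) ^ n /\<^sub>R fact n) < \<epsilon>) sequentially"
  using assms by (intro order_tendstoD) auto
 then obtain n where n: "L * D * ((L * T) ^ n /\<^sub>R fact n) < \<epsilon>"
  by (auto simp: eventually_sequentially)
 define Z where "Z = picard y (Suc n)"
 define v where "v q = u q (picard y n q)" for q
 obtain R where R: "0 \<le> R" "set_integrable lborel {0..T} v" "AE q\<in>{0..T} in lborel. norm (v q) \<le> b q + R"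
  unfolding v_def using curve[OF picard_continuous[of y n]] by metis
 show ?thesis
 proof (rule that[OF _ R(1,2) _ R(3)])
  show "Z 0 = y" by (simp add: Z_def set_lebesgue_integral_def indicator_def)
   (rule integral_eq_zero_AE, use AE_lborel_singleton[of "0::real"] in \<open>auto elim!: eventually_mono\<close>)
  show "Z t = Z s + (LINT q:{s..t}|lborel. v q)" if "0 \<le> s" "s \<le> t" "t \<le> T" for s t
  proof -
   have i: "set_integrable lborel {0..t} v" "set_integrable lborel {0..s} v" "set_integrable lborel {s..t} v"
    by (rule set_integrable_subset[OF R(2)]; use that in auto)+
   have "(LINT q:{0..s}|lborel. v q) + (LINT q:{s..t}|lborel. v q) = (LINT q:{0..t}|lborel. v q)"
    unfolding set_borel_integral_eq_integral(2)[OF i(1)] set_borel_integral_eq_integral(2)[OF i(2)]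
     set_borel_integral_eq_integral(2)[OF i(3)]
    using that by (intro Henstock_Kurzweil_Integration.integral_combine set_borel_integral_eq_integral(1)[OF i(1)]) auto
   then show ?thesis by (simp add: Z_def v_def[symmetric])
  qed
  show "AE q\<in>{0..T} in lborel. norm (u q (Z q) - v q) \<le> \<epsilon>"
   using u_lipschitz
  proof eventually_elim
   case (elim q)
   show ?case
   proof
    assume q: "q \<in> {0..T}"
    have "norm (u q (Z q) - v q) \<le> L * norm (picard y (Suc n) q - picard y n q)"
     unfolding Z_def v_def using elim q by blast
    also have "\<dots> \<le> L * (D * (L * q) ^ n / fact n)" using D(2)[OF q] L_nonneg by (rule mult_left_mono)
    also have "\<dots> \<le> L * (D * (L * T) ^ n / fact n)"
     using q D(1) L_nonneg by (intro mult_left_mono divide_right_mono power_mono) auto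
    also have "\<dots> \<le> \<epsilon>" using n by (simp add: divide_inverse mult_ac)
    finally show "norm (u q (Z q) - v q) \<le> \<epsilon>" .
   qed
  qed
 qed
qed

lemma add_constant: "0 \<le> c \<Longrightarrow> measurable_velocity u T L (\<lambda>t. b t + c)"
proof (unfold_locales)
 assume c: "0 \<le> c"
 show "1 \<le> b t + c" for t using b_ge_1[of t] c by simp
 show "set_integrable lborel {0..T} (\<lambda>t. b t + c)"
  by (intro set_integral_add b_integrable borel_integrable_atLeastAtMost') simp
 show "AE t\<in>{0..T} in lborel. (\<forall>x y. norm (u t x - u t y) \<le> L * norm (x - y)) \<and> norm (u t 0) \<le> b t + c"
  using u_lipschitz by eventually_elim (use c in force)
qed (use T_nonneg L_nonneg u_measurable in auto)

lemma reversed: "measurable_velocity (\<lambda>t x. - u (T - t) x) T L (\<lambda>t. b (T - t))"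
proof (unfold_locales)
 show "set_integrable lborel {0..T} (\<lambda>t. b (T - t))"
  using b_integrable by (subst set_integral_reflect) simp
 show "AE t\<in>{0..T} in lborel. (\<forall>x y. norm (- u (T - t) x - - u (T - t) y) \<le> L * norm (x - y)) \<and> norm (- u (T - t) 0) \<le> b (T - t)"
  using AE_reflect[OF u_lipschitz, of T]
 proof eventually_elim
  case (elim t)
  show ?case
  proof
   assume "t \<in> {0..T}"
   then have "T - t \<in> {0..T}" by auto
   then show "(\<forall>x y. norm (- u (T - t) x - - u (T - t) y) \<le> L * norm (x - y)) \<and> norm (- u (T - t) 0) \<le> b (T - t)"
    using elim by (simp add: norm_minus_commute)
  qed
 qed
 have "(\<lambda>p. (\<lambda>(t, x). u t x) (T - fst p, snd p)) \<in> borel_measurable (borel \<Otimes>\<^sub>M borel)"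
  by (rule measurable_compose[OF _ u_measurable]) measurable
 then show "(\<lambda>(t, x). - u (T - t) x) \<in> borel_measurable (borel \<Otimes>\<^sub>M borel)"
  by (simp add: case_prod_beta)
qed (use T_nonneg L_nonneg b_ge_1 in auto)

end

lemma continuity_solution_reversed:
 assumes "continuity_solution u T M \<rho>"
 shows "continuity_solution (\<lambda>t x. - u (T - t) x) T M (\<lambda>t. \<rho> (T - t))"
 unfolding continuity_solution_def
proof (intro conjI ballI allI impI)
 fix t assume "t \<in> {0..T}"
 then have "T - t \<in> {0..T}" by auto
 from continuity_solution_density[OF assms this]
 show "\<rho> (T - t) \<in> borel_measurable borel" "AE x in lborel. 0 \<le> \<rho> (T - t) x \<and> \<rho> (T - t) x \<le> M" .
next
 fix \<psi> :: "'a \<Rightarrow> real" and s t assume psi: "test_function \<psi>" and st: "0 \<le> s" "s \<le> t" "t \<le> T"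
 have neg: "grad \<psi> x (- w) = - grad \<psi> x w" for x w
  by (rule linear_neg[OF bounded_linear.linear[OF has_derivative_bounded_linear[OF test_function_has_derivative[OF psi]]]])
 let ?h = "\<lambda>q. LINT x|lborel. \<rho> q x * grad \<psi> x (u q x)"
 have e: "(LINT x|lborel. \<rho> (T - q) x * grad \<psi> x (- u (T - q) x)) = - ?h (T - q)" for q
  by (simp add: neg)
 note w = continuity_solution_weak[OF assms psi, of "T - t" "T - s"]
 have hi: "set_integrable lborel {s..t} (\<lambda>q. ?h (T - q))"
  using w(1) st by (subst set_integral_reflect(1)) auto
 then show "set_integrable lborel {s..t} (\<lambda>q. LINT x|lborel. \<rho> (T - q) x * grad \<psi> x (- u (T - q) x))"
  unfolding e by (simp add: set_integrable_def)
 have "(LINT q:{s..t}|lborel. - ?h (T - q)) = - (LINT q:{T - t..T - s}|lborel. ?h q)"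
  using set_integral_reflect(2)[of s t ?h T] by (simp add: set_lebesgue_integral_def)
 then show "(LINT x|lborel. \<psi> x * \<rho> (T - t) x) = (LINT x|lborel. \<psi> x * \<rho> (T - s) x) +
   (LINT q:{s..t}|lborel. (LINT x|lborel. \<rho> (T - q) x * grad \<psi> x (- u (T - q) x)))"
  unfolding e using w(2) st by simp
qed

section \<open>Comparison of a density with Lebesgue measure\<close>

context measurable_velocity begin

text \<open>Invariance of Lebesgue measure under a divergence-free field, in the form to which the
  moving balls apply.\<close>

lemma continuity_solution_one:
 assumes "AE t\<in>{0..T} in lborel. weakly_divergence_free (u t)"
 shows "continuity_solution u T 1 (\<lambda>_ _. 1)"
 unfolding continuity_solution_def
proof (intro conjI ballI allI impI)
 fix \<psi> :: "'a \<Rightarrow> real" and s t assume psi: "test_function \<psi>" and st: "0 \<le> s" "s \<le> t" "t \<le> T"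
 let ?h = "\<lambda>q. LINT x|lborel. 1 * grad \<psi> x (u q x)"
 have z: "AE q in lborel. indicator {s..t} q *\<^sub>R ?h q = 0"
  using assms
 proof eventually_elim
  case (elim q)
  then show ?case using psi st by (cases "q \<in> {s..t}") (auto simp: weakly_divergence_free_def)
 qed
 have um: "(\<lambda>p. u (fst p) (snd p)) \<in> borel_measurable (lborel \<Otimes>\<^sub>M lborel)"
  using u_measurable by (simp add: case_prod_beta cong: measurable_cong_sets sets_pair_measure_cong)
 have "(\<lambda>p. grad \<psi> (snd p) (u (fst p) (snd p))) \<in> borel_measurable (lborel \<Otimes>\<^sub>M lborel)"
  by (rule test_function_frechet_measurable[OF psi _ um]) measurable
 then have "(\<lambda>q. LINT x|lborel. grad \<psi> x (u q x)) \<in> borel_measurable lborel"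
  by (intro lborel.borel_measurable_lebesgue_integral) (simp add: case_prod_beta)
 then have m: "(\<lambda>q. indicator {s..t} q *\<^sub>R ?h q) \<in> borel_measurable lborel" by simp
 have "integrable lborel (\<lambda>q. indicator {s..t} q *\<^sub>R ?h q)"
  by (subst integrable_cong_AE[OF m _ z]) auto
 then show "set_integrable lborel {s..t} ?h" by (simp add: set_integrable_def)
 show "(LINT x|lborel. \<psi> x * 1) = (LINT x|lborel. \<psi> x * 1) + (LINT q:{s..t}|lborel. ?h q)"
  using integral_eq_zero_AE[OF z] by (simp add: set_lebesgue_integral_def)
qed auto

text \<open>Backwards in time the balls carry the mass at time \<open>T\<close> to a union
  \<open>?U\<close> at time 0, whose mass is at most \<open>M\<close> times its volume. Forwards,
  along the same curves and with density 1, that volume is at most the volume of balls around the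
  original centers. The radii have grown by a fixed factor, which is harmless as \<open>r\<close>
  tends to 0.\<close>

lemma density_bound_balls:
 assumes sol: "continuity_solution u T M' \<rho>" and M': "0 \<le> M'" and M: "0 \<le> M"
  and div: "AE t\<in>{0..T} in lborel. weakly_divergence_free (u t)"
  and init: "\<And>\<psi>. test_function \<psi> \<Longrightarrow> (\<And>x. 0 \<le> \<psi> x) \<Longrightarrow> (LINT x|lborel. \<psi> x * \<rho> 0 x) \<le> M * (LINT x|lborel. \<psi> x)"
  and F: "finite F" and r: "0 < r"
 shows "(LINT x|lborel. indicator (\<Union>y\<in>F. cball y r) x * \<rho> T x) \<le>
  M * measure lborel (\<Union>y\<in>F. ball y (4 * r * exp (2 * ((L + 1) * T))))"
proof -
 \<comment> \<open>The excess 1 over \<open>L\<close> leaves room for the velocity error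
   \<open>r\<close> of the approximate trajectories.\<close>
 define \<Lambda> where "\<Lambda> = L + 1"
 have La: "0 \<le> \<Lambda>" "\<Lambda> - L = 1" using L_nonneg by (auto simp: \<Lambda>_def)
 let ?u = "\<lambda>t x. - u (T - t) x"
 interpret rv: measurable_velocity ?u T L "\<lambda>t. b (T - t)" by (rule reversed)
 let ?P = "\<lambda>y Z v R. Z 0 = y \<and> 0 \<le> R \<and> set_integrable lborel {0..T} v \<and>
  (\<forall>s t. 0 \<le> s \<longrightarrow> s \<le> t \<longrightarrow> t \<le> T \<longrightarrow> Z t = Z s + (LINT q:{s..t}|lborel. v q)) \<and>
  (AE q\<in>{0..T} in lborel. norm (v q) \<le> b (T - q) + R) \<and>
  (AE q\<in>{0..T} in lborel. norm (?u q (Z q) - v q) \<le> r)"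
 define PP where "PP y Z v R \<longleftrightarrow> ?P y Z v R" for y Z v R
 have "\<exists>Z v R. PP y Z v R" for y
  unfolding PP_def by (rule rv.approximate_trajectory[OF r, of y]) blast
 then obtain Z v R where "\<And>y. PP y (Z y) (v y) (R y)" by metis
 note P = this[unfolded PP_def]
 define c where "c = (\<Sum>y\<in>F. R y)"
 note Z0 = P[THEN conjunct1] and R0 = P[THEN conjunct2, THEN conjunct1]
  and v_int = P[THEN conjunct2, THEN conjunct2, THEN conjunct1]
  and Z_eq = P[THEN conjunct2, THEN conjunct2, THEN conjunct2, THEN conjunct1, rule_format]
 note v_le' = P[THEN conjunct2, THEN conjunct2, THEN conjunct2, THEN conjunct2, THEN conjunct1]
  and err' = P[THEN conjunct2, THEN conjunct2, THEN conjunct2, THEN conjunct2, THEN conjunct2]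
 have Rc: "R y \<le> c" if "y \<in> F" for y
  unfolding c_def using R0 F that by (intro member_le_sum) auto
 have c: "0 \<le> c" unfolding c_def using R0 by (intro sum_nonneg) auto
 have v_le: "AE q\<in>{0..T} in lborel. (\<forall>y\<in>F. norm (v y q) \<le> b (T - q) + c)"
 proof -
  have "AE q in lborel. \<forall>y\<in>F. q \<in> {0..T} \<longrightarrow> norm (v y q) \<le> b (T - q) + R y"
   using F v_le' by (rule AE_finite_allI)
  then show ?thesis by eventually_elim (use Rc in force)
 qed
 have err: "AE q\<in>{0..T} in lborel. (\<forall>y\<in>F. norm (?u q (Z y q) - v y q) \<le> r)"
 proof -
  have "AE q in lborel. \<forall>y\<in>F. q \<in> {0..T} \<longrightarrow> norm (?u q (Z y q) - v y q) \<le> r"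
   using F err' by (rule AE_finite_allI)
  then show ?thesis by eventually_elim auto
 qed
 have exp1: "s \<le> (\<Lambda> - L) * (s * exp (\<Lambda> * q))" if "q \<in> {0..T}" "0 < s" for q s
 proof -
  have "1 \<le> exp (\<Lambda> * q)" using La that by simp
  then show ?thesis using mult_left_mono[of 1 "exp (\<Lambda> * q)" s] that La by simp
 qed
 interpret ra: measurable_velocity ?u T L "\<lambda>t. b (T - t) + c" by (rule rv.add_constant[OF c])
 interpret mb: moving_balls ?u T L "\<lambda>t. b (T - t) + c" "\<lambda>t. \<rho> (T - t)" M' r \<Lambda> 2 F Z v
 proof unfold_locales
  show "AE q\<in>{0..T} in lborel. (\<forall>i\<in>F. norm (?u q (Z i q) - v i q) \<le> (\<Lambda> - L) * (r * exp (\<Lambda> * q)))"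
   using err by eventually_elim (use exp1[OF _ r] in force)
  show "AE q\<in>{0..T} in lborel. (\<forall>i\<in>F. norm (v i q) \<le> b (T - q) + c)" by (rule v_le)
  show "Z i t = Z i s + (LINT q:{s..t}|lborel. v i q)" if "0 \<le> s" "s \<le> t" "t \<le> T" for i s t using that by (rule Z_eq)
 qed (use continuity_solution_reversed[OF sol] M' r La F v_int in auto)
 define r1 where "r1 = 2 * r * exp (\<Lambda> * T)"
 have r1: "r \<le> r1" "0 < r1"
 proof -
  have "r * 1 \<le> r * exp (\<Lambda> * T)" using r La T_nonneg by (intro mult_left_mono) auto
  moreover have "r1 = 2 * (r * exp (\<Lambda> * T))" by (simp add: r1_def)
  ultimately show "r \<le> r1" "0 < r1" using r by linarith+
 qed
 let ?U = "\<Union>y\<in>F. ball (Z y T) r1"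
 have tT: "T \<in> {0..T}" using T_nonneg by simp
 have Us: "?U \<in> sets borel" by (intro borel_open open_UN) auto
 have Uf: "emeasure lborel ?U < \<infinity>"
  using F by (intro emeasure_bounded_finite) auto
 have "(LINT x|lborel. indicator (\<Union>y\<in>F. cball y r) x * \<rho> T x) \<le> (LINT x|lborel. mb.\<psi> T x * \<rho> 0 x)"
  using mb.initial_balls_le_psi by (simp add: Z0)
 also have "\<dots> \<le> M * (LINT x|lborel. mb.\<psi> T x)"
  by (rule init[OF mb.test_function_psi[OF tT] mb.psi_final(1)])
 also have "\<dots> \<le> M * (LINT x|lborel. indicator ?U x)"
 proof (intro mult_left_mono integral_mono_AE' M)
  show "integrable lborel (indicator ?U :: 'a \<Rightarrow> real)"
   using Uf Us by (intro integrable_real_indicator) auto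
  show "AE x in lborel. mb.\<psi> T x \<le> indicator ?U x" using mb.psi_final(2) by (simp add: r1_def)
  show "AE x in lborel. 0 \<le> (indicator ?U x :: real)" by simp
 qed
 finally have 1: "(LINT x|lborel. indicator (\<Union>y\<in>F. cball y r) x * \<rho> T x) \<le> M * measure lborel ?U"
  by simp
 interpret fa: measurable_velocity u T L "\<lambda>t. b t + c" by (rule add_constant[OF c])
 \<comment> \<open>The reversed curves end in the original centers. The starting radius
   \<open>r1\<close> is that of the backward balls at their end, with
   \<open>\<kappa> = 2\<close>.\<close>
 interpret mf: moving_balls u T L "\<lambda>t. b t + c" "\<lambda>_ _. 1" 1 r1 \<Lambda> 2 F "\<lambda>y s. Z y (T - s)" "\<lambda>y q. - v y (T - q)"
 proof unfold_locales
  show "set_integrable lborel {0..T} (\<lambda>q. - v i (T - q))" for i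
   using set_integral_reflect(1)[of 0 T "v i" T] v_int[of i] by (simp add: set_integrable_def)
  show "Z i (T - t) = Z i (T - s) + (LINT q:{s..t}|lborel. - v i (T - q))" if "0 \<le> s" "s \<le> t" "t \<le> T" for i s t
   using Z_eq[of "T - t" "T - s" i] that set_integral_reflect(2)[of s t "v i" T]
   by (simp add: set_lebesgue_integral_def)
  show "AE q\<in>{0..T} in lborel. (\<forall>i\<in>F. norm (- v i (T - q)) \<le> b q + c)"
   using AE_reflect[OF v_le, of T] by eventually_elim auto
  show "AE q\<in>{0..T} in lborel. (\<forall>i\<in>F. norm (u q (Z i (T - q)) - - v i (T - q)) \<le> (\<Lambda> - L) * (r1 * exp (\<Lambda> * q)))"
   using AE_reflect[OF err, of T]
  proof eventually_elim
   case (elim q)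
   show ?case
   proof (intro impI ballI)
    fix i assume q: "q \<in> {0..T}" and i: "i \<in> F"
    have "norm (- u (T - (T - q)) (Z i (T - q)) - v i (T - q)) \<le> r" using elim q i by auto
    moreover have "norm (- u q (Z i (T - q)) - v i (T - q)) = norm (u q (Z i (T - q)) - - v i (T - q))"
    proof -
     have "- u q (Z i (T - q)) - v i (T - q) = - (u q (Z i (T - q)) - - v i (T - q))" by simp
     then show ?thesis by (simp only: norm_minus_cancel)
    qed
    ultimately show "norm (u q (Z i (T - q)) - - v i (T - q)) \<le> (\<Lambda> - L) * (r1 * exp (\<Lambda> * q))"
     using exp1[OF q r1(2)] r1(1) by simp
   qed
  qed
 qed (use continuity_solution_one[OF div] r1 La F in auto)
 let ?V = "\<Union>y\<in>F. ball y (4 * r * exp (2 * (\<Lambda> * T)))"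
 have Vf: "emeasure lborel ?V < \<infinity>" using F by (intro emeasure_bounded_finite) auto
 have "measure lborel ?U = (LINT x|lborel. indicator ?U x)" by simp
 also have "\<dots> \<le> (LINT x|lborel. indicator (\<Union>y\<in>F. cball (Z y T) r1) x)"
 proof (intro integral_mono_AE')
  show "integrable lborel (indicator (\<Union>y\<in>F. cball (Z y T) r1) :: 'a \<Rightarrow> real)"
   using F by (intro integrable_real_indicator sets.finite_UN emeasure_bounded_finite) auto
  show "AE x in lborel. indicator ?U x \<le> (indicator (\<Union>y\<in>F. cball (Z y T) r1) x :: real)"
   by (intro always_eventually allI) (force simp: indicator_def intro: less_imp_le)
 qed auto
 also have "\<dots> \<le> (LINT x|lborel. indicator ?V x)"
 proof -
  have e: "2 * r1 * exp (\<Lambda> * T) = 4 * r * exp (2 * (\<Lambda> * T))"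
   by (simp add: r1_def mult_exp_exp mult.assoc)
  show ?thesis using mf.moving_balls_mono unfolding e by (simp add: Z0)
 qed
 also have "\<dots> = measure lborel ?V" by simp
 finally show ?thesis using 1 M by (auto simp: \<Lambda>_def intro: order.trans mult_left_mono)
qed

text \<open>Cover \<open>K\<close> by balls of radius \<open>r\<close> with centers in
  \<open>K\<close>; the enlarged balls lie in a closed neighbourhood whose width is a fixed multiple
  of \<open>r\<close>. These neighbourhoods decrease to \<open>K\<close>, so the enlargement factor
  disappears.\<close>

lemma density_bound_compact:
 assumes sol: "continuity_solution u T M' \<rho>" and M': "0 \<le> M'" and M: "0 \<le> M"
  and div: "AE t\<in>{0..T} in lborel. weakly_divergence_free (u t)"
  and init: "\<And>\<psi>. test_function \<psi> \<Longrightarrow> (\<And>x. 0 \<le> \<psi> x) \<Longrightarrow> (LINT x|lborel. \<psi> x * \<rho> 0 x) \<le> M * (LINT x|lborel. \<psi> x)"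
  and K: "compact K" "K \<noteq> {}"
 shows "(LINT x|lborel. indicator K x * \<rho> T x) \<le> M * measure lborel K"
proof -
 define c where "c = 4 * exp (2 * ((L + 1) * T))"
 have c: "0 < c" by (simp add: c_def)
 define S where "S n = {x. infdist x K \<le> c * (1 / real (Suc n))}" for n :: nat
 have tT: "T \<in> {0..T}" using T_nonneg by simp
 have clS: "closed (S n)" for n
  unfolding S_def by (intro closed_Collect_le continuous_intros) 
 have bS: "bounded (S n)" for n
 proof -
  obtain R where R: "\<And>x. x \<in> K \<Longrightarrow> norm x \<le> R" using compact_imp_bounded[OF K(1)] by (auto simp: bounded_iff)
  have "norm x \<le> R + c * (1 / real (Suc n))" if "x \<in> S n" for x
  proof -
   obtain y where y: "y \<in> K" "infdist x K = dist x y" using infdist_attains_inf[OF compact_imp_closed[OF K(1)] K(2)] by metis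
   then have "norm x \<le> norm y + dist x y" using norm_triangle_sub[of x y] by (simp add: dist_norm)
   then show ?thesis using y R that by (fastforce simp: S_def)
  qed
  then show ?thesis by (auto simp: bounded_iff)
 qed
 have le: "(LINT x|lborel. indicator K x * \<rho> T x) \<le> M * measure lborel (S n)" for n
 proof -
  define r where "r = 1 / real (Suc n)"
  have r: "r > 0" by (simp add: r_def)
  obtain F where F: "finite F" "F \<subseteq> K" "K \<subseteq> (\<Union>x\<in>F. ball x r)"
   using compactE_image[OF K(1), of K "\<lambda>x. ball x r"] r by (metis UN_I centre_in_ball open_ball subsetI)
  let ?A = "\<Union>y\<in>F. cball y r"
  have "(LINT x|lborel. indicator K x * \<rho> T x) \<le> (LINT x|lborel. indicator ?A x * \<rho> T x)"
  proof (rule integral_mono_AE')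
   have [measurable]: "\<rho> T \<in> borel_measurable borel" using continuity_solution_density[OF sol tT] by simp
   have A: "?A \<in> sets borel" using F by (intro sets.finite_UN) auto
   show "integrable lborel (\<lambda>x. indicator ?A x * \<rho> T x)"
   proof (rule Bochner_Integration.integrable_bound[where f = "\<lambda>x. M' * indicator ?A x"])
    show "integrable lborel (\<lambda>x. M' * indicator ?A x)"
     using F A by (intro integrable_mult_right integrable_real_indicator emeasure_bounded_finite) auto
    show "(\<lambda>x. indicator ?A x * \<rho> T x) \<in> borel_measurable lborel" using A by simp
    show "AE x in lborel. norm (indicator ?A x * \<rho> T x) \<le> norm (M' * indicator ?A x)"
     using continuity_solution_density(2)[OF sol tT] by eventually_elim (auto simp: indicator_def)
   qed
   show "AE x in lborel. indicator K x * \<rho> T x \<le> indicator ?A x * \<rho> T x"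
    using continuity_solution_density(2)[OF sol tT]
   proof eventually_elim
    case (elim x)
    have "x \<in> K \<Longrightarrow> x \<in> ?A" using F(3) by force
    then show ?case using elim by (auto simp: indicator_def)
   qed
   show "AE x in lborel. 0 \<le> indicator ?A x * \<rho> T x"
    using continuity_solution_density(2)[OF sol tT] by eventually_elim auto
  qed
  also have "\<dots> \<le> M * measure lborel (\<Union>y\<in>F. ball y (4 * r * exp (2 * ((L + 1) * T))))"
   by (rule density_bound_balls[OF sol M' M div init F(1) r])
  also have "\<dots> \<le> M * measure lborel (S n)"
  proof (intro mult_left_mono measure_mono_fmeasurable M)
   show "(\<Union>y\<in>F. ball y (4 * r * exp (2 * ((L + 1) * T)))) \<subseteq> S n"
   proof
    fix x assume "x \<in> (\<Union>y\<in>F. ball y (4 * r * exp (2 * ((L + 1) * T))))"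
    then obtain y where y: "y \<in> F" "dist y x < c * r" by (auto simp: c_def mult_ac)
    then have "infdist x K \<le> dist x y" using F by (intro infdist_le) auto
    then show "x \<in> S n" using y by (simp add: S_def r_def dist_commute)
   qed
   show "(\<Union>y\<in>F. ball y (4 * r * exp (2 * ((L + 1) * T)))) \<in> sets lborel" by (intro sets.finite_UN F) auto
   show "S n \<in> fmeasurable lborel"
    using clS bS by (intro fmeasurableI emeasure_bounded_finite) auto
  qed
  finally show ?thesis .
 qed
 have "(\<lambda>n. measure lborel (S n)) \<longlonglongrightarrow> measure lborel (\<Inter>n. S n)"
 proof (rule Lim_measure_decseq)
  show "range S \<subseteq> sets lborel" using clS by auto
  show "decseq S"
  proof (rule decseq_SucI)
   fix n
   have "c * (1 / real (Suc (Suc n))) \<le> c * (1 / real (Suc n))" using c by (intro mult_left_mono) (auto simp: frac_le)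
   then show "S (Suc n) \<subseteq> S n" by (auto simp: S_def)
  qed
  show "emeasure lborel (S n) \<noteq> \<infinity>" for n using emeasure_bounded_finite[OF bS[of n]] by simp
 qed
 also have "(\<Inter>n. S n) = K"
 proof
  show "K \<subseteq> (\<Inter>n. S n)" using c by (auto simp: S_def)
  show "(\<Inter>n. S n) \<subseteq> K"
  proof
   fix x assume x: "x \<in> (\<Inter>n. S n)"
   have "(\<lambda>n. c * (1 / real (Suc n))) \<longlonglongrightarrow> c * 0"
    using LIMSEQ_inverse_real_of_nat by (intro tendsto_mult tendsto_const) (simp add: inverse_eq_divide)
   then have "infdist x K \<le> c * 0" by (rule LIMSEQ_le_const) (use x in \<open>auto simp: S_def\<close>)
   then have "infdist x K = 0" using infdist_nonneg[of x K] by simp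
   then show "x \<in> K" using in_closed_iff_infdist_zero[OF compact_imp_closed[OF K(1)] K(2)] by blast
  qed
 qed
 finally have "(\<lambda>n. M * measure lborel (S n)) \<longlonglongrightarrow> M * measure lborel K" by (intro tendsto_mult tendsto_const)
 then show ?thesis by (rule LIMSEQ_le_const) (use le in auto)
qed

end

text \<open>By inner regularity a set of positive measure where \<open>g\<close> exceeds
  \<open>M\<close> by a fixed amount would contain a compact set of positive measure, against the
  hypothesis.\<close>

lemma AE_le_of_compact_integrals:
 fixes g :: "'a::euclidean_space \<Rightarrow> real"
 assumes g: "g \<in> borel_measurable borel" "AE x in lborel. 0 \<le> g x \<and> g x \<le> M'"
  and le: "\<And>K. compact K \<Longrightarrow> K \<noteq> {} \<Longrightarrow> (LINT x|lborel. indicator K x * g x) \<le> M * measure lborel K"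
 shows "AE x in lborel. g x \<le> M"
proof -
 note [measurable] = g(1)
 have "AE x in lborel. \<not> (M + 1 / real (Suc n) < g x \<and> norm x \<le> real n)" for n
 proof -
  define \<epsilon> where "\<epsilon> = 1 / real (Suc n)"
  have eps: "\<epsilon> > 0" by (simp add: \<epsilon>_def)
  define S where "S = {x. M + \<epsilon> < g x \<and> norm x \<le> real n}"
  have S: "S \<in> sets borel" unfolding S_def by measurable
  have Sb: "bounded S" by (auto simp: S_def bounded_iff)
  have Sf: "S \<in> fmeasurable lborel" using S emeasure_bounded_finite[OF Sb] by (intro fmeasurableI) auto
  have "measure lborel S = 0"
  proof (rule ccontr)
   assume "measure lborel S \<noteq> 0"
   then have pos: "measure lborel S > 0" using measure_nonneg[of lborel S] by linarith
   obtain C where C: "closed C" "C \<subseteq> S" "S - C \<in> lmeasurable" "emeasure lebesgue (S - C) < ennreal (measure lborel S)"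
    by (rule sets_lebesgue_inner_closed[OF sets_completionI_sets pos, of S]) (use S in simp, rule that)
   have Cb: "bounded C" by (rule bounded_subset[OF Sb C(2)])
   have comp: "compact C" using C(1) Cb by (simp add: compact_eq_bounded_closed)
   have Cs: "C \<in> sets borel" using C(1) by simp
   have Cf: "C \<in> fmeasurable lborel" using Cs emeasure_bounded_finite[OF Cb] by (intro fmeasurableI) auto
   have "measure lborel (S - C) = measure lborel S - measure lborel C"
    by (rule measurable_measure_Diff) (use Sf Cs C(2) in auto)
   moreover have "measure lborel (S - C) < measure lborel S"
   proof -
    have "S - C \<in> fmeasurable lborel" using Sf Cs by (intro fmeasurable_Diff) auto
    then have "emeasure lborel (S - C) = ennreal (measure lborel (S - C))" by (rule emeasure_eq_measure2)
    then show ?thesis using C(4) S Cs by (simp add: ennreal_less_iff)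
   qed
   ultimately have Cpos: "measure lborel C > 0" by simp
   then have Cne: "C \<noteq> {}" by auto
   have Cint: "integrable lborel (indicator C :: 'a \<Rightarrow> real)"
    using Cf by (intro integrable_real_indicator) (auto simp: fmeasurable_def)
   have gint: "integrable lborel (\<lambda>x. indicator C x * g x)"
   proof (rule Bochner_Integration.integrable_bound[where f = "\<lambda>x. M' * indicator C x"])
    show "integrable lborel (\<lambda>x. M' * indicator C x)" using Cint by (rule integrable_mult_right)
    show "(\<lambda>x. indicator C x * g x) \<in> borel_measurable lborel" using Cs by simp
    show "AE x in lborel. norm (indicator C x * g x) \<le> norm (M' * indicator C x)"
     using g(2) by eventually_elim (auto simp: indicator_def)
   qed
   have "(M + \<epsilon>) * measure lborel C = (LINT x|lborel. (M + \<epsilon>) * indicator C x)" by simp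
   also have "\<dots> \<le> (LINT x|lborel. indicator C x * g x)"
   proof (rule integral_mono[OF integrable_mult_right[OF Cint] gint])
    show "(M + \<epsilon>) * indicator C x \<le> indicator C x * g x" for x
     using C(2) by (cases "x \<in> C") (auto simp: S_def less_imp_le)
   qed
   also have "\<dots> \<le> M * measure lborel C" by (rule le[OF comp Cne])
   finally show False using mult_pos_pos[OF eps Cpos] by (simp add: distrib_right)
  qed
  then have "emeasure lborel S = 0" using Sf by (simp add: emeasure_eq_measure2)
  then have "S \<in> null_sets lborel" using S by (simp add: null_sets_def)
  then have "AE x in lborel. x \<notin> S" by (rule AE_not_in)
  then show ?thesis by eventually_elim (simp add: S_def \<epsilon>_def)
 qed
 then have "AE x in lborel. \<forall>n. \<not> (M + 1 / real (Suc n) < g x \<and> norm x \<le> real n)"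
  by (simp add: AE_all_countable)
 then show ?thesis
 proof eventually_elim
  case (elim x)
  show ?case
  proof (rule ccontr)
   assume "\<not> g x \<le> M"
   then obtain n1 where n1: "1 / real (Suc n1) < g x - M" using nat_approx_posE[of "g x - M"] by auto
   obtain n2 where n2: "norm x \<le> real n2" using real_arch_simple by blast
   define n where "n = max n1 n2"
   have "1 / real (Suc n) \<le> 1 / real (Suc n1)" by (intro divide_left_mono) (auto simp: n_def)
   then have "M + 1 / real (Suc n) < g x" using n1 by linarith
   moreover have "norm x \<le> real n" using n2 by (simp add: n_def)
   ultimately show False using elim by blast
  qed
 qed
qed

lemma (in measurable_velocity) density_bound:
 assumes "continuity_solution u T M' \<rho>" "0 \<le> M'" "0 \<le> M"
  and "AE t\<in>{0..T} in lborel. weakly_divergence_free (u t)"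
  and "\<And>\<psi>. test_function \<psi> \<Longrightarrow> (\<And>x. 0 \<le> \<psi> x) \<Longrightarrow> (LINT x|lborel. \<psi> x * \<rho> 0 x) \<le> M * (LINT x|lborel. \<psi> x)"
 shows "AE x in lborel. \<rho> T x \<le> M"
 using continuity_solution_density[OF assms(1), of T] T_nonneg
 by (intro AE_le_of_compact_integrals density_bound_compact[OF assms]) auto

section \<open>Lipschitz continuity from weak derivatives\<close>

lemma continuous_AE_le:
 fixes g :: "'a::euclidean_space \<Rightarrow> real"
 assumes g: "continuous_on UNIV g" and le: "AE x in lborel. g x \<le> c"
 shows "g x \<le> c"
proof (rule ccontr)
 assume "\<not> g x \<le> c"
 have op: "open {y. c < g y}" by (rule open_Collect_less[OF continuous_on_const g])
 have "x \<in> {y. c < g y}" using \<open>\<not> g x \<le> c\<close> by simp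
 then obtain e where e: "e > 0" "ball x e \<subseteq> {y. c < g y}" using op by (meson open_contains_ball)
 have "c < g y" if "y \<in> ball x e" for y using subsetD[OF e(2) that] by simp
 then have "AE y in lborel. y \<notin> ball x e" using le by (auto elim!: eventually_mono simp: not_le[symmetric] simp del: mem_ball)
 then have "ball x e \<in> null_sets lborel" by (subst AE_iff_null_sets) auto
 then have "unit_ball_vol (real DIM('a)) * e ^ DIM('a) \<le> 0"
  using e(1) emeasure_ball[of e x] by (simp add: null_sets_def ennreal_eq_0_iff)
 moreover have "0 < unit_ball_vol (real DIM('a)) * e ^ DIM('a)" using e(1) by simp
 ultimately show False by linarith
qed

lemma set_integrable_bounded_mult:
 fixes G :: "'a::euclidean_space \<Rightarrow> 'b::euclidean_space" and \<psi> :: "'a \<Rightarrow> real"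
 assumes "set_integrable lborel (cball 0 R) G" "\<psi> \<in> borel_measurable borel"
  "\<And>x. \<bar>\<psi> x\<bar> \<le> c" "\<And>x. R < norm x \<Longrightarrow> \<psi> x = 0"
 shows "integrable lborel (\<lambda>x. \<psi> x *\<^sub>R G x)"
proof -
 have i: "integrable lborel (\<lambda>x. c *\<^sub>R (indicator (cball 0 R) x *\<^sub>R G x))"
  using assms(1) unfolding set_integrable_def by (rule integrable_scaleR_right)
 have m: "(\<lambda>x. indicator (cball 0 R) x *\<^sub>R G x) \<in> borel_measurable borel"
  using assms(1) unfolding set_integrable_def by (auto dest: borel_measurable_integrable)
 have "integrable lborel (\<lambda>x. \<psi> x *\<^sub>R (indicator (cball 0 R) x *\<^sub>R G x))"
 proof (rule Bochner_Integration.integrable_bound[OF i])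
  show "(\<lambda>x. \<psi> x *\<^sub>R (indicator (cball 0 R) x *\<^sub>R G x)) \<in> borel_measurable lborel"
   using borel_measurable_scaleR[OF assms(2) m] by simp
  show "AE x in lborel. norm (\<psi> x *\<^sub>R (indicator (cball 0 R) x *\<^sub>R G x)) \<le> norm (c *\<^sub>R (indicator (cball 0 R) x *\<^sub>R G x))"
   unfolding norm_scaleR[of "\<psi> _"] norm_scaleR[of c]
   by (intro always_eventually allI mult_right_mono order.trans[OF assms(3) abs_ge_self] norm_ge_zero)
 qed
 also have "(\<lambda>x. \<psi> x *\<^sub>R (indicator (cball 0 R) x *\<^sub>R G x)) = (\<lambda>x. \<psi> x *\<^sub>R G x)"
 proof
  fix x show "\<psi> x *\<^sub>R (indicator (cball 0 R) x *\<^sub>R G x) = \<psi> x *\<^sub>R G x"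
   using assms(4)[of x] by (cases "norm x \<le> R") auto
 qed
 finally show ?thesis .
qed

lemma integral_translate:
 fixes f :: "'a::euclidean_space \<Rightarrow> real"
 assumes "f \<in> borel_measurable borel"
 shows "(LINT x|lborel. f (x + a)) = (LINT x|lborel. f x)"
 using integral_distr[of "(+) a" lborel borel f] assms by (simp add: lborel_distr_plus add.commute[of a])

text \<open>The weak derivative is tested in the direction \<open>h = x - y\<close> and against the
  vector \<open>e = v x - v y\<close>. Translating the test function along \<open>h\<close> gives
  the averaged form \<open>key\<close> of the increment bound, again by quadratic increments, and
  continuity of \<open>v\<close> removes the averaging.\<close>

lemma weak_derivative_lipschitz:
 fixes v :: "'a::euclidean_space \<Rightarrow> 'b::euclidean_space"
 assumes cont: "continuous_on UNIV v" and W: "has_weak_derivative v G"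
  and bnd: "\<And>x. norm (v x) \<le> c" and G: "AE x in lborel. onorm (G x) \<le> c"
 shows "norm (v x - v y) \<le> c * norm (x - y)"
proof -
 have c0: "0 \<le> c" using bnd[of 0] norm_ge_zero order.trans by blast
 define h e where "h = x - y" and "e = v x - v y"
 define k where "k = c * norm h * norm e"
 have vm [measurable]: "v \<in> borel_measurable borel" using cont by (rule borel_measurable_continuous_onI)
 have lin: "linear (G x)" for x using W by (simp add: has_weak_derivative_def)
 have ve: "\<bar>v z \<bullet> e\<bar> \<le> c * norm e" for z
  using Cauchy_Schwarz_ineq2[of "v z" e] mult_right_mono[OF bnd[of z] norm_ge_zero[of e]] by linarith
 have Ge: "AE z in lborel. G z h \<bullet> e \<le> k"
  using G
 proof eventually_elim
  case (elim z)
  have "norm (G z h) \<le> onorm (G z) * norm h"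
   by (rule onorm) (use lin in \<open>simp add: linear_conv_bounded_linear\<close>)
  also have "\<dots> \<le> c * norm h" using elim by (rule mult_right_mono) simp
  finally have "norm (G z h) * norm e \<le> c * norm h * norm e" by (rule mult_right_mono) simp
  then show ?case using norm_cauchy_schwarz[of "G z h" e] by (simp add: k_def)
 qed
 have key: "(LINT z|lborel. \<psi> z * ((v (z + h) - v z) \<bullet> e)) \<le> k * (LINT z|lborel. \<psi> z)"
  if psi: "test_function \<psi>" and pos: "\<And>z. 0 \<le> \<psi> z" for \<psi> :: "'a \<Rightarrow> real"
 proof -
  obtain R0 where R0: "R0 > 0" "\<And>x. R0 < norm x \<Longrightarrow> \<psi> x = 0" using test_function_support[OF psi] by blast
  define R where "R = R0 + norm h"
  obtain g0 where g0: "g0 > 0" "\<And>x. \<bar>\<psi> x\<bar> \<le> g0" using test_function_bounded[OF psi] by blast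
  obtain g1 where g1: "g1 > 0" "\<And>x v. \<bar>grad \<psi> x v\<bar> \<le> g1 * norm v"
   using test_function_gradient_bounded[OF psi] by blast
  obtain g2 where g2: "g2 > 0" "\<And>x y. \<bar>\<psi> y - \<psi> x - grad \<psi> x (y - x)\<bar> \<le> g2 * (dist x y)\<^sup>2"
   using test_function_taylor[OF psi] by blast
  note [measurable] = test_function_measurable[OF psi]
  have out: "R0 < norm (z - s *\<^sub>R h)" if "R < norm z" "0 \<le> s" "s \<le> 1" for z s
  proof -
   have "norm (s *\<^sub>R h) \<le> norm h" using that by (simp add: mult_left_le_one_le)
   then show ?thesis using that norm_triangle_ineq2[of z "s *\<^sub>R h"] by (simp add: R_def)
  qed
  \<comment> \<open>The mean of \<open>v \<bullet> e\<close> along a test function that moves from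
    its position to its translate by \<open>h\<close>; its derivative is the flux bounded in
    \<open>dle\<close>.\<close>
  define m where "m s = (LINT z|lborel. \<psi> (z - s *\<^sub>R h) * (v z \<bullet> e))" for s
  define d where "d s z = grad \<psi> (z - s *\<^sub>R h) h" for s z
  have d0: "d s z = 0" if "R < norm z" "0 \<le> s" "s \<le> 1" for s z
   using frechet_derivative_outside[of R0 \<psi>, OF R0(2) out[OF that]] by (simp add: d_def)
  have mi: "integrable lborel (\<lambda>z. \<psi> (z - s *\<^sub>R h) * (v z \<bullet> e))" if "0 \<le> s" "s \<le> 1" for s
  proof (rule integrable_bounded_support[where R = R and B = "g0 * (c * norm e)"])
   show "(\<lambda>z. \<psi> (z - s *\<^sub>R h) * (v z \<bullet> e)) \<in> borel_measurable borel" by measurable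
   show "\<bar>\<psi> (z - s *\<^sub>R h) * (v z \<bullet> e)\<bar> \<le> g0 * (c * norm e)" for z
    unfolding abs_mult using g0 ve by (intro mult_mono) auto
  qed (use R0(2) out that in auto)
  have dm [measurable]: "d s \<in> borel_measurable borel" for s
   unfolding d_def[abs_def] using psi by measurable
  have di: "integrable lborel (\<lambda>z. d s z * (v z \<bullet> e))" if "0 \<le> s" "s \<le> 1" for s
  proof (rule integrable_bounded_support[where R = R and B = "g1 * norm h * (c * norm e)"])
   show "\<bar>d s z * (v z \<bullet> e)\<bar> \<le> g1 * norm h * (c * norm e)" for z
    unfolding abs_mult d_def using g1 ve by (intro mult_mono) auto
  qed (use d0 that in auto)
  have dle: "- (LINT z|lborel. d s z * (v z \<bullet> e)) \<le> k * (LINT z|lborel. \<psi> z)" if s: "0 \<le> s" "s \<le> 1" for s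
  proof -
   let ?p = "\<lambda>z. \<psi> (1 *\<^sub>R z + - (s *\<^sub>R h))"
   have tp: "test_function ?p" by (rule test_function_affine[OF psi]) simp
   have dp: "frechet_derivative ?p (at z) = grad \<psi> (z - s *\<^sub>R h)" for z
   proof (rule frechet_derivative_at[symmetric])
    have "((\<lambda>z. 1 *\<^sub>R z + - (s *\<^sub>R h)) has_derivative (\<lambda>w. w)) (at z)" by (auto intro!: derivative_eq_intros)
    from has_derivative_compose[OF this, of \<psi>] test_function_has_derivative[OF psi, of "z - s *\<^sub>R h"]
    show "(?p has_derivative grad \<psi> (z - s *\<^sub>R h)) (at z)" by simp
   qed
   have p0: "R < norm z \<Longrightarrow> ?p z = 0" for z using R0(2) out s by simp
   have pm: "?p \<in> borel_measurable borel" by measurable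
   have Gi: "integrable lborel (\<lambda>z. ?p z *\<^sub>R G z h)"
    using W by (intro set_integrable_bounded_mult[where R = R and c = g0] pm p0 g0(2)) (auto simp: has_weak_derivative_def)
   have vi: "integrable lborel (\<lambda>z. d s z *\<^sub>R v z)"
    using W g1(2) by (intro set_integrable_bounded_mult[where R = R and c = "g1 * norm h"] dm d0 s)
     (auto simp: has_weak_derivative_def d_def)
   have "(LINT z|lborel. d s z *\<^sub>R v z) = - (LINT z|lborel. ?p z *\<^sub>R G z h)"
    using W tp unfolding has_weak_derivative_def d_def dp[symmetric] by blast
   then have "(LINT z|lborel. d s z *\<^sub>R v z) \<bullet> e = - ((LINT z|lborel. ?p z *\<^sub>R G z h) \<bullet> e)" by simp
   moreover have "(LINT z|lborel. d s z *\<^sub>R v z) \<bullet> e = (LINT z|lborel. (d s z *\<^sub>R v z) \<bullet> e)"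
    by (rule integral_inner_left[symmetric]) (rule vi)
   moreover have "(LINT z|lborel. ?p z *\<^sub>R G z h) \<bullet> e = (LINT z|lborel. (?p z *\<^sub>R G z h) \<bullet> e)"
    by (rule integral_inner_left[symmetric]) (rule Gi)
   ultimately have "- (LINT z|lborel. d s z * (v z \<bullet> e)) = (LINT z|lborel. (?p z *\<^sub>R G z h) \<bullet> e)" by simp
   also have "\<dots> \<le> (LINT z|lborel. k * ?p z)"
   proof (rule integral_mono_AE)
    show "integrable lborel (\<lambda>z. (?p z *\<^sub>R G z h) \<bullet> e)" by (rule integrable_inner_left) (rule Gi)
    show "integrable lborel (\<lambda>z. k * ?p z)"
     by (intro integrable_mult_right integrable_bounded_support[where R = R and B = g0] pm g0(2) p0)
    show "AE z in lborel. (?p z *\<^sub>R G z h) \<bullet> e \<le> k * ?p z"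
     using Ge by eventually_elim (use mult_left_mono[OF _ pos] in \<open>auto simp: mult.commute\<close>)
   qed
   also have "\<dots> = k * (LINT z|lborel. ?p z)" by simp
   also have "(LINT z|lborel. ?p z) = (LINT z|lborel. \<psi> z)"
    using integral_translate[of \<psi> "- (s *\<^sub>R h)"] by simp
   finally show ?thesis .
  qed
  let ?V = "measure lborel (cball 0 R :: 'a set)"
  define C2 where "C2 = g2 * (norm h)\<^sup>2 * (c * norm e) * ?V"
  have step: "(m t - k * (LINT z|lborel. \<psi> z) * t) - (m s - k * (LINT z|lborel. \<psi> z) * s) \<le> C2 * (t - s)\<^sup>2"
   if st: "0 \<le> s" "s \<le> t" "t \<le> 1" for s t
  proof -
   have s1: "s \<le> 1" and t0: "0 \<le> t" using st by auto
   let ?err = "\<lambda>z. (\<psi> (z - t *\<^sub>R h) - \<psi> (z - s *\<^sub>R h) + (t - s) * d s z) * (v z \<bullet> e)"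
   have "m t - m s + (t - s) * (LINT z|lborel. d s z * (v z \<bullet> e)) =
     (LINT z|lborel. \<psi> (z - t *\<^sub>R h) * (v z \<bullet> e) - \<psi> (z - s *\<^sub>R h) * (v z \<bullet> e) + (t - s) * (d s z * (v z \<bullet> e)))"
    unfolding m_def using mi[OF t0 st(3)] mi[OF st(1) s1] di[OF st(1) s1] by simp
   also have "\<dots> = (LINT z|lborel. ?err z)" by (simp add: algebra_simps)
   also have "\<dots> \<le> \<bar>LINT z|lborel. ?err z\<bar>" by simp
   also have "\<dots> \<le> g2 * ((t - s) * norm h)\<^sup>2 * (c * norm e) * ?V"
   proof (rule abs_integral_le_ball, rule always_eventually, rule allI)
    fix z
    show "\<bar>?err z\<bar> \<le> g2 * ((t - s) * norm h)\<^sup>2 * (c * norm e) * indicator (cball 0 R) z"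
    proof (cases "norm z \<le> R")
     case True
     have l: "grad \<psi> (z - s *\<^sub>R h) (- (t - s) *\<^sub>R h) = - (t - s) * d s z"
      using linear_scale[OF bounded_linear.linear[OF has_derivative_bounded_linear[OF test_function_has_derivative[OF psi]]], of "z - s *\<^sub>R h" "- (t - s)" h]
      by (simp add: d_def)
     have yx: "(z - t *\<^sub>R h) - (z - s *\<^sub>R h) = - (t - s) *\<^sub>R h" by (simp add: algebra_simps)
     have ds: "dist (z - s *\<^sub>R h) (z - t *\<^sub>R h) = (t - s) * norm h"
     proof -
      have "(z - s *\<^sub>R h) - (z - t *\<^sub>R h) = (t - s) *\<^sub>R h" by (simp add: algebra_simps)
      then show ?thesis using st by (simp add: dist_norm)
     qed
     have "\<bar>\<psi> (z - t *\<^sub>R h) - \<psi> (z - s *\<^sub>R h) + (t - s) * d s z\<bar> \<le> g2 * ((t - s) * norm h)\<^sup>2"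
      using g2(2)[of "z - t *\<^sub>R h" "z - s *\<^sub>R h"] unfolding yx l ds mult_minus_left diff_minus_eq_add .
     then show ?thesis using True g2(1) ve[of z] unfolding abs_mult by (auto intro!: mult_mono)
    next
     case False
     then show ?thesis
      using d0[of z s] R0(2)[OF out[of z s]] R0(2)[OF out[of z t]] st by simp
    qed
   qed
   also have "\<dots> = C2 * (t - s)\<^sup>2" by (simp add: C2_def power_mult_distrib mult_ac)
   finally have "m t - m s \<le> (t - s) * (- (LINT z|lborel. d s z * (v z \<bullet> e))) + C2 * (t - s)\<^sup>2" by simp
   also have "\<dots> \<le> (t - s) * (k * (LINT z|lborel. \<psi> z)) + C2 * (t - s)\<^sup>2"
    using dle[OF st(1) s1] st by (intro add_right_mono mult_left_mono) auto
   finally show ?thesis by (simp add: algebra_simps)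
  qed
  have "m 1 - k * (LINT z|lborel. \<psi> z) * 1 \<le> m 0 - k * (LINT z|lborel. \<psi> z) * 0"
   by (rule quadratic_increments_imp_le[where B = "\<lambda>t. t" and C = C2
      and g = "\<lambda>t. m t - k * (LINT z|lborel. \<psi> z) * t"]) (use step in auto)
  then have 1: "m 1 - m 0 \<le> k * (LINT z|lborel. \<psi> z)" by simp
  have m1: "m 1 = (LINT z|lborel. \<psi> z * (v (z + h) \<bullet> e))"
   using integral_translate[of "\<lambda>z. \<psi> (z - h) * (v z \<bullet> e)" h] by (simp add: m_def)
  have i0: "integrable lborel (\<lambda>z. \<psi> z * (v z \<bullet> e))" using mi[of 0] by simp
  have i1: "integrable lborel (\<lambda>z. \<psi> z * (v (z + h) \<bullet> e))"
  proof (rule integrable_bounded_support[where R = R0 and B = "g0 * (c * norm e)"])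
   show "(\<lambda>z. \<psi> z * (v (z + h) \<bullet> e)) \<in> borel_measurable borel" by measurable
   show "\<bar>\<psi> z * (v (z + h) \<bullet> e)\<bar> \<le> g0 * (c * norm e)" for z
    unfolding abs_mult using g0 ve by (intro mult_mono) auto
  qed (use R0 in auto)
  have "(LINT z|lborel. \<psi> z * ((v (z + h) - v z) \<bullet> e)) = m 1 - m 0"
   using i0 i1 unfolding m1 by (simp add: m_def inner_diff_left right_diff_distrib)
  then show ?thesis using 1 by simp
 qed
 \<comment> \<open>At \<open>y\<close> the tested increment equals \<open>e \<bullet> e\<close>. If
   it exceeded \<open>k\<close>, then by continuity a bump supported near \<open>y\<close> would
   contradict \<open>key\<close>.\<close>
 have "e \<bullet> e \<le> k"
 proof (rule ccontr)
  assume "\<not> e \<bullet> e \<le> k"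
  define q where "q z = (v (z + h) - v z) \<bullet> e - k" for z
  have qy: "q y > 0" using \<open>\<not> e \<bullet> e \<le> k\<close> by (simp add: q_def h_def e_def)
  have qc: "continuous_on UNIV q"
   unfolding q_def by (intro continuous_intros continuous_on_compose2[OF cont]) auto
  have op: "open {z. 0 < q z}" by (rule open_Collect_less[OF continuous_on_const qc])
  have "y \<in> {z. 0 < q z}" using qy by simp
  then obtain \<delta> where d: "\<delta> > 0" "ball y \<delta> \<subseteq> {z. 0 < q z}" using op by (meson open_contains_ball)
  define \<psi> :: "'a \<Rightarrow> real" where "\<psi> z = bump 2 ((2 / \<delta>) *\<^sub>R z + - ((2 / \<delta>) *\<^sub>R y))" for z
  have psi: "test_function \<psi>"
   unfolding \<psi>_def[abs_def] using d by (intro test_function_affine test_function_bump) auto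
  have pos: "0 \<le> \<psi> z" for z by (simp add: \<psi>_def bump_bounds)
  have pq: "0 \<le> \<psi> z * q z" for z
  proof (cases "z \<in> ball y \<delta>")
   case True then show ?thesis using d pos[of z] by (intro mult_nonneg_nonneg) (auto intro: less_imp_le)
  next
   case False
   have "norm ((2 / \<delta>) *\<^sub>R z + - ((2 / \<delta>) *\<^sub>R y)) = (2 / \<delta>) * norm (z - y)"
    using d by (simp add: scaleR_diff_right[symmetric])
   also have "\<dots> \<ge> 2" using False d by (simp add: dist_norm norm_minus_commute field_simps)
   finally have "\<psi> z = 0" by (simp add: \<psi>_def bump_eq_0)
   then show ?thesis by simp
  qed
  obtain R0 where R0: "R0 > 0" "\<And>x. R0 < norm x \<Longrightarrow> \<psi> x = 0" using test_function_support[OF psi] by blast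
  obtain g0 where g0: "g0 > 0" "\<And>x. \<bar>\<psi> x\<bar> \<le> g0" using test_function_bounded[OF psi] by blast
  note [measurable] = test_function_measurable[OF psi]
  have i1: "integrable lborel (\<lambda>z. \<psi> z * ((v (z + h) - v z) \<bullet> e))"
  proof (rule integrable_bounded_support[where R = R0 and B = "g0 * (c * norm e + c * norm e)"])
   show "(\<lambda>z. \<psi> z * ((v (z + h) - v z) \<bullet> e)) \<in> borel_measurable borel" by measurable
   show "\<bar>\<psi> z * ((v (z + h) - v z) \<bullet> e)\<bar> \<le> g0 * (c * norm e + c * norm e)" for z
    unfolding abs_mult inner_diff_left using g0 ve[of z] ve[of "z + h"] by (intro mult_mono) auto
  qed (use R0 in auto)
  have i2: "integrable lborel \<psi>"
   by (rule integrable_bounded_support[where R = R0 and B = g0]) (use R0 g0 in auto)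
  have "(LINT z|lborel. \<psi> z * q z) = (LINT z|lborel. \<psi> z * ((v (z + h) - v z) \<bullet> e)) - k * (LINT z|lborel. \<psi> z)"
   using i1 i2 by (simp add: q_def right_diff_distrib mult.commute[of _ k])
  also have "\<dots> \<le> 0" using key[OF psi pos] by simp
  finally have "(LINT z|lborel. \<psi> z * q z) \<le> 0" .
  moreover have "0 \<le> (LINT z|lborel. \<psi> z * q z)" by (rule Bochner_Integration.integral_nonneg) (rule pq)
  ultimately have z: "(LINT z|lborel. \<psi> z * q z) = 0" by simp
  have i3: "integrable lborel (\<lambda>z. \<psi> z * q z)"
  proof -
   have "integrable lborel (\<lambda>z. \<psi> z * ((v (z + h) - v z) \<bullet> e) - k * \<psi> z)"
    using i1 i2 by (intro Bochner_Integration.integrable_diff integrable_mult_right) auto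
   then show ?thesis by (simp add: q_def right_diff_distrib mult.commute[of _ k])
  qed
  have "AE z in lborel. \<psi> z * q z = 0"
   using integral_nonneg_eq_0_iff_AE[OF i3] pq z by simp
  then have "AE z in lborel. \<psi> z * q z \<le> 0" by eventually_elim auto
  then have "\<psi> y * q y \<le> 0"
   by (rule continuous_AE_le[rotated]) (intro continuous_intros test_function_continuous psi qc)
  moreover have "\<psi> y = 1" by (simp add: \<psi>_def bump_eq_1)
  ultimately show False using qy by simp
 qed
 then have "norm e * norm e \<le> c * norm h * norm e" by (simp add: k_def dot_square_norm power2_eq_square)
 then have "norm e \<le> c * norm h"
  by (cases "norm e = 0") (use c0 in \<open>auto simp: mult_le_cancel_right\<close>)
 then show ?thesis by (simp add: e_def h_def)
qed

text \<open>The strict bound selects one weak derivative that satisfies it, without recourse to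
  uniqueness.\<close>

lemma W1inf_lipschitz:
 fixes v :: "'a::euclidean_space \<Rightarrow> 'b::euclidean_space"
 assumes cont: "continuous_on UNIV v" and less: "W1inf_norm v < ennreal c"
 shows "norm (v x) \<le> c" "norm (v x - v y) \<le> c * norm (x - y)"
proof -
 obtain G where W: "has_weak_derivative v G"
  and le: "Linf_norm v < ennreal c" "esssup lborel (\<lambda>x. ennreal (onorm (G x))) < ennreal c"
  using less unfolding W1inf_norm_def INF_less_iff by auto
 have "AE x in lborel. norm (v x) \<le> c"
  using esssup_AE[of "\<lambda>x. ennreal (norm (v x))" lborel]
 proof eventually_elim
  case (elim x)
  then have "ennreal (norm (v x)) < ennreal c" using le(1) unfolding Linf_norm_def by (rule le_less_trans)
  then show ?case by (simp add: ennreal_less_iff)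
 qed
 then show bnd: "norm (v x) \<le> c" for x
  by (rule continuous_AE_le[rotated]) (intro continuous_intros cont)
 have "AE x in lborel. onorm (G x) \<le> c"
  using esssup_AE[of "\<lambda>x. ennreal (onorm (G x))" lborel]
 proof eventually_elim
  case (elim x)
  have "0 \<le> onorm (G x)" using W by (intro onorm_pos_le) (auto simp: has_weak_derivative_def linear_conv_bounded_linear)
  moreover have "ennreal (onorm (G x)) < ennreal c" using elim le(2) by (rule le_less_trans)
  ultimately show ?case by (simp add: ennreal_less_iff)
 qed
 then show "norm (v x - v y) \<le> c * norm (x - y)"
  by (rule weak_derivative_lipschitz[OF cont W bnd])
qed

section \<open>Solutions of the transport equation\<close>

context singular_kernel begin

text \<open>For a density \<open>\<rho> \<le> M\<close>, \<open>A'\<close> bounds the integral of \<open>norm (x - y) powr - \<beta>\<close> against \<open>\<rho>\<close>, \<open>S'\<close> the corresponding mean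
  over the particles, \<open>P'\<close> the velocity error per unit of \<open>W_inf\<close>, and \<open>L'\<close> the Lipschitz constant of the velocity.\<close>

definition A' :: "real \<Rightarrow> real" where "A' M = singular_const (real DIM('a)) \<beta> * M + 1"
definition S' :: "real \<Rightarrow> real" where "S' M = 2 powr \<beta> * A' M + 1"
definition P' :: "real \<Rightarrow> real" where "P' M = C' * (2 * A' M + 2 powr \<beta> * S' M)"
definition L' :: "real \<Rightarrow> real \<Rightarrow> real" where "L' M m = 2 * C' * A' M + (m + 1)"
text \<open>The constant \<open>Cp\<close> as a function of the density bound alone. Like the
  constants above, it has to be available before any solution is given.\<close>

definition Q' :: "real \<Rightarrow> real" where
 "Q' M = (1 + packing_const (real DIM('a)) \<beta>) * (M * unit_ball_vol (real DIM('a)) * 2 ^ DIM('a)) powr (1 - \<beta> / real DIM('a))"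
text \<open>\<open>3 * P' M + 1\<close> is the velocity error relative to \<open>h0 + e\<close>,
  where 3 is the factor in the radius of \<open>good_near\<close> and 1 is the contribution of the
  error terms. \<open>L' M m\<close> is counted twice, once for the growth in
  \<open>moving_balls\<close> and once for the Euler phase. The last three summands bound the
  relative speed of two particles.\<close>

definition rate :: "real \<Rightarrow> real \<Rightarrow> real \<Rightarrow> real" where
 "rate M m c = 2 * L' M m + 3 * P' M + 1 + (m + 1) + c + 3 * C' * S' M"

lemma constants_nonneg:
 assumes "0 \<le> M" "0 \<le> m" "0 \<le> c"
 shows "1 \<le> A' M" "1 \<le> S' M" "0 \<le> P' M" "0 \<le> L' M m" "0 \<le> Q' M" "1 \<le> rate M m c"
proof -
 show A: "1 \<le> A' M" using assms(1) singular_const_pos[of \<beta> "real DIM('a)"] beta by (simp add: A'_def)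
 then show S: "1 \<le> S' M" by (simp add: S'_def)
 show P: "0 \<le> P' M" unfolding P'_def using A S C'_pos by (intro mult_nonneg_nonneg add_nonneg_nonneg) auto
 show L: "0 \<le> L' M m" unfolding L'_def using A C'_pos assms by (intro mult_nonneg_nonneg add_nonneg_nonneg) auto
 show "0 \<le> Q' M" unfolding Q'_def packing_const_def using singular_const_pos[of \<beta> "real DIM('a)"] beta by simp
 have "0 \<le> 3 * C' * S' M" using S C'_pos by simp
 then show "1 \<le> rate M m c" unfolding rate_def using L P assms by linarith
qed

end

locale transport_setting = singular_kernel K \<alpha> C for K :: "'a::euclidean_space \<Rightarrow> 'a" and \<alpha> C +
 fixes \<phi> :: "real \<Rightarrow> 'a \<Rightarrow> 'a" and \<tau>0 :: "'a \<Rightarrow> real" and \<tau> :: "real \<Rightarrow> 'a \<Rightarrow> real" and M M\<phi> :: real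
 assumes field: "divergence_free_field \<phi>" and phi_norm: "Linf_W1inf_norm \<phi> \<le> ennreal M\<phi>" "0 \<le> M\<phi>"
  and initial: "prob_density \<tau>0" "Linf_norm \<tau>0 \<le> ennreal M" "0 \<le> M"
  and transport: "transport_solution K \<phi> \<tau>0 \<tau>"
begin

definition V :: "real \<Rightarrow> 'a \<Rightarrow> 'a" where "V t = kernel_conv K (density_measure (\<tau> t))"

lemma tau_measurable: "(\<lambda>(t, x). indicat_real {0..} t * \<tau> t x) \<in> borel_measurable (borel \<Otimes>\<^sub>M borel)"
 using transport[unfolded transport_solution_def Let_def, THEN conjunct1] unfolding borel_prod .

lemma tau_prob: "0 \<le> t \<Longrightarrow> prob_density (\<tau> t)"
 using transport[unfolded transport_solution_def Let_def, THEN conjunct2, THEN conjunct1] by blast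

lemma tau_bound: "\<exists>M. \<forall>t\<in>{0..T}. Linf_norm (\<tau> t) \<le> ennreal M"
 using transport[unfolded transport_solution_def Let_def, THEN conjunct2, THEN conjunct2, THEN conjunct1] by blast

lemma K_int: "0 \<le> t \<Longrightarrow> integrable (density_measure (\<tau> t)) (\<lambda>y. K (x - y))"
 using transport[unfolded transport_solution_def Let_def, THEN conjunct2, THEN conjunct2, THEN conjunct2, THEN conjunct1] by blast

lemma transport_weak:
 assumes "test_function \<psi>" "0 \<le> t"
 shows "integrable (lborel \<Otimes>\<^sub>M lborel)
     (\<lambda>(s, x). indicat_real {0..t} s * (\<tau> s x * grad \<psi> x (V s x + \<phi> s x)))"
  "(LINT x|lborel. \<psi> x * \<tau> t x) = (LINT x|lborel. \<psi> x * \<tau>0 x) +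
     (LINT s:{0..t}|lborel. (LINT x|lborel. \<tau> s x * grad \<psi> x (V s x + \<phi> s x)))"
 using transport[unfolded transport_solution_def Let_def, THEN conjunct2, THEN conjunct2, THEN conjunct2, THEN conjunct2,
   rule_format, OF assms] unfolding V_def by blast+

text \<open>\<open>W1inf_lipschitz\<close> asks for a strict bound, hence
  \<open>M\<phi> + 1\<close>.\<close>

lemma phi_facts:
 "AE t in lborel. 0 < t \<longrightarrow> weakly_divergence_free (\<phi> t) \<and> continuous_on UNIV (\<phi> t) \<and>
  (\<forall>x. norm (\<phi> t x) \<le> M\<phi> + 1) \<and> (\<forall>x y. norm (\<phi> t x - \<phi> t y) \<le> (M\<phi> + 1) * norm (x - y))"
proof -
 have "AE t in restrict_space lborel {0<..}. W1inf_norm (\<phi> t) \<le> Linf_W1inf_norm \<phi>"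
  unfolding Linf_W1inf_norm_def by (rule esssup_AE)
 then have 1: "AE t\<in>{0<..} in lborel. W1inf_norm (\<phi> t) \<le> Linf_W1inf_norm \<phi>"
  by (subst (asm) AE_restrict_space_iff) auto
 have 2: "AE t in lborel. 0 < t \<longrightarrow> continuous_on UNIV (\<phi> t) \<and> weakly_divergence_free (\<phi> t)"
  using field by (simp add: divergence_free_field_def)
 show ?thesis using 1 2
 proof eventually_elim
  case (elim t)
  show ?case
  proof
   assume t: "0 < t"
   have "W1inf_norm (\<phi> t) \<le> ennreal M\<phi>" using elim(1) t phi_norm(1) by (auto intro: order.trans)
   also have "\<dots> < ennreal (M\<phi> + 1)" using phi_norm(2) by (subst ennreal_less_iff) auto
   finally have less: "W1inf_norm (\<phi> t) < ennreal (M\<phi> + 1)" .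
   have c: "continuous_on UNIV (\<phi> t)" "weakly_divergence_free (\<phi> t)" using elim(2) t by auto
   show "weakly_divergence_free (\<phi> t) \<and> continuous_on UNIV (\<phi> t) \<and>
    (\<forall>x. norm (\<phi> t x) \<le> M\<phi> + 1) \<and> (\<forall>x y. norm (\<phi> t x - \<phi> t y) \<le> (M\<phi> + 1) * norm (x - y))"
    using c W1inf_lipschitz[OF c(1) less] by blast
  qed
 qed
qed

lemma tau_nonneg: "0 \<le> t \<Longrightarrow> AE x in lborel. 0 \<le> \<tau> t x"
 and tau_borel: "0 \<le> t \<Longrightarrow> \<tau> t \<in> borel_measurable borel"
 using tau_prob by (auto simp: prob_density_def)

lemma Linf_AE: 
 fixes f :: "'a \<Rightarrow> real"
 assumes "Linf_norm f \<le> ennreal m" "0 \<le> m"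
 shows "AE x in lborel. f x \<le> m"
 using esssup_AE[of "\<lambda>x. ennreal (norm (f x))" lborel]
proof eventually_elim
 case (elim x)
 then have "ennreal (norm (f x)) \<le> ennreal m" using assms(1) unfolding Linf_norm_def by (rule order.trans)
 then show ?case using assms(2) by simp
qed

lemma V_eq: "0 \<le> t \<Longrightarrow> V t x = (LINT y|lborel. (indicat_real {0..} t * \<tau> t y) *\<^sub>R K (x - y))"
 unfolding V_def kernel_conv_def density_measure_def
 by (subst integral_density) (auto simp: tau_borel tau_nonneg)

text \<open>The field is controlled only at positive times. The value 0 elsewhere makes
  \<open>w T\<close> jointly measurable and alters the velocity on \<open>{0..T}\<close> only at
  time 0.\<close>

definition w :: "real \<Rightarrow> real \<Rightarrow> 'a \<Rightarrow> 'a" where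
 "w T t x = (if 0 < t \<and> t \<le> T then V t x + \<phi> t x else 0)"

lemma w_measurable: "(\<lambda>(t, x). w T t x) \<in> borel_measurable (borel \<Otimes>\<^sub>M borel)"
proof -
 have "(\<lambda>p. (\<lambda>(t, x). indicat_real {0..} t * \<tau> t x) (fst (fst p), snd p)) \<in> borel_measurable ((borel \<Otimes>\<^sub>M borel) \<Otimes>\<^sub>M lborel)"
  by (rule measurable_compose[OF _ tau_measurable]) measurable
 then have "(\<lambda>p. (indicat_real {0..} (fst (fst p)) * \<tau> (fst (fst p)) (snd p)) *\<^sub>R K (snd (fst p) - snd p))
   \<in> borel_measurable ((borel \<Otimes>\<^sub>M borel) \<Otimes>\<^sub>M lborel)"
  by (intro borel_measurable_scaleR) (simp, measurable)
 then have m1: "(\<lambda>p. LINT y|lborel. (indicat_real {0..} (fst p) * \<tau> (fst p) y) *\<^sub>R K (snd p - y)) \<in> borel_measurable (borel \<Otimes>\<^sub>M borel)"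
  by (intro lborel.borel_measurable_lebesgue_integral) (simp add: case_prod_beta)
 have m2: "(\<lambda>p. indicat_real {0<..} (fst p) *\<^sub>R \<phi> (fst p) (snd p)) \<in> borel_measurable (borel \<Otimes>\<^sub>M borel)"
  using field[unfolded divergence_free_field_def, THEN conjunct1] unfolding borel_prod case_prod_unfold .
 have ind: "(\<lambda>p::real \<times> 'a. indicat_real {0<..T} (fst p)) \<in> borel_measurable (borel \<Otimes>\<^sub>M borel)" by measurable
 have "(\<lambda>p. indicat_real {0<..T} (fst p) *\<^sub>R ((LINT y|lborel. (indicat_real {0..} (fst p) * \<tau> (fst p) y) *\<^sub>R K (snd p - y)) +
   indicat_real {0<..} (fst p) *\<^sub>R \<phi> (fst p) (snd p))) \<in> borel_measurable (borel \<Otimes>\<^sub>M borel)"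
  by (rule borel_measurable_scaleR[OF ind borel_measurable_add[OF m1 m2]])
 also have "(\<lambda>p. indicat_real {0<..T} (fst p) *\<^sub>R ((LINT y|lborel. (indicat_real {0..} (fst p) * \<tau> (fst p) y) *\<^sub>R K (snd p - y)) +
   indicat_real {0<..} (fst p) *\<^sub>R \<phi> (fst p) (snd p))) = (\<lambda>(t, x). w T t x)"
 proof
  fix p :: "real \<times> 'a"
  obtain t x where p: "p = (t, x)" by (cases p)
  show "indicat_real {0<..T} (fst p) *\<^sub>R ((LINT y|lborel. (indicat_real {0..} (fst p) * \<tau> (fst p) y) *\<^sub>R K (snd p - y)) +
   indicat_real {0<..} (fst p) *\<^sub>R \<phi> (fst p) (snd p)) = (case p of (t, x) \<Rightarrow> w T t x)"
   using V_eq[of t x] unfolding p w_def by (cases "0 < t \<and> t \<le> T") auto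
 qed
 finally show ?thesis .
qed

text \<open>The facts are first derived for any bound \<open>M'\<close> on \<open>{0..T}\<close>,
  such as the unspecified one in the definition of a solution. This suffices for the maximum
  principle in \<open>tau_le_aux\<close>, after which they are available with the bound
  \<open>M\<close> of the initial density.\<close>

context
 fixes T M' :: real
 assumes T: "0 \<le> T" and M': "0 \<le> M'" and bound: "\<And>t. t \<in> {0..T} \<Longrightarrow> AE x in lborel. \<tau> t x \<le> M'"
begin

lemma kernel_density_tau: "t \<in> {0..T} \<Longrightarrow> kernel_density K \<alpha> C (\<tau> t) M'"
 using tau_prob bound M' K_int by unfold_locales auto

lemma A'_eq: "t \<in> {0..T} \<Longrightarrow> kernel_density.A TYPE('a) \<alpha> M' = A' M'"
 using kernel_density.A_def[OF kernel_density_tau] by (simp add: A'_def)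

lemma L'_nonneg: "0 \<le> L' M' M\<phi>"
 using kernel_density.A_ge_1[OF kernel_density_tau, of 0] A'_eq[of 0] T C'_pos phi_norm(2) by (simp add: L'_def)

lemma V_lipschitz: "t \<in> {0..T} \<Longrightarrow> norm (V t x - V t y) \<le> 2 * C' * A' M' * norm (x - y)"
 using kernel_density.kernel_conv_lipschitz[OF kernel_density_tau, of t x y] A'_eq[of t] by (simp add: V_def)

lemma w_lipschitz: "AE t\<in>{0..T} in lborel. (\<forall>x y. norm (w T t x - w T t y) \<le> L' M' M\<phi> * norm (x - y))"
 using phi_facts
proof eventually_elim
 case (elim t)
 show ?case
 proof (intro impI allI)
  fix x y assume t: "t \<in> {0..T}"
  show "norm (w T t x - w T t y) \<le> L' M' M\<phi> * norm (x - y)"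
  proof (cases "0 < t")
   case True
   have "w T t x - w T t y = (V t x - V t y) + (\<phi> t x - \<phi> t y)" using True t by (simp add: w_def)
   then have "norm (w T t x - w T t y) \<le> norm (V t x - V t y) + norm (\<phi> t x - \<phi> t y)"
    by (metis norm_triangle_ineq)
   also have "\<dots> \<le> 2 * C' * A' M' * norm (x - y) + (M\<phi> + 1) * norm (x - y)"
    using elim True V_lipschitz[OF t, of x y] by (intro add_mono) blast+
   finally show ?thesis by (simp add: L'_def algebra_simps)
  next
   case False
   then show ?thesis using L'_nonneg by (simp add: w_def)
  qed
 qed
qed

lemma frechet_flux_integrable:
 assumes psi: "test_function \<psi>" and v: "v \<in> borel_measurable borel" "\<And>x y. norm (v x - v y) \<le> l * norm (x - y)" "0 \<le> l"
 shows "integrable lborel (\<lambda>x. grad \<psi> x (v x))"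
proof -
 obtain R where R: "R > 0" "\<And>x. R < norm x \<Longrightarrow> \<psi> x = 0" using test_function_support[OF psi] by blast
 obtain G where G: "G > 0" "\<And>x v. \<bar>grad \<psi> x v\<bar> \<le> G * norm v"
  using test_function_gradient_bounded[OF psi] by blast
 show ?thesis
 proof (rule integrable_bounded_support[where R = R and B = "G * (norm (v 0) + l * R)"])
  show "(\<lambda>x. grad \<psi> x (v x)) \<in> borel_measurable borel"
   using v(1) by (intro test_function_frechet_measurable[OF psi]) auto
  show out: "grad \<psi> x (v x) = 0" if "R < norm x" for x
   using frechet_derivative_outside[of R \<psi> x, OF R(2) that] by simp
  show "\<bar>grad \<psi> x (v x)\<bar> \<le> G * (norm (v 0) + l * R)" for x
  proof (cases "R < norm x")
   case True
   then show ?thesis using out G(1) R(1) v(3) by simp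
  next
   case False
   have "norm (v x) \<le> norm (v 0) + norm (v x - v 0)" by (metis add.commute diff_add_cancel norm_triangle_ineq)
   also have "\<dots> \<le> norm (v 0) + l * R"
    using v(2)[of x 0] mult_left_mono[of "norm x" R l] False v(3) by simp
   finally have "G * norm (v x) \<le> G * (norm (v 0) + l * R)" using G(1) by simp
   then show ?thesis using G(2)[of x "v x"] by linarith
  qed
 qed
qed

lemma w_divergence_free: "AE t\<in>{0..T} in lborel. weakly_divergence_free (w T t)"
 using phi_facts AE_lborel_singleton[of "0::real"]
proof eventually_elim
 case (elim t)
 show ?case
 proof
  assume t: "t \<in> {0..T}"
  then have t0: "0 < t" using elim(2) by auto
  have phi: "weakly_divergence_free (\<phi> t)" "continuous_on UNIV (\<phi> t)"
   "\<And>x y. norm (\<phi> t x - \<phi> t y) \<le> (M\<phi> + 1) * norm (x - y)" using elim(1) t0 by blast+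
  have weq: "w T t = (\<lambda>x. V t x + \<phi> t x)" using t t0 by (auto simp: w_def)
  have Vm: "V t \<in> borel_measurable borel" unfolding V_def by (rule kernel_density.kernel_conv_measurable[OF kernel_density_tau[OF t]])
  have pm: "\<phi> t \<in> borel_measurable borel" by (rule borel_measurable_continuous_onI[OF phi(2)])
  have Vd: "weakly_divergence_free (V t)" unfolding V_def by (rule kernel_density.kernel_conv_weakly_divergence_free[OF kernel_density_tau[OF t]])
  have nn: "0 \<le> 2 * C' * A' M'" using L'_nonneg kernel_density.A_ge_1[OF kernel_density_tau[OF t]] A'_eq[OF t] C'_pos by simp
  show "weakly_divergence_free (w T t)" unfolding weakly_divergence_free_def
  proof (intro allI impI)
   fix \<psi> :: "'a \<Rightarrow> real" assume psi: "test_function \<psi>"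
   have "grad \<psi> x (w T t x) = grad \<psi> x (V t x) + grad \<psi> x (\<phi> t x)" for x
    unfolding weq using has_derivative_linear[OF test_function_has_derivative[OF psi, of x]] by (simp add: linear_add)
   then have "(LINT x|lborel. grad \<psi> x (w T t x)) =
     (LINT x|lborel. grad \<psi> x (V t x)) + (LINT x|lborel. grad \<psi> x (\<phi> t x))"
    using frechet_flux_integrable[OF psi Vm V_lipschitz[OF t] nn] frechet_flux_integrable[OF psi pm phi(3)] phi_norm(2)
    by (simp add: Bochner_Integration.integral_add)
   also have "\<dots> = 0" using Vd[unfolded weakly_divergence_free_def, rule_format, OF psi]
     phi(1)[unfolded weakly_divergence_free_def, rule_format, OF psi] by simp
   finally show "(LINT x|lborel. grad \<psi> x (w T t x)) = 0" .
  qed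
 qed
qed

lemma flux_integrable:
 assumes psi: "test_function \<psi>"
 shows "integrable (lborel \<Otimes>\<^sub>M lborel) (\<lambda>p. indicat_real {0<..T} (fst p) * (\<tau> (fst p) (snd p) * grad \<psi> (snd p) (w T (fst p) (snd p))))"
proof -
 have 1: "integrable (lborel \<Otimes>\<^sub>M lborel) (\<lambda>p. indicat_real ({0<..} \<times> UNIV) p *\<^sub>R
   (case p of (s, x) \<Rightarrow> indicat_real {0..T} s * (\<tau> s x * grad \<psi> x (V s x + \<phi> s x))))"
  by (rule integrable_mult_indicator[OF _ transport_weak(1)[OF psi T]]) simp
 have "indicat_real ({0<..} \<times> UNIV) p *\<^sub>R
   (case p of (s, x) \<Rightarrow> indicat_real {0..T} s * (\<tau> s x * grad \<psi> x (V s x + \<phi> s x))) =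
   indicat_real {0<..T} (fst p) * (\<tau> (fst p) (snd p) * grad \<psi> (snd p) (w T (fst p) (snd p)))" for p
 proof (cases "0 < fst p \<and> fst p \<le> T")
  case True
  then show ?thesis by (cases p) (simp add: w_def)
 next
  case False
  then show ?thesis by (cases p) (auto simp: indicator_def)
 qed
 with 1 show ?thesis by simp
qed

lemma continuity_solution_tau: "continuity_solution (w T) T M' \<tau>"
 unfolding continuity_solution_def
proof (intro conjI ballI allI impI)
 fix t assume t: "t \<in> {0..T}"
 show "\<tau> t \<in> borel_measurable borel" using t by (intro tau_borel) simp
 show "AE x in lborel. 0 \<le> \<tau> t x \<and> \<tau> t x \<le> M'" using tau_nonneg[of t] bound[OF t] t by (intro AE_conjI) simp_all
next
 fix \<psi> :: "'a \<Rightarrow> real" and s t assume psi: "test_function \<psi>" and st: "0 \<le> s" "s \<le> t" "t \<le> T"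
 define h where "h q = (LINT x|lborel. \<tau> q x * grad \<psi> x (V q x + \<phi> q x))" for q
 define g where "g q = (LINT x|lborel. \<tau> q x * grad \<psi> x (w T q x))" for q
 \<comment> \<open>The two velocities differ only at time 0, which does not affect the time
   integrals.\<close>
 have hg: "h q = g q" if "q \<in> {0..T}" "q \<noteq> 0" for q using that by (simp add: h_def g_def w_def)
 have hint: "set_integrable lborel {0..T} h"
  using lborel_pair.integrable_fst'[OF transport_weak(1)[OF psi T]] by (simp add: set_integrable_def h_def)
 have hsub: "set_integrable lborel {a..b} h" if "0 \<le> a" "b \<le> T" for a b
  by (rule set_integrable_subset[OF hint]) (use that in auto)
 have hHK: "h integrable_on {0..T}" by (rule set_borel_integral_eq_integral(1)[OF hint])
 have weak: "(LINT x|lborel. \<psi> x * \<tau> r x) = (LINT x|lborel. \<psi> x * \<tau>0 x) + integral {0..r} h" if "0 \<le> r" "r \<le> T" for r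
  using transport_weak(2)[OF psi that(1)] set_borel_integral_eq_integral(2)[OF hsub[OF order.refl that(2)]] by (simp add: h_def)
 have "integral {0..s} h + integral {s..t} h = integral {0..t} h"
  using st by (intro Henstock_Kurzweil_Integration.integral_combine integrable_subinterval_real[OF hHK]) auto
 then have "(LINT x|lborel. \<psi> x * \<tau> t x) = (LINT x|lborel. \<psi> x * \<tau> s x) + integral {s..t} h"
  using weak[of s] weak[of t] st by simp
 moreover have "integral {s..t} h = (LINT q:{s..t}|lborel. h q)"
  using set_borel_integral_eq_integral(2)[OF hsub[of s t]] st by simp
 moreover have "(LINT q:{s..t}|lborel. h q) = (LINT q:{s..t}|lborel. g q)"
  unfolding set_lebesgue_integral_def
  by (rule integral_discrete_difference[where X = "{0}"]) (use hg st in \<open>auto split: split_indicator\<close>)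
 ultimately show "(LINT x|lborel. \<psi> x * \<tau> t x) = (LINT x|lborel. \<psi> x * \<tau> s x) + (LINT q:{s..t}|lborel. g q)" by simp
 show "set_integrable lborel {s..t} g"
  using hsub[of s t] st unfolding set_integrable_def
  by (subst (asm) integrable_discrete_difference[where X = "{0}" and g = "\<lambda>q. indicat_real {s..t} q *\<^sub>R g q"])
   (use hg st in \<open>auto split: split_indicator\<close>)
qed

section \<open>A time-integrable bound for the velocity at the origin\<close>

lemma test_integral_continuous:
 assumes psi: "test_function \<psi>"
 shows "continuous_on {0..T} (\<lambda>s. LINT x|lborel. \<psi> x * \<tau> s x)"
proof -
 define g where "g q = (LINT x|lborel. \<tau> q x * grad \<psi> x (w T q x))" for q
 have int: "set_integrable lborel {0..s} g" if "s \<in> {0..T}" for s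
  using continuity_solution_weak(1)[OF continuity_solution_tau psi, of 0 s] that by (simp add: g_def[abs_def])
 have c: "continuous_on {0..T} (\<lambda>s. (LINT x|lborel. \<psi> x * \<tau> 0 x) + integral {0..s} g)"
  using T by (intro continuous_intros indefinite_integral_continuous_1 set_borel_integral_eq_integral(1)[OF int]) auto
 have eq: "(LINT x|lborel. \<psi> x * \<tau> s x) = (LINT x|lborel. \<psi> x * \<tau> 0 x) + integral {0..s} g" if "s \<in> {0..T}" for s
  using continuity_solution_weak(2)[OF continuity_solution_tau psi, of 0 s] set_borel_integral_eq_integral(2)[OF int[OF that]] that
  by (simp add: g_def[abs_def])
 show ?thesis by (rule continuous_on_eq[OF c]) (rule eq[symmetric])
qed

lemma tau_integrable: "0 \<le> t \<Longrightarrow> integrable lborel (\<tau> t)"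
 and tau_integral: "0 \<le> t \<Longrightarrow> (LINT x|lborel. \<tau> t x) = 1"
proof -
 assume t: "0 \<le> t"
 note nn = tau_prob[OF t, unfolded prob_density_def]
 show "integrable lborel (\<tau> t)" using nn by (intro integrableI_nonneg) auto
 show "(LINT x|lborel. \<tau> t x) = 1" using nn by (subst integral_eq_nn_integral) auto
qed

definition cutoff :: "nat \<Rightarrow> 'a \<Rightarrow> real" where "cutoff n x = bump 2 ((1 / real (Suc n)) *\<^sub>R x)"

lemma test_function_cutoff: "test_function (cutoff n)"
 using test_function_affine[OF test_function_bump[of 2], of "1 / real (Suc n)" 0] by (simp add: cutoff_def[abs_def])

lemma cutoff_bounds: "0 \<le> cutoff n x" "cutoff n x \<le> 1"
 by (simp_all add: cutoff_def bump_bounds)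

lemma cutoff_mono: "m \<le> n \<Longrightarrow> cutoff m x \<le> cutoff n x"
proof -
 assume "m \<le> n"
 then have "norm ((1 / real (Suc n)) *\<^sub>R x) \<le> norm ((1 / real (Suc m)) *\<^sub>R x)"
  by (auto intro!: divide_left_mono)
 then have "(norm ((1 / real (Suc n)) *\<^sub>R x))\<^sup>2 \<le> (norm ((1 / real (Suc m)) *\<^sub>R x))\<^sup>2"
  by (intro power_mono) auto
 then show ?thesis unfolding cutoff_def bump_def power2_norm_eq_inner
  by (intro smooth_step_mono divide_right_mono diff_left_mono) auto
qed

lemma cutoff_tau_integrable: "0 \<le> t \<Longrightarrow> integrable lborel (\<lambda>x. cutoff n x * \<tau> t x)"
 by (rule Bochner_Integration.integrable_bound[OF tau_integrable])
  (use cutoff_bounds[of n] test_function_measurable[OF test_function_cutoff, of n] tau_borel[of t] in \<open>auto simp: abs_mult intro!: mult_left_le_one_le\<close>)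

lemma cutoff_tendsto:
 assumes "0 \<le> t" shows "(\<lambda>n. LINT x|lborel. cutoff n x * \<tau> t x) \<longlonglongrightarrow> 1"
 unfolding tau_integral[OF assms, symmetric]
proof (rule integral_dominated_convergence[where w = "\<lambda>x. \<bar>\<tau> t x\<bar>"])
 show "\<tau> t \<in> borel_measurable lborel" using tau_borel[OF assms] by simp
 show "(\<lambda>x. cutoff n x * \<tau> t x) \<in> borel_measurable lborel" for n using cutoff_tau_integrable[OF assms] by (rule borel_measurable_integrable)
 show "integrable lborel (\<lambda>x. \<bar>\<tau> t x\<bar>)" using tau_integrable[OF assms] by (rule integrable_abs)
 show "AE x in lborel. norm (cutoff n x * \<tau> t x) \<le> \<bar>\<tau> t x\<bar>" for n
  using cutoff_bounds[of n] by (auto simp: abs_mult intro!: mult_left_le_one_le)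
 show "AE x in lborel. (\<lambda>n. cutoff n x * \<tau> t x) \<longlonglongrightarrow> \<tau> t x"
 proof (rule AE_I2)
  fix x :: 'a
  obtain n0 where n0: "norm x < real n0" using reals_Archimedean2 by blast
  have "cutoff n x = 1" if "n0 \<le> n" for n
  proof -
   have "norm x \<le> real (Suc n)" using n0 that by linarith
   then have "norm ((1 / real (Suc n)) *\<^sub>R x) \<le> 1" by (simp add: field_simps)
   then show ?thesis unfolding cutoff_def by (intro bump_eq_1) auto
  qed
  then have "\<forall>\<^sub>F n in sequentially. cutoff n x * \<tau> t x = \<tau> t x" by (auto simp: eventually_sequentially intro!: exI[of _ n0])
  then show "(\<lambda>n. cutoff n x * \<tau> t x) \<longlonglongrightarrow> \<tau> t x" by (rule tendsto_eventually)
 qed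
qed

text \<open>A compactness argument in time: the sets \<open>F n\<close> of times where the cutoff
  captures at most half of the mass are compact and decreasing. If none were empty, they would share
  a time at which the total mass is at most \<open>1 / 2\<close>.\<close>

lemma tightness: "\<exists>n. \<forall>t\<in>{0..T}. 1 / 2 \<le> (LINT x|lborel. cutoff n x * \<tau> t x)"
proof (rule ccontr)
 define F where "F n = {t\<in>{0..T}. (LINT x|lborel. cutoff n x * \<tau> t x) \<le> 1 / 2}" for n
 assume "\<not> ?thesis"
 then have "\<exists>t\<in>{0..T}. \<not> 1 / 2 \<le> (LINT x|lborel. cutoff n x * \<tau> t x)" for n by blast
 then have "\<exists>t\<in>{0..T}. (LINT x|lborel. cutoff n x * \<tau> t x) \<le> 1 / 2" for n by (meson linear)
 then have "\<exists>t. t \<in> F n" for n unfolding F_def by blast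
 then have ne: "F n \<noteq> {}" for n by blast
 have comp: "compact (F n)" for n
 proof -
  have "closed (F n)" unfolding F_def
   by (intro continuous_on_closed_Collect_le test_integral_continuous test_function_cutoff continuous_intros) auto
  moreover have "F n \<subseteq> {0..T}" by (auto simp: F_def)
  ultimately show ?thesis by (meson bounded_closed_interval bounded_subset compact_eq_bounded_closed)
 qed
 have mono: "F n \<subseteq> F m" if "m \<le> n" for m n
 proof
  fix t assume t: "t \<in> F n"
  then have t0: "0 \<le> t" by (auto simp: F_def)
  have "(LINT x|lborel. cutoff m x * \<tau> t x) \<le> (LINT x|lborel. cutoff n x * \<tau> t x)"
  proof (rule integral_mono_AE[OF cutoff_tau_integrable[OF t0] cutoff_tau_integrable[OF t0]])
   show "AE x in lborel. cutoff m x * \<tau> t x \<le> cutoff n x * \<tau> t x"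
    using tau_nonneg[OF t0] by eventually_elim (intro mult_right_mono cutoff_mono that)
  qed
  then show "t \<in> F m" using t by (simp add: F_def)
 qed
 obtain t where "t \<in> \<Inter>(range F)" using compact_nest[of F, OF comp ne mono] by blast
 then have t: "0 \<le> t" "\<And>n. (LINT x|lborel. cutoff n x * \<tau> t x) \<le> 1 / 2" by (auto simp: F_def)
 have "(1::real) \<le> 1 / 2" by (rule LIMSEQ_le_const2[OF cutoff_tendsto[OF t(1)]]) (use t(2) in auto)
 then show False by simp
qed

text \<open>The solution provides time-integrability of fluxes only. A test function that is linear
  near the origin makes the flux see the component of the velocity along \<open>k\<close>; half of
  the mass lies in that region, and the Lipschitz bound compares the velocity there with its value
  at 0.\<close>

lemma velocity_bound:
 fixes k :: 'a
 shows "\<exists>h c. integrable lborel h \<and> (\<forall>t. 0 \<le> h t) \<and> 0 \<le> c \<and> (AE t\<in>{0..T} in lborel. \<bar>w T t 0 \<bullet> k\<bar> \<le> h t + c)"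
proof -
 obtain n where n: "\<And>t. t \<in> {0..T} \<Longrightarrow> 1 / 2 \<le> (LINT x|lborel. cutoff n x * \<tau> t x)" using tightness by blast
 \<comment> \<open>\<open>cutoff n\<close> vanishes outside the ball of this radius, inside which
   \<open>ch\<close> is linear.\<close>
 define R where "R = 2 * real (Suc n)"
 have R: "R > 0" by (simp add: R_def)
 define ch where "ch x = bump 2 ((1 / R) *\<^sub>R x) * (x \<bullet> k)" for x :: 'a
 have chi: "test_function ch"
  using test_function_mult[OF test_function_affine[OF test_function_bump[of 2], of "1 / R" 0], of "\<lambda>x. x \<bullet> k"] R
  by (simp add: ch_def[abs_def] times_differentiable_linear bounded_linear_inner_left)
 have chi': "grad ch x v = v \<bullet> k" if "norm x < R" for x v
 proof -
  have "(ch has_derivative (\<lambda>v. v \<bullet> k)) (at x)"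
  proof (rule has_derivative_transform_within_open[where s = "ball 0 R"])
   show "((\<lambda>x. x \<bullet> k) has_derivative (\<lambda>v. v \<bullet> k)) (at x)"
    by (rule bounded_linear_imp_has_derivative[OF bounded_linear_inner_left])
   show "x' \<bullet> k = ch x'" if "x' \<in> ball 0 R" for x'
    using bump_eq_1[of 2 "(1 / R) *\<^sub>R x'"] that R by (simp add: ch_def)
  qed (use that in auto)
  then show ?thesis using frechet_derivative_at by metis
 qed
 define h where "h t = (LINT x|lborel. \<bar>indicat_real {0<..T} t * (\<tau> t x * grad ch x (w T t x))\<bar>)" for t
 define c where "c = 2 * (norm k * (L' M' M\<phi> * R))"
 have abs_int: "integrable (lborel \<Otimes>\<^sub>M lborel)
   (\<lambda>p. \<bar>indicat_real {0<..T} (fst p) * (\<tau> (fst p) (snd p) * grad ch (snd p) (w T (fst p) (snd p)))\<bar>)"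
  using flux_integrable[OF chi] by (rule integrable_abs)
 have "integrable lborel h" using lborel_pair.integrable_fst'[OF abs_int] by (simp add: h_def[abs_def])
 then have "integrable lborel (\<lambda>t. 2 * h t)" by simp
 moreover have "0 \<le> 2 * h t" for t unfolding h_def by simp
 moreover have "0 \<le> c" using L'_nonneg R by (simp add: c_def)
 moreover have "AE t\<in>{0..T} in lborel. \<bar>w T t 0 \<bullet> k\<bar> \<le> 2 * h t + c"
  using w_lipschitz lborel_pair.AE_integrable_fst'[OF abs_int] AE_lborel_singleton[of "0::real"]
 proof eventually_elim
  case (elim t)
  show ?case
  proof
   assume t: "t \<in> {0..T}"
   then have t0: "0 < t" "0 \<le> t" "t \<le> T" using elim(3) by auto
   have lip: "norm (w T t x - w T t 0) \<le> L' M' M\<phi> * norm x" for x using elim(1) t by (metis diff_zero)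
   define a where "a = \<bar>w T t 0 \<bullet> k\<bar>"
   have int1: "integrable lborel (\<lambda>x. \<bar>\<tau> t x * grad ch x (w T t x)\<bar>)"
    using elim(2) t0 by simp
   have ht: "h t = (LINT x|lborel. \<bar>\<tau> t x * grad ch x (w T t x)\<bar>)"
    using t0 by (simp add: h_def)
   have "(LINT x|lborel. a * (cutoff n x * \<tau> t x)) \<le>
     (LINT x|lborel. \<bar>\<tau> t x * grad ch x (w T t x)\<bar> + norm k * (L' M' M\<phi> * R) * \<tau> t x)"
   proof (rule integral_mono_AE)
    show "integrable lborel (\<lambda>x. a * (cutoff n x * \<tau> t x))" using cutoff_tau_integrable[OF t0(2)] by simp
    show "integrable lborel (\<lambda>x. \<bar>\<tau> t x * grad ch x (w T t x)\<bar> + norm k * (L' M' M\<phi> * R) * \<tau> t x)"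
     using int1 tau_integrable[OF t0(2)] by simp
    show "AE x in lborel. a * (cutoff n x * \<tau> t x) \<le> \<bar>\<tau> t x * grad ch x (w T t x)\<bar> + norm k * (L' M' M\<phi> * R) * \<tau> t x"
     using tau_nonneg[OF t0(2)]
    proof eventually_elim
     case (elim x)
     show ?case
     proof (cases "norm x < R")
      case True
      have "a \<le> \<bar>w T t x \<bullet> k\<bar> + \<bar>(w T t x - w T t 0) \<bullet> k\<bar>" by (simp add: a_def inner_diff_left)
      also have "\<bar>(w T t x - w T t 0) \<bullet> k\<bar> \<le> norm (w T t x - w T t 0) * norm k" by (rule Cauchy_Schwarz_ineq2)
      also have "\<dots> \<le> (L' M' M\<phi> * R) * norm k"
       using lip[of x] mult_left_mono[of "norm x" R "L' M' M\<phi>"] True L'_nonneg by (intro mult_right_mono) auto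
      finally have 1: "a \<le> \<bar>w T t x \<bullet> k\<bar> + norm k * (L' M' M\<phi> * R)" by (simp add: mult.commute)
      have "a * (cutoff n x * \<tau> t x) \<le> a * \<tau> t x"
       using elim cutoff_bounds[of n x] by (intro mult_left_mono mult_left_le_one_le) (auto simp: a_def)
      also have "\<dots> \<le> (\<bar>w T t x \<bullet> k\<bar> + norm k * (L' M' M\<phi> * R)) * \<tau> t x" using 1 elim by (intro mult_right_mono)
      also have "\<dots> = \<bar>\<tau> t x * grad ch x (w T t x)\<bar> + norm k * (L' M' M\<phi> * R) * \<tau> t x"
       using chi'[OF True] elim by (simp add: abs_mult algebra_simps)
      finally show ?thesis .
     next
      case False
      then have "2 \<le> norm ((1 / real (Suc n)) *\<^sub>R x)" by (simp add: R_def field_simps)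
      then have "cutoff n x = 0" unfolding cutoff_def by (intro bump_eq_0) auto
      then show ?thesis using elim L'_nonneg R by simp
     qed
    qed
   qed
   also have "\<dots> = h t + norm k * (L' M' M\<phi> * R)"
    using int1 tau_integrable[OF t0(2)] tau_integral[OF t0(2)] by (simp add: ht)
   finally have "a * (LINT x|lborel. cutoff n x * \<tau> t x) \<le> h t + norm k * (L' M' M\<phi> * R)"
    by simp
   moreover have "a * (1 / 2) \<le> a * (LINT x|lborel. cutoff n x * \<tau> t x)"
    using n[OF t] by (intro mult_left_mono) (auto simp: a_def)
   ultimately show "\<bar>w T t 0 \<bullet> k\<bar> \<le> 2 * h t + c" by (simp add: a_def c_def)
  qed
 qed
 ultimately show ?thesis by blast
qed

lemma velocity: obtains b where "measurable_velocity (w T) T (L' M' M\<phi>) b"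
proof -
 have "\<forall>k. \<exists>h c. integrable lborel h \<and> (\<forall>t. 0 \<le> h t) \<and> 0 \<le> c \<and> (AE t\<in>{0..T} in lborel. \<bar>w T t 0 \<bullet> k\<bar> \<le> h t + c)"
  using velocity_bound by blast
 from choice[OF this] obtain h where h: "\<forall>k. \<exists>c. integrable lborel (h k) \<and> (\<forall>t. 0 \<le> h k t) \<and> 0 \<le> c \<and> (AE t\<in>{0..T} in lborel. \<bar>w T t 0 \<bullet> k\<bar> \<le> h k t + c)" ..
 from choice[OF h] obtain c where c: "\<forall>k. integrable lborel (h k) \<and> (\<forall>t. 0 \<le> h k t) \<and> 0 \<le> c k \<and> (AE t\<in>{0..T} in lborel. \<bar>w T t 0 \<bullet> k\<bar> \<le> h k t + c k)" ..
 have hc: "integrable lborel (h k)" "0 \<le> h k t" "0 \<le> c k"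
   "AE t\<in>{0..T} in lborel. \<bar>w T t 0 \<bullet> k\<bar> \<le> h k t + c k" for k t using c[rule_format, of k] by simp_all
 define b where "b t = 1 + (\<Sum>k\<in>Basis. h k t + c k)" for t
 have "AE t in lborel. \<forall>k\<in>Basis. t \<in> {0..T} \<longrightarrow> \<bar>w T t 0 \<bullet> k\<bar> \<le> h k t + c k"
  by (rule AE_finite_allI[OF finite_Basis hc(4)])
 then have bb: "AE t\<in>{0..T} in lborel. norm (w T t 0) \<le> b t"
 proof eventually_elim
  case (elim t)
  show ?case
  proof
   assume t: "t \<in> {0..T}"
   have "norm (w T t 0) \<le> (\<Sum>k\<in>Basis. \<bar>w T t 0 \<bullet> k\<bar>)" by (rule norm_le_l1)
   also have "\<dots> \<le> (\<Sum>k\<in>Basis. h k t + c k)" using elim t by (intro sum_mono) auto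
   finally show "norm (w T t 0) \<le> b t" by (simp add: b_def)
  qed
 qed
 have "measurable_velocity (w T) T (L' M' M\<phi>) b"
 proof
  show "0 \<le> T" "0 \<le> L' M' M\<phi>" using T L'_nonneg by auto
  show "1 \<le> b t" for t unfolding b_def using hc(2,3) by (simp add: sum_nonneg)
  have "set_integrable lborel {0..T} (h k)" for k
   using integrable_mult_indicator[OF _ hc(1), of "{0..T}"] by (simp add: set_integrable_def)
  moreover have const: "set_integrable lborel {0..T} (\<lambda>t. r)" for r :: real
   using T by (intro borel_integrable_atLeastAtMost' continuous_on_const)
  ultimately have "set_integrable lborel {0..T} (\<lambda>t. h k t + c k)" for k by (intro set_integral_add(1))
  then have "integrable lborel (\<lambda>t. \<Sum>k\<in>Basis. indicat_real {0..T} t *\<^sub>R (h k t + c k))"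
   unfolding set_integrable_def by (intro Bochner_Integration.integrable_sum)
  then have "set_integrable lborel {0..T} (\<lambda>t. \<Sum>k\<in>Basis. h k t + c k)"
   unfolding set_integrable_def by (simp only: scaleR_sum_right)
  from set_integral_add(1)[OF const this] show "set_integrable lborel {0..T} b" unfolding b_def .
  show "AE t\<in>{0..T} in lborel. (\<forall>x y. norm (w T t x - w T t y) \<le> L' M' M\<phi> * norm (x - y)) \<and> norm (w T t 0) \<le> b t"
   using w_lipschitz bb by eventually_elim blast
  show "(\<lambda>(t, x). w T t x) \<in> borel_measurable (borel \<Otimes>\<^sub>M borel)" by (rule w_measurable)
 qed
 then show ?thesis by (rule that)
qed

lemma tau_le_aux: "AE x in lborel. \<tau> T x \<le> M"
proof -
 obtain b where v: "measurable_velocity (w T) T (L' M' M\<phi>) b" by (rule velocity)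
 show ?thesis
 proof (rule measurable_velocity.density_bound[OF v continuity_solution_tau M' initial(3) w_divergence_free])
  fix \<psi> :: "'a \<Rightarrow> real" assume psi: "test_function \<psi>" and nn: "\<And>x. 0 \<le> \<psi> x"
  obtain R where R: "R > 0" "\<And>x. R < norm x \<Longrightarrow> \<psi> x = 0" using test_function_support[OF psi] by blast
  obtain G where G: "G > 0" "\<And>x. \<bar>\<psi> x\<bar> \<le> G" using test_function_bounded[OF psi] by blast
  have int: "integrable lborel \<psi>"
   by (rule integrable_bounded_support[OF test_function_measurable[OF psi] G(2) R(2)])
  \<comment> \<open>The initial density is attained only in the weak sense, by the equation at time
    0.\<close>
  have "(LINT x|lborel. \<psi> x * \<tau> 0 x) = (LINT x|lborel. \<psi> x * \<tau>0 x)"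
  proof -
   have "(LINT s:{0..0}|lborel. h s) = 0" for h :: "real \<Rightarrow> real"
    using integral_discrete_difference[where X = "{0::real}" and g = "\<lambda>_. 0" and f = "\<lambda>s. indicat_real {0..0} s *\<^sub>R h s" and M = lborel]
    by (simp add: set_lebesgue_integral_def)
   then show ?thesis using transport_weak(2)[OF psi order.refl] by simp
  qed
  also have "\<dots> \<le> (LINT x|lborel. \<psi> x * M)"
  proof (rule integral_mono_AE')
   show "integrable lborel (\<lambda>x. \<psi> x * M)" using int by simp
   show "AE x in lborel. \<psi> x * \<tau>0 x \<le> \<psi> x * M"
    using Linf_AE[OF initial(2,3)] by eventually_elim (intro mult_left_mono nn)
   show "AE x in lborel. 0 \<le> \<psi> x * M" using nn initial(3) by simp
  qed
  also have "\<dots> = M * (LINT x|lborel. \<psi> x)" by simp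
  finally show "(LINT x|lborel. \<psi> x * \<tau> 0 x) \<le> M * (LINT x|lborel. \<psi> x)" .
 qed
qed

end

lemma tau_le: assumes "0 \<le> t" shows "AE x in lborel. \<tau> t x \<le> M"
proof -
 obtain m where m: "\<forall>s\<in>{0..t}. Linf_norm (\<tau> s) \<le> ennreal m" using tau_bound by blast
 have "AE x in lborel. \<tau> s x \<le> max m 0" if "s \<in> {0..t}" for s
  using m that by (intro Linf_AE) (auto simp: max_def ennreal_neg)
 then show ?thesis by (rule tau_le_aux[OF assms max.cobounded2])
qed

lemma kernel_density_at: "0 \<le> t \<Longrightarrow> kernel_density K \<alpha> C (\<tau> t) M"
 by (rule kernel_density_tau[OF _ initial(3) tau_le, of t]) auto

lemma velocity_at:
 assumes "0 \<le> T"
 obtains b where "measurable_velocity (w T) T (L' M M\<phi>) b"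
 by (rule velocity[OF assms initial(3) tau_le]) (auto intro: that)

lemma continuity_solution_at: "0 \<le> T \<Longrightarrow> continuity_solution (w T) T M \<tau>"
 by (rule continuity_solution_tau[OF _ initial(3) tau_le]) auto

lemma A_eq: "kernel_density.A TYPE('a) \<alpha> M = A' M"
 using kernel_density.A_def[OF kernel_density_at[of 0]] by (simp add: A'_def)

lemma Cp_eq: "kernel_density.Cp TYPE('a) \<alpha> M = Q' M"
 using kernel_density.Cp_def[OF kernel_density_at[of 0]] by (simp add: Q'_def)

end

section \<open>Bootstrap for the particle system\<close>

lemma set_integral_split:
 fixes f :: "real \<Rightarrow> 'a::euclidean_space"
 assumes "set_integrable lborel {a..c} f" "a \<le> b" "b \<le> c"
 shows "(LINT q:{a..c}|lborel. f q) = (LINT q:{a..b}|lborel. f q) + (LINT q:{b..c}|lborel. f q)"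
proof -
 have 1: "set_integrable lborel {a..b} f" "set_integrable lborel {b..c} f"
  by (rule set_integrable_subset[OF assms(1)]; use assms in auto)+
 show ?thesis
  using Henstock_Kurzweil_Integration.integral_combine[OF assms(2,3) set_borel_integral_eq_integral(1)[OF assms(1)]]
  by (simp add: set_borel_integral_eq_integral(2)[OF 1(1)] set_borel_integral_eq_integral(2)[OF 1(2)]
    set_borel_integral_eq_integral(2)[OF assms(1)])
qed

lemma set_integral_concat:
 fixes f g :: "real \<Rightarrow> 'a::euclidean_space"
 assumes f: "set_integrable lborel {a..b} f" and g: "set_integrable lborel {b..c} g" and "a \<le> b" "b \<le> c"
 defines "v \<equiv> \<lambda>s. if s \<le> b then f s else g s"
 shows "set_integrable lborel {a..c} v"
  and "s \<in> {a..b} \<Longrightarrow> (LINT q:{a..s}|lborel. v q) = (LINT q:{a..s}|lborel. f q)"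
  and "s \<in> {b..c} \<Longrightarrow> (LINT q:{a..s}|lborel. v q) = (LINT q:{a..b}|lborel. f q) + (LINT q:{b..s}|lborel. g q)"
proof -
 have vf: "(LINT q:{a..s}|lborel. v q) = (LINT q:{a..s}|lborel. f q)" if "s \<in> {a..b}" for s
  unfolding set_lebesgue_integral_def using that
  by (intro Bochner_Integration.integral_cong) (auto simp: v_def indicator_def)
 then show "s \<in> {a..b} \<Longrightarrow> (LINT q:{a..s}|lborel. v q) = (LINT q:{a..s}|lborel. f q)" .
 have "integrable lborel (\<lambda>q. indicat_real {a..b} q *\<^sub>R f q + indicat_real {b<..} q *\<^sub>R (indicat_real {b..c} q *\<^sub>R g q))"
  by (intro Bochner_Integration.integrable_add f[unfolded set_integrable_def]
    integrable_mult_indicator[OF _ g[unfolded set_integrable_def]]) simp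
 also have "(\<lambda>q. indicat_real {a..b} q *\<^sub>R f q + indicat_real {b<..} q *\<^sub>R (indicat_real {b..c} q *\<^sub>R g q)) =
   (\<lambda>q. indicat_real {a..c} q *\<^sub>R v q)"
  using assms(3,4) by (auto simp: v_def indicator_def fun_eq_iff)
 finally show int: "set_integrable lborel {a..c} v" unfolding set_integrable_def .
 assume s: "s \<in> {b..c}"
 have "(LINT q:{a..s}|lborel. v q) = (LINT q:{a..b}|lborel. v q) + (LINT q:{b..s}|lborel. v q)"
  using s assms(3) by (intro set_integral_split set_integrable_subset[OF int]) auto
 also have "(LINT q:{b..s}|lborel. v q) = (LINT q:{b..s}|lborel. g q)"
  unfolding set_lebesgue_integral_def
  by (rule integral_discrete_difference[where X = "{b}"]) (auto simp: v_def indicator_def)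
 finally show "(LINT q:{a..s}|lborel. v q) = (LINT q:{a..b}|lborel. f q) + (LINT q:{b..s}|lborel. g q)"
  using vf[of b] assms(3) by simp
qed

lemma set_integral_continuous:
 fixes f :: "real \<Rightarrow> 'a::euclidean_space"
 assumes "set_integrable lborel {a..c} f"
 shows "continuous_on {a..c} (\<lambda>s. LINT q:{a..s}|lborel. f q)"
proof (rule continuous_on_eq[OF indefinite_integral_continuous_1[OF set_borel_integral_eq_integral(1)[OF assms]]])
 fix s assume "s \<in> {a..c}"
 then have "set_integrable lborel {a..s} f" by (intro set_integrable_subset[OF assms]) auto
 then show "integral {a..s} f = (LINT q:{a..s}|lborel. f q)" by (simp add: set_borel_integral_eq_integral(2))
qed

lemma continuity_solution_restrict:
 assumes "continuity_solution (u :: real \<Rightarrow> 'a::euclidean_space \<Rightarrow> 'a) T M \<rho>" "q \<le> T"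
 shows "continuity_solution u q M \<rho>"
 unfolding continuity_solution_def
proof (intro conjI ballI allI impI)
 fix t assume "t \<in> {0..q}"
 then have "t \<in> {0..T}" using assms(2) by simp
 from continuity_solution_density[OF assms(1) this]
 show "\<rho> t \<in> borel_measurable borel" "AE x in lborel. 0 \<le> \<rho> t x \<and> \<rho> t x \<le> M" .
next
 fix \<psi> :: "'a \<Rightarrow> real" and s t assume psi: "test_function \<psi>" and st: "0 \<le> s" "s \<le> t" "t \<le> q"
 have "t \<le> T" using st(3) assms(2) by simp
 note weak = continuity_solution_weak[OF assms(1) psi st(1,2) this]
 show "set_integrable lborel {s..t} (\<lambda>q. LINT x|lborel. \<rho> q x * grad \<psi> x (u q x))" by (rule weak(1))
 show "(LINT x|lborel. \<psi> x * \<rho> t x) = (LINT x|lborel. \<psi> x * \<rho> s x) +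
   (LINT q:{s..t}|lborel. (LINT x|lborel. \<rho> q x * grad \<psi> x (u q x)))" by (rule weak(2))
qed

text \<open>With \<open>F s = \<integral>\<^sub>s\<^sup>t f\<close>, the function \<open>s \<mapsto> exp (\<Lambda> s) (f t + \<Lambda> F s)\<close> is nondecreasing.\<close>

lemma backward_gronwall:
 fixes f :: "real \<Rightarrow> real"
 assumes t: "0 \<le> t" and cont: "continuous_on {0..t} f" and L: "0 \<le> \<Lambda>"
  and le: "\<And>s. s \<in> {0..t} \<Longrightarrow> f s \<le> f t + \<Lambda> * (integral {0..t} f - integral {0..s} f)"
 shows "f 0 \<le> exp (\<Lambda> * t) * f t"
proof -
 define G where "G s = exp (\<Lambda> * s) * (f t + \<Lambda> * (integral {0..t} f - integral {0..s} f))" for s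
 have "G 0 \<le> G t"
 proof (rule DERIV_nonneg_imp_increasing_open[OF t])
  show "continuous_on {0..t} G" unfolding G_def
   by (intro continuous_intros indefinite_integral_continuous_1 integrable_continuous_real cont)
  fix s assume s: "0 < s" "s < t"
  have "((\<lambda>x. integral {0..x} f) has_real_derivative f s) (at s within {0..t})"
   using s by (intro integral_has_real_derivative cont) auto
  then have I: "((\<lambda>x. integral {0..x} f) has_real_derivative f s) (at s)"
   using s by (simp add: at_within_Icc_at)
  have "(G has_real_derivative \<Lambda> * exp (\<Lambda> * s) * (f t + \<Lambda> * (integral {0..t} f - integral {0..s} f) - f s)) (at s)"
   unfolding G_def by (auto intro!: derivative_eq_intros I simp: algebra_simps)
  moreover have "0 \<le> \<Lambda> * exp (\<Lambda> * s) * (f t + \<Lambda> * (integral {0..t} f - integral {0..s} f) - f s)"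
   using L le[of s] s by (intro mult_nonneg_nonneg) auto
  ultimately show "\<exists>y. DERIV G s :> y \<and> 0 \<le> y" by blast
 qed
 moreover have "f 0 \<le> G 0" using le[of 0] t by (simp add: G_def)
 ultimately show ?thesis by (simp add: G_def)
qed

lemma d_min_le: "i < N \<Longrightarrow> j < N \<Longrightarrow> i \<noteq> j \<Longrightarrow> d_min N X \<le> dist (X i) (X j)"
 and d_min_attained: "2 \<le> N \<Longrightarrow> \<exists>i<N. \<exists>j<N. i \<noteq> j \<and> d_min N X = dist (X i) (X j)"
proof -
 let ?S = "{dist (X i) (X j) | i j. i < N \<and> j < N \<and> i \<noteq> j}"
 have fin: "finite ?S"
  by (rule finite_subset[of _ "(\<lambda>(i, j). dist (X i) (X j)) ` ({..<N} \<times> {..<N})"]) auto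
 show "d_min N X \<le> dist (X i) (X j)" if "i < N" "j < N" "i \<noteq> j"
  unfolding d_min_def by (rule Min_le[OF fin]) (use that in blast)
 assume N: "2 \<le> N"
 have "dist (X 0) (X 1) \<in> ?S" using N by (intro CollectI exI[of _ 0] exI[of _ 1]) auto
 then have "Min ?S \<in> ?S" by (intro Min_in[OF fin]) blast
 then show "\<exists>i<N. \<exists>j<N. i \<noteq> j \<and> d_min N X = dist (X i) (X j)" unfolding d_min_def by blast
qed

lemma (in singular_kernel) kernel_conv_empirical:
 assumes "1 \<le> N"
 shows "kernel_conv K (empirical_measure N X) x = (1 / real N) *\<^sub>R (\<Sum>k<N. K (x - X k))"
proof -
 have "kernel_conv K (empirical_measure N X) x = (LINT k|uniform_count_measure {..<N}. K (x - X k))"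
  unfolding kernel_conv_def empirical_measure_def by (rule integral_distr[OF empirical_measurable]) simp
 also have "\<dots> = (LINT k|point_measure {..<N} (\<lambda>_. ennreal (1 / real N)). K (x - X k))"
  by (simp add: uniform_count_measure_def)
 also have "\<dots> = (\<Sum>k<N. (1 / real N) *\<^sub>R K (x - X k))"
  by (subst lebesgue_integral_point_measure_finite) auto
 finally show ?thesis by (simp add: scaleR_sum_right)
qed

lemma (in bounded_density) measure_density_eq:
 assumes "S \<in> sets borel"
 shows "measure (density_measure f) S = (LINT x|lborel. indicator S x * f x)"
proof -
 have "measure (density_measure f) S = (LINT x|density_measure f. indicator S x)"
  using assms by (simp add: space_density)
 also have "\<dots> = (LINT x|lborel. f x *\<^sub>R indicator S x)" unfolding density_measure_def
  using assms f_nonneg by (intro integral_density) auto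
 finally show ?thesis by (simp add: mult.commute)
qed

lemma (in bounded_density) hall_near_shift:
 assumes "hall_near N X f r" and "\<And>i. i < N \<Longrightarrow> norm (X i - Y i) \<le> h"
 shows "hall_near N Y f (r + h)"
 unfolding hall_near_def
proof (intro allI impI)
 fix I assume I: "I \<subseteq> {..<N}"
 interpret mu: prob_space "density_measure f" by (rule prob_space_density)
 have fin: "finite I" using I finite_subset by blast
 have "cball (X i) r \<subseteq> cball (Y i) (r + h)" if "i \<in> I" for i
 proof
  fix y assume y: "y \<in> cball (X i) r"
  have "dist (Y i) y \<le> dist (Y i) (X i) + dist (X i) y" by (rule dist_triangle)
  moreover have "dist (Y i) (X i) \<le> h" using assms(2)[of i] I that by (auto simp: dist_norm norm_minus_commute)
  ultimately show "y \<in> cball (Y i) (r + h)" using y by simp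
 qed
 then have "(\<Union>i\<in>I. cball (X i) r) \<subseteq> (\<Union>i\<in>I. cball (Y i) (r + h))" by blast
 moreover have "(\<Union>i\<in>I. cball (Y i) (r + h)) \<in> mu.events"
  unfolding sets_density using fin by (intro sets.finite_UN) auto
 ultimately have "measure (density_measure f) (\<Union>i\<in>I. cball (X i) r) \<le> measure (density_measure f) (\<Union>i\<in>I. cball (Y i) (r + h))"
  by (rule mu.finite_measure_mono)
 then show "real (card I) / real N \<le> measure (density_measure f) (\<Union>i\<in>I. cball (Y i) (r + h))"
  using assms(1)[unfolded hall_near_def, rule_format, OF I] by linarith
qed

text \<open>A single particle carries the mass \<open>1 / N\<close>, which a bounded density cannot place at one point.\<close>

lemma (in bounded_density) W_inf_pos:
 assumes "1 \<le> N" shows "0 < W_inf (empirical_measure N X) (density_measure f)"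
proof (rule ccontr)
 assume "\<not> ?thesis"
 then have z: "W_inf (empirical_measure N X) (density_measure f) = 0" by (simp add: not_less)
 have le: "1 / real N \<le> M * unit_ball_vol (real DIM('a)) * r ^ DIM('a)" if "0 < r" for r
 proof -
  have "hall_near N X f r" using z that by (intro hall_near_W_inf assms) auto
  then have "real (card {0::nat}) / real N \<le> measure (density_measure f) (\<Union>i\<in>{0}. cball (X i) r)"
   using assms unfolding hall_near_def by (meson empty_subsetI insert_subset lessThan_iff less_le_trans zero_less_one)
  then show ?thesis using measure_ball_le(2)[of r "X 0"] that by simp
 qed
 have "((\<lambda>r. M * unit_ball_vol (real DIM('a)) * r ^ DIM('a)) \<longlongrightarrow> M * unit_ball_vol (real DIM('a)) * 0 ^ DIM('a)) (at_right 0)"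
  by (intro tendsto_intros)
 then have "1 / real N \<le> M * unit_ball_vol (real DIM('a)) * 0 ^ DIM('a)"
  by (rule tendsto_lowerbound) (auto simp: eventually_at_right_field intro!: exI[of _ 1] le)
 then show False using assms by (simp add: power_0_left)
qed

text \<open>In \<open>small\<close> the radius and the minimal distance are those of the relaxed
  bootstrap bounds at time \<open>T\<close>, with 3 in place of 2 because Hall's condition needs a
  strict inequality. It is what bounds the second term of \<open>particle_singular_sum\<close> by
  1.\<close>

locale particle_system = transport_setting K \<alpha> C \<phi> \<tau>0 \<tau> M M\<phi>
 for K :: "'a::euclidean_space \<Rightarrow> 'a" and \<alpha> C \<phi> \<tau>0 \<tau> M M\<phi> +
 fixes N :: nat and X0 :: "nat \<Rightarrow> 'a" and X E :: "nat \<Rightarrow> real \<Rightarrow> 'a" and e :: "real \<Rightarrow> real" and T c1 h0 \<Lambda> L :: real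
 assumes Lambda: "\<Lambda> = rate M M\<phi> c1" and L: "L = L' M M\<phi>" and N: "2 \<le> N" and T: "0 < T" and c1: "0 \<le> c1"
  and particles: "particle_solution K N \<phi> E X0 X"
  and e_mono: "mono_on {0..} e" and e_nonneg: "\<And>t. 0 \<le> t \<Longrightarrow> 0 \<le> e t"
  and h0: "W_inf (empirical_measure N (\<lambda>i. X i 0)) (density_measure (\<tau> 0)) = ennreal h0" "0 < h0"
  and d0: "0 < d_min N (\<lambda>i. X i 0)"
  and small: "Q' M * ((3 * exp (\<Lambda> * T) * (h0 + e T)) powr (real DIM('a) - \<beta>) /
    ((d_min N (\<lambda>i. X i 0) / (2 * exp (\<Lambda> * T))) powr \<beta> * real N powr (\<beta> / real DIM('a)))) \<le> 1"
  and errors: "\<And>t. t \<in> {0..T} \<Longrightarrow>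
    W_inf (empirical_measure N (\<lambda>i. X i t)) (density_measure (\<tau> t)) \<le> ennreal (2 * exp (\<Lambda> * t) * (h0 + e t)) \<Longrightarrow>
    d_min N (\<lambda>i. X i 0) \<le> 2 * exp (\<Lambda> * t) * d_min N (\<lambda>i. X i t) \<Longrightarrow>
    (\<forall>i<N. norm (E i t) \<le> e t) \<and>
    (\<forall>i<N. \<forall>j<N. i \<noteq> j \<longrightarrow> norm (E i t - E j t) \<le> c1 * norm (X i t - X j t))"
begin

abbreviation d :: "real \<Rightarrow> real" where "d t \<equiv> d_min N (\<lambda>i. X i t)"
abbreviation \<eta> :: "real \<Rightarrow> ennreal" where "\<eta> t \<equiv> W_inf (empirical_measure N (\<lambda>i. X i t)) (density_measure (\<tau> t))"
abbreviation pv :: "nat \<Rightarrow> real \<Rightarrow> 'a" where "pv \<equiv> particle_velocity K N \<phi> E X"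

section \<open>Estimates while the relaxed bounds hold\<close>

definition good :: "real \<Rightarrow> bool" where
 "good t \<longleftrightarrow> \<eta> t \<le> ennreal (2 * exp (\<Lambda> * t) * (h0 + e t)) \<and> d 0 \<le> 2 * exp (\<Lambda> * t) * d t"

lemmas constants = constants_nonneg[OF initial(3) phi_norm(2) c1, folded Lambda L]

lemma Lambda_eq: "\<Lambda> = 2 * L + 3 * P' M + 1 + (M\<phi> + 1) + c1 + 3 * C' * S' M"
 by (simp add: Lambda L rate_def)

lemma e_le: "0 \<le> s \<Longrightarrow> s \<le> t \<Longrightarrow> e s \<le> e t"
 using e_mono by (auto simp: mono_on_def)

lemma h_pos: "0 \<le> t \<Longrightarrow> 0 < h0 + e t"
 using h0(2) e_nonneg[of t] by linarith

lemma pv_integrable: "i < N \<Longrightarrow> 0 \<le> s \<Longrightarrow> set_integrable lborel {s..t} (pv i)"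
proof (cases "0 \<le> t")
 case True
 assume "i < N" "0 \<le> s"
 then have "set_integrable lborel {0..t} (pv i)" using particles True unfolding particle_solution_def by blast
 then show ?thesis by (rule set_integrable_subset) (use \<open>0 \<le> s\<close> in auto)
qed (simp add: set_integrable_def)

lemma X_start: "i < N \<Longrightarrow> 0 \<le> t \<Longrightarrow> X i t = X i 0 + (LINT q:{0..t}|lborel. pv i q)"
proof -
 assume i: "i < N" and t: "0 \<le> t"
 have eq: "X i t = X0 i + (LINT q:{0..t}|lborel. pv i q)" if "0 \<le> t" for t
  using particles i that unfolding particle_solution_def by blast
 have "(LINT q:{0..0}|lborel. pv i q) = 0"
  using integral_discrete_difference[where X = "{0::real}" and g = "\<lambda>_. 0" and f = "\<lambda>s. indicat_real {0..0} s *\<^sub>R pv i s" and M = lborel]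
  by (simp add: set_lebesgue_integral_def)
 then show ?thesis using eq[of 0] eq[OF t] by simp
qed

lemma X_step: "i < N \<Longrightarrow> 0 \<le> s \<Longrightarrow> s \<le> t \<Longrightarrow> X i t = X i s + (LINT q:{s..t}|lborel. pv i q)"
 using X_start[of i s] X_start[of i t] set_integral_split[OF pv_integrable[of i 0 t], of s] by simp

lemma X_continuous: "i < N \<Longrightarrow> continuous_on {0..t} (X i)"
proof -
 assume i: "i < N"
 have "continuous_on {0..t} (\<lambda>s. X i 0 + (LINT q:{0..s}|lborel. pv i q))"
  by (intro continuous_intros set_integral_continuous pv_integrable i) simp
 then show ?thesis by (rule continuous_on_eq) (rule X_start[OF i, symmetric], simp)
qed

lemma good_separated:
 assumes "good t" "t \<in> {0..T}" "i < N" "j < N" "i \<noteq> j"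
 shows "d 0 / (2 * exp (\<Lambda> * T)) \<le> dist (X i t) (X j t)" "X i t \<noteq> X j t"
proof -
 have "d 0 \<le> 2 * exp (\<Lambda> * t) * d t" using assms(1) by (simp add: good_def)
 also have "\<dots> \<le> 2 * exp (\<Lambda> * t) * dist (X i t) (X j t)"
  using d_min_le[OF assms(3-5), of "\<lambda>i. X i t"] by simp
 also have "\<dots> \<le> 2 * exp (\<Lambda> * T) * dist (X i t) (X j t)"
  using assms(2) constants(6) by (intro mult_right_mono mult_left_mono) auto
 finally show 1: "d 0 / (2 * exp (\<Lambda> * T)) \<le> dist (X i t) (X j t)" by (simp add: field_simps)
 have "0 < d 0 / (2 * exp (\<Lambda> * T))" using d0 by simp
 then show "X i t \<noteq> X j t" using 1 by auto
qed

lemma good_near: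
 assumes "good t" "0 \<le> t" shows "hall_near N (\<lambda>i. X i t) (\<tau> t) (3 * exp (\<Lambda> * t) * (h0 + e t))"
proof -
 interpret kernel_density K \<alpha> C "\<tau> t" M by (rule kernel_density_at[OF assms(2)])
 show ?thesis
 proof (rule hall_near_W_inf)
  show "1 \<le> N" using N by simp
  have "\<eta> t \<le> ennreal (2 * exp (\<Lambda> * t) * (h0 + e t))" using assms(1) by (simp add: good_def)
  also have "\<dots> < ennreal (3 * exp (\<Lambda> * t) * (h0 + e t))"
   using h_pos[OF assms(2)] by (intro ennreal_lessI) auto
  finally show "\<eta> t < ennreal (3 * exp (\<Lambda> * t) * (h0 + e t))" .
 qed
qed

lemma good_sum:
 assumes "good t" "t \<in> {0..T}" "i < N"
 shows "(\<Sum>k\<in>{..<N} - {i}. norm (X i t - X k t) powr - \<beta>) / real N \<le> S' M"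
proof -
 have t: "0 \<le> t" "t \<le> T" using assms(2) by auto
 interpret kernel_density K \<alpha> C "\<tau> t" M by (rule kernel_density_at[OF t(1)])
 define r where "r = 3 * exp (\<Lambda> * t) * (h0 + e t)"
 define r' where "r' = 3 * exp (\<Lambda> * T) * (h0 + e T)"
 define \<delta> where "\<delta> = d 0 / (2 * exp (\<Lambda> * T))"
 define W where "W = \<delta> powr \<beta> * real N powr (\<beta> / real DIM('a))"
 have r: "0 < r" unfolding r_def using h_pos[OF t(1)] by simp
 have "r \<le> r'" unfolding r_def r'_def using t constants(6) e_le[OF t] h_pos[OF t(1)] by (intro mult_mono) auto
 have \<delta>: "0 < \<delta>" using d0 by (simp add: \<delta>_def)
 have "(\<Sum>k\<in>{..<N} - {i}. norm (X i t - X k t) powr - \<beta>) / real N \<le>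
   2 powr \<beta> * A + Cp * (r powr (real DIM('a) - \<beta>) / W)"
  unfolding W_def
 proof (rule particle_singular_sum[OF _ _ r \<delta> assms(3)])
  show "1 \<le> N" using N by simp
  show "hall_near N (\<lambda>i. X i t) (\<tau> t) r" unfolding r_def by (rule good_near[OF assms(1) t(1)])
  show "\<delta> \<le> dist (X j t) (X k t)" if "j < N" "k < N" "j \<noteq> k" for j k
   unfolding \<delta>_def by (rule good_separated(1)[OF assms(1,2) that])
 qed
 also have "Cp * (r powr (real DIM('a) - \<beta>) / W) \<le> Cp * (r' powr (real DIM('a) - \<beta>) / W)"
  using r \<open>r \<le> r'\<close> beta(2) Cp_nonneg by (intro mult_left_mono divide_right_mono powr_mono2) (auto simp: W_def)
 also have "\<dots> \<le> 1" using small by (simp add: Cp_eq W_def r'_def \<delta>_def)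
 finally show ?thesis by (simp add: S'_def A_eq)
qed

text \<open>The radius \<rho> is free above \<open>h0 + e t\<close> because
  \<open>hall_propagation\<close> uses one initial radius for all times up to the final one.\<close>

lemma good_error:
 assumes "good t" "0 < t" "t \<le> T" "i < N" "h0 + e t \<le> \<rho>"
 shows "norm (w T t (X i t) - pv i t) \<le> (\<Lambda> - L) * (\<rho> * exp (\<Lambda> * t))"
proof -
 have t: "0 \<le> t" "t \<in> {0..T}" using assms by auto
 interpret kernel_density K \<alpha> C "\<tau> t" M by (rule kernel_density_at[OF t(1)])
 let ?h = "exp (\<Lambda> * t) * (h0 + e t)"
 let ?D = "V t (X i t) - (1 / real N) *\<^sub>R (\<Sum>k\<in>{..<N} - {i}. K (X i t - X k t))"
 have h: "0 < ?h" using h_pos[OF t(1)] by simp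
 have "norm ?D \<le> C' * (3 * exp (\<Lambda> * t) * (h0 + e t)) * (2 * A + 2 powr \<beta> * S' M)"
  unfolding V_def
 proof (rule kernel_conv_error_particle[OF _ good_near[OF assms(1) t(1)] _ assms(4) _ good_sum[OF assms(1) t(2) assms(4)]])
  show "1 \<le> N" using N by simp
  show "0 \<le> 3 * exp (\<Lambda> * t) * (h0 + e t)" using h by (simp add: mult.assoc)
  show "X k t \<noteq> X i t" if "k < N" "k \<noteq> i" for k by (rule good_separated(2)[OF assms(1) t(2) that(1) assms(4) that(2)])
 qed
 also have "\<dots> = 3 * P' M * ?h" by (simp add: P'_def A_eq)
 finally have 1: "norm ?D \<le> 3 * P' M * ?h" .
 have "norm (E i t) \<le> e t" using errors[OF t(2)] assms(1,4) by (simp add: good_def)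
 also have "\<dots> \<le> 1 * (h0 + e t)" using h0(2) by simp
 also have "\<dots> \<le> ?h" using constants(6) t(1) h_pos[OF t(1)] by (intro mult_right_mono) auto
 finally have 2: "norm (E i t) \<le> ?h" .
 have "w T t (X i t) - pv i t = ?D - E i t"
  using assms(2,3) by (simp add: w_def particle_velocity_def)
 then have "norm (w T t (X i t) - pv i t) \<le> norm ?D + norm (E i t)" by (metis norm_triangle_ineq4)
 also have "\<dots> \<le> (3 * P' M + 1) * ?h" using 1 2 by (simp add: algebra_simps)
 also have "\<dots> \<le> (\<Lambda> - L) * ?h"
 proof (rule mult_right_mono)
  have "0 \<le> 3 * C' * S' M" using constants(2) C'_pos by simp
  then show "3 * P' M + 1 \<le> \<Lambda> - L" unfolding Lambda_eq using constants(4) phi_norm(2) c1 by linarith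
 qed (use h in simp)
 also have "\<dots> \<le> (\<Lambda> - L) * (\<rho> * exp (\<Lambda> * t))"
 proof (rule mult_left_mono)
  show "?h \<le> \<rho> * exp (\<Lambda> * t)" using assms(5) by (simp add: mult.commute)
  have "0 \<le> 3 * C' * S' M" using constants(2) C'_pos by simp
  then show "0 \<le> \<Lambda> - L" unfolding Lambda_eq using constants(3,4) phi_norm(2) c1 by linarith
 qed
 finally show ?thesis .
qed

text \<open>The relative speed is proportional to the distance: the mutual forces are bounded by
  their size, and the forces of each third particle on the two are compared by
  \<open>K_diff\<close>.\<close>

lemma good_pair:
 assumes "good t" "t \<in> {0..T}" "i < N" "j < N" "i \<noteq> j"
  and phi: "\<And>x y. norm (\<phi> t x - \<phi> t y) \<le> (M\<phi> + 1) * norm (x - y)"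
 shows "norm (pv i t - pv j t) \<le> \<Lambda> * norm (X i t - X j t)"
proof -
 have N0: "0 < real N" using N by simp
 define D where "D = norm (X i t - X j t)"
 define s where "s i = (\<Sum>k\<in>{..<N} - {i}. K (X i t - X k t))" for i
 have ne: "X k t \<noteq> X l t" if "k < N" "l < N" "k \<noteq> l" for k l
  using good_separated(2)[OF assms(1,2) that] .
 define J where "J = {..<N} - {i, j}"
 have Ji: "{..<N} - {i} = insert j J" and Jj: "{..<N} - {j} = insert i J" and fin: "finite J" "j \<notin> J" "i \<notin> J"
  using assms(3-5) by (auto simp: J_def)
 have si: "s i = K (X i t - X j t) + (\<Sum>k\<in>J. K (X i t - X k t))" unfolding s_def Ji using fin by simp
 have sj: "s j = K (X j t - X i t) + (\<Sum>k\<in>J. K (X j t - X k t))" unfolding s_def Jj using fin by simp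
 let ?p = "\<lambda>i k. norm (X i t - X k t) powr - \<beta>"
 have Sb: "(\<Sum>k\<in>{..<N} - {l}. ?p l k) \<le> real N * S' M" if "l < N" for l
  using good_sum[OF assms(1,2) that] N0 by (simp add: field_simps)
 have Si: "?p i j + (\<Sum>k\<in>J. ?p i k) \<le> real N * S' M" using Sb[OF assms(3)] unfolding Ji using fin by simp
 have Sj: "?p i j + (\<Sum>k\<in>J. ?p j k) \<le> real N * S' M" using Sb[OF assms(4)] unfolding Jj using fin
  by (simp add: norm_minus_commute)
 have sum_nn: "0 \<le> (\<Sum>k\<in>J. ?p i k)" "0 \<le> (\<Sum>k\<in>J. ?p j k)" by (intro sum_nonneg; simp)+
 have D: "0 < D" using ne[OF assms(3-5)] by (simp add: D_def)
 have K1: "norm (K (X i t - X j t)) \<le> C * D * ?p i j"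
  using K_norm[of "X i t - X j t"] ne[OF assms(3-5)] by (simp add: D_def)
 have K2: "norm (K (X j t - X i t)) \<le> C * D * ?p i j"
  using K_norm[of "X j t - X i t"] ne[OF assms(3-5)] by (simp add: D_def norm_minus_commute)
 have K3: "norm (\<Sum>k\<in>J. K (X i t - X k t) - K (X j t - X k t)) \<le> (\<Sum>k\<in>J. C' * D * (?p i k + ?p j k))"
 proof (rule sum_norm_le)
  fix k assume "k \<in> J"
  then have "k < N" "k \<noteq> i" "k \<noteq> j" by (auto simp: J_def)
  then show "norm (K (X i t - X k t) - K (X j t - X k t)) \<le> C' * D * (?p i k + ?p j k)"
   using K_diff[of "X i t - X k t" "X j t - X k t"] ne[of i k] ne[of j k] assms(3,4) by (simp add: D_def)
 qed
 have "norm (s i - s j) = norm (K (X i t - X j t) - K (X j t - X i t) + (\<Sum>k\<in>J. K (X i t - X k t) - K (X j t - X k t)))"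
  by (simp add: si sj sum_subtractf algebra_simps)
 also have "\<dots> \<le> norm (K (X i t - X j t)) + norm (K (X j t - X i t)) + norm (\<Sum>k\<in>J. K (X i t - X k t) - K (X j t - X k t))"
  using norm_triangle_ineq[of "K (X i t - X j t) - K (X j t - X i t)"] norm_triangle_ineq4[of "K (X i t - X j t)" "K (X j t - X i t)"]
  by (smt (verit))
 also have "\<dots> \<le> C * D * ?p i j + C * D * ?p i j + C' * D * ((\<Sum>k\<in>J. ?p i k) + (\<Sum>k\<in>J. ?p j k))"
  using K1 K2 K3 by (simp add: sum_distrib_left[symmetric] sum.distrib)
 \<comment> \<open>The three multiples of \<open>C' * S' M\<close> are one for the mutual forces and
   one for each of the two sums over third particles.\<close>
 also have "\<dots> \<le> C' * D * (real N * S' M) + C' * D * (real N * S' M + real N * S' M)"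
 proof (rule add_mono)
  have "C * D * ?p i j + C * D * ?p i j \<le> C' * D * ?p i j"
   using mult_right_mono[of "2 * C" C' "D * ?p i j"] C_le_C' C_pos D by (simp add: algebra_simps)
  also have "\<dots> \<le> C' * D * (real N * S' M)" using Si sum_nn C'_pos D by (intro mult_left_mono) auto
  finally show "C * D * ?p i j + C * D * ?p i j \<le> C' * D * (real N * S' M)" .
  have p: "0 \<le> ?p i j" by simp
  show "C' * D * ((\<Sum>k\<in>J. ?p i k) + (\<Sum>k\<in>J. ?p j k)) \<le> C' * D * (real N * S' M + real N * S' M)"
  proof (intro mult_left_mono add_mono)
   show "(\<Sum>k\<in>J. ?p i k) \<le> real N * S' M" "(\<Sum>k\<in>J. ?p j k) \<le> real N * S' M" using Si Sj p by linarith+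
  qed (use C'_pos D in simp)
 qed
 finally have s_le: "norm (s i - s j) \<le> real N * (3 * C' * S' M * D)" by (simp add: algebra_simps)
 have "pv i t - pv j t = (\<phi> t (X i t) - \<phi> t (X j t)) + (1 / real N) *\<^sub>R (s i - s j) + (E i t - E j t)"
  by (simp add: particle_velocity_def s_def algebra_simps)
 then have "norm (pv i t - pv j t) \<le> norm (\<phi> t (X i t) - \<phi> t (X j t)) + norm ((1 / real N) *\<^sub>R (s i - s j)) + norm (E i t - E j t)"
  by (simp only:) (rule order.trans[OF norm_triangle_ineq add_right_mono[OF norm_triangle_ineq]])
 also have "\<dots> \<le> (M\<phi> + 1) * D + 3 * C' * S' M * D + c1 * D"
 proof (intro add_mono)
  show "norm (\<phi> t (X i t) - \<phi> t (X j t)) \<le> (M\<phi> + 1) * D" using phi by (simp add: D_def)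
  show "norm ((1 / real N) *\<^sub>R (s i - s j)) \<le> 3 * C' * S' M * D" 
  proof -
   have "norm ((1 / real N) *\<^sub>R (s i - s j)) = norm (s i - s j) / real N" by (simp only: norm_scaleR) simp
   also have "\<dots> \<le> 3 * C' * S' M * D" using s_le N0 by (simp add: pos_divide_le_eq mult_ac)
   finally show ?thesis .
  qed
  show "norm (E i t - E j t) \<le> c1 * D" using errors[OF assms(2)] assms(1,3-5) by (simp add: good_def D_def)
 qed
 also have "\<dots> = (M\<phi> + 1 + 3 * C' * S' M + c1) * D" by (simp add: algebra_simps)
 also have "\<dots> \<le> \<Lambda> * D" using D constants(3,4) unfolding Lambda_eq by (intro mult_right_mono) auto
 finally show ?thesis by (simp add: D_def)
qed

text \<open>Gronwall's inequality is run backwards, since the initial distance is to be bounded by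
  the later one. Only times before \<open>t\<close> enter the integrals, so nothing has to be known
  at \<open>t\<close> itself.\<close>

lemma distance_lower_bound:
 assumes t: "t \<in> {0..T}" and gd: "\<And>s. 0 \<le> s \<Longrightarrow> s < t \<Longrightarrow> good s" and ij: "i < N" "j < N" "i \<noteq> j"
 shows "d 0 \<le> exp (\<Lambda> * t) * dist (X i t) (X j t)"
proof -
 define f where "f s = norm (X i s - X j s)" for s
 have t0: "0 \<le> t" "t \<le> T" using t by auto
 have cont: "continuous_on {0..t} f" unfolding f_def
  by (intro continuous_intros X_continuous ij)
 have int: "set_integrable lborel {s..t} (\<lambda>q. pv i q - pv j q)" if "0 \<le> s" for s
  by (intro set_integral_diff(1) pv_integrable ij that)
 have le: "f s \<le> f t + \<Lambda> * (integral {0..t} f - integral {0..s} f)" if s: "s \<in> {0..t}" for s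
 proof -
  have s0: "0 \<le> s" "s \<le> t" using s by auto
  have fint: "f integrable_on {0..t}" by (rule integrable_continuous_real[OF cont])
  have fset: "set_integrable lborel {s..t} f"
   using s0 by (intro borel_integrable_atLeastAtMost' continuous_on_subset[OF cont]) auto
  have "X i t - X j t = X i s - X j s + (LINT q:{s..t}|lborel. pv i q - pv j q)"
   using X_step[OF ij(1) s0] X_step[OF ij(2) s0] set_integral_diff(2)[OF pv_integrable[OF ij(1) s0(1)] pv_integrable[OF ij(2) s0(1)]]
   by simp
  then have "X i s - X j s = (X i t - X j t) - (LINT q:{s..t}|lborel. pv i q - pv j q)" by (simp add: algebra_simps)
  then have "f s \<le> f t + norm (LINT q:{s..t}|lborel. pv i q - pv j q)" unfolding f_def by (metis norm_triangle_ineq4)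
  also have "norm (LINT q:{s..t}|lborel. pv i q - pv j q) \<le> (LINT q:{s..t}|lborel. norm (pv i q - pv j q))"
   by (rule set_integral_norm_bound[OF int[OF s0(1)]])
  also have "\<dots> \<le> (LINT q:{s..t}|lborel. \<Lambda> * f q)"
   unfolding set_lebesgue_integral_def
  proof (rule integral_mono_AE)
   show "integrable lborel (\<lambda>q. indicat_real {s..t} q *\<^sub>R norm (pv i q - pv j q))"
    using set_integrable_norm[OF int[OF s0(1)]] by (simp add: set_integrable_def)
   show "integrable lborel (\<lambda>q. indicat_real {s..t} q *\<^sub>R (\<Lambda> * f q))"
    using set_integrable_mult_right[OF fset, of \<Lambda>] by (simp add: set_integrable_def)
   show "AE q in lborel. indicat_real {s..t} q *\<^sub>R norm (pv i q - pv j q) \<le> indicat_real {s..t} q *\<^sub>R (\<Lambda> * f q)"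
    using phi_facts AE_lborel_singleton[of "0::real"] AE_lborel_singleton[of t]
   proof eventually_elim
    case (elim q)
    show ?case
    proof (cases "q \<in> {s..t}")
     case True
     then have q: "0 < q" "q < t" "q \<in> {0..T}" using elim(2,3) s0 t0 by auto
     have "norm (pv i q - pv j q) \<le> \<Lambda> * f q" unfolding f_def
     proof (rule good_pair[OF gd q(3) ij])
      show "norm (\<phi> q x - \<phi> q y) \<le> (M\<phi> + 1) * norm (x - y)" for x y using elim(1) q(1) by blast
     qed (use q in auto)
     then show ?thesis using True by simp
    qed simp
   qed
  qed
  also have "\<dots> = \<Lambda> * (LINT q:{s..t}|lborel. f q)" by simp
  also have "(LINT q:{s..t}|lborel. f q) = integral {0..t} f - integral {0..s} f"
   using Henstock_Kurzweil_Integration.integral_combine[OF s0 fint] set_borel_integral_eq_integral(2)[OF fset] by simp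
  finally show ?thesis by simp
 qed
 have "f 0 \<le> exp (\<Lambda> * t) * f t" using constants(6) by (intro backward_gronwall[OF t0(1) cont _ le]) auto
 moreover have "d 0 \<le> f 0" unfolding f_def dist_norm[symmetric] by (rule d_min_le[OF ij])
 ultimately show ?thesis by (simp add: f_def dist_norm)
qed

lemma d_lower_bound:
 assumes "t \<in> {0..T}" "\<And>s. 0 \<le> s \<Longrightarrow> s < t \<Longrightarrow> good s"
 shows "d 0 \<le> exp (\<Lambda> * t) * d t"
 using d_min_attained[OF N, of "\<lambda>i. X i t"] distance_lower_bound[OF assms] by metis

text \<open>From time \<open>t\<close> on the particle velocities are not yet controlled, so the
  centers follow the velocity field at a fixed position instead.\<close>

definition Y :: "real \<Rightarrow> nat \<Rightarrow> real \<Rightarrow> 'a" where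
 "Y t i s = X i t + (LINT q:{t..s}|lborel. w T q (X i t))"

lemma w_curve_integrable: "0 \<le> t \<Longrightarrow> set_integrable lborel {t..T} (\<lambda>q. w T q x)"
proof -
 assume t: "0 \<le> t"
 obtain b where "measurable_velocity (w T) T (L' M M\<phi>) b" using velocity_at[OF less_imp_le[OF T]] by blast
 then interpret mv: measurable_velocity "w T" T "L' M M\<phi>" b .
 obtain R where "set_integrable lborel {0..T} (\<lambda>q. w T q ((\<lambda>_. x) q))"
  by (rule mv.curve[of "\<lambda>_. x" 0]) auto
 then show ?thesis by (rule set_integrable_subset) (use t in auto)
qed

lemma Y_start: "Y t i t = X i t"
 using integral_discrete_difference[where X = "{t}" and g = "\<lambda>_. 0" and f = "\<lambda>s. indicat_real {t..t} s *\<^sub>R w T s (X i t)" and M = lborel]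
 by (simp add: set_lebesgue_integral_def Y_def)

lemma Y_continuous: "0 \<le> t \<Longrightarrow> continuous_on {t..T} (Y t i)"
 unfolding Y_def by (intro continuous_intros set_integral_continuous w_curve_integrable)

text \<open>Up to time \<open>t\<close> the balls follow the particles; afterwards they move with one Euler step of the velocity field.\<close>

lemma hall_propagation:
 assumes t: "0 \<le> t" "t \<le> q" "q \<le> T" and gd: "\<And>s. 0 \<le> s \<Longrightarrow> s < t \<Longrightarrow> good s"
  and near: "\<And>i s. i < N \<Longrightarrow> s \<in> {t..q} \<Longrightarrow> norm (Y t i s - X i t) \<le> h0"
  and \<rho>: "h0 + e q < \<rho>" and \<kappa>: "1 < \<kappa>"
 shows "hall_near N (\<lambda>i. Y t i q) (\<tau> q) (\<kappa> * \<rho> * exp (\<Lambda> * q))"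
 unfolding hall_near_def
proof (intro allI impI)
 fix I assume I: "I \<subseteq> {..<N}"
 then have fin: "finite I" by (rule finite_subset) simp
 have q0: "0 \<le> q" using t by simp
 have \<rho>0: "0 < \<rho>" using h_pos[OF q0] \<rho> by simp
 obtain b where "measurable_velocity (w T) T L b" unfolding L using velocity_at[OF less_imp_le[OF T]] by blast
 then interpret mv: measurable_velocity "w T" T L b .
 \<comment> \<open>Particle velocities are merely integrable in time, so they are added to the
   majorant; the last sum covers the velocities after \<open>t\<close>.\<close>
 define b' where "b' s = b s + ((\<Sum>i<N. norm (pv i s)) + (\<Sum>i<N. L * norm (X i t)))" for s
 define v where "v i s = (if s \<le> t then pv i s else w T s (X i t))" for i s
 define Z where "Z i s = (if s \<le> t then X i s else Y t i s)" for i s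
 have wint: "set_integrable lborel {t..q} (\<lambda>s. w T s (X i t))" for i
  by (rule set_integrable_subset[OF w_curve_integrable[OF t(1)]]) (use t in auto)
 have v_alt: "v i = (\<lambda>s. if s \<le> t then pv i s else w T s (X i t))" for i by (simp add: v_def fun_eq_iff)
 have concat: "set_integrable lborel {0..q} (v i)"
   "s \<in> {0..t} \<Longrightarrow> (LINT q:{0..s}|lborel. v i q) = (LINT q:{0..s}|lborel. pv i q)"
   "s \<in> {t..q} \<Longrightarrow> (LINT q:{0..s}|lborel. v i q) = (LINT q:{0..t}|lborel. pv i q) + (LINT q:{t..s}|lborel. w T q (X i t))"
  if "i < N" for i s
  unfolding v_alt using set_integral_concat[OF pv_integrable[OF that order.refl] wint[of i] t(1,2)] by blast+
 have Z0: "Z i s = X i 0 + (LINT q:{0..s}|lborel. v i q)" if "i < N" "s \<in> {0..q}" for i s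
 proof (cases "s \<le> t")
  case True
  then show ?thesis using concat(2)[OF that(1), of s] that X_start[OF that(1), of s] by (simp add: Z_def)
 next
  case False
  then show ?thesis using concat(3)[OF that(1), of s] that X_start[OF that(1) t(1)] by (simp add: Z_def Y_def)
 qed
 have moving: "moving_balls (w T) q L b' \<tau> M \<rho> \<Lambda> \<kappa> I Z v"
 proof
  show "0 \<le> q" "0 \<le> L" "0 \<le> M" "0 < \<rho>" "0 \<le> \<Lambda>" "1 < \<kappa>" "finite I"
   using q0 constants(4,6) initial(3) \<rho>0 \<kappa> fin by auto
  have sn1: "0 \<le> (\<Sum>i<N. norm (pv i s))" for s by (intro sum_nonneg) simp
  have sn2: "0 \<le> (\<Sum>i<N. L * norm (X i t))" using constants(4) by (intro sum_nonneg) simp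
  show "1 \<le> b' s" for s using mv.b_ge_1[of s] sn1[of s] sn2 by (simp add: b'_def)
  have c: "set_integrable lborel {0..q} (\<lambda>s. r)" for r :: real by (intro borel_integrable_atLeastAtMost' continuous_on_const)
  have "integrable lborel (\<lambda>s. \<Sum>i<N. indicat_real {0..q} s *\<^sub>R norm (pv i s))"
   by (rule Bochner_Integration.integrable_sum) (use set_integrable_norm[OF pv_integrable[OF _ order.refl, of _ q]] in \<open>simp add: set_integrable_def\<close>)
  then have p: "set_integrable lborel {0..q} (\<lambda>s. \<Sum>i<N. norm (pv i s))"
   by (simp only: set_integrable_def scaleR_sum_right)
  have bq: "set_integrable lborel {0..q} b" by (rule set_integrable_subset[OF mv.b_integrable]) (use t in auto)
  show "set_integrable lborel {0..q} b'" unfolding b'_def by (intro set_integral_add(1) bq p c)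
  show "AE s\<in>{0..q} in lborel. (\<forall>x y. norm (w T s x - w T s y) \<le> L * norm (x - y)) \<and> norm (w T s 0) \<le> b' s"
   using mv.u_lipschitz
  proof eventually_elim
   case (elim s)
   show ?case
   proof
    assume "s \<in> {0..q}"
    then have "(\<forall>x y. norm (w T s x - w T s y) \<le> L * norm (x - y)) \<and> norm (w T s 0) \<le> b s" using elim t by simp
    then show "(\<forall>x y. norm (w T s x - w T s y) \<le> L * norm (x - y)) \<and> norm (w T s 0) \<le> b' s"
     using sn1[of s] sn2 by (simp add: b'_def)
   qed
  qed
  show "continuity_solution (w T) q M \<tau>"
   by (rule continuity_solution_restrict[OF continuity_solution_at[OF less_imp_le[OF T]] t(3)])
  show "set_integrable lborel {0..q} (v i)" if "i \<in> I" for i using concat(1)[of i] I that by auto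
  show "Z i s' = Z i s + (LINT q:{s..s'}|lborel. v i q)" if "i \<in> I" "0 \<le> s" "s \<le> s'" "s' \<le> q" for i s s'
  proof -
   have i: "i < N" using I that(1) by auto
   have "set_integrable lborel {0..s'} (v i)" by (rule set_integrable_subset[OF concat(1)[OF i]]) (use that in auto)
   from set_integral_split[OF this that(2,3)] show ?thesis using Z0[OF i, of s] Z0[OF i, of s'] that by simp
  qed
  show "AE s\<in>{0..q} in lborel. (\<forall>i\<in>I. norm (v i s) \<le> b' s)"
   using mv.u_le
  proof eventually_elim
   case (elim s)
   show ?case
   proof (intro impI ballI)
    fix i assume s: "s \<in> {0..q}" and "i \<in> I"
    then have i: "i \<in> {..<N}" using I by auto
    have m1: "norm (pv i s) \<le> (\<Sum>i<N. norm (pv i s))" by (rule member_le_sum[OF i]) auto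
    have m2: "L * norm (X i t) \<le> (\<Sum>i<N. L * norm (X i t))" by (rule member_le_sum[OF i]) (use constants(4) in auto)
    show "norm (v i s) \<le> b' s"
    proof (cases "s \<le> t")
     case True
     then show ?thesis using m1 sn2 mv.b_ge_1[of s] by (simp add: v_def b'_def)
    next
     case False
     have "norm (w T s (X i t)) \<le> b s + L * norm (X i t)" using elim s t by simp
     then show ?thesis using False m2 sn1[of s] by (simp add: v_def b'_def)
    qed
   qed
  qed
  show "AE s\<in>{0..q} in lborel. (\<forall>i\<in>I. norm (w T s (Z i s) - v i s) \<le> (\<Lambda> - L) * (\<rho> * exp (\<Lambda> * s)))"
   using mv.u_lipschitz AE_lborel_singleton[of "0::real"] AE_lborel_singleton[of t]
  proof eventually_elim
   case (elim s)
   show ?case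
   proof (intro impI ballI)
    fix i assume s: "s \<in> {0..q}" and "i \<in> I"
    then have i: "i < N" using I by auto
    show "norm (w T s (Z i s) - v i s) \<le> (\<Lambda> - L) * (\<rho> * exp (\<Lambda> * s))"
    proof (cases "s \<le> t")
     case True
     then have s': "0 < s" "s \<le> T" "0 \<le> s" "s < t" using s elim(2,3) t by auto
     have "h0 + e s \<le> \<rho>" using \<rho> e_le[of s q] s by simp
     from good_error[OF gd[OF s'(3,4)] s'(1,2) i this] show ?thesis using True by (simp add: Z_def v_def)
    next
     case False
     have "0 \<le> 3 * C' * S' M" using constants(2) C'_pos by simp
     \<comment> \<open>During the Euler phase the velocity error is at most \<open>L * h0\<close>;
       the second copy of \<open>L\<close> in the growth rate absorbs it.\<close>
     then have Le: "L \<le> \<Lambda> - L" unfolding Lambda_eq using constants(3) phi_norm(2) c1 by linarith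
     have "norm (w T s (Z i s) - v i s) \<le> L * norm (Y t i s - X i t)" using elim(1) s t False by (simp add: Z_def v_def)
     also have "\<dots> \<le> L * h0" using near[OF i, of s] s False constants(4) by (intro mult_left_mono) auto
     also have "\<dots> \<le> (\<Lambda> - L) * (\<rho> * exp (\<Lambda> * s))"
     proof (rule mult_mono[OF Le])
      have "h0 \<le> \<rho> * 1" using \<rho> e_nonneg[OF q0] by simp
      also have "\<dots> \<le> \<rho> * exp (\<Lambda> * s)" using \<rho>0 s constants(6) by (intro mult_left_mono) auto
      finally show "h0 \<le> \<rho> * exp (\<Lambda> * s)" .
     qed (use Le constants(4) h0 in auto)
     finally show ?thesis .
    qed
   qed
  qed
 qed
 interpret k0: kernel_density K \<alpha> C "\<tau> 0" M by (rule kernel_density_at) simp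
 interpret kq: kernel_density K \<alpha> C "\<tau> q" M by (rule kernel_density_at[OF q0])
 interpret mu: prob_space "density_measure (\<tau> q)" by (rule kq.prob_space_density)
 have "hall_near N (\<lambda>i. X i 0) (\<tau> 0) \<rho>"
 proof (rule k0.hall_near_W_inf)
  show "1 \<le> N" using N by simp
  show "\<eta> 0 < ennreal \<rho>" unfolding h0(1) using \<rho> e_nonneg[OF q0] \<rho>0 by (intro ennreal_lessI) auto
 qed
 then have "real (card I) / real N \<le> measure (density_measure (\<tau> 0)) (\<Union>i\<in>I. cball (X i 0) \<rho>)"
  using I unfolding hall_near_def by blast
 also have "\<dots> = (LINT x|lborel. indicator (\<Union>i\<in>I. cball (Z i 0) \<rho>) x * \<tau> 0 x)"
  using t fin by (subst k0.measure_density_eq) (auto simp: Z_def)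
 also have "\<dots> \<le> (LINT x|lborel. indicator (\<Union>i\<in>I. ball (Z i q) (\<kappa> * \<rho> * exp (\<Lambda> * q))) x * \<tau> q x)"
  by (rule moving_balls.moving_balls_mono[OF moving])
 also have "\<dots> = measure (density_measure (\<tau> q)) (\<Union>i\<in>I. ball (Z i q) (\<kappa> * \<rho> * exp (\<Lambda> * q)))"
  using fin by (subst kq.measure_density_eq) auto
 also have "\<dots> \<le> measure (density_measure (\<tau> q)) (\<Union>i\<in>I. cball (Z i q) (\<kappa> * \<rho> * exp (\<Lambda> * q)))"
 proof (rule mu.finite_measure_mono)
  show "(\<Union>i\<in>I. ball (Z i q) (\<kappa> * \<rho> * exp (\<Lambda> * q))) \<subseteq> (\<Union>i\<in>I. cball (Z i q) (\<kappa> * \<rho> * exp (\<Lambda> * q)))"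
   using ball_subset_cball by blast
  show "(\<Union>i\<in>I. cball (Z i q) (\<kappa> * \<rho> * exp (\<Lambda> * q))) \<in> mu.events"
   unfolding kq.sets_density using fin by (intro sets.finite_UN) auto
 qed
 also have "(\<Union>i\<in>I. cball (Z i q) (\<kappa> * \<rho> * exp (\<Lambda> * q))) = (\<Union>i\<in>I. cball (Y t i q) (\<kappa> * \<rho> * exp (\<Lambda> * q)))"
  using t(2) by (cases "q = t") (auto simp: Z_def Y_start)
 finally show "real (card I) / real N \<le> measure (density_measure (\<tau> q)) (\<Union>i\<in>I. cball (Y t i q) (\<kappa> * \<rho> * exp (\<Lambda> * q)))" .
qed


section \<open>Closing the continuity argument\<close>

lemma eta_upper_bound:
 assumes t: "t \<in> {0..T}" and gd: "\<And>s. 0 \<le> s \<Longrightarrow> s < t \<Longrightarrow> good s"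
 shows "\<eta> t \<le> ennreal (exp (\<Lambda> * t) * (h0 + e t))"
proof (rule ennreal_le_epsilon)
 fix \<epsilon> :: real assume eps: "0 < \<epsilon>"
 have t0: "0 \<le> t" "t \<le> T" using t by auto
 interpret kernel_density K \<alpha> C "\<tau> t" M by (rule kernel_density_at[OF t0(1)])
 define c where "c = exp (\<Lambda> * t) * (h0 + e t)"
 have c: "0 < c" using h_pos[OF t0(1)] by (simp add: c_def)
 \<comment> \<open>One factor \<kappa> makes the initial radius strictly larger than
   \<open>h0 + e t\<close>, the other is the transition layer of the bumps; their product costs
   exactly \<epsilon>.\<close>
 define \<kappa> where "\<kappa> = sqrt ((c + \<epsilon>) / c)"
 have k1: "1 < \<kappa>" unfolding \<kappa>_def using c eps by simp
 have k2: "\<kappa> * \<kappa> = (c + \<epsilon>) / c" unfolding \<kappa>_def using c eps by simp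
 have "hall_near N (\<lambda>i. Y t i t) (\<tau> t) (\<kappa> * (\<kappa> * (h0 + e t)) * exp (\<Lambda> * t))"
 proof (rule hall_propagation[OF t0(1) order.refl t0(2) gd _ _ k1])
  show "norm (Y t i s - X i t) \<le> h0" if "i < N" "s \<in> {t..t}" for i s
   using that h0(2) by (simp add: Y_start)
  show "h0 + e t < \<kappa> * (h0 + e t)" using k1 h_pos[OF t0(1)] by simp
 qed
 also have "\<kappa> * (\<kappa> * (h0 + e t)) * exp (\<Lambda> * t) = (\<kappa> * \<kappa>) * c" by (simp add: c_def)
 also have "\<dots> = c + \<epsilon>" unfolding k2 using c by simp
 finally have "hall_near N (\<lambda>i. X i t) (\<tau> t) (c + \<epsilon>)" by (simp add: Y_start)
 then have "\<eta> t \<le> ennreal (c + \<epsilon>)" using N by (intro W_inf_le_hall_near) auto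
 then show "\<eta> t \<le> ennreal (exp (\<Lambda> * t) * (h0 + e t)) + ennreal \<epsilon>"
  using c eps by (simp add: c_def)
qed

text \<open>Only the continuity of the particles and of the auxiliary centers is used. The balls are
  propagated with the auxiliary centers and then shifted to the particles, and the gap between the
  sharp and the relaxed bounds pays for it. The time \<open>t\<close> itself is included.\<close>

lemma good_extends:
 assumes t: "t \<in> {0..T}" and gd: "\<And>s. 0 \<le> s \<Longrightarrow> s < t \<Longrightarrow> good s"
 obtains \<delta> where "0 < \<delta>" "\<And>q. t \<le> q \<Longrightarrow> q < t + \<delta> \<Longrightarrow> q \<le> T \<Longrightarrow> good q"
proof -
 have t0: "0 \<le> t" "t \<le> T" using t by auto
 \<comment> \<open>Two deviations of at most \<open>h0 / 8\<close> shift the balls by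
   \<open>h0 / 4\<close>, and two particle displacements cost at most half of \<open>d 0\<close>
   after multiplication by the exponential.\<close>
 define \<epsilon> where "\<epsilon> = min (h0 / 8) (d 0 / (4 * exp (\<Lambda> * T)))"
 have eps: "0 < \<epsilon>" "\<epsilon> \<le> h0 / 8" "\<epsilon> \<le> d 0 / (4 * exp (\<Lambda> * T))" using h0(2) d0 by (auto simp: \<epsilon>_def)
 have "\<exists>\<delta>>0. \<forall>q\<in>{t..T}. q < t + \<delta> \<longrightarrow> norm (Y t i q - X i t) \<le> \<epsilon> \<and> norm (X i q - X i t) \<le> \<epsilon>" if i: "i < N" for i
 proof -
  have "continuous_on {t..T} (X i)" by (rule continuous_on_subset[OF X_continuous[OF i, of T]]) (use t0 in auto)
  then have "continuous (at t within {t..T}) (X i)" using t0 by (simp add: continuous_on_eq_continuous_within)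
  then obtain \<delta>1 where d1: "\<delta>1 > 0" "\<forall>q\<in>{t..T}. dist q t < \<delta>1 \<longrightarrow> dist (X i q) (X i t) < \<epsilon>"
   using eps(1) unfolding continuous_within_eps_delta by blast
  have "continuous (at t within {t..T}) (Y t i)" using t0 Y_continuous[OF t0(1), of i] by (simp add: continuous_on_eq_continuous_within)
  then obtain \<delta>2 where d2: "\<delta>2 > 0" "\<forall>q\<in>{t..T}. dist q t < \<delta>2 \<longrightarrow> dist (Y t i q) (Y t i t) < \<epsilon>"
   using eps(1) unfolding continuous_within_eps_delta by blast
  show ?thesis
  proof (intro exI[of _ "min \<delta>1 \<delta>2"] conjI ballI impI)
   show "0 < min \<delta>1 \<delta>2" using d1 d2 by simp
   fix q assume q: "q \<in> {t..T}" "q < t + min \<delta>1 \<delta>2"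
   then have dq: "dist q t < \<delta>1" "dist q t < \<delta>2" by (auto simp: dist_real_def)
   show "norm (Y t i q - X i t) \<le> \<epsilon>" using bspec[OF d2(2) q(1)] dq(2) by (simp add: Y_start dist_norm)
   show "norm (X i q - X i t) \<le> \<epsilon>" using bspec[OF d1(2) q(1)] dq(1) by (simp add: dist_norm)
  qed
 qed
 then have "\<forall>i. \<exists>\<delta>. i < N \<longrightarrow> 0 < \<delta> \<and> (\<forall>q\<in>{t..T}. q < t + \<delta> \<longrightarrow> norm (Y t i q - X i t) \<le> \<epsilon> \<and> norm (X i q - X i t) \<le> \<epsilon>)"
  by blast
 from choice[OF this] obtain D where
  D: "\<forall>i. i < N \<longrightarrow> 0 < D i \<and> (\<forall>q\<in>{t..T}. q < t + D i \<longrightarrow> norm (Y t i q - X i t) \<le> \<epsilon> \<and> norm (X i q - X i t) \<le> \<epsilon>)" ..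
 define \<delta> where "\<delta> = Min (D ` {..<N})"
 have fin: "finite (D ` {..<N})" "D ` {..<N} \<noteq> {}" using N by (auto simp: lessThan_empty_iff)
 have "0 < \<delta>" unfolding \<delta>_def using D fin by (subst Min_gr_iff) auto
 have \<delta>: "norm (Y t i q - X i t) \<le> \<epsilon>" "norm (X i q - X i t) \<le> \<epsilon>" if "i < N" "t \<le> q" "q < t + \<delta>" "q \<le> T" for i q
 proof -
  have "\<delta> \<le> D i" unfolding \<delta>_def using that(1) by (intro Min_le fin) auto
  then have "q < t + D i" "q \<in> {t..T}" using that by auto
  then show "norm (Y t i q - X i t) \<le> \<epsilon>" "norm (X i q - X i t) \<le> \<epsilon>" using D that(1) by blast+
 qed
 have "good q" if q: "t \<le> q" "q < t + \<delta>" "q \<le> T" for q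
 proof -
  have q0: "0 \<le> q" using t0 q by simp
  interpret kernel_density K \<alpha> C "\<tau> q" M by (rule kernel_density_at[OF q0])
  define c where "c = exp (\<Lambda> * q) * (h0 + e q)"
  have "1 * h0 \<le> c" unfolding c_def using h0(2) e_nonneg[OF q0] constants(6) q0 by (intro mult_mono) auto
  then have c: "h0 \<le> c" by simp
  \<comment> \<open>The factors 5/4 and 6/5 multiply to 3/2; together with the shift by
    \<open>h0 / 4\<close> the radius stays below twice the sharp one.\<close>
  have "hall_near N (\<lambda>i. Y t i q) (\<tau> q) ((6 / 5) * ((5 / 4) * (h0 + e q)) * exp (\<Lambda> * q))"
  proof (rule hall_propagation[OF t0(1) q(1,3) gd])
   show "norm (Y t i s - X i t) \<le> h0" if "i < N" "s \<in> {t..q}" for i s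
    using \<delta>(1)[of i s] that q eps h0(2) by auto
   show "h0 + e q < (5 / 4) * (h0 + e q)" using h_pos[OF q0] by simp
  qed auto
  also have "(6 / 5) * ((5 / 4) * (h0 + e q)) * exp (\<Lambda> * q) = (3 / 2) * c" by (simp add: c_def)
  finally have "hall_near N (\<lambda>i. Y t i q) (\<tau> q) ((3 / 2) * c)" .
  then have "hall_near N (\<lambda>i. X i q) (\<tau> q) ((3 / 2) * c + h0 / 4)"
  proof (rule hall_near_shift)
   fix i assume "i < N"
   have "norm (Y t i q - X i q) \<le> norm (Y t i q - X i t) + norm (X i q - X i t)"
    using norm_triangle_ineq4[of "Y t i q - X i t" "X i q - X i t"] by simp
   then show "norm (Y t i q - X i q) \<le> h0 / 4" using \<delta>[OF \<open>i < N\<close> q] eps(2) by linarith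
  qed
  then have "\<eta> q \<le> ennreal ((3 / 2) * c + h0 / 4)" using N by (intro W_inf_le_hall_near) auto
  also have "\<dots> \<le> ennreal (2 * exp (\<Lambda> * q) * (h0 + e q))" using c h0(2) by (intro ennreal_leI) (simp add: c_def)
  finally have 1: "\<eta> q \<le> ennreal (2 * exp (\<Lambda> * q) * (h0 + e q))" .
  obtain i j where ij: "i < N" "j < N" "i \<noteq> j" "d q = dist (X i q) (X j q)" using d_min_attained[OF N, of "\<lambda>i. X i q"] by blast
  have "d 0 \<le> exp (\<Lambda> * t) * dist (X i t) (X j t)" by (rule distance_lower_bound[OF t gd ij(1-3)])
  also have "dist (X i t) (X j t) \<le> dist (X i t) (X i q) + dist (X i q) (X j q) + dist (X j q) (X j t)"
   by (metis add_mono_thms_linordered_semiring(2) dist_triangle order.trans add.assoc)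
  also have "\<dots> \<le> d q + 2 * \<epsilon>" using \<delta>(2)[OF ij(1) q] \<delta>(2)[OF ij(2) q] by (simp add: ij(4) dist_norm norm_minus_commute)
  finally have "d 0 \<le> exp (\<Lambda> * t) * (d q + 2 * \<epsilon>)" by simp
  also have "\<dots> \<le> exp (\<Lambda> * t) * d q + d 0 / 2"
  proof -
   have "exp (\<Lambda> * t) * (2 * \<epsilon>) \<le> exp (\<Lambda> * T) * (2 * (d 0 / (4 * exp (\<Lambda> * T))))"
    using eps t0 constants(6) by (intro mult_mono) auto
   then show ?thesis by (simp add: distrib_left)
  qed
  finally have "d 0 \<le> 2 * (exp (\<Lambda> * t) * d q)" by simp
  also have "\<dots> \<le> 2 * (exp (\<Lambda> * q) * d q)"
   using q t0 constants(6) ij(4) by (intro mult_left_mono mult_right_mono) auto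
  finally show "good q" using 1 by (simp add: good_def)
 qed
 then show ?thesis by (rule that[OF \<open>0 < \<delta>\<close>])
qed

text \<open>At the infimum of the bad times all earlier times are good, so
  \<open>good_extends\<close> moves the infimum to the right. As it covers the infimum itself, the
  set of good times need not be shown closed.\<close>

lemma all_good: assumes "t \<in> {0..T}" shows "good t"
proof (rule ccontr)
 assume bad: "\<not> good t"
 define B where "B = {s \<in> {0..T}. \<not> good s}"
 define s where "s = Inf B"
 have B: "B \<noteq> {}" "bdd_below B" using bad assms by (auto simp: B_def intro: bdd_belowI[of _ 0])
 have s0: "0 \<le> s" unfolding s_def by (rule cInf_greatest[OF B(1)]) (auto simp: B_def)
 have "s \<le> t" unfolding s_def using bad assms by (intro cInf_lower[OF _ B(2)]) (auto simp: B_def)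
 then have s: "s \<in> {0..T}" using s0 assms by auto
 have gd: "good r" if "0 \<le> r" "r < s" for r
 proof (rule ccontr)
  assume "\<not> good r"
  then have "r \<in> B" using that s by (auto simp: B_def)
  then have "s \<le> r" unfolding s_def by (rule cInf_lower[OF _ B(2)])
  then show False using that by simp
 qed
 obtain \<delta> where \<delta>: "0 < \<delta>" "\<And>q. s \<le> q \<Longrightarrow> q < s + \<delta> \<Longrightarrow> q \<le> T \<Longrightarrow> good q"
  using good_extends[OF s gd] by blast
 have "s + \<delta> \<le> Inf B"
 proof (rule cInf_greatest[OF B(1)])
  fix r assume r: "r \<in> B"
  then have "s \<le> r" unfolding s_def by (rule cInf_lower[OF _ B(2)])
  then show "s + \<delta> \<le> r" using \<delta>(2)[of r] r by (force simp: B_def)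
 qed
 then show False using \<delta>(1) by (simp add: s_def)
qed

lemma eta_bound: "t \<in> {0..T} \<Longrightarrow> \<eta> t \<le> ennreal (exp (\<Lambda> * t) * (h0 + e t))"
 by (rule eta_upper_bound) (auto intro: all_good)

lemma d_bound: "t \<in> {0..T} \<Longrightarrow> d 0 * exp (- \<Lambda> * t) \<le> d t"
proof -
 assume t: "t \<in> {0..T}"
 have "d 0 \<le> exp (\<Lambda> * t) * d t" by (rule d_lower_bound[OF t]) (use t in \<open>auto intro: all_good\<close>)
 then show ?thesis by (simp add: exp_minus field_simps)
qed

lemma field_bound:
 assumes t: "t \<in> {0..T}" and x: "x \<notin> (\<lambda>i. X i t) ` {..<N}"
 shows "norm (kernel_conv K (density_measure (\<tau> t)) x - kernel_conv K (empirical_measure N (\<lambda>i. X i t)) x) \<le>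
  C' / (real N * infdist x ((\<lambda>i. X i t) ` {..<N}) powr \<alpha>) + 2 * P' M * (exp (\<Lambda> * t) * (h0 + e t))"
proof -
 have t0: "0 \<le> t" using t by simp
 have g: "good t" by (rule all_good[OF t])
 interpret kernel_density K \<alpha> C "\<tau> t" M by (rule kernel_density_at[OF t0])
 let ?X = "\<lambda>i. X i t"
 \<comment> \<open>The factor 2 turns the sharp bound into the strict inequality required by
   \<open>hall_near_W_inf\<close>.\<close>
 let ?r = "2 * (exp (\<Lambda> * t) * (h0 + e t))"
 have h: "0 < exp (\<Lambda> * t) * (h0 + e t)" using h_pos[OF t0] by simp
 have near: "hall_near N ?X (\<tau> t) ?r"
 proof (rule hall_near_W_inf)
  show "1 \<le> N" using N by simp
  show "\<eta> t < ennreal ?r" by (rule order.strict_trans1[OF eta_bound[OF t] ennreal_lessI]) (use h_pos[OF t0] in auto)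
 qed
 have fin: "finite (?X ` {..<N})" "?X ` {..<N} \<noteq> {}" using N by (auto simp: lessThan_empty_iff)
 obtain k0 where k0: "k0 < N" "infdist x (?X ` {..<N}) = dist x (?X k0)"
  using infdist_attains_inf[OF finite_imp_closed[OF fin(1)] fin(2), of x] by auto
 have nearest: "norm (x - ?X k0) \<le> norm (x - ?X k)" if "k < N" for k
  using infdist_le[of "?X k" "?X ` {..<N}" x] that by (simp add: k0(2) dist_norm)
 have "norm (kernel_conv K (density_measure (\<tau> t)) x - (1 / real N) *\<^sub>R (\<Sum>k<N. K (x - ?X k))) \<le>
   C' * norm (x - ?X k0) powr - \<alpha> / real N + C' * ?r * (2 * A + 2 powr \<beta> * S' M)"
 proof (rule kernel_conv_error_outside[OF _ near _ k0(1) nearest _ good_sum[OF g t k0(1)]])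
  show "1 \<le> N" "0 \<le> ?r" using N h by auto
  show "?X k \<noteq> ?X k0" if "k < N" "k \<noteq> k0" for k by (rule good_separated(2)[OF g t that(1) k0(1) that(2)])
  show "x \<noteq> ?X k0" using x k0(1) by auto
 qed
 moreover have "kernel_conv K (empirical_measure N ?X) x = (1 / real N) *\<^sub>R (\<Sum>k<N. K (x - ?X k))"
  by (rule kernel_conv_empirical) (use N in auto)
 moreover have "C' * norm (x - ?X k0) powr - \<alpha> / real N = C' / (real N * infdist x (?X ` {..<N}) powr \<alpha>)"
  by (simp add: k0(2) dist_norm powr_minus divide_simps)
 moreover have "C' * ?r * (2 * A + 2 powr \<beta> * S' M) = 2 * P' M * (exp (\<Lambda> * t) * (h0 + e t))"
  by (simp add: P'_def A_eq)
 ultimately show ?thesis by simp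
qed

end

theorem theorem2p4:
  fixes K :: "'a::euclidean_space \<Rightarrow> 'a" and \<alpha> C C\<^sub>1 M\<^sub>\<tau> M\<^sub>\<phi> :: real
  assumes "-1 \<le> \<alpha>" and "\<alpha> < real DIM('a) - 1" and "0 < C"
    and "interaction_kernel K \<alpha> C"
    and "0 \<le> C\<^sub>1" and "0 \<le> M\<^sub>\<tau>" and "0 \<le> M\<^sub>\<phi>"
  shows "\<exists>C\<^sub>2>0. \<forall>(\<phi> :: nat \<Rightarrow> real \<Rightarrow> 'a \<Rightarrow> 'a) (\<tau>0 :: nat \<Rightarrow> 'a \<Rightarrow> real)
      (\<tau> :: nat \<Rightarrow> real \<Rightarrow> 'a \<Rightarrow> real) (X0 :: nat \<Rightarrow> nat \<Rightarrow> 'a) (X :: nat \<Rightarrow> nat \<Rightarrow> real \<Rightarrow> 'a)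
      (E :: nat \<Rightarrow> nat \<Rightarrow> real \<Rightarrow> 'a) (e :: nat \<Rightarrow> real \<Rightarrow> real)
      (\<sigma> :: nat \<Rightarrow> real \<Rightarrow> 'a measure) (\<eta> :: nat \<Rightarrow> real \<Rightarrow> ennreal) (dmin :: nat \<Rightarrow> real \<Rightarrow> real).
    (\<forall>N\<ge>1. divergence_free_field (\<phi> N)) \<and>
    (SUP N\<in>{1..}. Linf_W1inf_norm (\<phi> N)) = ennreal M\<^sub>\<phi> \<and>
    (\<forall>N\<ge>1. prob_density (\<tau>0 N)) \<and>
    (SUP N\<in>{1..}. Linf_norm (\<tau>0 N)) = ennreal M\<^sub>\<tau> \<and>
    (\<forall>N\<ge>1. transport_solution K (\<phi> N) (\<tau>0 N) (\<tau> N)) \<and>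
    (\<forall>N\<ge>1. particle_solution K N (\<phi> N) (E N) (X0 N) (X N)) \<and>
    \<sigma> = (\<lambda>N t. empirical_measure N (\<lambda>i. X N i t)) \<and>
    \<eta> = (\<lambda>N t. W_inf (\<sigma> N t) (density_measure (\<tau> N t))) \<and>
    dmin = (\<lambda>N t. d_min N (\<lambda>i. X N i t)) \<and>
    (\<forall>N\<ge>1. mono_on {0..} (e N) \<and> (\<forall>t\<ge>0. 0 \<le> e N t)) \<and>
    (\<forall>t\<ge>0. (\<lambda>N. ennreal_powr (\<eta> N 0 + ennreal (e N t)) (real DIM('a) - (1 + \<alpha>)) /
        ennreal (dmin N 0 powr (1 + \<alpha>) * real N powr ((1 + \<alpha>) / real DIM('a)))) \<longlonglongrightarrow> 0) \<and>
    (\<exists>c. \<forall>N\<ge>2. dmin N 0 * real N powr (1 / real DIM('a)) \<le> c) \<and>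
    (\<forall>T>0. \<forall>L::real. L > 0 \<longrightarrow> (\<exists>N0. \<forall>N>N0. \<forall>t\<in>{0..T}.
        \<eta> N t / (\<eta> N 0 + ennreal (e N t)) + ennreal (dmin N 0) / ennreal (dmin N t) \<le> ennreal L \<longrightarrow>
        (\<forall>i<N. norm (E N i t) \<le> e N t) \<and>
        (\<forall>i<N. \<forall>j<N. i \<noteq> j \<longrightarrow>
          norm (E N i t - E N j t) / norm (X N i t - X N j t) \<le> C\<^sub>1)))
    \<longrightarrow>
    (\<forall>T>0. \<exists>N0. \<forall>N>N0. \<forall>t\<in>{0..T}.
        \<eta> N t \<le> ennreal (exp (C\<^sub>2 * t)) * (\<eta> N 0 + ennreal (e N t)) \<and>
        dmin N t \<ge> dmin N 0 * exp (- C\<^sub>2 * t) \<and>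
        (\<forall>x. x \<notin> (\<lambda>i. X N i t) ` {..<N} \<longrightarrow>
          ennreal (norm (kernel_conv K (density_measure (\<tau> N t)) x - kernel_conv K (\<sigma> N t) x)) \<le>
            ennreal (C\<^sub>2 / (real N * infdist x ((\<lambda>i. X N i t) ` {..<N}) powr \<alpha>)) +
            ennreal (C\<^sub>2 * exp (C\<^sub>2 * t)) * (\<eta> N 0 + ennreal (e N t))))"
proof -
 interpret singular_kernel K \<alpha> C by unfold_locales (use assms in auto)
 note pos = assms(5-7)
 \<comment> \<open>A sum that dominates the exponential rate, the coefficient near a particle, and
   the coefficient of the regular part of the velocity error.\<close>
 define C2 where C2: "C2 = rate M\<^sub>\<tau> M\<^sub>\<phi> C\<^sub>1 + C' + 2 * P' M\<^sub>\<tau>"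
 note cs = constants_nonneg[OF pos(2,3,1)]
 show ?thesis
 proof (intro exI[of _ C2] conjI allI impI, goal_cases)
  case 1
  then show ?case unfolding C2 using cs C'_pos by linarith
 next
  case (2 \<phi> \<tau>0 \<tau> X0 X E e \<sigma> \<eta> dmin T)
  let ?goal = "\<lambda>N. \<forall>t\<in>{0..T}.
    \<eta> N t \<le> ennreal (exp (C2 * t)) * (\<eta> N 0 + ennreal (e N t)) \<and>
    dmin N t \<ge> dmin N 0 * exp (- C2 * t) \<and>
    (\<forall>x. x \<notin> (\<lambda>i. X N i t) ` {..<N} \<longrightarrow>
     ennreal (norm (kernel_conv K (density_measure (\<tau> N t)) x - kernel_conv K (\<sigma> N t) x)) \<le>
      ennreal (C2 / (real N * infdist x ((\<lambda>i. X N i t) ` {..<N}) powr \<alpha>)) +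
      ennreal (C2 * exp (C2 * t)) * (\<eta> N 0 + ennreal (e N t)))"
  from 2(1) show ?case
  proof (elim conjE, goal_cases)
   case 1
   note field = 1(1) and field_norm = 1(2) and dens = 1(3) and dens_norm = 1(4) and transport = 1(5)
    and particles = 1(6) and \<sigma> = 1(7) and \<eta> = 1(8) and dmin = 1(9) and e = 1(10) and lim = 1(11)
    and errors = 1(13) and T = 2(2)
   let ?D = "real DIM('a)"
   define \<Lambda> where "\<Lambda> = rate M\<^sub>\<tau> M\<^sub>\<phi> C\<^sub>1"
   have L1: "1 \<le> \<Lambda>" using cs(6) by (simp add: \<Lambda>_def)
   have C2': "\<Lambda> \<le> C2" "C' \<le> C2" "2 * P' M\<^sub>\<tau> \<le> C2" "0 < C2"
    using cs C'_pos by (auto simp: C2 \<Lambda>_def)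
   \<comment> \<open>The exponential factors in \<open>small\<close>, collected so that what remains
     is the quotient tending to 0.\<close>
   define k where "k = (3 * exp (\<Lambda> * T)) powr (?D - \<beta>) * (2 * exp (\<Lambda> * T)) powr \<beta>"
   have k: "0 \<le> k" by (simp add: k_def)
   define \<epsilon> where "\<epsilon> = 1 / (Q' M\<^sub>\<tau> * k + 1)"
   have Qk: "0 \<le> Q' M\<^sub>\<tau> * k" using cs(5) k by simp
   then have eps: "0 < \<epsilon>" "Q' M\<^sub>\<tau> * k * \<epsilon> \<le> 1" by (auto simp: \<epsilon>_def divide_simps)
   \<comment> \<open>The smallness hypothesis is taken at time \<open>T\<close> only; monotonicity
     of \<open>e\<close> covers earlier times.\<close>
   define x where "x N = ennreal_powr (\<eta> N 0 + ennreal (e N T)) (?D - (1 + \<alpha>)) /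
      ennreal (dmin N 0 powr (1 + \<alpha>) * real N powr ((1 + \<alpha>) / ?D))" for N
   have "x \<longlonglongrightarrow> 0" using lim T unfolding x_def by simp
   then have "\<forall>\<^sub>F N in sequentially. x N < ennreal \<epsilon>" using eps(1) by (intro order_tendstoD(2)) auto
   then obtain N1 where N1: "\<And>N. N1 \<le> N \<Longrightarrow> x N < ennreal \<epsilon>" unfolding eventually_sequentially by blast
   \<comment> \<open>Each of the two quotients in the hypothesis on the errors is at most
     \<open>2 * exp (\<Lambda> * T)\<close> while the relaxed bounds hold.\<close>
   have "0 < 4 * exp (\<Lambda> * T)" by simp
   then obtain N2 where N2: "\<forall>N>N2. \<forall>t\<in>{0..T}.
      \<eta> N t / (\<eta> N 0 + ennreal (e N t)) + ennreal (dmin N 0) / ennreal (dmin N t) \<le> ennreal (4 * exp (\<Lambda> * T)) \<longrightarrow>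
      (\<forall>i<N. norm (E N i t) \<le> e N t) \<and>
      (\<forall>i<N. \<forall>j<N. i \<noteq> j \<longrightarrow>
       norm (E N i t - E N j t) / norm (X N i t - X N j t) \<le> C\<^sub>1)"
    using errors T by blast
   show ?case
   proof (intro exI[of _ "max 2 (max N1 N2)"] allI impI)
    fix N assume "max 2 (max N1 N2) < N"
    then have N: "2 \<le> N" "1 \<le> N" "N1 \<le> N" "N2 < N" by auto
    have ts: "transport_setting K \<alpha> C (\<phi> N) (\<tau>0 N) (\<tau> N) M\<^sub>\<tau> M\<^sub>\<phi>"
    proof
     show "divergence_free_field (\<phi> N)" "prob_density (\<tau>0 N)" "transport_solution K (\<phi> N) (\<tau>0 N) (\<tau> N)" "0 \<le> M\<^sub>\<tau>" "0 \<le> M\<^sub>\<phi>"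
      using field dens transport N pos by auto
     show "Linf_W1inf_norm (\<phi> N) \<le> ennreal M\<^sub>\<phi>" unfolding field_norm[symmetric] using N by (intro SUP_upper) auto
     show "Linf_norm (\<tau>0 N) \<le> ennreal M\<^sub>\<tau>" unfolding dens_norm[symmetric] using N by (intro SUP_upper) auto
    qed
    interpret ts: transport_setting K \<alpha> C "\<phi> N" "\<tau>0 N" "\<tau> N" M\<^sub>\<tau> M\<^sub>\<phi> by (rule ts)
    interpret k0: kernel_density K \<alpha> C "\<tau> N 0" M\<^sub>\<tau> by (rule ts.kernel_density_at) simp
    have eN: "mono_on {0..} (e N)" "\<And>t. 0 \<le> t \<Longrightarrow> 0 \<le> e N t" using e N by auto
    have eT: "0 \<le> e N T" using eN(2) T by simp
    have xN: "x N < ennreal \<epsilon>" by (rule N1[OF N(3)])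
    have eta_pos: "0 < \<eta> N 0" unfolding \<eta> \<sigma> by (rule k0.W_inf_pos[OF N(2)])
    \<comment> \<open>Finiteness of the initial distance is a consequence of the smallness
      hypothesis, because an infinite numerator makes the quotient infinite.\<close>
    have "\<eta> N 0 \<noteq> top"
    proof
     assume "\<eta> N 0 = top"
     then have "x N = top" by (simp add: x_def ennreal_powr_def ennreal_top_divide)
     then show False using xN by simp
    qed
    then obtain h0 where h0: "\<eta> N 0 = ennreal h0" "0 < h0" using eta_pos by (cases "\<eta> N 0") auto
    define a where "a = (h0 + e N T) powr (?D - \<beta>)"
    define W where "W = dmin N 0 powr \<beta> * real N powr (\<beta> / ?D)"
    have a: "0 < a" using h0 eT by (simp add: a_def)
    have xa: "x N = ennreal a / ennreal W"
     using h0 eT by (simp add: x_def ennreal_powr_def a_def W_def \<beta>_def ennreal_plus[symmetric] del: ennreal_plus)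
    \<comment> \<open>A positive number divided by 0 is infinite, so the same hypothesis excludes a
      vanishing denominator.\<close>
    have "W \<noteq> 0"
    proof
     assume "W = 0"
     then have "x N = top" using a by (simp add: xa)
     then show False using xN by simp
    qed
    moreover have "0 \<le> W" by (simp add: W_def)
    ultimately have W: "0 < W" by linarith
    \<comment> \<open>\<open>0 powr \<beta>\<close> is 0 also for \<open>\<beta> = 0\<close>, so the
      particles are initially distinct in all cases.\<close>
    have "dmin N 0 \<noteq> 0"
    proof
     assume "dmin N 0 = 0"
     then show False using W by (simp add: W_def)
    qed
    moreover have "0 \<le> dmin N 0" using d_min_attained[OF N(1), of "\<lambda>i. X N i 0"] by (auto simp: dmin)
    ultimately have d0: "0 < dmin N 0" by simp
    have aW: "a / W \<le> \<epsilon>"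
     using xN a W eps(1) by (simp add: xa divide_ennreal ennreal_less_iff)
    have small: "Q' M\<^sub>\<tau> * ((3 * exp (\<Lambda> * T) * (h0 + e N T)) powr (?D - \<beta>) /
      ((dmin N 0 / (2 * exp (\<Lambda> * T))) powr \<beta> * real N powr (\<beta> / ?D))) \<le> 1"
    proof -
     have "(3 * exp (\<Lambda> * T) * (h0 + e N T)) powr (?D - \<beta>) = (3 * exp (\<Lambda> * T)) powr (?D - \<beta>) * a"
      using h0 eT by (simp add: a_def powr_mult)
     moreover have "(dmin N 0 / (2 * exp (\<Lambda> * T))) powr \<beta> * real N powr (\<beta> / ?D) = W / (2 * exp (\<Lambda> * T)) powr \<beta>"
      using d0 by (simp add: W_def powr_divide)
     ultimately have "Q' M\<^sub>\<tau> * ((3 * exp (\<Lambda> * T) * (h0 + e N T)) powr (?D - \<beta>) /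
      ((dmin N 0 / (2 * exp (\<Lambda> * T))) powr \<beta> * real N powr (\<beta> / ?D))) = Q' M\<^sub>\<tau> * k * (a / W)"
      by (simp add: k_def)
     also have "\<dots> \<le> Q' M\<^sub>\<tau> * k * \<epsilon>" using aW Qk by (intro mult_left_mono) auto
     finally show ?thesis using eps(2) by simp
    qed
    have err: "(\<forall>i<N. norm (E N i t) \<le> e N t) \<and>
      (\<forall>i<N. \<forall>j<N. i \<noteq> j \<longrightarrow> norm (E N i t - E N j t) \<le> C\<^sub>1 * norm (X N i t - X N j t))"
     if t: "t \<in> {0..T}" and 1: "\<eta> N t \<le> ennreal (2 * exp (\<Lambda> * t) * (h0 + e N t))"
      and 2: "dmin N 0 \<le> 2 * exp (\<Lambda> * t) * dmin N t" for t
    proof -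
     have et: "0 \<le> e N t" using eN(2) t by simp
     have ee: "exp (\<Lambda> * t) \<le> exp (\<Lambda> * T)" using t L1 by simp
     have "0 < 2 * exp (\<Lambda> * t) * dmin N t" using 2 d0 by linarith
     then have dt: "0 < dmin N t" by (simp add: zero_less_mult_iff)
     have "\<eta> N t / (\<eta> N 0 + ennreal (e N t)) \<le> ennreal (2 * exp (\<Lambda> * t) * (h0 + e N t)) / ennreal (h0 + e N t)"
      using h0 et by (simp add: divide_right_mono_ennreal 1 ennreal_plus)
     also have "\<dots> = ennreal (2 * exp (\<Lambda> * t))" using h0 et by (subst divide_ennreal) auto
     finally have r1: "\<eta> N t / (\<eta> N 0 + ennreal (e N t)) \<le> ennreal (2 * exp (\<Lambda> * t))" .
     have "ennreal (dmin N 0) / ennreal (dmin N t) = ennreal (dmin N 0 / dmin N t)" using d0 dt by (intro divide_ennreal) auto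
     also have "\<dots> \<le> ennreal (2 * exp (\<Lambda> * t))" using 2 dt by (intro ennreal_leI) (simp add: divide_simps)
     finally have "\<eta> N t / (\<eta> N 0 + ennreal (e N t)) + ennreal (dmin N 0) / ennreal (dmin N t) \<le>
       ennreal (2 * exp (\<Lambda> * t)) + ennreal (2 * exp (\<Lambda> * t))" using r1 by (intro add_mono)
     also have "\<dots> = ennreal (4 * exp (\<Lambda> * t))" by (subst ennreal_plus[symmetric]) auto
     also have "\<dots> \<le> ennreal (4 * exp (\<Lambda> * T))" using ee by (intro ennreal_leI) simp
     finally have E: "(\<forall>i<N. norm (E N i t) \<le> e N t) \<and>
      (\<forall>i<N. \<forall>j<N. i \<noteq> j \<longrightarrow> norm (E N i t - E N j t) / norm (X N i t - X N j t) \<le> C\<^sub>1)"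
      using N2[rule_format, OF N(4) t] by blast
     have "norm (E N i t - E N j t) \<le> C\<^sub>1 * norm (X N i t - X N j t)" if ij: "i < N" "j < N" "i \<noteq> j" for i j
     proof -
      have "dmin N t \<le> norm (X N i t - X N j t)"
       using d_min_le[OF ij, of "\<lambda>i. X N i t"] by (simp only: dmin dist_norm)
      then have "0 < norm (X N i t - X N j t)" using dt by linarith
      moreover have "norm (E N i t - E N j t) / norm (X N i t - X N j t) \<le> C\<^sub>1" using E ij by blast
      ultimately show ?thesis by (simp add: pos_divide_le_eq)
     qed
     then show ?thesis using E by blast
    qed
    interpret ps: particle_system K \<alpha> C "\<phi> N" "\<tau>0 N" "\<tau> N" M\<^sub>\<tau> M\<^sub>\<phi> N "X0 N" "X N" "E N" "e N" T C\<^sub>1 h0 \<Lambda> "L' M\<^sub>\<tau> M\<^sub>\<phi>"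
    proof
     show "\<Lambda> = rate M\<^sub>\<tau> M\<^sub>\<phi> C\<^sub>1" "L' M\<^sub>\<tau> M\<^sub>\<phi> = L' M\<^sub>\<tau> M\<^sub>\<phi>" "2 \<le> N" "0 < T" "0 \<le> C\<^sub>1" "mono_on {0..} (e N)" "0 < h0"
      using N T pos h0 eN(1) by (auto simp: \<Lambda>_def)
     show "particle_solution K N (\<phi> N) (E N) (X0 N) (X N)" using particles N by blast
     show "0 \<le> e N t" if "0 \<le> t" for t using eN(2) that .
     show "W_inf (empirical_measure N (\<lambda>i. X N i 0)) (density_measure (\<tau> N 0)) = ennreal h0"
      using h0(1) by (simp add: \<eta> \<sigma>)
     show "0 < d_min N (\<lambda>i. X N i 0)" using d0 by (simp add: dmin)
     show "Q' M\<^sub>\<tau> * ((3 * exp (\<Lambda> * T) * (h0 + e N T)) powr (?D - \<beta>) /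
      ((d_min N (\<lambda>i. X N i 0) / (2 * exp (\<Lambda> * T))) powr \<beta> * real N powr (\<beta> / ?D))) \<le> 1"
      using small by (simp add: dmin)
     show "(\<forall>i<N. norm (E N i t) \<le> e N t) \<and>
      (\<forall>i<N. \<forall>j<N. i \<noteq> j \<longrightarrow> norm (E N i t - E N j t) \<le> C\<^sub>1 * norm (X N i t - X N j t))"
      if "t \<in> {0..T}"
       "W_inf (empirical_measure N (\<lambda>i. X N i t)) (density_measure (\<tau> N t)) \<le> ennreal (2 * exp (\<Lambda> * t) * (h0 + e N t))"
       "d_min N (\<lambda>i. X N i 0) \<le> 2 * exp (\<Lambda> * t) * d_min N (\<lambda>i. X N i t)" for t
      using err[OF that(1)] that(2,3) by (simp add: \<eta> \<sigma> dmin)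
    qed
    show "?goal N"
    proof (intro ballI conjI allI impI)
     fix t assume t: "t \<in> {0..T}"
     have et: "0 \<le> e N t" using eN(2) t by simp
     have ex: "exp (\<Lambda> * t) \<le> exp (C2 * t)" using C2'(1) t by (auto intro: mult_right_mono)
     have sum: "\<eta> N 0 + ennreal (e N t) = ennreal (h0 + e N t)" using h0 et by simp
     have hh: "exp (\<Lambda> * t) * (h0 + e N t) \<le> exp (C2 * t) * (h0 + e N t)"
      using ex h0 et by (intro mult_right_mono) auto
     have "\<eta> N t \<le> ennreal (exp (\<Lambda> * t) * (h0 + e N t))" using ps.eta_bound[OF t] by (simp add: \<eta> \<sigma>)
     also have "\<dots> \<le> ennreal (exp (C2 * t) * (h0 + e N t))" by (rule ennreal_leI[OF hh])
     also have "\<dots> = ennreal (exp (C2 * t)) * (\<eta> N 0 + ennreal (e N t))" unfolding sum by (simp add: ennreal_mult')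
     finally show "\<eta> N t \<le> ennreal (exp (C2 * t)) * (\<eta> N 0 + ennreal (e N t))" .
     have "dmin N 0 * exp (- C2 * t) \<le> dmin N 0 * exp (- \<Lambda> * t)"
      using C2'(1) t d0 by (intro mult_left_mono) (auto intro: mult_right_mono)
     also have "\<dots> \<le> dmin N t" using ps.d_bound[OF t] by (simp add: dmin)
     finally show "dmin N 0 * exp (- C2 * t) \<le> dmin N t" .
     fix x assume x: "x \<notin> (\<lambda>i. X N i t) ` {..<N}"
     let ?I = "real N * infdist x ((\<lambda>i. X N i t) ` {..<N}) powr \<alpha>"
     have "norm (kernel_conv K (density_measure (\<tau> N t)) x - kernel_conv K (\<sigma> N t) x) \<le>
       C' / ?I + 2 * P' M\<^sub>\<tau> * (exp (\<Lambda> * t) * (h0 + e N t))"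
      using ps.field_bound[OF t x] by (simp add: \<sigma>)
     also have "\<dots> \<le> C2 / ?I + C2 * (exp (C2 * t) * (h0 + e N t))"
      using C2' hh cs(3) h0 et by (intro add_mono divide_right_mono mult_mono) auto
     finally have "ennreal (norm (kernel_conv K (density_measure (\<tau> N t)) x - kernel_conv K (\<sigma> N t) x)) \<le>
       ennreal (C2 / ?I + C2 * (exp (C2 * t) * (h0 + e N t)))" by (rule ennreal_leI)
     also have "\<dots> = ennreal (C2 / ?I) + ennreal (C2 * (exp (C2 * t) * (h0 + e N t)))"
      using C2'(4) h0 et by (intro ennreal_plus) auto
     also have "ennreal (C2 * (exp (C2 * t) * (h0 + e N t))) = ennreal (C2 * exp (C2 * t)) * (\<eta> N 0 + ennreal (e N t))"
      unfolding sum using C2'(4) h0 et by (subst ennreal_mult'[symmetric]) (auto simp: mult.assoc)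
     finally show "ennreal (norm (kernel_conv K (density_measure (\<tau> N t)) x - kernel_conv K (\<sigma> N t) x)) \<le>
       ennreal (C2 / ?I) + ennreal (C2 * exp (C2 * t)) * (\<eta> N 0 + ennreal (e N t))" .
    qed
   qed
  qed
 qed
qed

end
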